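(* Let $d \ge 2$. Let $Q$ be a symmetric, translation-invariant, heavy-tailed transition kernel on $\mathbb{Z}^d$ with exponent $\alpha > 0$, and let $Q_L$ be its standard projection onto $\mathbb{T}^d_L$. Consider the frog model on $\mathbb{T}^d_L$ with kernel $Q_L$, particle density $\lambda>0$, particle lifespan $\ell\in\{1,2,\dots\}$ and a planted particle at the origin with lifespan $\ell_o=\ell_o(L)$, where $\ell_o(L)\to\infty$ as $L\to\infty$. Let $\mathcal{A}(t)$ be the set of vertices activated by time $t$. (1) If $\alpha \in (0, d)$, let $\Delta>0$ be defined by $\Delta^{-1} = \log_2\big(2d/(d+\alpha)\big)$. Then for every $\lambda > 0$, $\rho \in (0, 1)$ and $\epsilon > 0$ there exists a constant $C_0>0$ such that, for every particle lifespan $\ell > C_0$, $$\lim_{L \to \infty} \mathbb{P}_L^+\left(\frac{|\mathcal{A}((\log L)^{\Delta + \epsilon})|}{L^d} \geq \rho\right) = 1 .$$ (2) If $\alpha \ge d$, then for every $\lambda>0$ and every $\rho \in (0, 1)$ there exist constants $C>0$ and $C_0>0$ such that, for every particle lifespan $\ell > C_0$, $$\lim_{L \to \infty} \mathbb{P}_L^+\left(\frac{|\mathcal{A}(CL)|}{L^d} \geq \rho\right) = 1 .$$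
   Context: **Kernels.** $|\cdot|$ is the $\ell_\infty$-norm. A transition kernel $Q$ on $\mathbb{Z}^d$ (nonnegative, rows summing to 1) is symmetric if $Q(x,y)=Q(y,x)$, translation-invariant if $Q(x,y)=Q(0,y-x)$, and heavy-tailed with exponent $\alpha$ if there is $K>0$ with $K^{-1}|x-y|^{-(d+\alpha)}\le Q(x,y)\le K|x-y|^{-(d+\alpha)}$ for all $x\neq y$. $\mathbb{T}^d_L=\mathbb{Z}^d/L\mathbb{Z}^d$, $\pi:\mathbb{Z}^d\to\mathbb{T}^d_L$ is the canonical projection, $o=0$ is the origin, and $Q_L(u,v)=\sum_{x\in\pi^{-1}(v-u)}Q(o,x)$. **Frog model with planted particle.** On the vertex set $V=\mathbb{T}^d_L$, each vertex $v$ carries an independent Poisson($\lambda$) number of (ordinary) particles, and $o$ carries one additional particle, the planted particle. Every particle has an independent infinite discrete-time random walk trajectory with kernel $Q_L$ started at its initial vertex. Ordinary particles have lifespan $\ell$ (they stop existing after $\ell$ steps once activated) and the planted particle has lifespan $\ell_o$. Dynamically: at time 0 the particles at $o$ are active and all others are inactive; an active particle walks along its trajectory for its lifespan, and inactive particles at a vertex become active as soon as an active particle visits that vertex. Formally, let $T(v,u)$ be the smallest $k\ge0$ such that either $k\le\ell$ and some ordinary particle started at $v$ is at $u$ after $k$ steps, or $v=o$, $k\le \ell_o$ and the planted particle is at $u$ after $k$ steps ($T(v,u)=\infty$ if there is no such $k$). The activation time is $\mathrm{AT}(o,u)=\inf\sum_{i=1}^m T(v_{i-1},v_i)$, the infimum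 being over $m\ge0$ and sequences $o=v_0,v_1,\dots,v_m=u$ with all $T(v_{i-1},v_i)<\infty$ ($\inf\emptyset=\infty$). Set $\mathcal{A}(t)=\{u\in V:\mathrm{AT}(o,u)\le t\}$. $\mathbb{P}_L^+$ is the law of this model. *)

theory Defs
  imports "HOL-Probability.Probability"
begin

subsection \<open>Transition kernels on the integer lattice\<close>

definition linf :: "int ^ 'd::finite \<Rightarrow> int" where
  "linf x = (MAX i\<in>UNIV. \<bar>x $ i\<bar>)"

definition transition_kernel :: "('a \<Rightarrow> 'a \<Rightarrow> real) \<Rightarrow> bool" where
  "transition_kernel Q \<longleftrightarrow> (\<forall>x y. 0 \<le> Q x y) \<and> (\<forall>x. (Q x has_sum 1) UNIV)"

definition symmetric_kernel :: "('a \<Rightarrow> 'a \<Rightarrow> real) \<Rightarrow> bool" where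
  "symmetric_kernel Q \<longleftrightarrow> (\<forall>x y. Q x y = Q y x)"

definition translation_invariant :: "('a::ab_group_add \<Rightarrow> 'a \<Rightarrow> real) \<Rightarrow> bool" where
  "translation_invariant Q \<longleftrightarrow> (\<forall>x y. Q x y = Q 0 (y - x))"

definition heavy_tailed :: "real \<Rightarrow> (int ^ 'd::finite \<Rightarrow> int ^ 'd \<Rightarrow> real) \<Rightarrow> bool" where
  "heavy_tailed \<alpha> Q \<longleftrightarrow>
     (\<exists>K>0. \<forall>x y. x \<noteq> y \<longrightarrow>
        inverse K * real_of_int (linf (x - y)) powr - (real CARD('d) + \<alpha>) \<le> Q x y \<and>
        Q x y \<le> K * real_of_int (linf (x - y)) powr - (real CARD('d) + \<alpha>))"


subsection \<open>The torus and the projected kernel\<close>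

text \<open>A vertex of the torus of side length \<open>L \<ge> 1\<close> is identified with its unique
  representative that has all coordinates in \<open>{0..<L}\<close>.\<close>

definition torus :: "nat \<Rightarrow> (int ^ 'd::finite) set" where
  "torus L = {x. \<forall>i. x $ i \<in> {0..<int L}}"

definition proj :: "nat \<Rightarrow> int ^ 'd::finite \<Rightarrow> int ^ 'd" where
  "proj L x = (\<chi> i. x $ i mod int L)"

definition torus_kernel ::
    "nat \<Rightarrow> (int ^ 'd::finite \<Rightarrow> int ^ 'd \<Rightarrow> real) \<Rightarrow> int ^ 'd \<Rightarrow> int ^ 'd \<Rightarrow> real" where
  "torus_kernel L Q u v = (\<Sum>\<^sub>\<infinity>x\<in>{x. proj L x = proj L (v - u)}. Q 0 x)"


subsection \<open>Law of the frog model with planted particle\<close>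

text \<open>The random walk is realised by summing independent increments with law \<open>Q\<^sub>L(0, \<cdot>)\<close> on the
  torus; lemma \<open>walk_law_cylinder\<close> below confirms that it is the Markov chain with kernel
  \<open>Q\<^sub>L\<close> started at \<open>v\<close>.\<close>

definition step_law ::
    "nat \<Rightarrow> (int ^ 'd::finite \<Rightarrow> int ^ 'd \<Rightarrow> real) \<Rightarrow> (int ^ 'd) measure" where
  "step_law L Q = point_measure (torus L) (\<lambda>v. ennreal (torus_kernel L Q 0 v))"

definition walk_law ::
    "nat \<Rightarrow> (int ^ 'd::finite \<Rightarrow> int ^ 'd \<Rightarrow> real) \<Rightarrow> int ^ 'd \<Rightarrow> (nat \<Rightarrow> int ^ 'd) measure" where
  "walk_law L Q v =
     distr (\<Pi>\<^sub>M k\<in>UNIV. step_law L Q) (\<Pi>\<^sub>M k\<in>UNIV. count_space (torus L))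
       (\<lambda>\<xi> k. proj L (v + (\<Sum>i<k. \<xi> i)))"

text \<open>A sample point \<open>(\<eta>, S, S')\<close> consists of the numbers \<open>\<eta> v\<close> of ordinary particles
  at the vertices \<open>v\<close>, the trajectories \<open>S (v, j)\<close> and the trajectory \<open>S'\<close> of the planted
  particle.  Trajectories are attached to all \<open>j :: nat\<close>, but only the particles \<open>(v, j)\<close> with
  \<open>j < \<eta> v\<close> are present.\<close>

type_synonym 'd frog_sample =
  "(int ^ 'd \<Rightarrow> nat) \<times> ((int ^ 'd) \<times> nat \<Rightarrow> nat \<Rightarrow> int ^ 'd) \<times> (nat \<Rightarrow> int ^ 'd)"

definition frog_law ::
    "nat \<Rightarrow> (int ^ 'd::finite \<Rightarrow> int ^ 'd \<Rightarrow> real) \<Rightarrow> real \<Rightarrow> 'd frog_sample measure" where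
  "frog_law L Q lam =
     (\<Pi>\<^sub>M v\<in>torus L. measure_pmf (poisson_pmf lam)) \<Otimes>\<^sub>M
     ((\<Pi>\<^sub>M p\<in>torus L \<times> UNIV. walk_law L Q (fst p)) \<Otimes>\<^sub>M walk_law L Q 0)"


subsection \<open>Activation\<close>

text \<open>Here \<open>l\<close> is the lifespan of the ordinary particles and \<open>lo\<close> that of the planted one.
  In the type \<open>enat\<close> the infimum of the empty set is \<open>\<infinity>\<close>.\<close>

fun travel_time ::
    "nat \<Rightarrow> nat \<Rightarrow> ('d::finite) frog_sample \<Rightarrow> int ^ 'd \<Rightarrow> int ^ 'd \<Rightarrow> enat" where
  "travel_time l lo (\<eta>, S, S') v u =
     (INF k\<in>{k. (k \<le> l \<and> (\<exists>j<\<eta> v. S (v, j) k = u)) \<or> (v = 0 \<and> k \<le> lo \<and> S' k = u)}. enat k)"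

definition activation_time ::
    "nat \<Rightarrow> nat \<Rightarrow> nat \<Rightarrow> ('d::finite) frog_sample \<Rightarrow> int ^ 'd \<Rightarrow> enat" where
  "activation_time L l lo \<omega> u =
     Inf {\<Sum>i<m. travel_time l lo \<omega> (v i) (v (Suc i)) | m v.
            v 0 = 0 \<and> v m = u \<and> (\<forall>i\<le>m. v i \<in> torus L) \<and>
            (\<forall>i<m. travel_time l lo \<omega> (v i) (v (Suc i)) < \<infinity>)}"

definition activated ::
    "nat \<Rightarrow> nat \<Rightarrow> nat \<Rightarrow> ('d::finite) frog_sample \<Rightarrow> real \<Rightarrow> (int ^ 'd) set" where
  "activated L l lo \<omega> t =
     {u \<in> torus L. ereal_of_enat (activation_time L l lo \<omega> u) \<le> ereal t}"


subsection \<open>Well-posedness of the construction\<close>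

lemma proj_simps [simp]:
  "proj L (proj L x) = proj L x"
  "proj L (proj L x + y) = proj L (x + y)"
  "proj L (x + proj L y) = proj L (x + y)"
  "proj L (proj L x - y) = proj L (x - y)"
  "proj L (x - proj L y) = proj L (x - y)"
  by (simp_all add: proj_def vec_eq_iff mod_simps)

lemma proj_in_torus [simp]: "L > 0 \<Longrightarrow> proj L x \<in> torus L"
  by (simp add: proj_def torus_def)

lemma proj_id: "x \<in> torus L \<Longrightarrow> proj L x = x"
  by (simp add: proj_def torus_def vec_eq_iff)

lemma finite_torus [simp]: "finite (torus L :: (int ^ 'd::finite) set)"
proof (rule finite_subset)
  show "torus L \<subseteq> vec_lambda ` ((UNIV :: 'd set) \<rightarrow>\<^sub>E {0..<int L})"
  proof
    fix x :: "int ^ 'd" assume "x \<in> torus L"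
    then show "x \<in> vec_lambda ` ((UNIV :: 'd set) \<rightarrow>\<^sub>E {0..<int L})"
      by (intro image_eqI[where x = "vec_nth x"]) (auto simp: torus_def)
  qed
qed (intro finite_imageI finite_PiE; simp)

lemma torus_kernel_nonneg: "transition_kernel Q \<Longrightarrow> torus_kernel L Q u v \<ge> 0"
  by (auto simp: torus_kernel_def transition_kernel_def intro: infsum_nonneg)

lemma torus_kernel_shift: "torus_kernel L Q 0 (proj L (v - u)) = torus_kernel L Q u v"
  by (simp add: torus_kernel_def)

lemma sum_torus_kernel:
  fixes Q :: "int ^ 'd::finite \<Rightarrow> int ^ 'd \<Rightarrow> real"
  assumes "transition_kernel Q" "L > 0"
  shows "(\<Sum>v\<in>torus L. torus_kernel L Q 0 v) = 1"
proof -
  let ?B = "\<lambda>v. {x. proj L x = v}"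
  let ?S = "Sigma (torus L :: (int ^ 'd) set) ?B"
  have Q: "(Q 0 has_sum 1) UNIV" using assms(1) by (auto simp: transition_kernel_def)
  have bij: "bij_betw snd ?S (UNIV :: (int ^ 'd) set)"
    by (rule bij_betw_byWitness[where f' = "\<lambda>x. (proj L x, x)"]) (use assms in auto)
  have hs: "((\<lambda>p. Q 0 (snd p)) has_sum 1) ?S"
    using has_sum_reindex_bij_betw[OF bij, of "Q 0" 1] Q by simp
  have "(\<Sum>v\<in>torus L. torus_kernel L Q 0 v) = (\<Sum>v\<in>torus L. infsum (Q 0) (?B v))"
    by (intro sum.cong) (auto simp: torus_kernel_def proj_id)
  also have "\<dots> = infsum (\<lambda>v. infsum (\<lambda>x. Q 0 (snd (v, x))) (?B v)) (torus L)"
    by (simp add: infsum_finite)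
  also have "\<dots> = infsum (\<lambda>p. Q 0 (snd p)) ?S"
    using infsum_Sigma'_banach[of "\<lambda>v x. Q 0 x" "torus L" ?B] hs
    by (auto simp: case_prod_unfold summable_on_def)
  also have "\<dots> = 1" using hs by (rule infsumI)
  finally show ?thesis .
qed

lemma prob_space_step_law:
  assumes "transition_kernel Q" "L > 0"
  shows "prob_space (step_law L Q)"
  unfolding step_law_def
  by (intro prob_space_point_measure)
     (use sum_torus_kernel[OF assms] torus_kernel_nonneg[OF assms(1)]
       in \<open>auto simp: sum_ennreal\<close>)

lemma space_step_law [simp]: "space (step_law L Q) = torus L"
  by (simp add: step_law_def space_point_measure)

lemma sets_step_law [measurable_cong]: "sets (step_law L Q) = sets (count_space (torus L))"
  by (simp add: step_law_def sets_point_measure_count_space)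

lemma sets_walk_law [measurable_cong]:
  "sets (walk_law L Q v) = sets (\<Pi>\<^sub>M k\<in>UNIV. count_space (torus L))"
  by (simp add: walk_law_def)

lemma measurable_walk:
  fixes v :: "int ^ 'd::finite"
  assumes L: "L > 0"
  shows "(\<lambda>\<xi> k::nat. proj L (v + (\<Sum>i<k. \<xi> i))) \<in>
           (\<Pi>\<^sub>M k\<in>UNIV. step_law L Q) \<rightarrow>\<^sub>M (\<Pi>\<^sub>M k\<in>UNIV. count_space (torus L))"
proof -
  let ?M = "\<Pi>\<^sub>M k\<in>(UNIV::nat set). step_law L Q"
  have "(\<lambda>\<xi>. proj L (v + (\<Sum>i<k. \<xi> i))) \<in> ?M \<rightarrow>\<^sub>M count_space (torus L)" for k
  proof (induction k)
    case 0
    show ?case using L by simp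
  next
    case (Suc k)
    have eq: "proj L (v + (\<Sum>i<Suc k. \<xi> i)) = proj L (proj L (v + (\<Sum>i<k. \<xi> i)) + \<xi> k)" for \<xi>
      by (simp add: add.assoc)
    have comp: "(\<lambda>\<xi>. \<xi> k) \<in> ?M \<rightarrow>\<^sub>M count_space (torus L)"
      by measurable
    have cnt: "countable (torus L :: (int ^ 'd) set)" by (simp add: countable_finite)
    show ?case unfolding eq
      by (rule measurable_compose_countable'[OF _ Suc cnt],
          rule measurable_compose[OF comp]) (use L in simp)
  qed
  then show ?thesis by (intro measurable_PiM_single') (auto simp: space_PiM PiE_def L)
qed

lemma prob_space_walk_law:
  assumes "transition_kernel Q" "L > 0"
  shows "prob_space (walk_law L Q v)"
  unfolding walk_law_def
  by (intro prob_space.prob_space_distr prob_space_PiM prob_space_step_law measurable_walk assms)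

lemma walk_law_cylinder:
  fixes Q :: "int ^ 'd::finite \<Rightarrow> int ^ 'd \<Rightarrow> real"
  assumes Q: "transition_kernel Q" and L: "L > 0"
    and v: "v \<in> torus L" and x: "\<And>k. k \<le> n \<Longrightarrow> x k \<in> torus L"
  shows "measure (walk_law L Q v) {S \<in> space (walk_law L Q v). \<forall>k\<le>n. S k = x k} =
           (if x 0 = v then \<Prod>k<n. torus_kernel L Q (x k) (x (Suc k)) else 0)"
proof -
  let ?M = "\<Pi>\<^sub>M k\<in>(UNIV::nat set). step_law L Q"
  let ?X = "\<lambda>\<xi> k. proj L (v + (\<Sum>i<k. \<xi> i))"
  let ?y = "\<lambda>k. proj L (x (Suc k) - x k)"
  interpret product_prob_space "\<lambda>_. step_law L Q" "UNIV :: nat set"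
    using prob_space_step_law[OF Q L]
    by (simp add: product_prob_space_def product_sigma_finite_def product_prob_space_axioms_def
        prob_space_imp_sigma_finite)
  have key: "(\<forall>k\<le>n. ?X \<xi> k = x k) \<longleftrightarrow> x 0 = v \<and> (\<forall>k<n. \<xi> k = ?y k)"
    if \<xi>: "\<And>k. \<xi> k \<in> torus L" for \<xi> :: "nat \<Rightarrow> int ^ 'd"
  proof (intro iffI conjI allI impI)
    assume *: "\<forall>k\<le>n. ?X \<xi> k = x k"
    show "x 0 = v" using *[rule_format, of 0] v by (simp add: proj_id)
    fix k assume "k < n"
    then have "?X \<xi> (Suc k) = x (Suc k)" "?X \<xi> k = x k" using * by (blast intro: Suc_leI less_imp_le)+
    then have "?y k = proj L (?X \<xi> (Suc k) - ?X \<xi> k)" by (simp only:)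
    also have "\<dots> = \<xi> k" using \<xi> by (simp add: proj_id algebra_simps)
    finally show "\<xi> k = ?y k" by simp
  next
    fix k assume *: "x 0 = v \<and> (\<forall>k<n. \<xi> k = ?y k)" and "k \<le> n"
    from \<open>k \<le> n\<close> show "?X \<xi> k = x k"
    proof (induction k)
      case 0
      then show ?case using * v by (simp add: proj_id)
    next
      case (Suc k)
      have "?X \<xi> (Suc k) = proj L (?X \<xi> k + \<xi> k)" by (simp add: add.assoc)
      also have "\<dots> = x (Suc k)" using Suc * x[of "Suc k"] by (simp add: proj_id)
      finally show ?case .
    qed
  qed
  have "{S \<in> space (walk_law L Q v). \<forall>k\<le>n. S k = x k} \<in> sets (walk_law L Q v)"
    by measurable (auto simp: x)
  then have "measure (walk_law L Q v) {S \<in> space (walk_law L Q v). \<forall>k\<le>n. S k = x k} =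
      measure ?M (?X -` {S \<in> space (walk_law L Q v). \<forall>k\<le>n. S k = x k} \<inter> space ?M)"
    unfolding walk_law_def by (intro measure_distr measurable_walk L) auto
  also have "?X -` {S \<in> space (walk_law L Q v). \<forall>k\<le>n. S k = x k} \<inter> space ?M =
      (if x 0 = v then prod_emb UNIV (\<lambda>_. step_law L Q) {..<n} (\<Pi>\<^sub>E k\<in>{..<n}. {?y k}) else {})"
  proof -
    have "?X -` {S \<in> space (walk_law L Q v). \<forall>k\<le>n. S k = x k} \<inter> space ?M =
        {\<xi> \<in> space ?M. \<forall>k\<le>n. ?X \<xi> k = x k}"
      using L by (auto simp: walk_law_def space_PiM)
    also have "\<dots> = {\<xi> \<in> space ?M. x 0 = v \<and> (\<forall>k<n. \<xi> k = ?y k)}"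
      by (intro Collect_cong conj_cong refl key) (auto simp: space_PiM)
    also have "\<dots> = (if x 0 = v then
        prod_emb UNIV (\<lambda>_. step_law L Q) {..<n} (\<Pi>\<^sub>E k\<in>{..<n}. {?y k}) else {})"
      by (auto simp: prod_emb_def space_PiM PiE_iff)
    finally show ?thesis .
  qed
  also have "measure ?M \<dots> =
      (if x 0 = v then \<Prod>k<n. measure (step_law L Q) {?y k} else 0)"
    using L by (auto intro!: measure_PiM_emb simp: sets_step_law)
  also have "(\<lambda>k. measure (step_law L Q) {?y k}) = (\<lambda>k. torus_kernel L Q (x k) (x (Suc k)))"
    using L torus_kernel_nonneg[OF Q]
    by (auto simp: step_law_def measure_def emeasure_point_measure_finite torus_kernel_shift)
  finally show ?thesis .
qed

lemma prob_space_frog_law: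
  assumes "transition_kernel Q" "L > 0"
  shows "prob_space (frog_law L Q lam)"
  unfolding frog_law_def
  by (intro prob_space_pair prob_space_PiM prob_space_walk_law prob_space_measure_pmf assms)

lemma sets_activated_event:
  fixes Q :: "int ^ 'd::finite \<Rightarrow> int ^ 'd \<Rightarrow> real"
  assumes L: "L > 0"
  shows "{\<omega> \<in> space (frog_law L Q lam). P (activated L l lo \<omega> t)} \<in> sets (frog_law L Q lam)"
proof -
  let ?F = "frog_law L Q lam"
  let ?V = "torus L :: (int ^ 'd) set"
  define hit where "hit \<omega> v u k \<longleftrightarrow>
      (k \<le> l \<and> (\<exists>j<fst \<omega> v. fst (snd \<omega>) (v, j) k = u)) \<or>
      (v = 0 \<and> k \<le> lo \<and> snd (snd \<omega>) k = u)" for \<omega> :: "'d frog_sample" and v u k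
  have T: "travel_time l lo \<omega> v u = (INF k\<in>Collect (hit \<omega> v u). enat k)" for \<omega> v u
    by (cases \<omega>) (simp add: hit_def[abs_def])
  have mhit [measurable]: "Measurable.pred ?F (\<lambda>\<omega>. hit \<omega> v u k)" if v: "v \<in> ?V" and u: "u \<in> ?V" for v u k
  proof -
    have "(\<lambda>\<omega>. fst \<omega> v) \<in> ?F \<rightarrow>\<^sub>M measure_pmf (poisson_pmf lam)"
      unfolding frog_law_def using v by measurable
    then have [measurable]: "(\<lambda>\<omega>. fst \<omega> v) \<in> ?F \<rightarrow>\<^sub>M count_space UNIV" by simp
    have "(\<lambda>\<omega>. fst (snd \<omega>) (v, j)) \<in> ?F \<rightarrow>\<^sub>M walk_law L Q (fst (v, j))" for j
      unfolding frog_law_def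
      by (rule measurable_compose[where g = "\<lambda>S. S (v, j)",
            OF measurable_compose[OF measurable_snd measurable_fst]
              measurable_component_singleton]) (use v in auto)
    then have [measurable]:
      "(\<lambda>\<omega>. fst (snd \<omega>) (v, j)) \<in> ?F \<rightarrow>\<^sub>M (\<Pi>\<^sub>M k\<in>UNIV. count_space ?V)" for j
      by (simp cong: measurable_cong_sets add: sets_walk_law)
    have "(\<lambda>\<omega>. snd (snd \<omega>)) \<in> ?F \<rightarrow>\<^sub>M walk_law L Q 0"
      unfolding frog_law_def by measurable
    then have [measurable]: "(\<lambda>\<omega>. snd (snd \<omega>)) \<in> ?F \<rightarrow>\<^sub>M (\<Pi>\<^sub>M k\<in>UNIV. count_space ?V)"
      by (simp cong: measurable_cong_sets add: sets_walk_law)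
    have 1: "Measurable.pred ?F (\<lambda>\<omega>. fst (snd \<omega>) (v, j) k = u)" for j
      by (rule pred_eq_const1[where N = "count_space ?V"]) (use u in \<open>measurable; simp\<close>)+
    have 2: "Measurable.pred ?F (\<lambda>\<omega>. snd (snd \<omega>) k = u)"
      by (rule pred_eq_const1[where N = "count_space ?V"]) (use u in \<open>measurable; simp\<close>)+
    note [measurable] = 1 2
    show ?thesis unfolding hit_def by measurable
  qed
  have Teq: "Measurable.pred ?F (\<lambda>\<omega>. travel_time l lo \<omega> v u = c)" if "v \<in> ?V" "u \<in> ?V" for v u c
  proof (cases c)
    case (enat n)
    have "travel_time l lo \<omega> v u = c \<longleftrightarrow> hit \<omega> v u n \<and> (\<forall>k<n. \<not> hit \<omega> v u k)" for \<omega>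
    proof
      assume *: "travel_time l lo \<omega> v u = c"
      have ne: "Collect (hit \<omega> v u) \<noteq> {}"
      proof
        assume e: "Collect (hit \<omega> v u) = {}"
        show False using * unfolding T e enat by (simp add: top_enat_def)
      qed
      then obtain k where k: "hit \<omega> v u k" "enat k = c"
        using * Inf_enat_def unfolding T
        by (smt (verit, ccfv_SIG) LeastI_ex ex_in_conv image_iff image_is_empty mem_Collect_eq)
      moreover have "c \<le> enat j" if "hit \<omega> v u j" for j
        using * that unfolding T by (metis INF_lower mem_Collect_eq)
      ultimately show "hit \<omega> v u n \<and> (\<forall>k<n. \<not> hit \<omega> v u k)" using enat by force
    next
      assume "hit \<omega> v u n \<and> (\<forall>k<n. \<not> hit \<omega> v u k)"
      then show "travel_time l lo \<omega> v u = c"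
        unfolding T enat
        by (intro antisym INF_lower INF_greatest) (auto simp: not_less[symmetric])
    qed
    then show ?thesis using that by simp
  next
    case infinity
    have "travel_time l lo \<omega> v u = c \<longleftrightarrow> (\<forall>k. \<not> hit \<omega> v u k)" for \<omega>
      unfolding T infinity top_enat_def[symmetric] INF_top_conv by (simp add: top_enat_def)
    then show ?thesis using that by simp
  qed
  define R where "R \<omega> = restrict (\<lambda>(v, u). travel_time l lo \<omega> v u) (?V \<times> ?V)"
    for \<omega> :: "'d frog_sample"
  have RP: "R \<omega> \<in> ?V \<times> ?V \<rightarrow>\<^sub>E UNIV" for \<omega> by (auto simp: R_def)
  have R: "R \<in> ?F \<rightarrow>\<^sub>M count_space (?V \<times> ?V \<rightarrow>\<^sub>E UNIV)"
  proof (subst measurable_count_space_eq_countable)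
    show "countable (?V \<times> ?V \<rightarrow>\<^sub>E (UNIV :: enat set))"
      by (intro countable_PiE finite_cartesian_product finite_torus countableI_type)
    have "R -` {a} \<inter> space ?F \<in> sets ?F" if a: "a \<in> ?V \<times> ?V \<rightarrow>\<^sub>E UNIV" for a
    proof -
      have "R -` {a} \<inter> space ?F =
          {\<omega> \<in> space ?F. \<forall>v\<in>?V. \<forall>u\<in>?V. travel_time l lo \<omega> v u = a (v, u)}"
        using a unfolding R_def by (auto simp: fun_eq_iff restrict_def PiE_iff extensional_def)
      also have "\<dots> \<in> sets ?F"
        using Teq by (intro sets.sets_Collect_finite_All finite_torus) (auto simp: pred_def)
      finally show ?thesis .
    qed
    then show "R \<in> space ?F \<rightarrow> (?V \<times> ?V \<rightarrow>\<^sub>E UNIV) \<and>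
        (\<forall>a\<in>?V \<times> ?V \<rightarrow>\<^sub>E UNIV. R -` {a} \<inter> space ?F \<in> sets ?F)"
      by (auto simp: R_def)
  qed
  have dep: "activated L l lo \<omega> t = activated L l lo \<omega>' t" if "R \<omega> = R \<omega>'" for \<omega> \<omega>'
  proof -
    have T': "travel_time l lo \<omega> v u = travel_time l lo \<omega>' v u" if "v \<in> ?V" "u \<in> ?V" for v u
      using fun_cong[OF \<open>R \<omega> = R \<omega>'\<close>, of "(v, u)"] that by (simp add: R_def)
    have "activation_time L l lo \<omega> u = activation_time L l lo \<omega>' u" for u
    proof -
      have "(a = (\<Sum>i<m. travel_time l lo \<omega> (v i) (v (Suc i))) \<and>
             v 0 = 0 \<and> v m = u \<and> (\<forall>i\<le>m. v i \<in> ?V) \<and>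
             (\<forall>i<m. travel_time l lo \<omega> (v i) (v (Suc i)) < \<infinity>)) \<longleftrightarrow>
            (a = (\<Sum>i<m. travel_time l lo \<omega>' (v i) (v (Suc i))) \<and>
             v 0 = 0 \<and> v m = u \<and> (\<forall>i\<le>m. v i \<in> ?V) \<and>
             (\<forall>i<m. travel_time l lo \<omega>' (v i) (v (Suc i)) < \<infinity>))" for a m v
      proof (cases "\<forall>i\<le>m. v i \<in> ?V")
        case True
        then have eq: "travel_time l lo \<omega> (v i) (v (Suc i)) = travel_time l lo \<omega>' (v i) (v (Suc i))"
          if "i < m" for i
          using that by (intro T') auto
        have "(\<Sum>i<m. travel_time l lo \<omega> (v i) (v (Suc i))) =
            (\<Sum>i<m. travel_time l lo \<omega>' (v i) (v (Suc i)))"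
          by (intro sum.cong) (auto simp: eq)
        moreover have "(\<forall>i<m. travel_time l lo \<omega> (v i) (v (Suc i)) < \<infinity>) \<longleftrightarrow>
            (\<forall>i<m. travel_time l lo \<omega>' (v i) (v (Suc i)) < \<infinity>)"
          by (simp add: eq)
        ultimately show ?thesis by (simp only:)
      qed auto
      then show ?thesis unfolding activation_time_def by (simp only:)
    qed
    then show ?thesis by (simp add: activated_def)
  qed
  have "{\<omega> \<in> space ?F. P (activated L l lo \<omega> t)} =
      R -` (R ` {\<omega> \<in> space ?F. P (activated L l lo \<omega> t)}) \<inter> space ?F"
  proof (intro equalityI subsetI)
    fix \<omega> assume "\<omega> \<in> R -` (R ` {\<omega> \<in> space ?F. P (activated L l lo \<omega> t)}) \<inter> space ?F"
    then obtain \<omega>' where "\<omega> \<in> space ?F" "R \<omega> = R \<omega>'" "P (activated L l lo \<omega>' t)" by blast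
    then show "\<omega> \<in> {\<omega> \<in> space ?F. P (activated L l lo \<omega> t)}"
      using dep[of \<omega> \<omega>'] by simp
  qed blast
  also have "\<dots> \<in> sets ?F"
    by (intro measurable_sets[OF R]) (simp only: sets_count_space, use RP in blast)
  finally show ?thesis .
qed

end

theory Submission
  imports Defs "HOL-Real_Asymp.Real_Asymp"
begin

text \<open>Grouping the ordinary particles according to their first \<open>l\<close> steps turns the model into
  independent Bernoulli variables indexed by paths.  A lower bound on Green functions on the torus
  shows that a block of large fixed side is open with high probability: its particles visit, within
  a bounded number of steps, every vertex of the block and of the neighbouring blocks.  Only
  particles with one prescribed first step are used for this, which leaves all other paths available
  for independent constructions.  A box of level \<open>k + 1\<close> is good if at most one of its \<open>3\<^sup>d\<close> sub-boxes
  is bad; since \<open>p\<^sub>k\<^sub>+\<^sub>1 \<le> 9\<^sup>d p\<^sub>k\<^sup>2\<close> for the probabilities of bad boxes, almost all blocks are connected along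
  lines by detours whose total length is linear, which is the case \<open>\<alpha> \<ge> d\<close>.

  If \<open>\<alpha> < d\<close>, choose \<open>(d + \<alpha>) / (2 d) < \<gamma> < 1\<close> and divide a box of side \<open>n\<close> into boxes of side
  \<open>n\<^sup>\<gamma>\<close>.  Two sub-boxes contain of order \<open>n\<close> to the power \<open>2 d \<gamma>\<close> pairs of vertices, and a jump
  between a given pair has probability at least of order \<open>n\<close> to the power \<open>- (d + \<alpha>)\<close>; hence all good
  sub-boxes are linked directly.  Hence the number of hops satisfies \<open>\<tau>(n) = 2 \<tau>(n\<^sup>\<gamma>) + 1\<close> and grows like \<open>log n\<close> to the
  power \<open>log 2 / log (1 / \<gamma>)\<close>.  The planted particle only serves to activate all vertices of some
  box of fixed side in bounded time.\<close>

section \<open>Independence in finite products of probability mass functions\<close>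

text \<open>A vertex reached by open blocks may carry no particle, so chains of open blocks are
  traced backwards and cannot start at a prescribed vertex; a start is either a swept box or a seed,
  a block almost all of whose pairs are joined by direct jumps. For the walk, bounds uniform in
  \<open>L\<close> are needed rather than exact asymptotics. A truncated moment bounds the return
  probability \<open>u k = p (2 * k) 0\<close> below by a power of \<open>k\<close>, log-convexity
  turns this into a bound on its relative decrease \<open>s k\<close>, and \<open>s k\<close> is an
  average of the defects \<open>1 - p (2 * k) z / u k\<close>. Hence \<open>p (2 * k)\<close> is
  almost flat on cubes of radius nearly \<open>k\<close> to the power
  \<open>1 / min \<alpha> 2\<close>, which bounds \<open>u\<close> from above and Green functions
  from below. As the swept box has a random position, all estimates are uniform in the position
  \<open>x\<close>; the sweep is independent of the ordinary particles, and the cases are summed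
  over \<open>x\<close>. The block construction fixes a path length \<open>l0\<close>, and every
  lifespan \<open>l \<ge> l0\<close> is covered because only the first \<open>l0\<close> steps of
  the particles are used.\<close>

lemma Pi_pmf_merge:
  assumes [simp]: "finite I"
  shows "map_pmf (\<lambda>(g, f) i. if i \<in> J then g i else f i) (pair_pmf (Pi_pmf I d p) (Pi_pmf I d p))
    = Pi_pmf I d p"
proof -
  let ?P = "Pi_pmf I d p"
  define m1 where "m1 = (\<lambda>(g, f) i. if i \<in> I \<inter> J then g i else f i :: 'b)"
  define m2 where "m2 = (\<lambda>(g, f) i. if i \<in> J then g i else f i :: 'b)"
  define r where "r K = (\<lambda>f i. if i \<in> K then f i else d)" for K :: "'a set"
  have "?P = Pi_pmf ((I \<inter> J) \<union> (I - J)) d p"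
    by (rule arg_cong[of _ _ "\<lambda>A. Pi_pmf A d p"]) auto
  also have "\<dots> = map_pmf m1 (pair_pmf (Pi_pmf (I \<inter> J) d p) (Pi_pmf (I - J) d p))"
    unfolding m1_def by (rule Pi_pmf_union) auto
  also have "Pi_pmf (I \<inter> J) d p = map_pmf (r (I \<inter> J)) ?P"
    unfolding r_def by (rule Pi_pmf_subset) auto
  also have "Pi_pmf (I - J) d p = map_pmf (r (I - J)) ?P"
    unfolding r_def by (rule Pi_pmf_subset) auto
  also have "map_pmf m1 (pair_pmf (map_pmf (r (I \<inter> J)) ?P) (map_pmf (r (I - J)) ?P)) =
     map_pmf (\<lambda>x. m1 (r (I \<inter> J) (fst x), r (I - J) (snd x))) (pair_pmf ?P ?P)"
    unfolding map_pair[symmetric] pmf.map_comp by (simp add: o_def case_prod_unfold)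
  \<comment> \<open>Outside \<open>I\<close> both samples take the default value, so replacing
    \<open>I \<inter> J\<close> by \<open>J\<close> in the merge changes nothing on the
    support.\<close>
  also have "\<dots> = map_pmf m2 (pair_pmf ?P ?P)"
  proof (rule map_pmf_cong[OF refl])
    fix x assume x: "x \<in> set_pmf (pair_pmf ?P ?P)"
    have "snd x \<in> set_pmf ?P" "fst x \<in> set_pmf ?P"
      using x by auto
    then have "snd x i = d" "fst x i = d" if "i \<notin> I" for i
      using set_Pi_pmf_subset[OF assms, of d p] that by blast+
    then show "m1 (r (I \<inter> J) (fst x), r (I - J) (snd x)) = m2 x"
      unfolding m1_def m2_def r_def by (simp add: case_prod_unfold fun_eq_iff)
  qed
  finally show ?thesis unfolding m2_def by (rule sym)
qed

text \<open>The codomain is arbitrary, so that not only events but also set-valued choices such as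
  \<open>pick\<close> can be said to depend on the coordinates in \<open>J\<close> only.\<close>

definition dep :: "(('i \<Rightarrow> 'b) \<Rightarrow> 'c) \<Rightarrow> 'i set \<Rightarrow> bool" where
  "dep A J \<longleftrightarrow> (\<forall>f g. (\<forall>i\<in>J. f i = g i) \<longrightarrow> A f = A g)"

lemma depD: "dep A J \<Longrightarrow> (\<And>i. i \<in> J \<Longrightarrow> f i = g i) \<Longrightarrow> A f = A g"
  unfolding dep_def by blast

lemma dep_mono: "dep A J \<Longrightarrow> J \<subseteq> J' \<Longrightarrow> dep A J'"
  unfolding dep_def by blast

lemma dep_merge: "dep A J \<Longrightarrow> A (\<lambda>i. if i \<in> J then g i else f i) = A g"
  by (rule depD[of A J "\<lambda>i. if i \<in> J then g i else f i" g]) auto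

lemma dep_merge_disj: "dep A J' \<Longrightarrow> J \<inter> J' = {} \<Longrightarrow> A (\<lambda>i. if i \<in> J then g i else f i) = A f"
  by (rule depD[of A J' "\<lambda>i. if i \<in> J then g i else f i" f]) auto

text \<open>The supports are countable, and restricting both factors to them reduces the claim to
  the product rule for countable sets.\<close>

lemma measure_pmf_prob_Times:
  "measure_pmf.prob (pair_pmf M N) (A \<times> B) = measure_pmf.prob M A * measure_pmf.prob N B"
proof -
  let ?A = "A \<inter> set_pmf M" and ?B = "B \<inter> set_pmf N"
  have "measure_pmf.prob (pair_pmf M N) (A \<times> B) = measure_pmf.prob (pair_pmf M N) (?A \<times> ?B)"
    by (subst (1) measure_Int_set_pmf[symmetric], rule arg_cong[of _ _ "measure _"]) auto
  also have "\<dots> = measure_pmf.prob M ?A * measure_pmf.prob N ?B"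
    by (rule measure_pmf_prob_product) auto
  finally show ?thesis by (simp add: measure_Int_set_pmf)
qed

text \<open>After merging two independent samples along \<open>J\<close>, one event sees only the
  first sample and the other only the second.\<close>

lemma Pi_pmf_indep:
  assumes "finite I" "dep A J" "dep B J'" "J \<inter> J' = {}"
  shows "measure_pmf.prob (Pi_pmf I d p) {f. A f \<and> B f} =
    measure_pmf.prob (Pi_pmf I d p) {f. A f} * measure_pmf.prob (Pi_pmf I d p) {f. B f}"
proof -
  let ?P = "Pi_pmf I d p"
  have "measure_pmf.prob ?P {f. A f \<and> B f} = measure_pmf.prob (pair_pmf ?P ?P)
     ((\<lambda>(g, f) i. if i \<in> J then g i else f i) -` {f. A f \<and> B f})"
    by (subst Pi_pmf_merge[OF assms(1), of J, symmetric], subst measure_map_pmf) simp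
  also have "(\<lambda>(g, f) i. if i \<in> J then g i else f i) -` {f. A f \<and> B f} = {f. A f} \<times> {f. B f}"
    by (auto simp: dep_merge[OF assms(2)] dep_merge_disj[OF assms(3,4)])
  finally show ?thesis by (simp add: measure_pmf_prob_Times)
qed

lemma prob_pair_le:
  assumes "\<And>g. g \<in> set_pmf M \<Longrightarrow> measure_pmf.prob N {f. A g f} \<le> e"
  shows "measure_pmf.prob (pair_pmf M N) {(g, f). A g f} \<le> e"
proof -
  have e: "e \<ge> 0"
  proof -
    obtain g where "g \<in> set_pmf M" using set_pmf_not_empty[of M] by auto
    from assms[OF this] show ?thesis by (rule order_trans[OF measure_nonneg])
  qed
  have "measure_pmf.prob (pair_pmf M N) {(g, f). A g f} =
      measure_pmf.expectation M (\<lambda>g. measure_pmf.prob N {f. A g f})"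
  proof -
    have "emeasure (pair_pmf M N) {(g, f). A g f} = (\<integral>\<^sup>+g. emeasure N {f. A g f} \<partial>M)"
      unfolding pair_pmf_def map_pmf_def[symmetric]
      by (subst emeasure_bind_pmf)
         (auto intro!: nn_integral_cong arg_cong2[of _ _ _ _ emeasure]
            simp flip: map_pmf_def)
    also have "\<dots> = ennreal (measure_pmf.expectation M (\<lambda>g. measure_pmf.prob N {f. A g f}))"
      by (simp add: measure_pmf.emeasure_eq_measure,
          rule nn_integral_eq_integral) (auto intro!: measure_pmf.integrable_const_bound[where B = 1])
    finally show ?thesis
      by (simp add: measure_pmf.emeasure_eq_measure integral_nonneg_AE)
  qed
  also have "\<dots> \<le> e"
    by (rule measure_pmf.integral_le_const)
       (auto simp: AE_measure_pmf_iff assms intro!: measure_pmf.integrable_const_bound[where B = 1])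
  finally show ?thesis .
qed

text \<open>This replaces conditioning on the coordinates in \<open>J\<close>: they are frozen at an
  arbitrary configuration \<open>g\<close>, while the others remain random. It is applied when an
  object chosen from the coordinates in \<open>J\<close> meets fresh randomness.\<close>

lemma Pi_pmf_cond_le:
  assumes "finite I"
    and "\<And>g. measure_pmf.prob (Pi_pmf I d p) {f. A (\<lambda>i. if i \<in> J then g i else f i)} \<le> e"
  shows "measure_pmf.prob (Pi_pmf I d p) {f. A f} \<le> e"
proof -
  have "measure_pmf.prob (Pi_pmf I d p) {f. A f} =
      measure_pmf.prob (pair_pmf (Pi_pmf I d p) (Pi_pmf I d p))
        {(g, f). A (\<lambda>i. if i \<in> J then g i else f i)}"
    by (subst Pi_pmf_merge[OF assms(1), of J, symmetric], subst measure_map_pmf)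
       (auto intro!: arg_cong2[of _ _ _ _ measure])
  also have "\<dots> \<le> e" by (rule prob_pair_le) (rule assms)
  finally show ?thesis .
qed

text \<open>Chebyshev's inequality for a count of pairwise independent events. The covariances
  vanish, so the variance is at most \<open>card I * p\<close>; keeping the factor \<open>p\<close>
  in the bound is what makes a small \<open>t\<close> affordable for rare events.\<close>

lemma count_deviation:
  fixes M :: "'a pmf" and A :: "'i \<Rightarrow> 'a set"
  assumes fin: "finite I" "I \<noteq> {}" and t: "t > 0"
    and indep: "\<And>i j. i \<in> I \<Longrightarrow> j \<in> I \<Longrightarrow> i \<noteq> j \<Longrightarrow>
      measure_pmf.prob M (A i \<inter> A j) = measure_pmf.prob M (A i) * measure_pmf.prob M (A j)"
    and le: "\<And>i. i \<in> I \<Longrightarrow> measure_pmf.prob M (A i) \<le> p"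
  shows "measure_pmf.prob M {x. real (card I) * (p + t) \<le> real (card {i\<in>I. x \<in> A i})}
    \<le> p / (real (card I) * t\<^sup>2)"
proof -
  let ?P = "\<lambda>i. measure_pmf.prob M (A i)"
  let ?E = "measure_pmf.expectation M"
  define X where "X x = (\<Sum>i\<in>I. indicator (A i) x - ?P i)" for x
  have bnd: "\<bar>indicator (A i) x - ?P i\<bar> \<le> 1" for i x
  proof -
    have "0 \<le> ?P i" "?P i \<le> 1" by (rule measure_nonneg, rule measure_pmf.prob_le_1)
    then show ?thesis by (cases "x \<in> A i") simp_all
  qed
  have int: "integrable M (\<lambda>x. (indicator (A i) x - ?P i) * (indicator (A j) x - ?P j))" for i j
    by (rule measure_pmf.integrable_const_bound[where B = 1])
       (auto simp: abs_mult intro!: mult_le_one bnd)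
  have Xsq: "(X x)\<^sup>2 = (\<Sum>i\<in>I. \<Sum>j\<in>I. (indicator (A i) x - ?P i) * (indicator (A j) x - ?P j))" for x
    by (simp add: X_def power2_eq_square sum_product)
  have intX: "integrable M (\<lambda>x. (X x)\<^sup>2)"
    unfolding Xsq by (intro Bochner_Integration.integrable_sum int)
  have cov: "?E (\<lambda>x. (indicator (A i) x - ?P i) * (indicator (A j) x - ?P j)) =
      measure_pmf.prob M (A i \<inter> A j) - ?P i * ?P j" for i j
  proof -
    have "(\<lambda>x. (indicator (A i) x - ?P i) * (indicator (A j) x - ?P j)) =
      (\<lambda>x. indicator (A i \<inter> A j) x - ?P j * indicator (A i) x - ?P i * indicator (A j) x + ?P i * ?P j)"
      by (auto simp: fun_eq_iff indicator_def algebra_simps)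
    moreover have "integrable M (indicator S :: _ \<Rightarrow> real)" for S
      by (rule measure_pmf.integrable_const_bound[where B = 1]) (auto simp: indicator_def)
    ultimately show ?thesis by simp
  qed
  have "?E (\<lambda>x. (X x)\<^sup>2) = (\<Sum>i\<in>I. \<Sum>j\<in>I. measure_pmf.prob M (A i \<inter> A j) - ?P i * ?P j)"
    unfolding Xsq
    by (subst Bochner_Integration.integral_sum, intro Bochner_Integration.integrable_sum int)
       (intro sum.cong refl, subst Bochner_Integration.integral_sum, auto simp: int cov)
  also have "\<dots> = (\<Sum>i\<in>I. ?P i - ?P i * ?P i)"
  proof (intro sum.cong refl)
    fix i assume i: "i \<in> I"
    have "(\<Sum>j\<in>I. measure_pmf.prob M (A i \<inter> A j) - ?P i * ?P j) =
        (\<Sum>j\<in>I. if j = i then ?P i - ?P i * ?P i else 0)"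
      using i by (intro sum.cong refl) (auto simp: indep)
    then show "(\<Sum>j\<in>I. measure_pmf.prob M (A i \<inter> A j) - ?P i * ?P j) = ?P i - ?P i * ?P i"
      using i fin by simp
  qed
  also have "\<dots> \<le> (\<Sum>i\<in>I. p)"
  proof (rule sum_mono)
    fix i assume "i \<in> I"
    then have "?P i \<le> p" by (rule le)
    moreover have "0 \<le> ?P i * ?P i" by simp
    ultimately show "?P i - ?P i * ?P i \<le> p" by linarith
  qed
  finally have EX: "?E (\<lambda>x. (X x)\<^sup>2) \<le> real (card I) * p" by simp
  have n: "real (card I) > 0" using fin by (simp add: card_gt_0_iff)
  have "measure_pmf.prob M {x. real (card I) * (p + t) \<le> real (card {i\<in>I. x \<in> A i})} \<le>
      measure_pmf.prob M {x \<in> space M. (X x)\<^sup>2 \<ge> (real (card I) * t)\<^sup>2}"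
  proof (rule measure_pmf.finite_measure_mono)
    show "{x. real (card I) * (p + t) \<le> real (card {i\<in>I. x \<in> A i})} \<subseteq>
        {x \<in> space M. (X x)\<^sup>2 \<ge> (real (card I) * t)\<^sup>2}"
    proof safe
      fix x assume *: "real (card I) * (p + t) \<le> real (card {i\<in>I. x \<in> A i})"
      have "X x = real (card {i\<in>I. x \<in> A i}) - (\<Sum>i\<in>I. ?P i)"
        using fin by (simp add: X_def sum_subtractf indicator_def sum.If_cases Int_def)
      moreover have "(\<Sum>i\<in>I. ?P i) \<le> real (card I) * p"
        using sum_bounded_above[of I ?P p] le by simp
      ultimately have "X x \<ge> real (card I) * t" using * by (simp add: algebra_simps)
      then show "(real (card I) * t)\<^sup>2 \<le> (X x)\<^sup>2" using t by (intro power_mono) auto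
    qed simp
  qed auto
  also have "\<dots> \<le> ?E (\<lambda>x. (X x)\<^sup>2) / (real (card I) * t)\<^sup>2"
    by (rule integral_Markov_inequality_measure[where A = "{}"]) (use intX n t in auto)
  also have "\<dots> \<le> real (card I) * p / (real (card I) * t)\<^sup>2"
    by (intro divide_right_mono EX) auto
  also have "\<dots> = p / (real (card I) * t\<^sup>2)"
    using n t by (simp add: power2_eq_square field_simps)
  finally show ?thesis .
qed

lemma prob_union_le:
  fixes M :: "'a pmf"
  assumes "finite I" "\<And>i. i \<in> I \<Longrightarrow> measure_pmf.prob M {x. A i x} \<le> e i"
  shows "measure_pmf.prob M {x. \<exists>i\<in>I. A i x} \<le> (\<Sum>i\<in>I. e i)"
proof -
  have "{x. \<exists>i\<in>I. A i x} = (\<Union>i\<in>I. {x. A i x})" by auto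
  then have "measure_pmf.prob M {x. \<exists>i\<in>I. A i x} \<le> (\<Sum>i\<in>I. measure_pmf.prob M {x. A i x})"
    by (simp add: assms(1) measure_pmf.finite_measure_subadditive_finite)
  also have "\<dots> \<le> (\<Sum>i\<in>I. e i)" by (intro sum_mono assms)
  finally show ?thesis .
qed

lemma prob_disj_le:
  fixes M :: "'a pmf"
  shows "measure_pmf.prob M {x. A x} \<le> a \<Longrightarrow> measure_pmf.prob M {x. B x} \<le> b \<Longrightarrow>
    measure_pmf.prob M {x. A x \<or> B x} \<le> a + b"
  using measure_subadditive[of "{x. A x}" "measure_pmf M" "{x. B x}"]
  by (simp add: Collect_disj_eq measure_pmf.emeasure_eq_measure)

lemma prob_mono_pmf:
  fixes M :: "'a pmf"
  shows "(\<And>x. A x \<Longrightarrow> B x) \<Longrightarrow> measure_pmf.prob M {x. A x} \<le> measure_pmf.prob M {x. B x}"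
  by (rule measure_pmf.finite_measure_mono) auto

section \<open>Multiscale site percolation: geometry\<close>

definition rch :: "('a \<Rightarrow> 'a \<Rightarrow> bool) \<Rightarrow> nat \<Rightarrow> 'a \<Rightarrow> 'a \<Rightarrow> bool" where
  "rch R t x y \<longleftrightarrow> (\<exists>n\<le>t. (R ^^ n) x y)"

lemma rch_refl [simp]: "rch R t x x"
  unfolding rch_def by (rule exI[of _ 0]) simp

lemma rch_trans: "rch R s x y \<Longrightarrow> rch R t y z \<Longrightarrow> rch R (s + t) x z"
  unfolding rch_def by (metis add_mono relpowp_add relcomppI)

lemma rch_mono: "rch R s x y \<Longrightarrow> s \<le> t \<Longrightarrow> rch R t x y"
  unfolding rch_def using order_trans by blast

lemma rch_step: "R x y \<Longrightarrow> t \<ge> 1 \<Longrightarrow> rch R t x y"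
  unfolding rch_def by (rule exI[of _ 1]) auto

lemma rch_mono_rel: "rch R t x y \<Longrightarrow> (\<And>u v. R u v \<Longrightarrow> S u v) \<Longrightarrow> rch S t x y"
  unfolding rch_def using relpowp_mono[of R S] by metis

lemma rch_sym:
  assumes "\<And>u v. R u v \<Longrightarrow> R v u" "rch R t x y"
  shows "rch R t y x"
proof -
  have "(R ^^ n) u v \<Longrightarrow> (R ^^ n) v u" for n u v
  proof (induction n arbitrary: v)
    case (Suc n)
    then obtain w where "(R ^^ n) u w" "R w v" by auto
    with Suc assms(1) show ?case by (meson relpowp_Suc_I2)
  qed auto
  with assms(2) show ?thesis unfolding rch_def by blast
qed

section \<open>Boxes whose sides are powers of three, and their hubs\<close>

definition vdiv :: "int ^ 'd::finite \<Rightarrow> int ^ 'd" where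
  "vdiv y = (\<chi> i. y $ i div 3)"

abbreviation lev :: "nat \<Rightarrow> int ^ 'd::finite \<Rightarrow> int ^ 'd" where
  "lev k y \<equiv> (vdiv ^^ k) y"

lemma lev_nth: "lev k y $ i = y $ i div 3 ^ k"
proof (induction k)
  case (Suc k)
  have "lev (Suc k) y $ i = y $ i div 3 ^ k div 3" using Suc by (simp add: vdiv_def[of "lev k y"])
  also have "\<dots> = y $ i div 3 ^ Suc k" by (simp only: power_Suc2 zdiv_zmult2_eq zero_le_numeral)
  finally show ?case .
qed simp

definition adj :: "int ^ 'd::finite \<Rightarrow> int ^ 'd \<Rightarrow> bool" where
  "adj z z' \<longleftrightarrow> (\<exists>i. \<bar>z $ i - z' $ i\<bar> = 1 \<and> (\<forall>j. j \<noteq> i \<longrightarrow> z $ j = z' $ j))"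

lemma ex_other_index:
  assumes "CARD('d::finite) \<ge> 2"
  obtains j :: "'d::finite" where "j \<noteq> i"
proof -
  have "UNIV \<noteq> {i}"
  proof
    assume "UNIV = {i}"
    then have "CARD('d) = card {i}" by simp
    with assms show False by simp
  qed
  then show ?thesis using that by blast
qed

lemma adj_sym: "adj z z' \<Longrightarrow> adj z' z"
  unfolding adj_def by (metis abs_minus_commute)

text \<open>Boxes of level \<open>k\<close> are indexed by lattice points, box \<open>z\<close>
  consisting of the sites \<open>y\<close> with \<open>lev k y = z\<close>. Tolerating one bad child
  makes badness require two independent failures, hence the squaring of its probability.\<close>

primrec good :: "(int ^ 'd::finite \<Rightarrow> bool) \<Rightarrow> nat \<Rightarrow> int ^ 'd \<Rightarrow> bool" where
  "good op 0 z = op z"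
| "good op (Suc k) z = (\<forall>w w'. vdiv w = z \<and> vdiv w' = z \<and> \<not> good op k w \<and> \<not> good op k w' \<longrightarrow> w = w')"

text \<open>Goodness of a box says nothing about a particular site in it. The sites of a hub have
  good ancestors on every level, which is what the induction over levels needs in order to join any
  two of them.\<close>

definition hub :: "(int ^ 'd::finite \<Rightarrow> bool) \<Rightarrow> nat \<Rightarrow> int ^ 'd \<Rightarrow> (int ^ 'd) set" where
  "hub op k z = {y. lev k y = z \<and> (\<forall>j\<le>k. good op j (lev j y))}"

lemma hub_SucI: "y \<in> hub op k w \<Longrightarrow> good op (Suc k) (vdiv w) \<Longrightarrow> y \<in> hub op (Suc k) (vdiv w)"
  unfolding hub_def by (auto simp: le_Suc_eq simp del: good.simps)

lemma hub_SucD: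
  assumes "y \<in> hub op (Suc k) z"
  shows "y \<in> hub op k (lev k y)" "vdiv (lev k y) = z" "good op (Suc k) z" "good op k (lev k y)"
  using assms unfolding hub_def by (auto simp del: good.simps)

definition stp :: "(int ^ 'd::finite \<Rightarrow> bool) \<Rightarrow> int ^ 'd \<Rightarrow> int ^ 'd \<Rightarrow> bool" where
  "stp op y y' \<longleftrightarrow> op y \<and> op y' \<and> adj y y'"

definition upd :: "int ^ 'd::finite \<Rightarrow> 'd \<Rightarrow> int \<Rightarrow> int ^ 'd" where
  "upd w j c = (\<chi> i. if i = j then c else w $ i)"

lemma upd_nth [simp]: "upd w j c $ i = (if i = j then c else w $ i)"
  by (simp add: upd_def)

lemma div3_iff: "(a::int) div 3 = z \<longleftrightarrow> 3 * z \<le> a \<and> a \<le> 3 * z + 2"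
  by auto

lemma vdiv_iff: "vdiv w = z \<longleftrightarrow> (\<forall>i. 3 * z $ i \<le> w $ i \<and> w $ i \<le> 3 * z $ i + 2)"
  by (simp add: vec_eq_iff vdiv_def div3_iff)

definition sub_adj :: "int ^ 'd::finite \<Rightarrow> int ^ 'd \<Rightarrow> int ^ 'd \<Rightarrow> int ^ 'd \<Rightarrow> bool" where
  "sub_adj z b w w' \<longleftrightarrow> adj w w' \<and> vdiv w = z \<and> vdiv w' = z \<and> w \<noteq> b \<and> w' \<noteq> b"

lemma sub_adj_sym: "sub_adj z b w w' \<Longrightarrow> sub_adj z b w' w"
  unfolding sub_adj_def using adj_sym by blast

text \<open>Along the segment coordinate \<open>i\<close> stays different from \<open>b $ i\<close>,
  so \<open>b\<close> cannot be met; the three possible values of coordinate \<open>j\<close> cost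
  at most two steps.\<close>

lemma sub_adj_line:
  assumes w: "vdiv w = z" and i: "i \<noteq> j" "w $ i \<noteq> b $ i" and c: "3 * z $ j \<le> c" "c \<le> 3 * z $ j + 2"
  shows "rch (sub_adj z b) 2 w (upd w j c)"
proof -
  have one: "sub_adj z b (upd w j c) (upd w j c')"
    if "3 * z $ j \<le> c" "c \<le> 3 * z $ j + 2" "3 * z $ j \<le> c'" "c' \<le> 3 * z $ j + 2" "\<bar>c - c'\<bar> = 1" for c c'
    unfolding sub_adj_def adj_def using that w i by (auto simp: vdiv_iff intro!: exI[of _ j])
  let ?a = "w $ j"
  have a: "3 * z $ j \<le> ?a" "?a \<le> 3 * z $ j + 2" using w by (auto simp: vdiv_iff)
  have self: "upd w j ?a = w" by (simp add: vec_eq_iff)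
  consider "c = ?a" | "\<bar>?a - c\<bar> = 1" | "\<bar>?a - c\<bar> = 2" using a c by linarith
  then show ?thesis
  proof cases
    case 1
    then show ?thesis using self by simp
  next
    case 2
    then show ?thesis using one[of ?a c] a c self by (intro rch_step) auto
  next
    case 3
    define m where "m = 3 * z $ j + 1"
    have "\<bar>?a - m\<bar> = 1" "\<bar>m - c\<bar> = 1" using 3 a c unfolding m_def by linarith+
    then have "sub_adj z b w (upd w j m)" "sub_adj z b (upd w j m) (upd w j c)"
      using one[of ?a m] one[of m c] a c self unfolding m_def by auto
    then have "rch (sub_adj z b) 1 w (upd w j m)" "rch (sub_adj z b) 1 (upd w j m) (upd w j c)"
      by (auto intro: rch_step)
    from rch_trans[OF this] show ?thesis by (simp add: numeral_2_eq_2)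
  qed
qed

text \<open>A coordinate \<open>i\<close> in which \<open>w\<close> differs from \<open>b\<close> is
  kept until all others agree with \<open>c\<close>; then any other coordinate, already equal to
  that of \<open>c\<close>, protects the path from \<open>b\<close> while \<open>i\<close> is
  changed.\<close>

lemma sub_adj_to_center:
  fixes z b :: "int ^ 'd::finite"
  assumes d: "CARD('d) \<ge> 2" and w: "vdiv w = z" "w \<noteq> b"
    and c: "vdiv c = z" "\<And>i. c $ i \<noteq> b $ i"
  shows "rch (sub_adj z b) (2 * CARD('d)) w c"
proof -
  from w(2) obtain i where i: "w $ i \<noteq> b $ i" by (auto simp: vec_eq_iff)
  define g where "g S = (\<chi> k. if k \<in> S then c $ k else w $ k)" for S
  have vg: "vdiv (g S) = z" for S using w(1) c(1) by (auto simp: g_def vdiv_iff)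
  have *: "rch (sub_adj z b) (2 * card S) w (g S)" if "finite S" "i \<notin> S" for S
    using that
  proof (induction S)
    case empty
    have "g {} = w" by (simp add: g_def vec_eq_iff)
    then show ?case by simp
  next
    case (insert j S)
    have "upd (g S) j (c $ j) = g (insert j S)" by (auto simp: g_def vec_eq_iff)
    moreover have "rch (sub_adj z b) 2 (g S) (upd (g S) j (c $ j))"
      by (rule sub_adj_line[OF vg, of i]) (use insert i c(1) in \<open>auto simp: g_def vdiv_iff\<close>)
    ultimately have "rch (sub_adj z b) 2 (g S) (g (insert j S))" by simp
    from rch_trans[OF _ this] insert show ?case by force
  qed
  have 1: "rch (sub_adj z b) (2 * card (UNIV - {i})) w (g (UNIV - {i}))" by (rule *) auto
  obtain j where j: "j \<noteq> i" using ex_other_index[OF d] .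
  have "upd (g (UNIV - {i})) i (c $ i) = c" by (auto simp: g_def vec_eq_iff)
  moreover have "rch (sub_adj z b) 2 (g (UNIV - {i})) (upd (g (UNIV - {i})) i (c $ i))"
    by (rule sub_adj_line[OF vg, of j]) (use j c in \<open>auto simp: g_def vdiv_iff\<close>)
  ultimately have 2: "rch (sub_adj z b) 2 (g (UNIV - {i})) c" by simp
  have "2 * card (UNIV - {i}) + 2 = 2 * CARD('d)" using d by simp
  with rch_trans[OF 1 2] show ?thesis by simp
qed

text \<open>The center of the detour avoids the removed point in every coordinate, so two coordinates
  suffice to reach it without hitting that point.\<close>

lemma sub_adj_connected:
  fixes z b :: "int ^ 'd::finite"
  assumes d: "CARD('d) \<ge> 2" and w: "vdiv w = z" "w \<noteq> b" "vdiv w' = z" "w' \<noteq> b"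
  shows "rch (sub_adj z b) (4 * CARD('d)) w w'"
proof -
  define c where "c = (\<chi> i. if b $ i = 3 * z $ i then 3 * z $ i + 1 else 3 * z $ i)"
  have c: "vdiv c = z" "\<And>i. c $ i \<noteq> b $ i" unfolding vdiv_iff c_def by auto
  have "rch (sub_adj z b) (2 * CARD('d) + 2 * CARD('d)) w w'"
    using sub_adj_to_center[OF d w(1,2) c] sub_adj_to_center[OF d w(3,4) c] sub_adj_sym
    by (blast intro: rch_trans rch_sym)
  then show ?thesis by simp
qed

lemma good_Suc_unique_bad:
  assumes "good op (Suc k) z"
  obtains b where "\<And>w. vdiv w = z \<Longrightarrow> w \<noteq> b \<Longrightarrow> good op k w"
proof (cases "\<exists>b. vdiv b = z \<and> \<not> good op k b")
  case True
  then obtain b where b: "vdiv b = z" "\<not> good op k b" by blast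
  show ?thesis
  proof (rule that)
    fix w assume "vdiv w = z" "w \<noteq> b"
    then show "good op k w" using assms b unfolding good.simps by blast
  qed
next
  case False
  show ?thesis by (rule that[of undefined]) (use False in blast)
qed

lemma hub_nonempty: "good op k z \<Longrightarrow> hub op k z \<noteq> {}"
proof (induction k arbitrary: z)
  case 0
  then show ?case by (auto simp: hub_def)
next
  case (Suc k)
  define w1 w2 where "w1 = (\<chi> i. 3 * z $ i)" and "w2 = (\<chi> i. 3 * z $ i + 1)"
  have w: "vdiv w1 = z" "vdiv w2 = z" by (auto simp: vdiv_iff w1_def w2_def)
  have "w1 \<noteq> w2" by (auto simp: w1_def w2_def vec_eq_iff)
  with Suc.prems w have "good op k w1 \<or> good op k w2" unfolding good.simps by blast
  then obtain w where "vdiv w = z" "good op k w" using w by blast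
  then show ?case using hub_SucI[of _ op k w] Suc by (metis ex_in_conv)
qed

text \<open>The factor is \<open>2 * (4 * d + 1) + 1\<close>: inside each of two adjacent boxes a
  walk through children costs at most \<open>4 * d + 1\<close> detours of the lower level, and
  crossing the common face costs one.\<close>

fun detour :: "nat \<Rightarrow> nat \<Rightarrow> nat" where
  "detour d 0 = 1"
| "detour d (Suc k) = (8 * d + 3) * detour d k"

lemma detour_pos: "detour d k \<ge> 1"
  by (induction k) auto

text \<open>Both claims are proved together, since joining the hubs of one box uses steps between
  adjacent children, and joining adjacent boxes uses connections inside each of them.\<close>

lemma hub_connected:
  fixes op :: "int ^ 'd::finite \<Rightarrow> bool"
  assumes d: "CARD('d) \<ge> 2"
  shows "(\<forall>z. \<forall>y\<in>hub op k z. \<forall>y'\<in>hub op k z. rch (stp op) (detour CARD('d) k) y y') \<and>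
    (\<forall>z z'. adj z z' \<longrightarrow> (\<forall>y\<in>hub op k z. \<forall>y'\<in>hub op k z'. rch (stp op) (detour CARD('d) k) y y'))"
proof (induction k)
  case 0
  then show ?case by (auto simp: hub_def stp_def intro!: rch_step)
next
  case (Suc k)
  let ?E = "detour CARD('d) k" and ?d = "CARD('d)"
  have I1: "rch (stp op) ?E y y'" if "y \<in> hub op k z" "y' \<in> hub op k z" for y y' z
    using Suc that by blast
  have I2: "rch (stp op) ?E y y'" if "y \<in> hub op k z" "y' \<in> hub op k z'" "adj z z'" for y y' z z'
    using Suc that by blast
  have in1: "rch (stp op) ((4 * ?d + 1) * ?E) y y'"
    if y: "y \<in> hub op (Suc k) z" "y' \<in> hub op (Suc k) z" for y y' z
  proof -
    obtain b where b: "\<And>w. vdiv w = z \<Longrightarrow> w \<noteq> b \<Longrightarrow> good op k w"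
      using good_Suc_unique_bad hub_SucD(3)[OF y(1)] by metis
    \<comment> \<open>The avoided child must differ from the children that contain the two end
      points. If \<open>b\<close> is not really a bad child of \<open>z\<close>, a point outside the
      box takes its place.\<close>
    obtain b' where b': "\<And>w. vdiv w = z \<Longrightarrow> w \<noteq> b' \<Longrightarrow> good op k w" "lev k y \<noteq> b'" "lev k y' \<noteq> b'"
    proof (cases "vdiv b = z \<and> \<not> good op k b")
      case True
      then show ?thesis using that[of b] b hub_SucD(4)[OF y(1)] hub_SucD(4)[OF y(2)] by metis
    next
      case False
      define b' where "b' = (\<chi> i. 3 * z $ i - 1)"
      have "vdiv b' \<noteq> z" by (auto simp: vdiv_iff b'_def)
      then show ?thesis using that[of b'] b False hub_SucD(2)[OF y(1)] hub_SucD(2)[OF y(2)] by metis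
    qed
    have "rch (sub_adj z b') (4 * ?d) (lev k y) (lev k y')"
      using sub_adj_connected[OF d, of "lev k y" z b' "lev k y'"] b' hub_SucD(2)[OF y(1)] hub_SucD(2)[OF y(2)]
      by simp
    then obtain n where n: "n \<le> 4 * ?d" "(sub_adj z b' ^^ n) (lev k y) (lev k y')"
      unfolding rch_def by blast
    \<comment> \<open>Each of the \<open>n\<close> steps between children costs one
      \<open>?E\<close>; the additional one pays for the move inside the first child.\<close>
    have "rch (stp op) ((n + 1) * ?E) y y''"
      if "(sub_adj z b' ^^ n) (lev k y) w" "y'' \<in> hub op k w" for n w y''
      using that
    proof (induction n arbitrary: w y'')
      case 0
      then show ?case using I1[of y "lev k y" y''] hub_SucD(1)[OF y(1)] by simp
    next
      case (Suc n)
      then obtain v where v: "(sub_adj z b' ^^ n) (lev k y) v" "sub_adj z b' v w" by auto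
      then have "good op k v" using b' by (auto simp: sub_adj_def)
      then obtain x where x: "x \<in> hub op k v" using hub_nonempty by blast
      have "rch (stp op) ?E x y''" using I2 x Suc.prems(2) v(2) by (auto simp: sub_adj_def)
      from rch_trans[OF Suc.IH[OF v(1) x] this] show ?case by (simp add: algebra_simps)
    qed
    from this[OF n(2) hub_SucD(1)[OF y(2)]] show ?thesis
      by (rule rch_mono) (use n(1) in \<open>intro mult_right_mono, auto\<close>)
  qed
  have ac1: "rch (stp op) (detour ?d (Suc k)) y y'"
    if y: "y \<in> hub op (Suc k) z" "y' \<in> hub op (Suc k) z'"
      and i: "z' $ i = z $ i + 1" "\<And>j. j \<noteq> i \<Longrightarrow> z $ j = z' $ j" for y y' z z' i
  proof -
    obtain j where j: "j \<noteq> i" using ex_other_index[OF d] .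
    \<comment> \<open>Three facing pairs of children, indexed by \<open>v\<close> along a direction
      \<open>j\<close> parallel to the common face; the two exceptional children spoil at most two
      of the pairs.\<close>
    define w w' where "w v = (\<chi> l. if l = i then 3 * z $ i + 2 else if l = j then 3 * z $ j + v else 3 * z $ l)"
      and "w' v = (\<chi> l. if l = i then 3 * z $ i + 3 else if l = j then 3 * z $ j + v else 3 * z $ l)" for v :: int
    have vw: "vdiv (w v) = z" "vdiv (w' v) = z'" if "0 \<le> v" "v \<le> 2" for v
      using that i by (auto simp: vdiv_iff w_def w'_def)
    have wne: "w u \<noteq> w v" "w' u \<noteq> w' v" if "u \<noteq> v" for u v
      using that j by (auto simp: w_def w'_def vec_eq_iff)
    obtain b b' where b: "\<And>w. vdiv w = z \<Longrightarrow> w \<noteq> b \<Longrightarrow> good op k w"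
       "\<And>w. vdiv w = z' \<Longrightarrow> w \<noteq> b' \<Longrightarrow> good op k w"
      using good_Suc_unique_bad hub_SucD(3)[OF y(1)] hub_SucD(3)[OF y(2)] by metis
    have "\<exists>v. 0 \<le> v \<and> v \<le> 2 \<and> w v \<noteq> b \<and> w' v \<noteq> b'"
    proof -
      have "(w 0 \<noteq> b \<and> w' 0 \<noteq> b') \<or> (w 1 \<noteq> b \<and> w' 1 \<noteq> b') \<or> (w 2 \<noteq> b \<and> w' 2 \<noteq> b')"
        using wne[of 0 1] wne[of 0 2] wne[of 1 2] by auto
      then show ?thesis
        using zero_le_one zero_le_numeral order_refl one_le_numeral by metis
    qed
    then obtain v where v: "0 \<le> v" "v \<le> 2" "w v \<noteq> b" "w' v \<noteq> b'" by blast
    have gd: "good op k (w v)" "good op k (w' v)" using b vw v by auto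
    then obtain x x' where x: "x \<in> hub op k (w v)" "x' \<in> hub op k (w' v)" using hub_nonempty by blast
    have "adj (w v) (w' v)" unfolding adj_def by (rule exI[of _ i]) (auto simp: w_def w'_def)
    from I2[OF x this] have m: "rch (stp op) ?E x x'" .
    have "x \<in> hub op (Suc k) z" "x' \<in> hub op (Suc k) z'"
      using hub_SucI[OF x(1)] hub_SucI[OF x(2)] vw v hub_SucD(3)[OF y(1)] hub_SucD(3)[OF y(2)] by metis+
    from rch_trans[OF in1[OF y(1) this(1)] rch_trans[OF m in1[OF this(2) y(2)]]] show ?thesis
      by (simp add: algebra_simps)
  qed
  have ac: "rch (stp op) (detour ?d (Suc k)) y y'"
    if y: "y \<in> hub op (Suc k) z" "y' \<in> hub op (Suc k) z'" and "adj z z'" for y y' z z'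
  proof -
    from \<open>adj z z'\<close> obtain i where i: "\<bar>z $ i - z' $ i\<bar> = 1" "\<forall>j. j \<noteq> i \<longrightarrow> z $ j = z' $ j"
      unfolding adj_def by blast
    then consider "z' $ i = z $ i + 1" | "z $ i = z' $ i + 1" by linarith
    then show ?thesis
    proof cases
      case 1
      then show ?thesis using ac1[OF y, of i] i by auto
    next
      case 2
      then have "rch (stp op) (detour ?d (Suc k)) y' y" using ac1[OF y(2) y(1), of i] i by auto
      then show ?thesis by (rule rch_sym[rotated]) (auto simp: stp_def adj_sym)
    qed
  qed
  have "rch (stp op) (detour ?d (Suc k)) y y'"
    if "y \<in> hub op (Suc k) z" "y' \<in> hub op (Suc k) z" for y y' z
    by (rule rch_mono[OF in1[OF that]]) (simp add: algebra_simps)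
  with ac show ?case by blast
qed

section \<open>Representing the sites of a line by hubs, and the cost of doing so\<close>

lemma adj_lev: "adj y y' \<Longrightarrow> lev k y = lev k y' \<or> adj (lev k y) (lev k y')"
proof -
  assume "adj y y'"
  then obtain i where i: "\<bar>y $ i - y' $ i\<bar> = 1" "\<And>j. j \<noteq> i \<Longrightarrow> y $ j = y' $ j"
    unfolding adj_def by blast
  have step: "(a + 1) div 3 ^ k = a div 3 ^ k \<or> (a + 1) div 3 ^ k = a div 3 ^ k + 1" for a :: int
  proof -
    have p: "(3::int) ^ k > 0" by simp
    have "a div 3 ^ k \<le> (a + 1) div 3 ^ k" by (rule zdiv_mono1) auto
    moreover have "(a + 1) div 3 ^ k \<le> (a + 3 ^ k) div 3 ^ k" by (rule zdiv_mono1) auto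
    moreover have "(a + 3 ^ k) div 3 ^ k = a div 3 ^ k + 1" by simp
    ultimately show ?thesis by linarith
  qed
  have "y $ i = y' $ i + 1 \<or> y' $ i = y $ i + 1" using i(1) by linarith
  then have "y $ i div 3 ^ k = y' $ i div 3 ^ k \<or> \<bar>y $ i div 3 ^ k - y' $ i div 3 ^ k\<bar> = 1"
    using step[of "y $ i"] step[of "y' $ i"] by auto
  then show ?thesis
  proof
    assume "y $ i div 3 ^ k = y' $ i div 3 ^ k"
    then have "lev k y = lev k y'" using i(2) by (metis vec_eq_iff lev_nth)
    then show ?thesis ..
  next
    assume "\<bar>y $ i div 3 ^ k - y' $ i div 3 ^ k\<bar> = 1"
    then have "adj (lev k y) (lev k y')" unfolding adj_def using i(2) by (auto simp: lev_nth intro!: exI[of _ i])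
    then show ?thesis ..
  qed
qed

text \<open>Level \<open>Suc K\<close> satisfies the condition vacuously, so the minimum always
  exists; it is at most \<open>K\<close> exactly when the ancestor of \<open>a\<close> on level
  \<open>K\<close> is good.\<close>

definition kap :: "(int ^ 'd::finite \<Rightarrow> bool) \<Rightarrow> nat \<Rightarrow> int ^ 'd \<Rightarrow> nat" where
  "kap op K a = (LEAST k. \<forall>j. k \<le> j \<and> j \<le> K \<longrightarrow> good op j (lev j a))"

lemma kap_good: "kap op K a \<le> j \<Longrightarrow> j \<le> K \<Longrightarrow> good op j (lev j a)"
proof -
  have "\<forall>j. kap op K a \<le> j \<and> j \<le> K \<longrightarrow> good op j (lev j a)"
    unfolding kap_def by (rule LeastI[of _ "Suc K"]) auto
  then show "kap op K a \<le> j \<Longrightarrow> j \<le> K \<Longrightarrow> good op j (lev j a)" by blast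
qed

lemma kap_le: "(\<And>j. k \<le> j \<Longrightarrow> j \<le> K \<Longrightarrow> good op j (lev j a)) \<Longrightarrow> kap op K a \<le> k"
  unfolding kap_def by (rule Least_le) auto

text \<open>Only the highest bad level determines the detour around \<open>a\<close>. Summing over
  all bad levels instead bounds it by a quantity that can be averaged along a line level by
  level.\<close>

definition cost :: "(int ^ 'd::finite \<Rightarrow> bool) \<Rightarrow> nat \<Rightarrow> int ^ 'd \<Rightarrow> nat" where
  "cost op K a = 1 + (\<Sum>k<K. if good op k (lev k a) then 0 else detour CARD('d) (Suc k))"

lemma detour_kap_le_cost:
  fixes op :: "int ^ 'd::finite \<Rightarrow> bool"
  assumes "good op K (lev K a)"
  shows "kap op K a \<le> K" "detour CARD('d) (kap op K a) \<le> cost op K a"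
proof -
  show K: "kap op K a \<le> K" by (rule kap_le) (use assms in auto)
  show "detour CARD('d) (kap op K a) \<le> cost op K a"
  proof (cases "kap op K a")
    case 0
    then show ?thesis by (simp add: cost_def)
  next
    case (Suc k)
    have "\<not> good op k (lev k a)"
    proof
      assume g: "good op k (lev k a)"
      have "kap op K a \<le> k"
      proof (rule kap_le)
        fix j assume "k \<le> j" "j \<le> K"
        then show "good op j (lev j a)" using g kap_good[of op K a j] Suc by (cases "j = k") auto
      qed
      with Suc show False by simp
    qed
    then have "detour CARD('d) (Suc k) \<le> (\<Sum>k<K. if good op k (lev k a) then 0 else detour CARD('d) (Suc k))"
      using Suc K by (intro order_trans[OF _ member_le_sum[of k]]) auto
    then show ?thesis unfolding cost_def Suc by simp
  qed
qed

text \<open>A site with bad ancestors is represented by the hub of the ancestor above which no bad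
  one occurs, so that every site with a good ancestor on level \<open>K\<close> has
  representatives.\<close>

definition anchor :: "(int ^ 'd::finite \<Rightarrow> bool) \<Rightarrow> nat \<Rightarrow> int ^ 'd \<Rightarrow> (int ^ 'd) set" where
  "anchor op K a = hub op (kap op K a) (lev (kap op K a) a)"

lemma anchor_lift:
  assumes "y \<in> anchor op K a" "kap op K a \<le> m" "m \<le> K"
  shows "y \<in> hub op m (lev m a)"
proof -
  let ?k = "kap op K a"
  have y: "lev ?k y = lev ?k a" "\<And>j. j \<le> ?k \<Longrightarrow> good op j (lev j y)"
    using assms(1) by (auto simp: anchor_def hub_def)
  have eq: "lev j y = lev j a" if "?k \<le> j" for j
  proof -
    have "lev j x = lev (j - ?k) (lev ?k x)" for x :: "int ^ 'a"
      using that by (metis comp_apply funpow_add le_add_diff_inverse2)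
    then show ?thesis using y(1) by metis
  qed
  have "good op j (lev j y)" if "j \<le> m" for j
    using y(2)[of j] kap_good[of op K a j] eq[of j] that assms(3) by (cases "j \<le> ?k") auto
  then show ?thesis using eq[OF assms(2)] by (auto simp: hub_def)
qed

lemma anchor_nonempty: "kap op K a \<le> K \<Longrightarrow> anchor op K a \<noteq> {}"
  unfolding anchor_def by (intro hub_nonempty kap_good) auto

text \<open>On the larger of the two levels \<open>kap\<close> the representatives are hubs of equal
  or adjacent boxes, and a detour of that level is paid for by one of the two costs.\<close>

lemma anchor_step:
  fixes op :: "int ^ 'd::finite \<Rightarrow> bool"
  assumes d: "CARD('d) \<ge> 2" and g: "good op K (lev K a)" "good op K (lev K a')"
    and a: "a = a' \<or> adj a a'" and y: "y \<in> anchor op K a" "y' \<in> anchor op K a'"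
  shows "rch (stp op) (cost op K a + cost op K a') y y'"
proof -
  let ?m = "max (kap op K a) (kap op K a')"
  have m: "?m \<le> K" using detour_kap_le_cost(1)[OF g(1)] detour_kap_le_cost(1)[OF g(2)] by simp
  have "y \<in> hub op ?m (lev ?m a)" "y' \<in> hub op ?m (lev ?m a')"
    using anchor_lift y m by (metis max.cobounded1, metis max.cobounded2)
  moreover have "lev ?m a = lev ?m a' \<or> adj (lev ?m a) (lev ?m a')" using a adj_lev by blast
  ultimately have "rch (stp op) (detour CARD('d) ?m) y y'"
    using hub_connected[OF d, of op ?m] by metis
  moreover have "detour CARD('d) ?m \<le> cost op K a + cost op K a'"
    using detour_kap_le_cost(2)[OF g(1)] detour_kap_le_cost(2)[OF g(2)] by (cases "kap op K a \<le> kap op K a'") (auto simp: max_def)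
  ultimately show ?thesis by (rule rch_mono)
qed

text \<open>The induction charges interior sites twice and gives each end point a separate cost, so
  that the case \<open>T = 0\<close> pays for joining two sites of one anchor. The extra charge for
  the starting point turns the factor 2 into 3.\<close>

lemma anchor_chain:
  fixes op :: "int ^ 'd::finite \<Rightarrow> bool"
  assumes d: "CARD('d) \<ge> 2" and g: "\<And>t. t \<le> T \<Longrightarrow> good op K (lev K (a t))"
    and a: "\<And>t. t < T \<Longrightarrow> adj (a t) (a (Suc t))"
    and y: "y \<in> anchor op K (a 0)" "y' \<in> anchor op K (a T)"
  shows "rch (stp op) (3 * (\<Sum>t\<le>T. cost op K (a t))) y y'"
proof -
  have "rch (stp op) (cost op K (a 0) + 2 * (\<Sum>t<T. cost op K (a t)) + cost op K (a T)) y y'"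
    using g a y
  proof (induction T arbitrary: y')
    case 0
    have "rch (stp op) (cost op K (a 0) + cost op K (a 0)) y y'"
      by (rule anchor_step[OF d]) (use 0 in auto)
    then show ?case by simp
  next
    case (Suc T)
    obtain x where x: "x \<in> anchor op K (a T)"
      using anchor_nonempty[of op K "a T"] detour_kap_le_cost(1)[OF Suc.prems(1)[of T]] by auto
    have 1: "rch (stp op) (cost op K (a 0) + 2 * (\<Sum>t<T. cost op K (a t)) + cost op K (a T)) y x"
      by (rule Suc.IH) (use Suc.prems x in auto)
    have 2: "rch (stp op) (cost op K (a T) + cost op K (a (Suc T))) x y'"
      by (rule anchor_step[OF d]) (use Suc.prems x in auto)
    from rch_trans[OF 1 2] show ?case by (simp add: algebra_simps)
  qed
  moreover have "cost op K (a 0) \<le> (\<Sum>t\<le>T. cost op K (a t))" by (rule member_le_sum) auto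
  moreover have "(\<Sum>t\<le>T. cost op K (a t)) = (\<Sum>t<T. cost op K (a t)) + cost op K (a T)"
    by (metis lessThan_Suc_atMost sum.lessThan_Suc)
  ultimately show ?thesis by (elim rch_mono) simp
qed

section \<open>Multiscale site percolation: probability\<close>

lemma vec_box_eq_image: "{y::'a ^ 'd::finite. \<forall>i. y $ i \<in> A i} = vec_lambda ` (Pi\<^sub>E UNIV A)"
proof (intro equalityI subsetI)
  fix y assume "y \<in> {y::'a ^ 'd. \<forall>i. y $ i \<in> A i}"
  then show "y \<in> vec_lambda ` (Pi\<^sub>E UNIV A)"
    by (intro image_eqI[of _ _ "vec_nth y"]) auto
qed auto

lemma card_vec_box: "card {y::'a ^ 'd::finite. \<forall>i. y $ i \<in> A i} = (\<Prod>i\<in>UNIV. card (A i))"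
  unfolding vec_box_eq_image
  by (subst card_image) (auto simp: card_PiE vec_lambda_inject inj_on_def)

lemma finite_vec_box: "(\<And>i. finite (A i)) \<Longrightarrow> finite {y::'a ^ 'd::finite. \<forall>i. y $ i \<in> A i}"
  unfolding vec_box_eq_image by (intro finite_imageI finite_PiE) auto

lemma card_torus: "card (torus n :: (int ^ 'd::finite) set) = n ^ CARD('d)"
  unfolding torus_def by (subst card_vec_box) simp

lemma vdiv_fibre:
  "finite {w :: int ^ 'd::finite. vdiv w = z}" "card {w :: int ^ 'd::finite. vdiv w = z} = 3 ^ CARD('d)"
proof -
  have eq: "{w. vdiv w = z} = {w. \<forall>i. w $ i \<in> {3 * z $ i .. 3 * z $ i + 2}}"
    by (auto simp: vdiv_iff)
  show "finite {w. vdiv w = z}" unfolding eq by (rule finite_vec_box) simp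
  show "card {w. vdiv w = z} = 3 ^ CARD('d)" unfolding eq by (subst card_vec_box) simp
qed

lemma prob_card_ge:
  fixes M :: "'a pmf"
  assumes "finite X" "b > 0" "\<And>x. x \<in> X \<Longrightarrow> measure_pmf.prob M {f. A x f} \<le> e"
  shows "measure_pmf.prob M {f. b \<le> real (card {x\<in>X. A x f})} \<le> real (card X) * e / b"
proof -
  have int: "integrable M (indicator {f. A x f} :: _ \<Rightarrow> real)" for x
    by (rule measure_pmf.integrable_const_bound[where B = 1]) (auto simp: indicator_def)
  have eq: "real (card {x\<in>X. A x f}) = (\<Sum>x\<in>X. indicator {f. A x f} f)" for f
    using assms(1) by (simp add: indicator_def sum.If_cases Int_def)
  have "measure_pmf.prob M {f \<in> space M. b \<le> (\<Sum>x\<in>X. indicator {f. A x f} f)} \<le>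
      measure_pmf.expectation M (\<lambda>f. \<Sum>x\<in>X. indicator {f. A x f} f) / b"
    by (rule integral_Markov_inequality_measure[where A = "{}"])
       (use assms(2) in \<open>auto intro!: Bochner_Integration.integrable_sum int sum_nonneg\<close>)
  also have "measure_pmf.expectation M (\<lambda>f. \<Sum>x\<in>X. indicator {f. A x f} f :: real) =
      (\<Sum>x\<in>X. measure_pmf.prob M {f. A x f})"
    by (subst Bochner_Integration.integral_sum) (auto simp: int)
  also have "\<dots> / b \<le> real (card X) * e / b"
    using assms(2) sum_bounded_above[of X "\<lambda>x. measure_pmf.prob M {f. A x f}" e] assms(3)
    by (intro divide_right_mono) auto
  finally show ?thesis by (simp add: eq)
qed

text \<open>Division rounds down, so negative coordinates stay negative, and
  \<open>3 ^ k dvd Q\<close> means that no box of level \<open>k\<close> is cut by the upper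
  boundary.\<close>

lemma lev_torus:
  assumes "3 ^ k dvd Q"
  shows "lev k y \<in> torus (Q div 3 ^ k) \<longleftrightarrow> y \<in> torus Q"
proof -
  obtain q where q: "Q = 3 ^ k * q" using assms by blast
  have 1: "(0 \<le> a div 3 ^ k) = (0 \<le> a)" for a :: int
    by (simp add: pos_imp_zdiv_nonneg_iff)
  have 2: "(a div 3 ^ k < int q) = (a < int Q)" for a :: int
  proof -
    have p: "(0::int) < 3 ^ k" by simp
    have m: "a = 3 ^ k * (a div 3 ^ k) + a mod 3 ^ k" "0 \<le> a mod 3 ^ k" "a mod 3 ^ k < 3 ^ k" by auto
    show ?thesis
    proof
      assume "a div 3 ^ k < int q"
      then have "3 ^ k * (a div 3 ^ k) \<le> 3 ^ k * (int q - 1)" by (intro mult_left_mono) auto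
      then have "3 ^ k * (a div 3 ^ k) + 3 ^ k \<le> int Q" by (simp add: q algebra_simps)
      then show "a < int Q" using m by linarith
    next
      assume a: "a < int Q"
      show "a div 3 ^ k < int q"
      proof (rule ccontr)
        assume "\<not> a div 3 ^ k < int q"
        then have "3 ^ k * int q \<le> 3 ^ k * (a div 3 ^ k)" by (intro mult_left_mono) auto
        then have "int Q \<le> 3 ^ k * (a div 3 ^ k)" by (simp add: q)
        then show False using m a by linarith
      qed
    qed
  qed
  show ?thesis by (simp add: torus_def lev_nth 1 2 q)
qed

lemma lev_upd: "lev k (upd y i t) = upd (lev k y) i (t div 3 ^ k)"
  by (simp add: vec_eq_iff lev_nth)

lemma good_cong:
  "(\<And>y. lev k y = z \<Longrightarrow> op y = op' y) \<Longrightarrow> good op k z = good op' k z"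
proof (induction k arbitrary: z)
  case (Suc k)
  have "good op k w = good op' k w" if "vdiv w = z" for w
    by (rule Suc.IH) (rule Suc.prems, use that in simp)
  then show ?case unfolding good.simps by blast
qed simp

lemma geometric_bound:
  fixes x :: real
  assumes "0 \<le> x" "x \<le> 1 / 2"
  shows "(\<Sum>k<K. x ^ Suc k) \<le> 2 * x"
proof -
  \<comment> \<open>The factor \<open>1 - x ^ K\<close> makes the bound inductive.\<close>
  have "(\<Sum>k<K. x ^ Suc k) \<le> 2 * x * (1 - x ^ K)"
  proof (induction K)
    case (Suc K)
    have "x ^ K * (x * 2) \<le> x ^ K * 1"
      using assms by (intro mult_left_mono) auto
    then have "x ^ K * (x * 2) * x \<le> x ^ K * 1 * x" by (rule mult_right_mono) (use assms in auto)
    then show ?case using Suc by (simp add: algebra_simps)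
  qed simp
  also have "\<dots> \<le> 2 * x" using assms by (simp add: mult_left_le)
  finally show ?thesis .
qed

lemma power_two_power_le:
  fixes c :: real
  assumes "0 \<le> c" "c \<le> 1"
  shows "c ^ 2 ^ k \<le> c ^ Suc k"
  by (rule power_decreasing) (use assms Suc_leI[OF less_exp[of k]] in auto)

text \<open>The thresholds exceed the mean frequency of bad boxes of level \<open>k\<close> by enough for
  Chebyshev's inequality, and are summable against the detour lengths.\<close>

definition nice_line :: "real \<Rightarrow> nat \<Rightarrow> nat \<Rightarrow> (int ^ 'd::finite \<Rightarrow> bool) \<Rightarrow> 'd \<Rightarrow> int ^ 'd \<Rightarrow> bool" where
  "nice_line c K Q op i y \<longleftrightarrow> (\<forall>k<K. real (card {s. s < Q div 3 ^ k \<and> \<not> good op k (upd (lev k y) i (int s))})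
      \<le> real (Q div 3 ^ k) * (c ^ (4 * 2 ^ k) + c ^ 2 ^ k))"

section \<open>Costs and hubs along nice lines\<close>

definition hub_site :: "nat \<Rightarrow> (int ^ 'd::finite \<Rightarrow> bool) \<Rightarrow> int ^ 'd \<Rightarrow> bool" where
  "hub_site K op x \<longleftrightarrow> (\<forall>k\<le>K. good op k (lev k x))"

lemma hub_site_anchor: "hub_site K op x \<Longrightarrow> x \<in> anchor op K x"
proof -
  assume "hub_site K op x"
  then have "kap op K x = 0" "good op 0 x"
    using kap_le[of 0 K op x] unfolding hub_site_def by force+
  then show ?thesis by (simp add: anchor_def hub_def)
qed

lemma card_div_le:
  assumes "m > 0" "m dvd Q"
  shows "card {t. t < Q \<and> B (t div m)} \<le> m * card {s. s < Q div m \<and> B s}"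
proof -
  have "{t. t < Q \<and> B (t div m)} \<subseteq> (\<Union>s\<in>{s. s < Q div m \<and> B s}. {s * m..<s * m + m})"
  proof
    fix t assume t: "t \<in> {t. t < Q \<and> B (t div m)}"
    then have "t div m < Q div m" using assms by (auto elim!: dvdE simp: less_mult_imp_div_less mult.commute)
    moreover have "t \<in> {t div m * m..<t div m * m + m}"
      using assms(1) mod_less_divisor[of m t] div_mult_mod_eq[of t m] unfolding atLeastLessThan_iff by linarith
    ultimately show "t \<in> (\<Union>s\<in>{s. s < Q div m \<and> B s}. {s * m..<s * m + m})" using t by blast
  qed
  then have "card {t. t < Q \<and> B (t div m)} \<le> card (\<Union>s\<in>{s. s < Q div m \<and> B s}. {s * m..<s * m + m})"
    by (rule card_mono[rotated]) auto
  also have "\<dots> \<le> (\<Sum>s\<in>{s. s < Q div m \<and> B s}. card {s * m..<s * m + m})"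
    by (rule card_UN_le) auto
  finally show ?thesis by (simp add: mult.commute)
qed

text \<open>A box of level \<open>k\<close> meets the line in \<open>3 ^ k\<close> consecutive
  sites, so the frequency of bad boxes bounds the frequency of sites in bad boxes.\<close>

lemma nice_line_count:
  assumes "nice_line c K Q op i y" "k < K" "3 ^ K dvd Q"
  shows "real (card {t. t < Q \<and> \<not> good op k (lev k (upd y i (int t)))})
    \<le> real Q * (c ^ (4 * 2 ^ k) + c ^ 2 ^ k)"
proof -
  have dv: "3 ^ k dvd Q" using assms(2,3) by (meson dvd_trans le_imp_power_dvd less_imp_le)
  let ?B = "\<lambda>s. \<not> good op k (upd (lev k y) i (int s))"
  have "{t. t < Q \<and> \<not> good op k (lev k (upd y i (int t)))} = {t. t < Q \<and> ?B (t div 3 ^ k)}"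
    by (simp add: lev_upd zdiv_int)
  then have "real (card {t. t < Q \<and> \<not> good op k (lev k (upd y i (int t)))})
      \<le> real (3 ^ k * card {s. s < Q div 3 ^ k \<and> ?B s})"
    using card_div_le[of "3 ^ k" Q ?B] dv by (simp only: of_nat_le_iff) simp
  also have "\<dots> \<le> real (3 ^ k) * (real (Q div 3 ^ k) * (c ^ (4 * 2 ^ k) + c ^ 2 ^ k))"
    using assms(1,2) unfolding nice_line_def of_nat_mult by (intro mult_left_mono) auto
  also have "\<dots> = real (3 ^ k * (Q div 3 ^ k)) * (c ^ (4 * 2 ^ k) + c ^ 2 ^ k)"
    by (simp only: of_nat_mult mult.assoc)
  also have "3 ^ k * (Q div 3 ^ k) = Q" using dv by simp
  finally show ?thesis .
qed

lemma detour_eq: "detour d k = (8 * d + 3) ^ k"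
  by (induction k) auto

text \<open>The doubly exponential decay is weakened to \<open>c ^ 2 ^ k \<le> c ^ Suc k\<close>,
  which already beats the growth \<open>(8 * d + 3) ^ Suc k\<close> of the detours.\<close>

lemma threshold_sum:
  fixes c \<eta> :: real
  assumes c: "0 \<le> c" "4 * (8 * real d + 3) * c \<le> \<eta>" "\<eta> \<le> 1"
  shows "(\<Sum>k<K. real (detour d (Suc k)) * (c ^ (4 * 2 ^ k) + c ^ 2 ^ k)) \<le> \<eta>"
proof -
  define a where "a = 8 * real d + 3"
  have a: "a \<ge> 1" "a * c \<le> 1 / 4" "0 \<le> a * c"
  proof -
    have "4 * a * c \<le> 1" using order_trans[OF c(2,3)] unfolding a_def .
    then show "a * c \<le> 1 / 4" by simp
  qed (use c(1) in \<open>auto simp: a_def\<close>)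
  have c1: "c \<le> 1" using mult_right_mono[of 1 a c] a c by linarith
  have "(\<Sum>k<K. real (detour d (Suc k)) * (c ^ (4 * 2 ^ k) + c ^ 2 ^ k)) \<le> (\<Sum>k<K. 2 * (a * c) ^ Suc k)"
  proof (rule sum_mono)
    fix k
    have "c ^ (4 * 2 ^ k) \<le> c ^ 2 ^ k" by (rule power_decreasing) (use c c1 in auto)
    then have "c ^ (4 * 2 ^ k) + c ^ 2 ^ k \<le> 2 * c ^ Suc k"
      using power_two_power_le[OF c(1) c1, of k] by linarith
    then have "a ^ Suc k * (c ^ (4 * 2 ^ k) + c ^ 2 ^ k) \<le> a ^ Suc k * (2 * c ^ Suc k)"
      by (rule mult_left_mono) (use a in auto)
    moreover have "real (detour d (Suc k)) = a ^ Suc k" by (simp add: detour_eq a_def)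
    ultimately show "real (detour d (Suc k)) * (c ^ (4 * 2 ^ k) + c ^ 2 ^ k) \<le> 2 * (a * c) ^ Suc k"
      by (simp only: power_mult_distrib mult_ac)
  qed
  also have "\<dots> = 2 * (\<Sum>k<K. (a * c) ^ Suc k)" by (simp only: sum_distrib_left)
  also have "\<dots> \<le> 2 * (2 * (a * c))"
    by (intro mult_left_mono geometric_bound) (use a in auto)
  also have "\<dots> \<le> \<eta>" using c by (simp add: a_def algebra_simps)
  finally show ?thesis .
qed

text \<open>Exchanging the sums over sites and levels turns the total cost into detour lengths
  weighted by frequencies of bad boxes; by \<open>threshold_sum\<close> these add at most one to the
  basic cost of one per site.\<close>

lemma nice_line_cost:
  fixes op :: "int ^ 'd::finite \<Rightarrow> bool"
  assumes "nice_line c K Q op i y" "3 ^ K dvd Q" "0 \<le> c" "4 * (8 * real CARD('d) + 3) * c \<le> 1"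
  shows "real (\<Sum>t<Q. cost op K (upd y i (int t))) \<le> 2 * real Q"
proof -
  let ?b = "\<lambda>k t. \<not> good op k (lev k (upd y i (int t)))"
  let ?D = "\<lambda>k. detour CARD('d) (Suc k)"
  have "(\<Sum>t<Q. cost op K (upd y i (int t))) = Q + (\<Sum>t<Q. \<Sum>k<K. if ?b k t then ?D k else 0)"
    unfolding cost_def sum.distrib by (simp add: if_distrib[of Not] if_not_P cong: if_cong)
       (intro sum.cong refl, auto)
  also have "(\<Sum>t<Q. \<Sum>k<K. if ?b k t then ?D k else 0) = (\<Sum>k<K. \<Sum>t<Q. if ?b k t then ?D k else 0)"
    by (rule sum.swap)
  also have "\<dots> = (\<Sum>k<K. ?D k * card {t. t < Q \<and> ?b k t})"
    by (intro sum.cong refl) (simp add: sum.If_cases Int_def mult.commute)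
  finally have "real (\<Sum>t<Q. cost op K (upd y i (int t))) =
      real Q + (\<Sum>k<K. real (?D k) * real (card {t. t < Q \<and> ?b k t}))"
    by (simp only: of_nat_add of_nat_sum of_nat_mult)
  also have "(\<Sum>k<K. real (?D k) * real (card {t. t < Q \<and> ?b k t})) \<le>
      (\<Sum>k<K. real (?D k) * (real Q * (c ^ (4 * 2 ^ k) + c ^ 2 ^ k)))"
    by (intro sum_mono mult_left_mono nice_line_count[OF assms(1) _ assms(2)]) auto
  also have "\<dots> = real Q * (\<Sum>k<K. real (?D k) * (c ^ (4 * 2 ^ k) + c ^ 2 ^ k))"
    by (simp only: sum_distrib_left mult_ac)
  also have "\<dots> \<le> real Q * 1"
    by (intro mult_left_mono threshold_sum) (use assms in auto)
  finally show ?thesis by simp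
qed

lemma nice_line_hub:
  fixes op :: "int ^ 'd::finite \<Rightarrow> bool"
  assumes "nice_line c K Q op i y" "3 ^ K dvd Q" "0 \<le> c" "4 * (8 * real CARD('d) + 3) * c \<le> \<eta>" "\<eta> \<le> 1"
    and top: "\<And>t. t < Q \<Longrightarrow> good op K (lev K (upd y i (int t)))"
  shows "real (card {t. t < Q \<and> \<not> hub_site K op (upd y i (int t))}) \<le> \<eta> * real Q"
proof -
  let ?b = "\<lambda>k t. \<not> good op k (lev k (upd y i (int t)))"
  have "{t. t < Q \<and> \<not> hub_site K op (upd y i (int t))} \<subseteq> (\<Union>k\<in>{..<K}. {t. t < Q \<and> ?b k t})"
    unfolding hub_site_def using top by (force simp: le_less)
  then have "card {t. t < Q \<and> \<not> hub_site K op (upd y i (int t))} \<le> card (\<Union>k\<in>{..<K}. {t. t < Q \<and> ?b k t})"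
    by (rule card_mono[rotated]) auto
  also have "\<dots> \<le> (\<Sum>k<K. card {t. t < Q \<and> ?b k t})" by (rule card_UN_le) auto
  finally have "real (card {t. t < Q \<and> \<not> hub_site K op (upd y i (int t))}) \<le>
      (\<Sum>k<K. real (card {t. t < Q \<and> ?b k t}))" by (simp only: of_nat_le_iff flip: of_nat_sum)
  also have "\<dots> \<le> (\<Sum>k<K. real Q * (real (detour CARD('d) (Suc k)) * (c ^ (4 * 2 ^ k) + c ^ 2 ^ k)))"
  proof (rule sum_mono)
    fix k assume "k \<in> {..<K}"
    then have "real (card {t. t < Q \<and> ?b k t}) \<le> real Q * (c ^ (4 * 2 ^ k) + c ^ 2 ^ k)"
      by (intro nice_line_count[OF assms(1) _ assms(2)]) auto
    also have "\<dots> \<le> real Q * (real (detour CARD('d) (Suc k)) * (c ^ (4 * 2 ^ k) + c ^ 2 ^ k))"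
    proof (rule mult_left_mono)
      have "1 * (c ^ (4 * 2 ^ k) + c ^ 2 ^ k) \<le>
          real (detour CARD('d) (Suc k)) * (c ^ (4 * 2 ^ k) + c ^ 2 ^ k)"
        using detour_pos[of "CARD('d)" "Suc k"] assms(3)
        by (intro mult_right_mono) (simp_all del: detour.simps)
      then show "c ^ (4 * 2 ^ k) + c ^ 2 ^ k \<le>
          real (detour CARD('d) (Suc k)) * (c ^ (4 * 2 ^ k) + c ^ 2 ^ k)" by simp
    qed simp
    finally show "real (card {t. t < Q \<and> ?b k t}) \<le>
      real Q * (real (detour CARD('d) (Suc k)) * (c ^ (4 * 2 ^ k) + c ^ 2 ^ k))" .
  qed
  also have "\<dots> \<le> real Q * \<eta>"
    unfolding sum_distrib_left[symmetric] by (intro mult_left_mono threshold_sum) (use assms in auto)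
  finally show ?thesis by (simp add: mult.commute)
qed

text \<open>The corners are the turning points of the paths from the origin to \<open>x\<close> that
  adjust one coordinate after another.\<close>

definition corner :: "int ^ 'd::finite \<Rightarrow> 'd set \<Rightarrow> int ^ 'd" where
  "corner x S = (\<chi> i. if i \<in> S then x $ i else 0)"

text \<open>Quantifying over all \<open>S\<close> frees the induction in
  \<open>nice_site_reach\<close> from fixing an order of the coordinates;
  \<open>S = UNIV - {i}\<close> gives the full line in direction \<open>i\<close> through
  \<open>x\<close>.\<close>

definition nice_site :: "real \<Rightarrow> nat \<Rightarrow> nat \<Rightarrow> (int ^ 'd::finite \<Rightarrow> bool) \<Rightarrow> int ^ 'd \<Rightarrow> bool" where
  "nice_site c K Q op x \<longleftrightarrow> (\<forall>i S. nice_line c K Q op i (corner x S))"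

text \<open>Each coordinate is adjusted along a line of total cost at most \<open>2 * Q\<close>,
  which \<open>anchor_chain\<close> turns into \<open>6 * Q\<close> steps; \<open>4 * Q\<close>
  steps join two sites of the anchor of the origin, and
  \<open>4 + 6 * d \<le> 10 * d\<close>.\<close>

lemma nice_site_reach:
  fixes op :: "int ^ 'd::finite \<Rightarrow> bool"
  assumes d: "CARD('d) \<ge> 2" and c: "3 ^ K dvd Q" "0 \<le> c" "4 * (8 * real CARD('d) + 3) * c \<le> 1"
    and top: "\<And>y. y \<in> torus Q \<Longrightarrow> good op K (lev K y)"
    and x: "x \<in> torus Q" "nice_site c K Q op x" and ab: "a \<in> anchor op K 0" "b \<in> anchor op K x"
  shows "rch (stp op) (10 * CARD('d) * Q) a b"
proof -
  have cost: "(\<Sum>t<Q. cost op K (upd (corner x S) i (int t))) \<le> 2 * Q" for i S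
    using nice_line_cost[OF _ c] x(2) unfolding nice_site_def
    by (metis of_nat_le_iff of_nat_mult of_nat_numeral)
  have xi: "0 \<le> x $ i" "x $ i < int Q" for i using x(1) by (auto simp: torus_def)
  have ct: "corner x S \<in> torus Q" for S using x(1) xi(1) order_le_less_trans[OF xi]
    by (auto simp: torus_def corner_def)
  have Q: "Q > 0" using order_le_less_trans[OF xi] by auto
  have c0: "cost op K 0 \<le> 2 * Q"
  proof -
    have "cost op K (upd (corner x {}) i (int 0)) \<le> (\<Sum>t<Q. cost op K (upd (corner x {}) i (int t)))" for i :: 'd
      using Q by (intro member_le_sum) auto
    moreover have "upd (corner x {}) i 0 = 0" for i by (simp add: vec_eq_iff corner_def)
    ultimately show ?thesis using cost[of "{}"] by (metis le_trans of_nat_0)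
  qed
  have "\<forall>b\<in>anchor op K (corner x S). rch (stp op) (4 * Q + 6 * Q * card S) a b" if "finite S" for S
    using that
  proof (induction S)
    case empty
    have eq: "corner x {} = 0" by (simp add: vec_eq_iff corner_def)
    have g0: "good op K (lev K 0)" using top[OF ct[of "{}"]] eq by simp
    have "rch (stp op) (cost op K 0 + cost op K 0) a b" if "b \<in> anchor op K 0" for b
      by (rule anchor_step[OF d g0 g0 _ ab(1) that]) simp
    then have "rch (stp op) (4 * Q + 6 * Q * 0) a b" if "b \<in> anchor op K 0" for b
      by (rule rch_mono[OF _ _]) (use that c0 in auto)
    then show ?case unfolding eq by simp
  next
    case (insert j S)
    define T where "T = nat (x $ j)"
    have T: "int T = x $ j" "T < Q" using xi[of j] by (auto simp: T_def nat_less_iff)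
    define p where "p t = upd (corner x S) j (int t)" for t
    have p0: "p 0 = corner x S" using insert by (auto simp: p_def vec_eq_iff corner_def)
    have pT: "p T = corner x (insert j S)" using T by (auto simp: p_def vec_eq_iff corner_def)
    have pt: "p t \<in> torus Q" if "t \<le> T" for t
      using ct[of S] that T(2) by (auto simp: p_def torus_def)
    have gd: "good op K (lev K (p t))" if "t \<le> T" for t by (rule top[OF pt[OF that]])
    have ad: "adj (p t) (p (Suc t))" for t unfolding adj_def p_def by (rule exI[of _ j]) auto
    obtain b' where b': "b' \<in> anchor op K (p 0)"
      using anchor_nonempty[OF detour_kap_le_cost(1)[OF gd[of 0]]] by auto
    have "(\<Sum>t\<le>T. cost op K (p t)) \<le> (\<Sum>t<Q. cost op K (p t))"
      using T(2) by (intro sum_mono2) auto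
    also have "\<dots> \<le> 2 * Q" using cost[of S j] by (simp add: p_def)
    finally have s: "3 * (\<Sum>t\<le>T. cost op K (p t)) \<le> 6 * Q" by simp
    show ?case
    proof
      fix b assume b: "b \<in> anchor op K (corner x (insert j S))"
      have "rch (stp op) (3 * (\<Sum>t\<le>T. cost op K (p t))) b' b"
        by (rule anchor_chain[OF d gd ad b']) (use b pT in auto)
      then have "rch (stp op) (6 * Q) b' b" using s by (rule rch_mono)
      with insert.IH b' p0 have "rch (stp op) ((4 * Q + 6 * Q * card S) + 6 * Q) a b"
        using rch_trans by metis
      then show "rch (stp op) (4 * Q + 6 * Q * card (insert j S)) a b"
        using insert by (simp add: algebra_simps)
    qed
  qed
  from this[of UNIV] ab(2) have "rch (stp op) (4 * Q + 6 * Q * CARD('d)) a b"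
    by (simp add: corner_def)
  moreover have "4 * Q \<le> 4 * CARD('d) * Q" using d by simp
  ultimately show ?thesis by (elim rch_mono) (simp add: algebra_simps)
qed

text \<open>The cube is cut into the lines of one direction: on each nice line the proportion of
  sites that are not hubs is at most \<open>\<eta>\<close>, and there are at most
  \<open>Q ^ (d - 1)\<close> lines.\<close>

lemma nonhub_on_nice_lines:
  fixes op :: "int ^ 'd::finite \<Rightarrow> bool"
  assumes c: "3 ^ K dvd Q" "0 \<le> c" "4 * (8 * real CARD('d) + 3) * c \<le> \<eta>" "\<eta> \<le> 1"
    and top: "\<And>y. y \<in> torus Q \<Longrightarrow> good op K (lev K y)"
  shows "real (card {x\<in>torus Q. nice_site c K Q op x \<and> \<not> hub_site K op x}) \<le> \<eta> * real Q ^ CARD('d)"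
proof -
  obtain i :: 'd where True by simp
  let ?B = "{y\<in>torus Q. y $ i = 0} :: (int ^ 'd) set"
  let ?N = "\<lambda>y. {t. t < Q \<and> \<not> hub_site K op (upd y i (int t))}"
  let ?B' = "{y\<in>?B. nice_line c K Q op i y}"
  have "{x\<in>torus Q. nice_site c K Q op x \<and> \<not> hub_site K op x} \<subseteq>
      (\<Union>y\<in>?B'. (\<lambda>t. upd y i (int t)) ` ?N y)"
  proof
    fix x :: "int ^ 'd" assume x: "x \<in> {x\<in>torus Q. nice_site c K Q op x \<and> \<not> hub_site K op x}"
    define y where "y = corner x (UNIV - {i})"
    have xi: "0 \<le> x $ j" "x $ j < int Q" for j using x by (auto simp: torus_def)
    have "y \<in> ?B" using xi order_le_less_trans[OF xi] unfolding y_def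
      by (auto simp: torus_def corner_def)
    then have "y \<in> ?B'" using x unfolding y_def by (simp add: nice_site_def)
    moreover have "x = upd y i (int (nat (x $ i)))" using xi by (auto simp: y_def vec_eq_iff corner_def)
    moreover from this have "nat (x $ i) \<in> ?N y" using x xi[of i] by (auto simp: nat_less_iff)
    ultimately show "x \<in> (\<Union>y\<in>?B'. (\<lambda>t. upd y i (int t)) ` ?N y)" by blast
  qed
  then have "card {x\<in>torus Q. nice_site c K Q op x \<and> \<not> hub_site K op x} \<le>
      card (\<Union>y\<in>?B'. (\<lambda>t. upd y i (int t)) ` ?N y)"
    by (rule card_mono[rotated]) auto
  also have "\<dots> \<le> (\<Sum>y\<in>?B'. card (?N y))"
    by (rule order_trans[OF card_UN_le]) (auto intro!: sum_mono card_image_le)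
  finally have "real (card {x\<in>torus Q. nice_site c K Q op x \<and> \<not> hub_site K op x}) \<le>
      (\<Sum>y\<in>?B'. real (card (?N y)))" by (simp only: of_nat_le_iff flip: of_nat_sum)
  also have "\<dots> \<le> (\<Sum>y\<in>?B'. \<eta> * real Q)"
  proof (rule sum_mono)
    fix y assume y: "y \<in> ?B'"
    then have "upd y i (int t) \<in> torus Q" if "t < Q" for t using that by (auto simp: torus_def)
    then show "real (card (?N y)) \<le> \<eta> * real Q"
      using y by (intro nice_line_hub[OF _ c]) (auto intro: top)
  qed
  also have "\<dots> = real (card ?B') * (\<eta> * real Q)" by simp
  also have "\<dots> \<le> real (Q ^ (CARD('d) - 1)) * (\<eta> * real Q)"
  proof (intro mult_right_mono)
    have "?B \<subseteq> {y. \<forall>j. y $ j \<in> (if j = i then {0} else {0..<int Q})}"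
      by (auto simp: torus_def)
    then have "card ?B \<le> card {y::int ^ 'd. \<forall>j. y $ j \<in> (if j = i then {0} else {0..<int Q})}"
      by (intro card_mono finite_vec_box) auto
    also have "\<dots> = (\<Prod>j\<in>UNIV. if j = i then 1 else Q)"
      by (subst card_vec_box) (intro prod.cong, auto)
    also have "\<dots> = Q ^ (CARD('d) - 1)"
    proof -
      have "(\<Prod>j\<in>UNIV. if j = i then 1 else Q) = (\<Prod>j\<in>insert i (UNIV - {i}). if j = i then 1 else Q)"
        by (simp add: insert_absorb)
      also have "\<dots> = (\<Prod>j\<in>UNIV - {i}. Q)" by (subst prod.insert) (auto intro!: prod.cong)
      finally show ?thesis by simp
    qed
    finally show "real (card ?B') \<le> real (Q ^ (CARD('d) - 1))"
      by (intro of_nat_mono order_trans[OF card_mono[of ?B ?B']]) auto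
    have "0 \<le> \<eta>" using c(2,3) by (intro order_trans[OF _ c(3)]) auto
    then show "0 \<le> \<eta> * real Q" by simp
  qed
  also have "\<dots> = \<eta> * real Q ^ CARD('d)"
    by (cases "CARD('d)") (simp_all add: algebra_simps)
  finally show ?thesis .
qed

text \<open>This solves the recursion \<open>p (k + 1) = 9 ^ D * p k ^ 2\<close> with initial value
  \<open>c ^ 4 / 9 ^ D\<close>. The fourth power leaves room for the excess \<open>c ^ 2 ^ k\<close>
  allowed in \<open>nice_line\<close>, whose square appears in Chebyshev's denominator.\<close>

definition bad_bound :: "nat \<Rightarrow> real \<Rightarrow> nat \<Rightarrow> real" where
  "bad_bound D c k = c ^ (4 * 2 ^ k) / 9 ^ D"

text \<open>Openness of a site is a function of the coordinates in \<open>J y\<close>, and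
  independence comes from the disjointness of these sets. This form fits blocks whose openness is
  read off from the paths starting in them.\<close>

locale percolation =
  fixes I :: "'i set" and dflt :: 'b and p :: "'i \<Rightarrow> 'b pmf"
    and opn :: "('i \<Rightarrow> 'b) \<Rightarrow> int ^ 'd::finite \<Rightarrow> bool" and J :: "int ^ 'd \<Rightarrow> 'i set"
    and Q :: nat and c :: real
  assumes fin: "finite I"
    and dep_opn: "y \<in> torus Q \<Longrightarrow> dep (\<lambda>f. opn f y) (J y)"
    and disj: "y \<in> torus Q \<Longrightarrow> y' \<in> torus Q \<Longrightarrow> y \<noteq> y' \<Longrightarrow> J y \<inter> J y' = {}"
    and prob_opn: "y \<in> torus Q \<Longrightarrow> measure_pmf.prob (Pi_pmf I dflt p) {f. \<not> opn f y} \<le> c ^ 4 / 9 ^ CARD('d)"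
    and c: "0 < c" "4 * (8 * real CARD('d) + 3) * c \<le> 1"
begin

abbreviation "pr A \<equiv> measure_pmf.prob (Pi_pmf I dflt p) {f. A f}"

lemma c_le: "c \<le> 1 / 4"
proof -
  have "1 * c \<le> (8 * real CARD('d) + 3) * c" by (rule mult_right_mono) (use c in auto)
  with c(2) show ?thesis unfolding mult.assoc by linarith
qed

lemma bad_bound_Suc: "9 ^ CARD('d) * (bad_bound CARD('d) c k)\<^sup>2 = bad_bound CARD('d) c (Suc k)"
proof -
  have "(c ^ (4 * 2 ^ k))\<^sup>2 = c ^ (4 * 2 ^ Suc k)" by (simp add: power2_eq_square flip: power_add)
  then show ?thesis by (simp add: bad_bound_def power_divide power2_eq_square[of "9 ^ _"])
qed

lemma bad_bound_pos: "bad_bound CARD('d) c k \<ge> 0"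
  using c by (simp add: bad_bound_def)

lemma bad_bound_le: "bad_bound CARD('d) c k \<le> c ^ (4 * 2 ^ k)"
proof -
  have "c ^ (4 * 2 ^ k) * 1 \<le> c ^ (4 * 2 ^ k) * 9 ^ CARD('d)"
    by (intro mult_left_mono) (use c in auto)
  then show ?thesis by (simp add: bad_bound_def divide_le_eq)
qed

definition JJ :: "nat \<Rightarrow> int ^ 'd \<Rightarrow> 'i set" where
  "JJ k z = (\<Union>y\<in>{y. lev k y = z}. J y)"

definition inside :: "nat \<Rightarrow> int ^ 'd \<Rightarrow> bool" where
  "inside k z \<longleftrightarrow> (\<forall>y. lev k y = z \<longrightarrow> y \<in> torus Q)"

lemma dep_good: "inside k z \<Longrightarrow> dep (\<lambda>f. good (opn f) k z) (JJ k z)"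
  unfolding dep_def
proof (intro allI impI)
  fix f g :: "'i \<Rightarrow> 'b" assume i: "inside k z" and eq: "\<forall>i\<in>JJ k z. f i = g i"
  show "good (opn f) k z = good (opn g) k z"
  proof (rule good_cong)
    fix y assume y: "lev k y = z"
    then have "y \<in> torus Q" using i by (auto simp: inside_def)
    from depD[OF dep_opn[OF this], of f g] show "opn f y = opn g y"
      using eq y by (auto simp: JJ_def)
  qed
qed

lemma JJ_disj: "inside k z \<Longrightarrow> inside k z' \<Longrightarrow> z \<noteq> z' \<Longrightarrow> JJ k z \<inter> JJ k z' = {}"
  unfolding JJ_def inside_def using disj by blast

lemma indep_good:
  assumes "inside k z" "inside k z'" "z \<noteq> z'"
  shows "pr (\<lambda>f. \<not> good (opn f) k z \<and> \<not> good (opn f) k z') =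
    pr (\<lambda>f. \<not> good (opn f) k z) * pr (\<lambda>f. \<not> good (opn f) k z')"
proof (rule Pi_pmf_indep[OF fin _ _ JJ_disj[OF assms]])
  show "dep (\<lambda>f. \<not> good (opn f) k z) (JJ k z)" using dep_good[OF assms(1)] unfolding dep_def by blast
  show "dep (\<lambda>f. \<not> good (opn f) k z') (JJ k z')" using dep_good[OF assms(2)] unfolding dep_def by blast
qed

text \<open>A bad box contains an ordered pair of distinct bad children; there are fewer than
  \<open>9 ^ d\<close> such pairs, and distinct children are independent.\<close>

lemma prob_good: "inside k z \<Longrightarrow> pr (\<lambda>f. \<not> good (opn f) k z) \<le> bad_bound CARD('d) c k"
proof (induction k arbitrary: z)
  case 0
  then show ?case using prob_opn by (simp add: inside_def bad_bound_def)
next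
  case (Suc k)
  let ?W = "{w. vdiv w = z}"
  let ?PP = "{(w, w'). w \<in> ?W \<and> w' \<in> ?W \<and> w \<noteq> w'}"
  have ins: "inside k w" if "w \<in> ?W" for w
    using Suc.prems that by (simp add: inside_def)
  have PP: "?PP \<subseteq> ?W \<times> ?W" by auto
  have fin_PP: "finite ?PP" by (rule finite_subset[OF PP]) (simp add: vdiv_fibre)
  have "pr (\<lambda>f. \<not> good (opn f) (Suc k) z) =
      pr (\<lambda>f. \<exists>x\<in>?PP. \<not> good (opn f) k (fst x) \<and> \<not> good (opn f) k (snd x))"
    by (rule arg_cong[of _ _ "measure _"]) auto
  also have "\<dots> \<le> (\<Sum>x\<in>?PP. (bad_bound CARD('d) c k)\<^sup>2)"
  proof (rule prob_union_le[OF fin_PP])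
    fix x assume "x \<in> ?PP"
    then obtain w w' where x: "x = (w, w')" "w \<in> ?W" "w' \<in> ?W" "w \<noteq> w'" by auto
    show "pr (\<lambda>f. \<not> good (opn f) k (fst x) \<and> \<not> good (opn f) k (snd x)) \<le> (bad_bound CARD('d) c k)\<^sup>2"
      unfolding x fst_conv snd_conv power2_eq_square
      by (subst indep_good) (use x ins in \<open>auto intro!: mult_mono Suc.IH bad_bound_pos\<close>)
  qed
  also have "\<dots> = real (card ?PP) * (bad_bound CARD('d) c k)\<^sup>2" by simp
  also have "\<dots> \<le> 9 ^ CARD('d) * (bad_bound CARD('d) c k)\<^sup>2"
  proof (rule mult_right_mono)
    have "card ?PP \<le> card (?W \<times> ?W)" by (rule card_mono[OF _ PP]) (simp add: vdiv_fibre)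
    also have "\<dots> = 9 ^ CARD('d)" by (simp add: vdiv_fibre card_cartesian_product flip: power_mult_distrib)
    finally have "real (card ?PP) \<le> real (9 ^ CARD('d))" by (rule of_nat_mono)
    then show "real (card ?PP) \<le> 9 ^ CARD('d)" by (simp only: of_nat_power of_nat_numeral)
  qed simp
  also have "\<dots> = bad_bound CARD('d) c (Suc k)" by (rule bad_bound_Suc)
  finally show ?case .
qed

lemma inside_iff: "3 ^ k dvd Q \<Longrightarrow> z \<in> torus (Q div 3 ^ k) \<Longrightarrow> inside k z"
  unfolding inside_def using lev_torus by blast

text \<open>On level \<open>k\<close> Chebyshev's inequality with \<open>t = c ^ 2 ^ k\<close> over
  \<open>Q div 3 ^ k\<close> boxes gives \<open>3 ^ k * c ^ (2 * 2 ^ k) / Q\<close>, and the sum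
  over \<open>k\<close> stays below \<open>1 / Q\<close>.\<close>

lemma prob_nice_line:
  assumes K: "3 ^ K dvd Q" and Q: "Q > 0" and y: "y \<in> torus Q"
  shows "pr (\<lambda>f. \<not> nice_line c K Q (opn f) i y) \<le> 1 / real Q"
proof -
  define z where "z k s = upd (lev k y) i (int s)" for k s
  have le: "pr (\<lambda>f. real (Q div 3 ^ k) * (c ^ (4 * 2 ^ k) + c ^ 2 ^ k) \<le>
      real (card {s. s < Q div 3 ^ k \<and> \<not> good (opn f) k (z k s)})) \<le> 3 ^ k * c ^ (2 * 2 ^ k) / real Q"
    if "k < K" for k
  proof -
    have dv: "3 ^ k dvd Q" using K that by (meson dvd_trans le_imp_power_dvd less_imp_le)
    then have q: "Q = 3 ^ k * (Q div 3 ^ k)" by simp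
    have q0: "Q div 3 ^ k > 0" using Q q by (metis mult_0_right neq0_conv)
    have ins: "inside k (z k s)" if "s < Q div 3 ^ k" for s
    proof (rule inside_iff[OF dv])
      have "lev k y \<in> torus (Q div 3 ^ k)" using lev_torus[OF dv] y by blast
      then show "z k s \<in> torus (Q div 3 ^ k)" using that by (auto simp: torus_def z_def)
    qed
    have zne: "z k s \<noteq> z k s'" if "s \<noteq> s'" for s s' using that by (auto simp: z_def vec_eq_iff)
    have "measure_pmf.prob (Pi_pmf I dflt p) {f. real (card {..<Q div 3 ^ k}) * (c ^ (4 * 2 ^ k) + c ^ 2 ^ k) \<le>
        real (card {s\<in>{..<Q div 3 ^ k}. f \<in> {f. \<not> good (opn f) k (z k s)}})}
        \<le> c ^ (4 * 2 ^ k) / (real (card {..<Q div 3 ^ k}) * (c ^ 2 ^ k)\<^sup>2)"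
    proof (rule count_deviation)
      fix s s' assume s: "s \<in> {..<Q div 3 ^ k}" "s' \<in> {..<Q div 3 ^ k}" "s \<noteq> s'"
      show "measure_pmf.prob (Pi_pmf I dflt p) ({f. \<not> good (opn f) k (z k s)} \<inter> {f. \<not> good (opn f) k (z k s')}) =
        pr (\<lambda>f. \<not> good (opn f) k (z k s)) * pr (\<lambda>f. \<not> good (opn f) k (z k s'))"
        using indep_good[OF ins ins zne, of s s'] s by (simp add: Collect_conj_eq)
    next
      fix s assume "s \<in> {..<Q div 3 ^ k}"
      then show "pr (\<lambda>f. \<not> good (opn f) k (z k s)) \<le> c ^ (4 * 2 ^ k)"
        by (intro order_trans[OF prob_good bad_bound_le] ins) auto
    qed (use q0 c in auto)
    also have "\<dots> = 3 ^ k * c ^ (2 * 2 ^ k) / real Q"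
    proof -
      have "c ^ (4 * 2 ^ k) = c ^ (2 * 2 ^ k) * (c ^ 2 ^ k)\<^sup>2"
        by (simp flip: power_mult power_add)
      moreover have "real Q = 3 ^ k * real (Q div 3 ^ k)"
        by (subst q) (simp only: of_nat_mult of_nat_power of_nat_numeral)
      ultimately show ?thesis using c(1) q0 by (simp add: field_simps)
    qed
    finally show ?thesis by simp
  qed
  have "pr (\<lambda>f. \<not> nice_line c K Q (opn f) i y) \<le>
    pr (\<lambda>f. \<exists>k\<in>{..<K}. real (Q div 3 ^ k) * (c ^ (4 * 2 ^ k) + c ^ 2 ^ k) \<le>
      real (card {s. s < Q div 3 ^ k \<and> \<not> good (opn f) k (z k s)}))"
    by (rule prob_mono_pmf) (force simp: nice_line_def z_def not_le)
  also have "\<dots> \<le> (\<Sum>k<K. 3 ^ k * c ^ (2 * 2 ^ k) / real Q)"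
    by (rule prob_union_le) (use le in auto)
  also have "\<dots> \<le> (\<Sum>k<K. (3 * c) ^ Suc k / real Q)"
  proof (intro sum_mono divide_right_mono)
    fix k
    have "c ^ (2 * 2 ^ k) \<le> c ^ 2 ^ k" by (rule power_decreasing) (use c c_le in auto)
    also have "\<dots> \<le> c ^ Suc k" by (rule power_two_power_le) (use c c_le in auto)
    finally have "3 ^ k * c ^ (2 * 2 ^ k) \<le> 3 ^ Suc k * c ^ Suc k"
      by (intro mult_mono) (use c in auto)
    then show "3 ^ k * c ^ (2 * 2 ^ k) \<le> (3 * c) ^ Suc k" by (simp only: power_mult_distrib)
  qed simp
  also have "\<dots> = (\<Sum>k<K. (3 * c) ^ Suc k) / real Q" by (simp only: sum_divide_distrib)
  also have "\<dots> \<le> 1 / real Q"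
  proof (intro divide_right_mono)
    have "CARD('d) \<ge> 1" by (simp add: Suc_leI)
    then have "real CARD('d) \<ge> 1" by linarith
    then have "7 \<le> 8 * real CARD('d) + 3" by linarith
    then have "7 * c \<le> (8 * real CARD('d) + 3) * c" by (rule mult_right_mono) (use c in auto)
    then have "28 * c \<le> 1" using c(2) unfolding mult.assoc by linarith
    then show "(\<Sum>k<K. (3 * c) ^ Suc k) \<le> 1"
      by (intro order_trans[OF geometric_bound]) (use c in auto)
  qed simp
  finally show ?thesis .
qed

definition typical :: "real \<Rightarrow> nat \<Rightarrow> (int ^ 'd \<Rightarrow> bool) \<Rightarrow> bool" where
  "typical \<eta> K op \<longleftrightarrow> (\<forall>y\<in>torus Q. good op K (lev K y)) \<and>
     real (card {x\<in>torus Q. \<not> (nice_site c K Q op x \<and> hub_site K op x)}) \<le> 2 * \<eta> * real Q ^ CARD('d)"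

text \<open>The first error term is a union bound for the boxes of level \<open>K\<close>. Of the
  allowed proportion \<open>2 * \<eta>\<close>, one half is for sites that are not nice, by Markov's
  inequality and at the price of the second error term; the other half is for nice sites that are
  not hubs and holds deterministically.\<close>

lemma prob_not_typical:
  assumes K: "3 ^ K dvd Q" and Q: "Q > 0"
    and \<eta>: "4 * (8 * real CARD('d) + 3) * c \<le> \<eta>" "\<eta> \<le> 1"
  shows "pr (\<lambda>f. \<not> typical \<eta> K (opn f)) \<le>
    real Q ^ CARD('d) * c ^ (4 * 2 ^ K) + real CARD('d) * 2 ^ CARD('d) / (\<eta> * real Q)"
proof -
  have \<eta>0: "\<eta> > 0" using c(1) \<eta>(1) by (smt (verit) mult_pos_pos of_nat_0_le_iff)
  let ?n = "\<lambda>f. {x\<in>torus Q. \<not> nice_site c K Q (opn f) x}"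
  have 1: "pr (\<lambda>f. \<exists>y\<in>torus Q. \<not> good (opn f) K (lev K y)) \<le> real Q ^ CARD('d) * c ^ (4 * 2 ^ K)"
  proof (rule order_trans[OF prob_union_le])
    fix y :: "int ^ 'd" assume "y \<in> torus Q"
    then have "inside K (lev K y)" using inside_iff[OF K] lev_torus[OF K] by blast
    then show "pr (\<lambda>f. \<not> good (opn f) K (lev K y)) \<le> c ^ (4 * 2 ^ K)"
      by (rule order_trans[OF prob_good bad_bound_le])
  qed (auto simp: card_torus)
  have 2: "pr (\<lambda>f. \<eta> * real Q ^ CARD('d) \<le> real (card (?n f))) \<le>
      real (card (torus Q :: (int ^ 'd) set)) * (real CARD('d) * 2 ^ CARD('d) / real Q) / (\<eta> * real Q ^ CARD('d))"
  proof (rule prob_card_ge)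
    fix x :: "int ^ 'd" assume x: "x \<in> torus Q"
    have ct: "corner x S \<in> torus Q" for S
    proof -
      have "0 \<le> x $ i" "x $ i < int Q" for i using x by (auto simp: torus_def)
      then show ?thesis using Q by (auto simp: torus_def corner_def)
    qed
    have "pr (\<lambda>f. \<not> nice_site c K Q (opn f) x) \<le>
        pr (\<lambda>f. \<exists>iS\<in>UNIV \<times> UNIV. \<not> nice_line c K Q (opn f) (fst iS) (corner x (snd iS)))"
      by (rule prob_mono_pmf) (auto simp: nice_site_def)
    also have "\<dots> \<le> (\<Sum>iS\<in>(UNIV :: ('d \<times> 'd set) set). 1 / real Q)"
      using prob_union_le[of "UNIV :: ('d \<times> 'd set) set" "Pi_pmf I dflt p"
          "\<lambda>iS f. \<not> nice_line c K Q (opn f) (fst iS) (corner x (snd iS))" "\<lambda>_. 1 / real Q"]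
        prob_nice_line[OF K Q ct] by simp
    also have "\<dots> = real CARD('d) * 2 ^ CARD('d) / real Q" by simp
    finally show "pr (\<lambda>f. \<not> nice_site c K Q (opn f) x) \<le> real CARD('d) * 2 ^ CARD('d) / real Q" .
  qed (use Q \<eta>0 in auto)
  also have "real (card (torus Q :: (int ^ 'd) set)) * (real CARD('d) * 2 ^ CARD('d) / real Q) / (\<eta> * real Q ^ CARD('d))
      = real CARD('d) * 2 ^ CARD('d) / (\<eta> * real Q)"
    using Q \<eta>0 by (simp add: card_torus field_simps)
  finally have 2: "pr (\<lambda>f. \<eta> * real Q ^ CARD('d) \<le> real (card (?n f))) \<le> real CARD('d) * 2 ^ CARD('d) / (\<eta> * real Q)" .
  have "pr (\<lambda>f. \<not> typical \<eta> K (opn f)) \<le>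
     pr (\<lambda>f. (\<exists>y\<in>torus Q. \<not> good (opn f) K (lev K y)) \<or> \<eta> * real Q ^ CARD('d) \<le> real (card (?n f)))"
  proof (rule prob_mono_pmf, rule ccontr)
    fix f assume nt: "\<not> typical \<eta> K (opn f)"
      and "\<not> ((\<exists>y\<in>torus Q. \<not> good (opn f) K (lev K y)) \<or> \<eta> * real Q ^ CARD('d) \<le> real (card (?n f)))"
    then have top: "\<forall>y\<in>torus Q. good (opn f) K (lev K y)" and n: "real (card (?n f)) < \<eta> * real Q ^ CARD('d)" by auto
    let ?h = "{x\<in>torus Q. nice_site c K Q (opn f) x \<and> \<not> hub_site K (opn f) x}"
    have "real (card ?h) \<le> \<eta> * real Q ^ CARD('d)"
      by (rule nonhub_on_nice_lines[OF K]) (use c \<eta> top in auto)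
    moreover have "card {x\<in>torus Q. \<not> (nice_site c K Q (opn f) x \<and> hub_site K (opn f) x)} \<le> card (?n f \<union> ?h)"
      by (rule card_mono) auto
    then have "real (card {x\<in>torus Q. \<not> (nice_site c K Q (opn f) x \<and> hub_site K (opn f) x)}) \<le>
        real (card (?n f)) + real (card ?h)"
      using card_Un_le[of "?n f" ?h] by linarith
    ultimately have "typical \<eta> K (opn f)" using n top by (simp add: typical_def)
    with nt show False by simp
  qed
  also have "\<dots> \<le> real Q ^ CARD('d) * c ^ (4 * 2 ^ K) + real CARD('d) * 2 ^ CARD('d) / (\<eta> * real Q)"
    by (rule prob_disj_le[OF 1 2])
  finally show ?thesis .
qed

end

section \<open>Random walk on the torus\<close>

lemma proj_zero [simp]: "proj L 0 = 0"
  by (simp add: proj_def vec_eq_iff)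

lemma proj_uminus_proj [simp]: "proj L (- proj L x) = proj L (- x)"
  using proj_simps(5)[of L 0 x] by simp

lemma bij_betw_torus_add:
  assumes "L > 0"
  shows "bij_betw (\<lambda>z. proj L (z + a)) (torus L) (torus L)"
proof (rule bij_betw_byWitness[where f' = "\<lambda>z. proj L (z - a)"])
  show "\<forall>z\<in>torus L. proj L (proj L (z + a) - a) = z" by (simp add: proj_id)
  show "\<forall>z\<in>torus L. proj L (proj L (z - a) + a) = z" by (simp add: proj_id)
qed (use assms in auto)

lemma bij_betw_torus_uminus:
  assumes "L > 0"
  shows "bij_betw (\<lambda>z. proj L (- z)) (torus L) (torus L)"
  by (rule bij_betw_byWitness[where f' = "\<lambda>z. proj L (- z)"]) (use assms in \<open>auto simp: proj_id\<close>)

definition periodic :: "nat \<Rightarrow> (int ^ 'd::finite \<Rightarrow> 'b) \<Rightarrow> bool" where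
  "periodic L F \<longleftrightarrow> (\<forall>x. F (proj L x) = F x)"

lemma periodicD: "periodic L F \<Longrightarrow> F (proj L x) = F x"
  by (simp add: periodic_def)

lemma periodic_cong: "periodic L F \<Longrightarrow> proj L x = proj L y \<Longrightarrow> F x = F y"
  by (metis periodicD)

lemma sum_torus_shift:
  fixes F :: "int ^ 'd::finite \<Rightarrow> real"
  assumes "L > 0" "periodic L F"
  shows "(\<Sum>z\<in>torus L. F (z + a)) = (\<Sum>z\<in>torus L. F z)"
  using sum.reindex_bij_betw[OF bij_betw_torus_add[OF assms(1), of a], of F] periodicD[OF assms(2)]
  by simp

lemma sum_torus_uminus:
  fixes F :: "int ^ 'd::finite \<Rightarrow> real"
  assumes "L > 0" "periodic L F"
  shows "(\<Sum>z\<in>torus L. F (- z)) = (\<Sum>z\<in>torus L. F z)"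
  using sum.reindex_bij_betw[OF bij_betw_torus_uminus[OF assms(1)], of F] periodicD[OF assms(2)]
  by simp

text \<open>Functions on the torus are represented by periodic functions on the lattice, so
  differences of vertices need no reduction; transition and hitting probabilities become functions
  of a displacement.\<close>

locale torus_walk =
  fixes L :: nat and q :: "int ^ 'd::finite \<Rightarrow> real"
  assumes L: "L > 0"
    and q_periodic: "periodic L q"
    and q_nonneg: "\<And>z. q z \<ge> 0"
    and q_sum: "(\<Sum>z\<in>torus L. q z) = 1"
    and q_sym: "\<And>z. q (- z) = q z"
begin

abbreviation "V \<equiv> torus L :: (int ^ 'd) set"

primrec p :: "nat \<Rightarrow> int ^ 'd \<Rightarrow> real" where
  "p 0 x = (if proj L x = 0 then 1 else 0)"
| "p (Suc k) x = (\<Sum>z\<in>V. q z * p k (x - z))"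

primrec hit :: "nat \<Rightarrow> int ^ 'd \<Rightarrow> real" where
  "hit 0 x = (if proj L x = 0 then 1 else 0)"
| "hit (Suc k) x = (if proj L x = 0 then 1 else \<Sum>z\<in>V. q z * hit k (x + z))"

definition green :: "nat \<Rightarrow> int ^ 'd \<Rightarrow> real" where "green n x = (\<Sum>j\<le>n. p j x)"

lemma zero_in_V: "0 \<in> V" using L by (simp add: torus_def)

lemma p_periodic: "periodic L (p k)"
proof (induction k)
  case (Suc k)
  have "p k (proj L x - z) = p k (x - z)" for x z
    by (rule periodic_cong[OF Suc]) simp
  then show ?case by (simp add: periodic_def)
qed (simp add: periodic_def)

lemma p_nonneg: "p k x \<ge> 0"
  by (induction k arbitrary: x) (auto intro!: sum_nonneg mult_nonneg_nonneg q_nonneg)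

lemma periodic_shift: "periodic L F \<Longrightarrow> periodic L (\<lambda>x. F (x + a))" for F :: "int ^ 'd \<Rightarrow> 'b"
  unfolding periodic_def by (metis proj_simps(2))

lemma periodic_uminus: "periodic L F \<Longrightarrow> periodic L (\<lambda>x. F (a - x))" for F :: "int ^ 'd \<Rightarrow> 'b"
  unfolding periodic_def by (metis proj_simps(5))

lemma periodic_mult: "periodic L F \<Longrightarrow> periodic L G \<Longrightarrow> periodic L (\<lambda>x. F x * G x)"
  for F G :: "int ^ 'd \<Rightarrow> real"
  unfolding periodic_def by simp

lemma sum_reflect:
  fixes F :: "int ^ 'd \<Rightarrow> real"
  assumes "periodic L F"
  shows "(\<Sum>z\<in>V. F (a - z)) = (\<Sum>z\<in>V. F z)"
proof -
  have "(\<Sum>z\<in>V. F (a - z)) = (\<Sum>z\<in>V. (\<lambda>z. F (z + a)) (- z))" by simp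
  also have "\<dots> = (\<Sum>z\<in>V. F (z + a))"
    by (rule sum_torus_uminus[OF L periodic_shift[OF assms]])
  also have "\<dots> = (\<Sum>z\<in>V. F z)" by (rule sum_torus_shift[OF L assms])
  finally show ?thesis .
qed

lemma p_sum: "(\<Sum>x\<in>V. p k x) = 1"
proof (induction k)
  case 0
  have "(\<Sum>x\<in>V. p 0 x) = (\<Sum>x\<in>V. if x = 0 then 1 else 0)"
    by (intro sum.cong) (auto simp: proj_id)
  then show ?case using zero_in_V by simp
next
  case (Suc k)
  have one: "(\<Sum>x\<in>V. p k (x - z)) = 1" for z
    using sum_torus_shift[OF L p_periodic, of k "- z"] Suc by simp
  have "(\<Sum>x\<in>V. p (Suc k) x) = (\<Sum>z\<in>V. q z * (\<Sum>x\<in>V. p k (x - z)))"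
    by (simp add: sum_distrib_left) (rule sum.swap)
  then show ?case by (simp only: one q_sum mult_1_right)
qed

lemma p_sym: "p k (- x) = p k x"
proof (induction k arbitrary: x)
  case 0
  have neg: "proj L (- y) = 0" if "proj L y = 0" for y :: "int ^ 'd"
  proof -
    have "proj L (- y) = proj L (- proj L y)" by simp
    with that show ?thesis by (simp del: proj_uminus_proj)
  qed
  have "proj L (- x) = 0 \<longleftrightarrow> proj L x = 0" using neg[of x] neg[of "- x"] by auto
  then show ?case by simp
next
  case (Suc k)
  have "p (Suc k) (- x) = (\<Sum>z\<in>V. (\<lambda>z. q z * p k (x - z)) (- z))"
  proof -
    have "p k (- x - z) = p k (x + z)" for z using Suc[of "x + z"] by simp
    then show ?thesis by (simp add: q_sym)
  qed
  also have "\<dots> = p (Suc k) x"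
    using sum_torus_uminus[OF L periodic_mult[OF q_periodic periodic_uminus[OF p_periodic]], of k x]
    by simp
  finally show ?case .
qed

lemma p_chapman: "p (a + b) x = (\<Sum>z\<in>V. p a z * p b (x - z))"
proof (induction a arbitrary: x)
  case 0
  have "(\<Sum>z\<in>V. p 0 z * p b (x - z)) = (\<Sum>z\<in>V. if z = 0 then p b x else 0)"
    by (intro sum.cong) (auto simp: proj_id)
  then show ?case using zero_in_V by simp
next
  case (Suc a)
  have "p (Suc a + b) x = (\<Sum>y\<in>V. q y * (\<Sum>z\<in>V. p a z * p b (x - y - z)))"
    using Suc by simp
  also have "\<dots> = (\<Sum>y\<in>V. q y * (\<Sum>z\<in>V. p a (z - y) * p b (x - z)))"
  proof (rule sum.cong[OF refl])
    fix y :: "int ^ 'd"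
    have per: "periodic L (\<lambda>z. p a (z - y) * p b (x - z))"
      using periodic_mult[OF periodic_shift[OF p_periodic, of a "- y"] periodic_uminus[OF p_periodic, of b x]]
      by simp
    have "(\<Sum>z\<in>V. p a z * p b (x - y - z)) = (\<Sum>z\<in>V. p a (z - y) * p b (x - z))"
      using sum_torus_shift[OF L per, of y] by (simp add: algebra_simps)
    then show "q y * (\<Sum>z\<in>V. p a z * p b (x - y - z)) = q y * (\<Sum>z\<in>V. p a (z - y) * p b (x - z))"
      by simp
  qed
  also have "\<dots> = (\<Sum>z\<in>V. (\<Sum>y\<in>V. q y * p a (z - y)) * p b (x - z))"
    by (simp add: sum_distrib_left sum_distrib_right mult.assoc) (rule sum.swap)
  finally show ?case by simp
qed

section \<open>Return probabilities at even times\<close>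

definition u :: "nat \<Rightarrow> real" where "u k = p (2 * k) 0"

lemma u_eq: "u k = (\<Sum>z\<in>V. (p k z)\<^sup>2)"
  using p_chapman[of k k 0] unfolding u_def mult_2 by (simp add: p_sym power2_eq_square)

lemma u_0: "u 0 = 1" by (simp add: u_def)

lemma u_pos: "u k > 0"
proof -
  have "\<exists>z\<in>V. p k z \<noteq> 0" using p_sum[of k] by (metis sum.neutral zero_neq_one)
  then obtain z where "z \<in> V" "p k z \<noteq> 0" by blast
  then show ?thesis unfolding u_eq by (intro sum_pos2[of V z]) auto
qed

lemma sum_sq_shift: "(\<Sum>z\<in>V. (p k (x - z))\<^sup>2) = u k"
  unfolding u_eq power2_eq_square by (rule sum_reflect[OF periodic_mult[OF p_periodic p_periodic]])

lemma p_even_le: "p (2 * k) x \<le> u k"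
proof -
  have "p (2 * k) x = (\<Sum>z\<in>V. p k z * p k (x - z))"
    unfolding mult_2 by (rule p_chapman)
  then have "2 * p (2 * k) x = (\<Sum>z\<in>V. 2 * p k z * p k (x - z))"
    by (simp only: sum_distrib_left mult.assoc)
  also have "\<dots> \<le> (\<Sum>z\<in>V. (p k z)\<^sup>2 + (p k (x - z))\<^sup>2)"
    by (intro sum_mono sum_squares_bound)
  also have "\<dots> = 2 * u k" by (simp add: sum.distrib sum_sq_shift u_eq)
  finally show ?thesis by simp
qed

lemma p_odd_le: "p (Suc (2 * k)) x \<le> u k"
proof -
  have "p (Suc (2 * k)) x \<le> (\<Sum>z\<in>V. q z * u k)"
    unfolding p.simps by (intro sum_mono mult_left_mono p_even_le q_nonneg)
  also have "\<dots> = u k" by (simp add: q_sum flip: sum_distrib_right)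
  finally show ?thesis .
qed

lemma u_Suc: "u (Suc k) = (\<Sum>z\<in>V. p 2 z * p (2 * k) z)"
  using p_chapman[of 2 "2 * k" 0] by (simp add: u_def p_sym)

lemma u_decseq: "u (Suc k) \<le> u k"
proof -
  have "u (Suc k) \<le> (\<Sum>z\<in>V. p 2 z * u k)"
    unfolding u_Suc by (intro sum_mono mult_left_mono p_even_le p_nonneg)
  also have "\<dots> = u k" by (simp add: p_sum flip: sum_distrib_right)
  finally show ?thesis .
qed

lemma u_mono: "j \<le> k \<Longrightarrow> u k \<le> u j"
  by (rule lift_Suc_antimono_le[of u]) (rule u_decseq)

lemma u_le_1: "u k \<le> 1" using u_mono[of 0 k] u_0 by simp

text \<open>Symmetry writes \<open>u (Suc k)\<close> as the inner product of \<open>p k\<close> and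
  \<open>p (Suc (Suc k))\<close>, to which the Cauchy-Schwarz inequality applies.\<close>

lemma u_logconvex: "(u (Suc k))\<^sup>2 \<le> u k * u (Suc (Suc k))"
proof -
  have e: "u (Suc k) = (\<Sum>z\<in>V. p k z * p (Suc (Suc k)) z)"
    using p_chapman[of k "Suc (Suc k)" 0] by (simp add: u_def p_sym del: p.simps flip: mult_2)
  show ?thesis unfolding e u_eq[of k] u_eq[of "Suc (Suc k)"] by (rule Cauchy_Schwarz_ineq_sum)
qed

definition s :: "nat \<Rightarrow> real" where "s k = 1 - u (Suc k) / u k"

lemma ratio_mono: "u (Suc k) / u k \<le> u (Suc (Suc k)) / u (Suc k)"
  using u_logconvex[of k] u_pos[of k] u_pos[of "Suc k"]
  by (simp add: divide_simps power2_eq_square mult.commute)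

text \<open>\<open>u k\<close> is the product of the first \<open>k\<close> ratios, and by
  log-convexity none of them exceeds the next one.\<close>

lemma u_le_ratio_power: "u k \<le> (u (Suc k) / u k) ^ k"
proof (induction k)
  case (Suc k)
  have "u (Suc k) = (u (Suc k) / u k) * u k" using u_pos[of k] by simp
  also have "\<dots> \<le> (u (Suc k) / u k) * (u (Suc k) / u k) ^ k"
    using u_pos[of k] u_pos[of "Suc k"] by (intro mult_left_mono Suc) auto
  also have "\<dots> = (u (Suc k) / u k) ^ Suc k" by simp
  also have "\<dots> \<le> (u (Suc (Suc k)) / u (Suc k)) ^ Suc k"
    using u_pos[of k] u_pos[of "Suc k"] by (intro power_mono ratio_mono) auto
  finally show ?case .
qed (simp add: u_0)

text \<open>Since the return probabilities are log-convex, a polynomial lower bound on them already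
  forces their relative decrease to be of order \<open>ln k / k\<close>.\<close>

lemma s_le: "real k * s k \<le> - ln (u k)"
proof -
  let ?r = "u (Suc k) / u k"
  have r: "?r > 0" using u_pos by simp
  have "ln (u k) \<le> ln (?r ^ k)" using u_le_ratio_power[of k] u_pos[of k] r by simp
  also have "\<dots> = real k * ln ?r" using r by (simp add: ln_realpow)
  also have "\<dots> \<le> real k * (?r - 1)" by (intro mult_left_mono ln_le_minus_one r) auto
  finally show ?thesis by (simp add: s_def algebra_simps)
qed

text \<open>Two more steps express \<open>u (Suc k)\<close> through the values of
  \<open>p (2 * k)\<close> with weights \<open>p 2\<close>. As the defects are nonnegative, a small
  \<open>s k\<close> forces \<open>p (2 * k)\<close> to be close to \<open>u k\<close> wherever
  \<open>p 2\<close> is not too small.\<close>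

lemma s_eq: "(\<Sum>z\<in>V. p 2 z * (1 - p (2 * k) z / u k)) = s k"
proof -
  have "(\<Sum>z\<in>V. p 2 z * (1 - p (2 * k) z / u k)) = (\<Sum>z\<in>V. p 2 z) - (\<Sum>z\<in>V. p 2 z * p (2 * k) z) / u k"
    by (simp add: algebra_simps sum_subtractf sum_divide_distrib)
  then show ?thesis unfolding p_sum u_Suc[symmetric] s_def .
qed

lemma defect_nonneg: "0 \<le> 1 - p (2 * k) z / u k"
  using p_even_le[of k z] u_pos[of k] by (simp add: divide_le_eq)

lemma s_nonneg: "0 \<le> s k"
  unfolding s_eq[symmetric] by (intro sum_nonneg mult_nonneg_nonneg p_nonneg defect_nonneg)

lemma sum_defect_le:
  assumes "inj_on (proj L) B"
  shows "(\<Sum>z\<in>B. p 2 z * (1 - p (2 * k) z / u k)) \<le> s k"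
proof -
  have sub: "proj L ` B \<subseteq> V" using L by auto
  have "(\<Sum>z\<in>B. p 2 z * (1 - p (2 * k) z / u k)) = (\<Sum>z\<in>proj L ` B. p 2 z * (1 - p (2 * k) z / u k))"
    using periodicD[OF p_periodic] by (simp add: sum.reindex[OF assms])
  also have "\<dots> \<le> (\<Sum>z\<in>V. p 2 z * (1 - p (2 * k) z / u k))"
    by (rule sum_mono2[OF _ sub]) (auto intro!: mult_nonneg_nonneg p_nonneg defect_nonneg)
  finally show ?thesis by (simp add: s_eq)
qed

text \<open>A norm whose square is \<open>2 * (u k - p (2 * k) z)\<close>. It is subadditive in
  \<open>z\<close>, so control at unit vectors extends linearly to all vectors; this is used for
  \<open>\<alpha> \<ge> 2\<close>.\<close>

definition energy :: "nat \<Rightarrow> int ^ 'd \<Rightarrow> real" where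
  "energy k z = L2_set (\<lambda>y. p k y - p k (y - z)) V"

lemma energy_sq: "(energy k z)\<^sup>2 = 2 * (u k - p (2 * k) z)"
proof -
  have "(energy k z)\<^sup>2 = (\<Sum>y\<in>V. (p k y - p k (y - z))\<^sup>2)"
    by (simp add: energy_def L2_set_def sum_nonneg)
  also have "\<dots> = (\<Sum>y\<in>V. (p k y)\<^sup>2) + (\<Sum>y\<in>V. (p k (z - y))\<^sup>2) - 2 * (\<Sum>y\<in>V. p k y * p k (z - y))"
  proof -
    have "p k (y - z) = p k (z - y)" for y using p_sym[of k "z - y"] by simp
    then show ?thesis by (simp add: power2_diff sum.distrib sum_subtractf sum_distrib_left mult.assoc)
  qed
  also have "\<dots> = u k + u k - 2 * p (2 * k) z"
    using p_chapman[of k k z] unfolding sum_sq_shift u_eq[symmetric] mult_2[of k] by simp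
  finally show ?thesis by simp
qed

lemma energy_add: "energy k (a + b) \<le> energy k a + energy k b"
proof -
  have "energy k (a + b) = L2_set (\<lambda>y. (p k y - p k (y - a)) + (p k (y - a) - p k (y - (a + b)))) V"
    unfolding energy_def by simp
  also have "\<dots> \<le> L2_set (\<lambda>y. p k y - p k (y - a)) V + L2_set (\<lambda>y. p k (y - a) - p k (y - (a + b))) V"
    by (rule L2_set_triangle_ineq)
  also have "L2_set (\<lambda>y. p k (y - a) - p k (y - (a + b))) V = energy k b"
  proof -
    have per: "periodic L (\<lambda>y. (p k y - p k (y - b))\<^sup>2)"
      using p_periodic[of k] periodic_shift[OF p_periodic, of k "- b"] by (simp add: periodic_def)
    have "(\<Sum>y\<in>V. (p k (y - a) - p k (y - (a + b)))\<^sup>2) = (\<Sum>y\<in>V. (p k y - p k (y - b))\<^sup>2)"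
      using sum_torus_shift[OF L per, of "- a"] by (simp add: algebra_simps)
    then show ?thesis by (simp add: energy_def L2_set_def)
  qed
  finally show ?thesis by (simp add: energy_def)
qed

lemma energy_nonneg: "energy k z \<ge> 0" by (simp add: energy_def)

lemma energy_zero: "energy k 0 = 0" by (simp add: energy_def L2_set_def)

lemma energy_uminus: "energy k (- z) = energy k z"
proof -
  have "(energy k (- z))\<^sup>2 = (energy k z)\<^sup>2" by (simp only: energy_sq p_sym)
  then show ?thesis using energy_nonneg by (simp add: power2_eq_iff_nonneg)
qed

lemma energy_axis_le: "energy k (axis i t) \<le> real_of_int \<bar>t\<bar> * energy k (axis i 1)"
proof -
  have nn: "energy k (axis i (int n)) \<le> real n * energy k (axis i 1)" for n
  proof (induction n)
    case 0
    have a: "axis i (0::int) = (0 :: int ^ 'd)" by (simp add: axis_def vec_eq_iff)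
    have "energy k (axis i (int 0)) = 0" unfolding of_nat_0 a by (rule energy_zero)
    then show ?case by simp
  next
    case (Suc n)
    have "axis i (int (Suc n)) = (axis i (int n) + axis i 1 :: int ^ 'd)"
      by (auto simp: axis_def vec_eq_iff)
    then show ?case using energy_add[of k "axis i (int n)" "axis i 1"] Suc by (simp add: algebra_simps)
  qed
  show ?thesis
  proof (cases "t \<ge> 0")
    case True
    then show ?thesis using nn[of "nat t"] by simp
  next
    case False
    have "axis i (- t) = - (axis i t :: int ^ 'd)" by (auto simp: axis_def vec_eq_iff)
    then have "energy k (axis i t) = energy k (axis i (- t))" by (simp add: energy_uminus)
    then show ?thesis using nn[of "nat (- t)"] False by simp
  qed
qed

lemma energy_le:
  assumes "\<And>i. energy k (axis i 1) \<le> e" "\<And>i. \<bar>z $ i\<bar> \<le> int N"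
  shows "energy k z \<le> real CARD('d) * real N * e"
proof -
  have sub: "energy k (\<Sum>i\<in>S. axis i (z $ i)) \<le> (\<Sum>i\<in>S. energy k (axis i (z $ i)))" if "finite S" for S
    using that
  proof (induction S)
    case (insert x F)
    then show ?case using energy_add[of k "axis x (z $ x)" "\<Sum>i\<in>F. axis i (z $ i)"] by simp
  qed (simp add: energy_zero)
  have "z = (\<Sum>i\<in>UNIV. axis i (z $ i))"
  proof -
    have "(\<Sum>i\<in>UNIV. axis i (z $ i)) $ j = z $ j" for j
    proof -
      have "(\<Sum>i\<in>UNIV. axis i (z $ i)) $ j = (\<Sum>i\<in>UNIV. if i = j then z $ j else 0)"
        by (simp add: axis_def)
      then show ?thesis by simp
    qed
    then show ?thesis by (simp add: vec_eq_iff)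
  qed
  then have "energy k z \<le> (\<Sum>i\<in>UNIV. energy k (axis i (z $ i)))" using sub[of UNIV] by simp
  also have "\<dots> \<le> (\<Sum>i\<in>(UNIV::'d set). real N * e)"
  proof (rule sum_mono)
    fix i
    have "energy k (axis i (z $ i)) \<le> real_of_int \<bar>z $ i\<bar> * energy k (axis i 1)" by (rule energy_axis_le)
    also have "\<dots> \<le> real N * e"
      using assms(2)[of i] by (intro mult_mono assms(1) energy_nonneg) auto
    finally show "energy k (axis i (z $ i)) \<le> real N * e" .
  qed
  finally show ?thesis by simp
qed

section \<open>Hitting probabilities and Green functions\<close>

lemma hit_periodic: "periodic L (hit k)"
proof (induction k)
  case (Suc k)
  have "hit k (proj L x + z) = hit k (x + z)" for x z
    by (rule periodic_cong[OF Suc]) simp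
  then show ?case by (simp add: periodic_def)
qed (simp add: periodic_def)

lemma hit_nonneg: "hit k x \<ge> 0"
  by (induction k arbitrary: x) (auto intro!: sum_nonneg mult_nonneg_nonneg q_nonneg)

lemma p_Suc_plus: "p (Suc k) x = (\<Sum>z\<in>V. q z * p k (x + z))"
  using sum_torus_uminus[OF L periodic_mult[OF q_periodic periodic_uminus[OF p_periodic]], of k x]
  by (simp add: q_sym)

lemma green_mono: "green n x \<le> green (Suc n) x"
  by (simp add: green_def p_nonneg del: p.simps)

text \<open>Visits to the origin start at the first hit, after which at most
  \<open>green n 0\<close> of them are expected. Induction over the first step replaces the strong
  Markov property; it needs that \<open>green n 0\<close> increases with \<open>n\<close>.\<close>

lemma green_le_hit: "green n x \<le> green n 0 * hit n x"
proof (induction n arbitrary: x)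
  case (Suc n)
  show ?case
  proof (cases "proj L x = 0")
    case True
    then have "green (Suc n) x = green (Suc n) 0"
      unfolding green_def by (intro sum.cong refl periodic_cong[OF p_periodic]) simp
    then show ?thesis using True by simp
  next
    case False
    have "green (Suc n) x = (\<Sum>j\<le>n. p (Suc j) x)"
      unfolding green_def by (subst sum.atMost_Suc_shift) (simp add: False del: p.simps(2))
    also have "\<dots> = (\<Sum>z\<in>V. q z * green n (x + z))"
      unfolding green_def p_Suc_plus sum_distrib_left by (rule sum.swap)
    also have "\<dots> \<le> (\<Sum>z\<in>V. q z * (green n 0 * hit n (x + z)))"
      by (intro sum_mono mult_left_mono Suc q_nonneg)
    also have "\<dots> = green n 0 * hit (Suc n) x"
      using False by (simp add: sum_distrib_left mult_ac)
    also have "\<dots> \<le> green (Suc n) 0 * hit (Suc n) x"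
      by (intro mult_right_mono green_mono hit_nonneg)
    finally show ?thesis .
  qed
qed (simp add: green_def)

end

section \<open>Distance to the nearest multiple of \<open>L\<close> and truncated second
  moments\<close>

definition dl :: "nat \<Rightarrow> int \<Rightarrow> int" where
  "dl L t = min (t mod int L) (int L - t mod int L)"

lemma dl_nonneg: "L > 0 \<Longrightarrow> 0 \<le> dl L t"
  by (simp add: dl_def less_imp_le)

lemma dl_mod [simp]: "dl L (t mod int L) = dl L t"
  by (simp add: dl_def)

lemma dl_le_abs:
  assumes "L > 0"
  shows "dl L t \<le> \<bar>t\<bar>"
proof (cases "t \<ge> 0")
  case True
  then have "t mod int L \<le> t" by (rule zmod_le_nonneg_dividend)
  then show ?thesis by (simp add: dl_def)
next
  case False
  have "(- t) mod int L \<le> - t" using False by (intro zmod_le_nonneg_dividend) simp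
  then show ?thesis using False assms by (auto simp: dl_def zmod_zminus1_eq_if split: if_splits)
qed

lemma dl_le: "L > 0 \<Longrightarrow> t' mod int L = t mod int L \<Longrightarrow> dl L t \<le> \<bar>t'\<bar>"
  using dl_le_abs[of L t'] by (metis dl_mod)

lemma dl_attained:
  assumes "L > 0"
  obtains t' where "t' mod int L = t mod int L" "\<bar>t'\<bar> = dl L t"
proof (cases "t mod int L \<le> int L - t mod int L")
  case True
  show ?thesis by (rule that[of "t mod int L"]) (use True assms in \<open>auto simp: dl_def\<close>)
next
  case False
  have "t mod int L < int L" using assms by simp
  then show ?thesis using False
    by (intro that[of "t mod int L - int L"]) (auto simp: dl_def mod_diff_right_eq)
qed

definition psi :: "nat \<Rightarrow> nat \<Rightarrow> int \<Rightarrow> real" where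
  "psi L R t = min 1 ((real_of_int (dl L t) / real R)\<^sup>2)"

lemma psi_mod [simp]: "psi L R (t mod int L) = psi L R t"
  by (simp add: psi_def)

lemma psi_nonneg: "psi L R t \<ge> 0" and psi_le_1: "psi L R t \<le> 1"
  by (simp_all add: psi_def)

text \<open>The parallelogram law survives the truncation and the passage to the quotient; it replaces
  the additivity of variances.\<close>

lemma psi_parallelogram:
  assumes L: "L > 0" and R: "R > 0"
  shows "psi L R (x + z) + psi L R (x - z) \<le> 2 * psi L R x + 2 * psi L R z"
proof (cases "psi L R x = 1 \<or> psi L R z = 1")
  case True
  then show ?thesis
    using psi_le_1[of L R "x + z"] psi_le_1[of L R "x - z"] psi_nonneg[of L R x] psi_nonneg[of L R z] by auto
next
  case False
  obtain x' where x': "x' mod int L = x mod int L" "\<bar>x'\<bar> = dl L x" using dl_attained[OF L] by blast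
  obtain z' where z': "z' mod int L = z mod int L" "\<bar>z'\<bar> = dl L z" using dl_attained[OF L] by blast
  have sq: "psi L R t = (real_of_int t' / real R)\<^sup>2" if "\<bar>t'\<bar> = dl L t" "psi L R t \<noteq> 1" for t t'
  proof -
    have "(real_of_int t' / real R)\<^sup>2 = (real_of_int \<bar>t'\<bar> / real R)\<^sup>2" by (simp add: power_divide)
    then show ?thesis using that by (auto simp: psi_def min_def split: if_splits)
  qed
  have le: "psi L R t \<le> (real_of_int t' / real R)\<^sup>2" if "t' mod int L = t mod int L" for t t'
  proof -
    have "(real_of_int (dl L t) / real R)\<^sup>2 \<le> (real_of_int \<bar>t'\<bar> / real R)\<^sup>2"
      using dl_le[OF L that] dl_nonneg[OF L, of t] by (intro power_mono divide_right_mono) auto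
    then show ?thesis by (simp add: psi_def power_divide)
  qed
  have "psi L R (x + z) + psi L R (x - z) \<le> (real_of_int (x' + z') / real R)\<^sup>2 + (real_of_int (x' - z') / real R)\<^sup>2"
    by (intro add_mono le) (use x' z' in \<open>auto intro: mod_add_cong mod_diff_cong\<close>)
  also have "\<dots> = 2 * (real_of_int x' / real R)\<^sup>2 + 2 * (real_of_int z' / real R)\<^sup>2"
    by (simp add: add_divide_distrib diff_divide_distrib power2_sum power2_diff)
  also have "\<dots> = 2 * psi L R x + 2 * psi L R z"
    using sq[OF x'(2)] sq[OF z'(2)] False by simp
  finally show ?thesis .
qed

definition Phi :: "nat \<Rightarrow> nat \<Rightarrow> int ^ 'd::finite \<Rightarrow> real" where
  "Phi L R x = (\<Sum>i\<in>UNIV. psi L R (x $ i))"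

lemma Phi_nonneg: "Phi L R x \<ge> 0"
  unfolding Phi_def by (intro sum_nonneg psi_nonneg)

lemma Phi_periodic: "periodic L (Phi L R)"
  by (simp add: periodic_def Phi_def proj_def)

lemma Phi_lt_1_card:
  assumes L: "L > 0" and R: "R > 0"
  shows "card {x \<in> torus L. Phi L R (x :: int ^ 'd::finite) < 1} \<le> (2 * R) ^ CARD('d)"
proof -
  let ?A = "{0..<int R} \<union> {int L - int R<..<int L}"
  have "{x \<in> torus L. Phi L R (x :: int ^ 'd) < 1} \<subseteq> {x. \<forall>i. x $ i \<in> ?A}"
  proof safe
    fix x :: "int ^ 'd" and i assume x: "x \<in> torus L" "Phi L R x < 1" and ni: "\<not> x $ i \<in> {int L - int R<..<int L}"
    have xi: "0 \<le> x $ i" "x $ i < int L" using x by (auto simp: torus_def)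
    have "psi L R (x $ i) \<le> Phi L R x" unfolding Phi_def by (rule member_le_sum) (auto simp: psi_nonneg)
    then have "(real_of_int (dl L (x $ i)) / real R)\<^sup>2 < 1" using x(2) by (auto simp: psi_def)
    then have "real_of_int (dl L (x $ i)) / real R < 1" by (rule power2_less_imp_less[of _ 1, simplified])
    then have "dl L (x $ i) < int R" using R by (simp add: divide_less_eq)
    then show "x $ i \<in> {0..<int R}" using xi ni by (auto simp: dl_def)
  qed
  then have "card {x \<in> torus L. Phi L R (x :: int ^ 'd) < 1} \<le> card {x::int ^ 'd. \<forall>i. x $ i \<in> ?A}"
    by (rule card_mono[OF finite_vec_box[of "\<lambda>_. ?A"], rotated]) simp
  also have "\<dots> = card ?A ^ CARD('d)" by (subst card_vec_box) simp
  also have "\<dots> \<le> (2 * R) ^ CARD('d)"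
  proof (rule power_mono)
    have "card ?A \<le> card {0..<int R} + card {int L - int R<..<int L}" by (rule card_Un_le)
    then show "card ?A \<le> 2 * R" by simp
  qed simp
  finally show ?thesis .
qed

context torus_walk
begin

text \<open>The kernel is symmetric, so a step can be averaged over \<open>z\<close> and
  \<open>- z\<close>; by the parallelogram inequality each step then adds at most one mean of
  \<open>Phi\<close>.\<close>

lemma moment:
  assumes R: "R > 0"
  shows "(\<Sum>x\<in>V. p k x * Phi L R x) \<le> real k * (\<Sum>z\<in>V. q z * Phi L R z)"
proof (induction k)
  case 0
  have "(\<Sum>x\<in>V. p 0 x * Phi L R x) = 0"
    by (intro sum.neutral) (auto simp: proj_id Phi_def psi_def dl_def)
  then show ?case by simp
next
  case (Suc k)
  let ?F = "Phi L R :: int ^ 'd \<Rightarrow> real" and ?m = "\<Sum>z\<in>V. q z * Phi L R z"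
  have shift: "(\<Sum>x\<in>V. p k (x - z) * ?F x) = (\<Sum>y\<in>V. p k y * ?F (y + z))" for z
  proof -
    have "periodic L (\<lambda>y. p k y * ?F (y + z))"
      by (intro periodic_mult p_periodic periodic_shift Phi_periodic)
    from sum_torus_shift[OF L this, of "- z"] show ?thesis by simp
  qed
  have e1: "(\<Sum>x\<in>V. p (Suc k) x * ?F x) = (\<Sum>z\<in>V. q z * (\<Sum>y\<in>V. p k y * ?F (y + z)))"
    unfolding shift[symmetric] by (simp add: sum_distrib_left sum_distrib_right mult.assoc) (rule sum.swap)
  have per: "periodic L (\<lambda>z. q z * (\<Sum>y\<in>V. p k y * ?F (y - z)))"
  proof -
    have "?F (y - proj L z) = ?F (y - z)" for y z by (rule periodic_cong[OF Phi_periodic]) simp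
    then show ?thesis using q_periodic by (simp add: periodic_def)
  qed
  have e2: "(\<Sum>z\<in>V. q z * (\<Sum>y\<in>V. p k y * ?F (y + z))) = (\<Sum>z\<in>V. q z * (\<Sum>y\<in>V. p k y * ?F (y - z)))"
    using sum_torus_uminus[OF L per] by (simp add: q_sym)
  have "2 * (\<Sum>x\<in>V. p (Suc k) x * ?F x) =
      (\<Sum>z\<in>V. q z * (\<Sum>y\<in>V. p k y * ?F (y + z))) + (\<Sum>z\<in>V. q z * (\<Sum>y\<in>V. p k y * ?F (y - z)))"
    using e1 e2 by simp
  also have "\<dots> = (\<Sum>z\<in>V. q z * (\<Sum>y\<in>V. p k y * (?F (y + z) + ?F (y - z))))"
    by (simp add: sum.distrib distrib_left)
  also have "\<dots> \<le> (\<Sum>z\<in>V. q z * (\<Sum>y\<in>V. p k y * (2 * ?F y + 2 * ?F z)))"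
  proof (intro sum_mono mult_left_mono q_nonneg p_nonneg)
    fix y z :: "int ^ 'd"
    have "?F (y + z) + ?F (y - z) = (\<Sum>i\<in>UNIV. psi L R (y $ i + z $ i) + psi L R (y $ i - z $ i))"
      by (simp add: Phi_def sum.distrib)
    also have "\<dots> \<le> (\<Sum>i\<in>UNIV. 2 * psi L R (y $ i) + 2 * psi L R (z $ i))"
      by (intro sum_mono psi_parallelogram L R)
    also have "\<dots> = 2 * ?F y + 2 * ?F z" by (simp add: Phi_def sum.distrib sum_distrib_left)
    finally show "?F (y + z) + ?F (y - z) \<le> 2 * ?F y + 2 * ?F z" .
  qed
  also have "\<dots> = (\<Sum>z\<in>V. q z * (2 * (\<Sum>y\<in>V. p k y * ?F y) + 2 * ?F z))"
  proof (rule sum.cong[OF refl])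
    fix z
    have "(\<Sum>y\<in>V. p k y * (2 * ?F y + 2 * ?F z)) = 2 * (\<Sum>y\<in>V. p k y * ?F y) + (\<Sum>y\<in>V. p k y) * (2 * ?F z)"
      by (simp add: distrib_left sum.distrib sum_distrib_left sum_distrib_right mult_ac)
    then show "q z * (\<Sum>y\<in>V. p k y * (2 * ?F y + 2 * ?F z)) = q z * (2 * (\<Sum>y\<in>V. p k y * ?F y) + 2 * ?F z)"
      by (simp add: p_sum)
  qed
  also have "\<dots> = (\<Sum>z\<in>V. q z) * (2 * (\<Sum>y\<in>V. p k y * ?F y)) + 2 * ?m"
  proof -
    have "(\<Sum>z\<in>V. q z * (2 * S + 2 * ?F z)) = (\<Sum>z\<in>V. q z) * (2 * S) + 2 * ?m" for S
      by (simp add: distrib_left sum.distrib sum_distrib_left sum_distrib_right mult_ac)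
    then show ?thesis .
  qed
  also have "\<dots> = 2 * (\<Sum>y\<in>V. p k y * ?F y) + 2 * ?m" by (simp add: q_sum)
  finally show ?case using Suc by (simp add: algebra_simps del: p.simps)
qed

text \<open>At least half of the mass at time \<open>k\<close> lies where \<open>Phi\<close> is
  below 1, a set of at most \<open>(2 * R) ^ d\<close> vertices; as \<open>u k\<close> is the sum of
  the squares of \<open>p k\<close>, Cauchy-Schwarz gives the bound.\<close>

lemma u_lower:
  assumes R: "R > 0" and m: "real k * (\<Sum>z\<in>V. q z * Phi L R z) \<le> 1 / 2"
  shows "u k \<ge> 1 / (4 * (2 * real R) ^ CARD('d))"
proof -
  let ?W = "{x \<in> V. Phi L R x < 1}"
  have "1 - (\<Sum>x\<in>?W. p k x) = (\<Sum>x\<in>V - ?W. p k x)"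
    using sum_diff[of V ?W "p k"] p_sum[of k] by simp
  also have "\<dots> \<le> (\<Sum>x\<in>V - ?W. p k x * Phi L R x)"
  proof (rule sum_mono)
    fix x assume "x \<in> V - ?W"
    then have "p k x * 1 \<le> p k x * Phi L R x" by (intro mult_left_mono p_nonneg) auto
    then show "p k x \<le> p k x * Phi L R x" by simp
  qed
  also have "\<dots> \<le> (\<Sum>x\<in>V. p k x * Phi L R x)"
    by (intro sum_mono2) (auto intro!: mult_nonneg_nonneg p_nonneg Phi_nonneg)
  also have "\<dots> \<le> 1 / 2" using moment[OF R, of k] m by linarith
  finally have h: "1 / 2 \<le> (\<Sum>x\<in>?W. p k x * 1)" by simp
  have "(1 / 2)\<^sup>2 \<le> (\<Sum>x\<in>?W. p k x * 1)\<^sup>2" by (rule power_mono[OF h]) simp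
  also have "\<dots> \<le> (\<Sum>x\<in>?W. (p k x)\<^sup>2) * (\<Sum>x\<in>?W. 1\<^sup>2)" by (rule Cauchy_Schwarz_ineq_sum)
  also have "\<dots> \<le> u k * (2 * real R) ^ CARD('d)"
  proof (rule mult_mono)
    show "(\<Sum>x\<in>?W. (p k x)\<^sup>2) \<le> u k" unfolding u_eq by (rule sum_mono2) auto
    have "real (card ?W) \<le> real ((2 * R) ^ CARD('d))"
      by (rule of_nat_mono) (rule Phi_lt_1_card[OF L R])
    then show "(\<Sum>x\<in>?W. 1\<^sup>2) \<le> (2 * real R) ^ CARD('d)" by simp
  qed (use u_pos[of k] in auto)
  finally show ?thesis using R by (simp add: power2_eq_square divide_simps mult_ac)
qed

section \<open>Flatness of the even-time kernel on cubes\<close>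

definition cube :: "nat \<Rightarrow> (int ^ 'd) set" where "cube N = {z. \<forall>i. \<bar>z $ i\<bar> \<le> int N}"

lemma cube_eq: "cube N = {z. \<forall>i. z $ i \<in> {- int N..int N}}"
  by (auto simp: cube_def abs_le_iff minus_le_iff)

lemma finite_cube: "finite (cube N)"
  unfolding cube_eq by (rule finite_vec_box) simp

lemma card_cube: "card (cube N) = (2 * N + 1) ^ CARD('d)"
proof -
  have "card {- int N..int N} = 2 * N + 1" by simp
  then show ?thesis unfolding cube_eq by (subst card_vec_box) simp
qed

lemma inj_on_cube:
  assumes "2 * N < L"
  shows "inj_on (proj L) (cube N)"
proof (rule inj_onI)
  fix x y assume x: "x \<in> cube N" and y: "y \<in> cube N" and e: "proj L x = proj L y"
  have "x $ i = y $ i" for i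
  proof -
    have "x $ i mod int L = y $ i mod int L" using e by (simp add: proj_def vec_eq_iff)
    then have "int L dvd x $ i - y $ i" by (simp add: mod_eq_dvd_iff)
    moreover have "\<bar>x $ i - y $ i\<bar> < int L"
    proof -
      have "\<bar>x $ i\<bar> \<le> int N" "\<bar>y $ i\<bar> \<le> int N" using x y by (auto simp: cube_def)
      then show ?thesis using assms by linarith
    qed
    ultimately show ?thesis using dvd_imp_le_int[of "x $ i - y $ i" "int L"] by linarith
  qed
  then show "x = y" by (simp add: vec_eq_iff)
qed

definition bad :: "nat \<Rightarrow> nat \<Rightarrow> (int ^ 'd) set" where
  "bad N k = {z \<in> cube N. p (2 * k) z < u k / 2}"

text \<open>The bound concerns two steps because the defects in \<open>s_eq\<close> are weighted by
  \<open>p 2\<close>.\<close>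

definition p2_lower :: "real \<Rightarrow> real \<Rightarrow> bool" where
  "p2_lower e c \<longleftrightarrow> c > 0 \<and> (\<forall>N z. N \<ge> 1 \<longrightarrow> z \<in> cube N \<longrightarrow> z \<noteq> 0 \<longrightarrow> c * real N powr - e \<le> p 2 z)"

text \<open>For \<open>\<alpha> < 2\<close> long jumps suffice: every bad point has defect at least
  1/2 and a weight of order \<open>N powr - (d + \<alpha>)\<close> in \<open>s k\<close>. For
  \<open>\<alpha> \<ge> 2\<close> unit steps are used: their small energies add up along a path to
  \<open>z\<close>, and no bad point remains. The minimum of two constants serves both
  cases.\<close>

lemma card_bad:
  assumes c: "p2_lower (real CARD('d) + \<alpha>) c" and a: "a = min \<alpha> 2" and N: "N \<ge> 1" "2 * N < L"
    and s: "s k \<le> min (c / (4 * 4 ^ CARD('d))) (c / (4 * (real CARD('d))\<^sup>2)) * real N powr - a"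
  shows "real (card (bad N k)) \<le> real N ^ CARD('d) / (2 * 4 ^ CARD('d))"
proof (cases "\<alpha> < 2")
  case True
  let ?D = "real CARD('d)"
  have c0: "c > 0" using c by (simp add: p2_lower_def)
  have B: "bad N k \<subseteq> cube N" by (auto simp: bad_def)
  have "real (card (bad N k)) * (c * real N powr - (?D + \<alpha>) * (1 / 2)) =
      (\<Sum>z\<in>bad N k. c * real N powr - (?D + \<alpha>) * (1 / 2))" by simp
  also have "\<dots> \<le> (\<Sum>z\<in>bad N k. p 2 z * (1 - p (2 * k) z / u k))"
  proof (intro sum_mono mult_mono)
    fix z assume z: "z \<in> bad N k"
    have "z \<noteq> 0" using z u_pos[of k] by (auto simp: bad_def u_def)
    then show "c * real N powr - (?D + \<alpha>) \<le> p 2 z"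
      using c N(1) z by (auto simp: p2_lower_def bad_def)
    show "1 / 2 \<le> 1 - p (2 * k) z / u k" using z u_pos[of k] by (simp add: bad_def field_simps)
  qed (use p_nonneg in auto)
  also have "\<dots> \<le> s k" by (rule sum_defect_le) (rule inj_on_subset[OF inj_on_cube[OF N(2)] B])
  also have "\<dots> \<le> min (c / (4 * 4 ^ CARD('d))) (c / (4 * (real CARD('d))\<^sup>2)) * real N powr - \<alpha>"
    using s True by (simp add: a)
  also have "\<dots> \<le> c / (4 * 4 ^ CARD('d)) * real N powr - \<alpha>"
    by (intro mult_right_mono min.cobounded1) simp
  also have "\<dots> = (real N ^ CARD('d) / (2 * 4 ^ CARD('d))) * (c * real N powr - (?D + \<alpha>) * (1 / 2))"
  proof -
    have "real N powr - \<alpha> = real N ^ CARD('d) * real N powr - (?D + \<alpha>)"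
      using N(1) by (simp add: powr_add[symmetric] flip: powr_realpow)
    then show ?thesis by simp
  qed
  finally show ?thesis using c0 N(1) by (subst (asm) mult_le_cancel_right_pos) auto
next
  case False
  have c0: "c > 0" using c by (simp add: p2_lower_def)
  \<comment> \<open>The defect of a unit vector is at most \<open>s k / c\<close>, so its energy is
    at most of order \<open>sqrt (u k * s k)\<close>.\<close>
  have e1: "energy k (axis i 1) \<le> sqrt (2 * u k * (s k / c))" for i
  proof (rule real_le_rsqrt)
    have z: "axis i 1 \<in> cube 1" "axis i 1 \<noteq> (0 :: int ^ 'd)" by (auto simp: cube_def axis_def vec_eq_iff)
    then have "c \<le> p 2 (axis i 1)" using c by (force simp: p2_lower_def)
    then have "c * (1 - p (2 * k) (axis i 1) / u k) \<le> p 2 (axis i 1) * (1 - p (2 * k) (axis i 1) / u k)"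
      by (intro mult_right_mono defect_nonneg)
    also have "\<dots> \<le> s k" using sum_defect_le[of "{axis i 1}" k] by simp
    finally have "1 - p (2 * k) (axis i 1) / u k \<le> s k / c" using c0 by (simp add: field_simps)
    then have "u k * (1 - p (2 * k) (axis i 1) / u k) \<le> u k * (s k / c)"
      using u_pos[of k] by (intro mult_left_mono) auto
    then show "(energy k (axis i 1))\<^sup>2 \<le> 2 * u k * (s k / c)"
      using u_pos[of k] by (simp add: energy_sq algebra_simps)
  qed
  have "bad N k = {}"
  proof (rule ccontr)
    assume "bad N k \<noteq> {}"
    then obtain z where z: "z \<in> cube N" "p (2 * k) z < u k / 2" by (auto simp: bad_def)
    have "energy k z \<le> real CARD('d) * real N * sqrt (2 * u k * (s k / c))"
      by (rule energy_le[OF e1]) (use z in \<open>auto simp: cube_def\<close>)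
    then have "(energy k z)\<^sup>2 \<le> (real CARD('d) * real N * sqrt (2 * u k * (s k / c)))\<^sup>2"
      by (rule power_mono) (rule energy_nonneg)
    also have "\<dots> = (real CARD('d) * real N)\<^sup>2 * (2 * u k * (s k / c))"
      using u_pos[of k] s_nonneg[of k] c0 by (simp add: power_mult_distrib)
    also have "\<dots> \<le> (real CARD('d) * real N)\<^sup>2 * (2 * u k * (1 / (4 * (real CARD('d))\<^sup>2 * (real N)\<^sup>2)))"
    proof (intro mult_left_mono)
      have "s k \<le> min (c / (4 * 4 ^ CARD('d))) (c / (4 * (real CARD('d))\<^sup>2)) * real N powr - 2"
        using s False by (simp add: a)
      also have "\<dots> \<le> c / (4 * (real CARD('d))\<^sup>2) * real N powr - 2"
        by (intro mult_right_mono min.cobounded2) simp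
      finally have "s k \<le> c / (4 * (real CARD('d))\<^sup>2) * real N powr - 2" .
      then show "s k / c \<le> 1 / (4 * (real CARD('d))\<^sup>2 * (real N)\<^sup>2)"
        using c0 N(1) by (simp add: powr_minus field_simps)
    qed (use u_pos[of k] in auto)
    also have "\<dots> = u k / 2" using N(1) by (simp add: power_mult_distrib)
    finally have "2 * (u k - p (2 * k) z) \<le> u k / 2" by (simp only: energy_sq)
    moreover define x where "x = p (2 * k) z"
    ultimately have "4 * u k - 4 * x \<le> u k" "2 * x < u k" using z(2) by auto
    then show False using u_pos[of k] by linarith
  qed
  then show ?thesis by simp
qed

text \<open>At least \<open>N ^ d / 2\<close> points of the cube are not bad and carry mass at least
  \<open>u k / 2\<close> each, while the total mass is 1.\<close>

lemma u_upper:
  assumes N: "N \<ge> 1" "2 * N < L" and b: "real (card (bad N k)) \<le> real N ^ CARD('d) / (2 * 4 ^ CARD('d))"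
  shows "u k \<le> 4 / real N ^ CARD('d)"
proof -
  have B: "bad N k \<subseteq> cube N" by (auto simp: bad_def)
  have "real N ^ CARD('d) \<le> real (card (cube N))"
  proof -
    have "N ^ CARD('d) \<le> (2 * N + 1) ^ CARD('d)" by (rule power_mono) auto
    then show ?thesis unfolding card_cube by (metis of_nat_le_iff of_nat_power)
  qed
  moreover have "real N ^ CARD('d) / (2 * 4 ^ CARD('d)) \<le> real N ^ CARD('d) / (2 * 1)"
    by (intro divide_left_mono mult_left_mono) auto
  moreover have "real (card (cube N - bad N k)) = real (card (cube N)) - real (card (bad N k))"
    using card_Diff_subset[OF finite_subset[OF B finite_cube] B] card_mono[OF finite_cube B]
    by (simp add: of_nat_diff)
  ultimately have "real N ^ CARD('d) / 2 \<le> real (card (cube N - bad N k))" using b by linarith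
  then have "real N ^ CARD('d) / 2 * (u k / 2) \<le> real (card (cube N - bad N k)) * (u k / 2)"
    by (rule mult_right_mono) (use u_pos[of k] in simp)
  also have "\<dots> = (\<Sum>z\<in>cube N - bad N k. u k / 2)" by simp
  also have "\<dots> \<le> (\<Sum>z\<in>cube N - bad N k. p (2 * k) z)"
    by (rule sum_mono) (auto simp: bad_def)
  also have "\<dots> \<le> (\<Sum>z\<in>cube N. p (2 * k) z)"
    by (rule sum_mono2[OF finite_cube]) (auto simp: p_nonneg)
  also have "\<dots> = (\<Sum>z\<in>proj L ` cube N. p (2 * k) z)"
    using periodicD[OF p_periodic] by (simp add: sum.reindex[OF inj_on_cube[OF N(2)]])
  also have "\<dots> \<le> (\<Sum>z\<in>V. p (2 * k) z)"
    by (rule sum_mono2) (use L p_nonneg in auto)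
  also have "\<dots> = 1" by (rule p_sum)
  finally show ?thesis using N(1) by (simp add: field_simps)
qed

text \<open>The number of bad points allowed in the cube of radius \<open>4 * r\<close> is
  \<open>r ^ d / 2\<close>, half of any set of \<open>r ^ d\<close> points; this is the origin of
  the constant \<open>2 * 4 ^ d\<close>.\<close>

lemma cube_sum_p:
  assumes r: "r \<ge> 1" and b: "real (card (bad (4 * r) k)) \<le> real (4 * r) ^ CARD('d) / (2 * 4 ^ CARD('d))"
    and W: "W \<subseteq> cube (4 * r)" "card W = r ^ CARD('d)"
  shows "(\<Sum>z\<in>W. p (2 * k) z) \<ge> real r ^ CARD('d) * u k / 4"
proof -
  have fW: "finite W" by (rule finite_subset[OF W(1) finite_cube])
  have fB: "finite (bad (4 * r) k)" by (rule finite_subset[OF _ finite_cube]) (auto simp: bad_def)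
  have "real (card W) \<le> real (card (W - bad (4 * r) k)) + real (card (bad (4 * r) k))"
  proof -
    have "card W \<le> card ((W - bad (4 * r) k) \<union> bad (4 * r) k)" by (rule card_mono) (use fW fB in auto)
    also have "\<dots> \<le> card (W - bad (4 * r) k) + card (bad (4 * r) k)" by (rule card_Un_le)
    finally show ?thesis by simp
  qed
  moreover have "real (4 * r) ^ CARD('d) / (2 * 4 ^ CARD('d)) = real r ^ CARD('d) / 2"
    by (simp add: power_mult_distrib)
  ultimately have "real r ^ CARD('d) / 2 \<le> real (card (W - bad (4 * r) k))" using b W(2) by simp
  then have "real r ^ CARD('d) / 2 * (u k / 2) \<le> real (card (W - bad (4 * r) k)) * (u k / 2)"
    by (rule mult_right_mono) (use u_pos[of k] in simp)
  also have "\<dots> = (\<Sum>z\<in>W - bad (4 * r) k. u k / 2)" by simp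
  also have "\<dots> \<le> (\<Sum>z\<in>W - bad (4 * r) k. p (2 * k) z)"
    by (rule sum_mono) (use W(1) in \<open>auto simp: bad_def\<close>)
  also have "\<dots> \<le> (\<Sum>z\<in>W. p (2 * k) z)" by (rule sum_mono2[OF fW]) (auto simp: p_nonneg)
  finally show ?thesis by simp
qed

lemma sum_green_split: "(\<Sum>j\<le>Suc (2 * n). f j) = (\<Sum>k\<le>n. f (2 * k) + f (Suc (2 * k)))" for f :: "nat \<Rightarrow> real"
  by (induction n) simp_all

lemma green_upper: "green (Suc (2 * n)) 0 \<le> 2 * (\<Sum>k\<le>n. u k)"
  unfolding green_def sum_green_split sum_distrib_left
proof (rule sum_mono)
  fix k
  show "p (2 * k) 0 + p (Suc (2 * k)) 0 \<le> 2 * u k"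
    using p_even_le[of k 0] p_odd_le[of k 0] by linarith
qed

text \<open>Times below \<open>m\<close> are bounded by 1 and the others by monotonicity;
  \<open>m\<close> is later chosen of the order of the square root of the time.\<close>

lemma sum_u_le: "(\<Sum>k\<le>n. u k) \<le> real m + (real n + 1) * u m"
proof -
  have "(\<Sum>k\<le>n. u k) \<le> (\<Sum>k\<le>n. (if k < m then 1 else 0) + u m)"
    using u_le_1 u_mono u_pos by (intro sum_mono) (auto simp: add_increasing2 less_imp_le not_less)
  also have "\<dots> = real (card {k. k \<le> n \<and> k < m}) + (real n + 1) * u m"
    by (simp add: sum.distrib sum.If_cases Int_def)
  also have "real (card {k. k \<le> n \<and> k < m}) \<le> real m"
    using card_mono[of "{..<m}" "{k. k \<le> n \<and> k < m}"] by auto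
  finally show ?thesis by simp
qed

text \<open>The even times \<open>2 * k\<close> with \<open>K \<le> k < 2 * K\<close>, at which
  flatness holds, bound the Green function summed over \<open>W\<close> from below. Division by the
  Green function at the origin, controlled by \<open>sum_u_le\<close>, leaves hitting
  probabilities.\<close>

lemma hit_sum_lower:
  assumes r: "r \<ge> 1" and W: "W \<subseteq> cube (4 * r)" "card W = r ^ CARD('d)" and K: "K \<ge> 1"
    and b: "\<And>k. K \<le> k \<Longrightarrow> k < 2 * K \<Longrightarrow>
      real (card (bad (4 * r) k)) \<le> real (4 * r) ^ CARD('d) / (2 * 4 ^ CARD('d))"
  shows "real K * real r ^ CARD('d) * u (2 * K) / 4
    \<le> 2 * (real m + 3 * real K * u m) * (\<Sum>z\<in>W. hit (Suc (4 * K)) z)"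
proof -
  have fW: "finite W" by (rule finite_subset[OF W(1) finite_cube])
  let ?n = "Suc (4 * K)"
  have n: "?n = Suc (2 * (2 * K))" by simp
  have "real K * real r ^ CARD('d) * u (2 * K) / 4 = (\<Sum>k\<in>{K..<2*K}. real r ^ CARD('d) * u (2 * K) / 4)"
    by simp
  also have "\<dots> \<le> (\<Sum>k\<in>{K..<2*K}. \<Sum>z\<in>W. p (2 * k) z)"
  proof (rule sum_mono)
    fix k assume k: "k \<in> {K..<2*K}"
    have "real r ^ CARD('d) * u (2 * K) \<le> real r ^ CARD('d) * u k" using k by (intro mult_left_mono u_mono) auto
    then show "real r ^ CARD('d) * u (2 * K) / 4 \<le> (\<Sum>z\<in>W. p (2 * k) z)"
      using cube_sum_p[OF r b W, of k] k by auto
  qed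
  also have "\<dots> = (\<Sum>z\<in>W. \<Sum>k\<in>{K..<2*K}. p (2 * k) z)" by (rule sum.swap)
  also have "\<dots> \<le> (\<Sum>z\<in>W. green ?n z)"
  proof (rule sum_mono)
    fix z assume "z \<in> W"
    have "(\<Sum>k\<in>{K..<2*K}. p (2 * k) z) \<le> (\<Sum>k\<le>2*K. p (2 * k) z)"
      by (rule sum_mono2) (auto simp: p_nonneg)
    also have "\<dots> \<le> (\<Sum>k\<le>2*K. p (2 * k) z + p (Suc (2 * k)) z)"
      by (rule sum_mono) (use p_nonneg in \<open>simp del: p.simps\<close>)
    also have "\<dots> = green ?n z" unfolding green_def n sum_green_split ..
    finally show "(\<Sum>k\<in>{K..<2*K}. p (2 * k) z) \<le> green ?n z" .
  qed
  also have "\<dots> \<le> (\<Sum>z\<in>W. green ?n 0 * hit ?n z)" by (intro sum_mono green_le_hit)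
  also have "\<dots> = green ?n 0 * (\<Sum>z\<in>W. hit ?n z)" by (simp only: sum_distrib_left)
  also have "\<dots> \<le> 2 * (real m + 3 * real K * u m) * (\<Sum>z\<in>W. hit ?n z)"
  proof (rule mult_right_mono)
    have "green ?n 0 \<le> 2 * (\<Sum>k\<le>2*K. u k)" unfolding n by (rule green_upper)
    also have "\<dots> \<le> 2 * (real m + (real (2 * K) + 1) * u m)" using sum_u_le[of "2 * K" m] by simp
    also have "\<dots> \<le> 2 * (real m + 3 * real K * u m)"
      using K u_pos[of m] by (intro mult_left_mono add_left_mono mult_right_mono) auto
    finally show "green ?n 0 \<le> 2 * (real m + 3 * real K * u m)" .
  qed (intro sum_nonneg hit_nonneg)
  finally show ?thesis .
qed

end

section \<open>Heavy-tailed kernels\<close>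

lemma abs_nth_le_linf: "\<bar>x $ i\<bar> \<le> linf x"
  unfolding linf_def by (rule Max_ge) auto

lemma linf_le_iff: "linf x \<le> N \<longleftrightarrow> (\<forall>i. \<bar>x $ i\<bar> \<le> N)"
  unfolding linf_def by (subst Max_le_iff) auto

lemma linf_nonneg: "linf x \<ge> 0"
  using abs_nth_le_linf[of x undefined] by (meson abs_ge_zero order_trans)

lemma linf_eq_0_iff: "linf x = 0 \<longleftrightarrow> x = 0"
proof
  assume *: "linf x = 0"
  have "\<bar>x $ i\<bar> \<le> 0" for i using abs_nth_le_linf[of x i] * by simp
  then show "x = 0" by (auto simp: vec_eq_iff)
next
  assume "x = 0"
  then have "linf x \<le> 0" by (simp add: linf_le_iff)
  with linf_nonneg[of x] show "linf x = 0" by simp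
qed

lemma linf_pos: "x \<noteq> 0 \<Longrightarrow> linf x \<ge> 1"
  using linf_nonneg[of x] linf_eq_0_iff[of x] by linarith

lemma linf_uminus: "linf (- x) = linf x"
  by (simp add: linf_def)

section \<open>Summability of powers of the norm\<close>

lemma summable_int_powr:
  fixes s :: real
  assumes "s > 1"
  obtains B where "B \<ge> 0" "\<And>N::nat. (\<Sum>t\<in>{- int N..int N}. (1 + real_of_int \<bar>t\<bar>) powr - s) \<le> B"
proof -
  have "summable (\<lambda>n. real n powr - s)" using assms by (simp add: summable_real_powr_iff)
  then have sm: "summable (\<lambda>n. real (Suc n) powr - s)" by (subst summable_Suc_iff)
  define B where "B = (\<Sum>n. real (Suc n) powr - s)"
  have B: "(\<Sum>n\<le>N. (1 + real n) powr - s) \<le> B" for N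
    unfolding B_def using sum_le_suminf[OF sm, of "{..N}"] by (simp add: add.commute)
  have "(\<Sum>t\<in>{- int N..int N}. (1 + real_of_int \<bar>t\<bar>) powr - s) \<le> 2 * B" for N
  proof -
    have "{- int N..int N} \<subseteq> int ` {..N} \<union> (\<lambda>n. - int n) ` {..N}"
    proof
      fix t assume "t \<in> {- int N..int N}"
      then have "t = int (nat t) \<and> nat t \<le> N \<or> t = - int (nat (- t)) \<and> nat (- t) \<le> N" by auto
      then show "t \<in> int ` {..N} \<union> (\<lambda>n. - int n) ` {..N}" by blast
    qed
    then have "(\<Sum>t\<in>{- int N..int N}. (1 + real_of_int \<bar>t\<bar>) powr - s) \<le>
        (\<Sum>t\<in>int ` {..N} \<union> (\<lambda>n. - int n) ` {..N}. (1 + real_of_int \<bar>t\<bar>) powr - s)"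
      by (intro sum_mono2) auto
    also have "\<dots> \<le> (\<Sum>t\<in>int ` {..N}. (1 + real_of_int \<bar>t\<bar>) powr - s) +
        (\<Sum>t\<in>(\<lambda>n. - int n) ` {..N}. (1 + real_of_int \<bar>t\<bar>) powr - s)"
      by (subst sum_Un) (auto intro!: sum_nonneg)
    also have "\<dots> = (\<Sum>n\<le>N. (1 + real n) powr - s) + (\<Sum>n\<le>N. (1 + real n) powr - s)"
      by (intro arg_cong2[of _ _ _ _ "(+)"]; subst sum.reindex) (auto simp: inj_on_def o_def)
    also have "\<dots> \<le> 2 * B" using B[of N] by linarith
    finally show ?thesis .
  qed
  moreover have "B \<ge> 0" using B[of 0] by (meson order_trans sum_nonneg powr_ge_zero)
  ultimately show ?thesis using that[of "2 * B"] by simp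
qed

text \<open>With \<open>s = 1 + \<delta> / d\<close> the power of the norm is a product of
  \<open>d\<close> equal factors \<open>linf x powr - s\<close>. Each is dominated by a summable
  weight of one coordinate, because \<open>1 + \<bar>x $ i\<bar> \<le> 2 * linf x\<close> for
  \<open>x \<noteq> 0\<close>.\<close>

lemma summable_linf_powr:
  fixes \<delta> :: real
  assumes "\<delta> > 0"
  shows "(\<lambda>x::int ^ 'd::finite. real_of_int (linf x) powr - (real CARD('d) + \<delta>)) summable_on UNIV"
proof -
  define D s where "D = real CARD('d)" and "s = 1 + \<delta> / real CARD('d)"
  have D: "D > 0" by (simp add: D_def)
  have s: "s > 1" using assms by (simp add: s_def)
  obtain B where B: "B \<ge> 0" "\<And>N::nat. (\<Sum>t\<in>{- int N..int N}. (1 + real_of_int \<bar>t\<bar>) powr - s) \<le> B"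
    using summable_int_powr[OF s] by blast
  define w where "w t = 2 powr s * (1 + real_of_int \<bar>t\<bar>) powr - s" for t :: int
  have le: "real_of_int (linf x) powr - (D + \<delta>) \<le> (\<Prod>i\<in>UNIV. w (x $ i))" for x :: "int ^ 'd"
  proof (cases "x = 0")
    case True
    then have "linf x = 0" by (simp add: linf_eq_0_iff)
    then show ?thesis by (auto simp: w_def intro!: prod_nonneg)
  next
    case False
    then have l1: "linf x \<ge> 1" by (rule linf_pos)
    have "real_of_int (linf x) powr - (D + \<delta>) = (real_of_int (linf x) powr - s) ^ CARD('d)"
    proof -
      have "- s * D = - (D + \<delta>)" using D by (simp add: s_def D_def field_simps)
      then have "real_of_int (linf x) powr - (D + \<delta>) = (real_of_int (linf x) powr - s) powr D"
        by (simp add: powr_powr)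
      also have "\<dots> = (real_of_int (linf x) powr - s) ^ CARD('d)"
        using l1 unfolding D_def by (subst powr_realpow) auto
      finally show ?thesis .
    qed
    also have "\<dots> = (\<Prod>i\<in>(UNIV::'d set). real_of_int (linf x) powr - s)" by simp
    also have "\<dots> \<le> (\<Prod>i\<in>UNIV. w (x $ i))"
    proof (rule prod_mono, intro conjI)
      fix i
      have "(1 + real_of_int \<bar>x $ i\<bar>) / 2 \<le> real_of_int (linf x)"
      proof -
        have "1 + \<bar>x $ i\<bar> \<le> 2 * linf x" using abs_nth_le_linf[of x i] l1 by linarith
        then have "real_of_int (1 + \<bar>x $ i\<bar>) \<le> real_of_int (2 * linf x)" by (simp only: of_int_le_iff)
        then show ?thesis by simp
      qed
      then have "real_of_int (linf x) powr - s \<le> ((1 + real_of_int \<bar>x $ i\<bar>) / 2) powr - s"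
        by (rule powr_mono2'[rotated 2]) (use s in auto)
      also have "\<dots> = w (x $ i)"
        by (simp add: w_def powr_divide powr_minus field_simps)
      finally show "real_of_int (linf x) powr - s \<le> w (x $ i)" .
    qed simp
    finally show ?thesis .
  qed
  show ?thesis unfolding D_def[symmetric]
  proof (rule nonneg_bdd_above_summable_on)
    show "bdd_above (sum (\<lambda>x::int ^ 'd. real_of_int (linf x) powr - (D + \<delta>)) ` {F. F \<subseteq> UNIV \<and> finite F})"
    proof (rule bdd_aboveI2)
      fix F :: "(int ^ 'd) set" assume "F \<in> {F. F \<subseteq> UNIV \<and> finite F}"
      then have F: "finite F" by simp
      define N where "N = nat (Max (insert 0 (linf ` F)))"
      have N: "\<bar>x $ i\<bar> \<le> int N" if "x \<in> F" for x i
      proof -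
        have "linf x \<le> Max (insert 0 (linf ` F))" using F that by (intro Max_ge) auto
        then have "\<bar>x $ i\<bar> \<le> Max (insert 0 (linf ` F))" using abs_nth_le_linf[of x i] by linarith
        then show ?thesis unfolding N_def by linarith
      qed
      let ?A = "{- int N..int N}"
      have sub: "F \<subseteq> {x. \<forall>i. x $ i \<in> ?A}"
      proof safe
        fix x i assume "x \<in> F"
        from N[OF this, of i] show "x $ i \<in> ?A" by auto
      qed
      have "(\<Sum>x\<in>F. real_of_int (linf x) powr - (D + \<delta>)) \<le> (\<Sum>x\<in>F. \<Prod>i\<in>UNIV. w (x $ i))"
        by (intro sum_mono le)
      also have "\<dots> \<le> (\<Sum>x\<in>{x::int ^ 'd. \<forall>i. x $ i \<in> ?A}. \<Prod>i\<in>UNIV. w (x $ i))"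
      proof (rule sum_mono2[OF _ sub])
        show "finite {x::int ^ 'd. \<forall>i. x $ i \<in> ?A}" by (rule finite_vec_box) simp
      qed (auto intro!: prod_nonneg simp: w_def)
      also have "\<dots> = (\<Sum>g\<in>Pi\<^sub>E UNIV (\<lambda>_::'d. ?A). \<Prod>i\<in>UNIV. w (g i))"
        unfolding vec_box_eq_image by (subst sum.reindex) (auto simp: inj_on_def vec_lambda_inject)
      also have "\<dots> = (\<Prod>i\<in>(UNIV::'d set). \<Sum>t\<in>?A. w t)" by (rule prod_sum_PiE[symmetric]) auto
      also have "\<dots> \<le> (\<Prod>i\<in>(UNIV::'d set). 2 powr s * B)"
      proof (rule prod_mono, intro conjI)
        show "(\<Sum>t\<in>?A. w t) \<le> 2 powr s * B"
          unfolding w_def sum_distrib_left[symmetric] by (intro mult_left_mono B(2)) simp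
      qed (simp add: w_def sum_nonneg)
      finally show "(\<Sum>x\<in>F. real_of_int (linf x) powr - (D + \<delta>)) \<le> (\<Prod>i\<in>(UNIV::'d set). 2 powr s * B)" .
    qed
  qed simp
qed

section \<open>The kernel and bounds uniform in the side of the torus\<close>

locale heavy_kernel =
  fixes Q :: "int ^ 'd::finite \<Rightarrow> int ^ 'd \<Rightarrow> real" and \<alpha> K :: real
  assumes dim: "CARD('d) \<ge> 2"
    and kernel: "transition_kernel Q"
    and symmetric: "symmetric_kernel Q"
    and invariant: "translation_invariant Q"
    and \<alpha>: "\<alpha> > 0"
    and K: "K > 0"
    and heavy: "\<And>x y. x \<noteq> y \<Longrightarrow>
        inverse K * real_of_int (linf (x - y)) powr - (real CARD('d) + \<alpha>) \<le> Q x y \<and>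
        Q x y \<le> K * real_of_int (linf (x - y)) powr - (real CARD('d) + \<alpha>)"
begin

abbreviation "qL L \<equiv> torus_kernel L Q 0"

lemma Q_nonneg: "Q x y \<ge> 0" using kernel by (simp add: transition_kernel_def)

lemma Q_shift: "Q x y = Q 0 (y - x)" using invariant unfolding translation_invariant_def by blast

lemma Q_sym: "Q x y = Q y x" using symmetric unfolding symmetric_kernel_def by blast

lemma Q0_uminus: "Q 0 (- x) = Q 0 x"
  using Q_sym[of 0 "- x"] Q_shift[of "- x" 0] by simp

lemma Q0_sum: "(Q 0 has_sum 1) UNIV" using kernel by (simp add: transition_kernel_def)

lemma Q0_summable: "Q 0 summable_on A"
  using Q0_sum has_sum_imp_summable summable_on_subset_banach by blast

lemma Q0_lower: "x \<noteq> 0 \<Longrightarrow> linf x \<le> int N \<Longrightarrow> inverse K * real N powr - (real CARD('d) + \<alpha>) \<le> Q 0 x"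
proof -
  assume x: "x \<noteq> 0" "linf x \<le> int N"
  have "real N powr - (real CARD('d) + \<alpha>) \<le> real_of_int (linf x) powr - (real CARD('d) + \<alpha>)"
    by (rule powr_mono2') (use x linf_pos[OF x(1)] \<alpha> in auto)
  then have "inverse K * real N powr - (real CARD('d) + \<alpha>) \<le> inverse K * real_of_int (linf x) powr - (real CARD('d) + \<alpha>)"
    by (rule mult_left_mono) (use K in simp)
  also have "\<dots> \<le> Q 0 x" using heavy[of 0 x] x(1) by (simp add: linf_uminus)
  finally show ?thesis .
qed

lemma Q0_pos: "x \<noteq> 0 \<Longrightarrow> Q 0 x > 0"
proof -
  assume x: "x \<noteq> 0"
  have "0 < inverse K * real (nat (linf x)) powr - (real CARD('d) + \<alpha>)"
    using K linf_pos[OF x] by simp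
  also have "\<dots> \<le> Q 0 x" by (rule Q0_lower[OF x]) simp
  finally show ?thesis .
qed

lemma qL_ge: "Q 0 x \<le> qL L x"
proof -
  have "sum (Q 0) {x} \<le> infsum (Q 0) {y. proj L y = proj L x}"
    by (rule finite_sum_le_infsum[OF Q0_summable]) (auto simp: Q_nonneg)
  then show ?thesis by (simp add: torus_kernel_def)
qed

lemma torus_kernel_diff: "torus_kernel L Q u v = qL L (v - u)"
  by (simp add: torus_kernel_def)

lemma qL_uminus: "qL L (- z) = qL L z"
proof -
  have bij: "bij_betw uminus {x. proj L x = proj L (z :: int ^ 'd)} {x. proj L x = proj L (- z)}"
  proof (rule bij_betw_byWitness[where f' = uminus])
    have neg: "proj L (- x) = proj L (- y)" if "proj L x = proj L y" for x y :: "int ^ 'd"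
      using that by (metis proj_uminus_proj)
    show "uminus ` {x. proj L x = proj L z} \<subseteq> {x. proj L x = proj L (- z)}"
      by (intro image_subsetI CollectI) (rule neg, rule CollectD)
    show "uminus ` {x. proj L x = proj L (- z)} \<subseteq> {x. proj L x = proj L z}"
    proof (intro image_subsetI CollectI)
      fix x assume "x \<in> {x. proj L x = proj L (- z)}"
      then have "proj L (- x) = proj L (- (- z))" by (intro neg) (rule CollectD)
      then show "proj L (- x) = proj L z" by (simp only: minus_minus)
    qed
  qed auto
  have "infsum (\<lambda>x. Q 0 (- x)) {x. proj L x = proj L z} = infsum (Q 0) {x. proj L x = proj L (- z)}"
    by (rule infsum_reindex_bij_betw[OF bij])
  then show ?thesis by (simp add: torus_kernel_def Q0_uminus)
qed

lemma torus_walk: "L > 0 \<Longrightarrow> torus_walk L (qL L)"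
  by (rule torus_walk.intro)
     (use qL_uminus in \<open>simp_all add: sum_torus_kernel[OF kernel] torus_kernel_nonneg[OF kernel] periodic_def torus_kernel_shift[of L Q _ 0, simplified]\<close>)

text \<open>One jump combined with a step that stays put gives nothing if \<open>Q 0 0\<close>
  vanishes. The intermediate vertex \<open>a\<close> has norm at most 2 and differs from
  \<open>0\<close> and \<open>z\<close>, which leaves a displacement of norm at most
  \<open>3 * N\<close>; hence \<open>6 = 2 * 3\<close>.\<close>

lemma p2_lower:
  assumes L: "L > 0"
  shows "torus_walk.p2_lower L (qL L) (real CARD('d) + \<alpha>)
    ((inverse K)\<^sup>2 * 6 powr - (real CARD('d) + \<alpha>))"
proof -
  interpret torus_walk L "qL L" by (rule torus_walk[OF L])
  let ?e = "real CARD('d) + \<alpha>"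
  have e: "?e > 0" using \<alpha> by simp
  have p1: "p 1 x = qL L x" for x
  proof -
    have "p 1 x = (\<Sum>z\<in>V. if z = proj L x then qL L z else 0)"
      unfolding One_nat_def p.simps
    proof (intro sum.cong refl)
      fix z assume z: "z \<in> V"
      have "proj L (x - z) = 0 \<longleftrightarrow> z = proj L x"
      proof
        assume *: "proj L (x - z) = 0"
        have "proj L x = proj L (proj L (x - z) + z)" by simp
        then show "z = proj L x" using z unfolding * by (simp add: proj_id)
      qed simp
      then show "qL L z * (if proj L (x - z) = 0 then 1 else 0) = (if z = proj L x then qL L z else 0)" by simp
    qed
    also have "\<dots> = qL L (proj L x)" using L by simp
    finally show ?thesis by (simp add: periodicD[OF q_periodic])
  qed
  have "(inverse K)\<^sup>2 * 6 powr - ?e * real N powr - ?e \<le> p 2 z" if N: "N \<ge> 1" and z: "z \<in> cube N" "z \<noteq> 0" for N z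
  proof -
    obtain i :: 'd where True by simp
    define a :: "int ^ 'd" where "a = axis i (if z = axis i 1 then 2 else 1)"
    have a0: "a \<noteq> 0" "linf a \<le> int 2" by (auto simp: a_def linf_le_iff axis_def vec_eq_iff)
    have za: "z - a \<noteq> 0" by (auto simp: a_def axis_def vec_eq_iff)
    have lz: "linf (z - a) \<le> int (3 * N)"
    proof (unfold linf_le_iff, intro allI)
      fix j
      have "\<bar>(z - a) $ j\<bar> \<le> \<bar>z $ j\<bar> + \<bar>a $ j\<bar>" by simp
      also have "\<dots> \<le> int N + 2" using z(1) a0(2) by (intro add_mono) (auto simp: cube_def linf_le_iff)
      also have "\<dots> \<le> int (3 * N)" using N by simp
      finally show "\<bar>(z - a) $ j\<bar> \<le> int (3 * N)" .
    qed
    have "(inverse K)\<^sup>2 * 6 powr - ?e * real N powr - ?e =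
        (inverse K * real 2 powr - ?e) * (inverse K * real (3 * N) powr - ?e)"
      using N by (simp add: power2_eq_square powr_mult[symmetric])
    also have "\<dots> \<le> qL L a * qL L (z - a)"
      by (intro mult_mono order_trans[OF Q0_lower qL_ge] a0 za lz q_nonneg) (use K in auto)
    also have "\<dots> = qL L (proj L a) * p 1 (z - proj L a)"
      unfolding p1 by (intro arg_cong2[of _ _ _ _ "(*)"] periodic_cong[OF q_periodic]) auto
    also have "\<dots> \<le> (\<Sum>y\<in>V. qL L y * p 1 (z - y))"
      by (rule member_le_sum[of "proj L a" V "\<lambda>y. qL L y * p 1 (z - y)"])
         (use L in \<open>auto intro!: mult_nonneg_nonneg q_nonneg p_nonneg simp del: p.simps One_nat_def\<close>)
    also have "\<dots> = p 2 z" by (simp add: numeral_2_eq_2)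
    finally show ?thesis .
  qed
  then show ?thesis unfolding p2_lower_def using K by simp
qed

text \<open>The sum over the torus is unfolded to the lattice, where the dominating function
  \<open>g\<close> need not be periodic; this is how bounds independent of \<open>L\<close>
  arise.\<close>

lemma sum_qL_le:
  fixes F g :: "int ^ 'd \<Rightarrow> real"
  assumes L: "L > 0" and F: "periodic L F" "\<And>x. 0 \<le> F x" "\<And>x. F x \<le> g x"
    and g: "(\<lambda>x. Q 0 x * g x) summable_on UNIV"
  shows "(\<Sum>z\<in>torus L. qL L z * F z) \<le> infsum (\<lambda>x. Q 0 x * g x) UNIV"
proof -
  let ?G = "\<lambda>x. Q 0 x * g x" and ?B = "\<lambda>z. {x. proj L x = (z :: int ^ 'd)}"
  have smG: "?G summable_on A" for A by (rule summable_on_subset_banach[OF g]) simp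
  have "(\<Sum>z\<in>torus L. qL L z * F z) \<le> (\<Sum>z\<in>torus L. infsum ?G (?B z))"
  proof (rule sum_mono)
    fix z :: "int ^ 'd" assume z: "z \<in> torus L"
    have "qL L z * F z = infsum (\<lambda>x. Q 0 x * F z) (?B z)"
      by (simp add: torus_kernel_def proj_id[OF z] infsum_cmult_left[OF Q0_summable])
    also have "\<dots> \<le> infsum ?G (?B z)"
    proof (rule infsum_mono[OF summable_on_cmult_left[OF Q0_summable] smG])
      fix x assume "x \<in> ?B z"
      then have "F z = F x" using periodicD[OF F(1), of x] by auto
      then show "Q 0 x * F z \<le> Q 0 x * g x" using F(3)[of x] by (simp add: mult_left_mono Q_nonneg)
    qed
    finally show "qL L z * F z \<le> infsum ?G (?B z)" .
  qed
  also have "\<dots> = infsum ?G (\<Union>z\<in>torus L. ?B z)"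
  proof -
    have "finite A \<Longrightarrow> (\<Sum>z\<in>A. infsum ?G (?B z)) = infsum ?G (\<Union>z\<in>A. ?B z)" for A
    proof (induction A rule: finite_induct)
      case (insert z A)
      have "infsum ?G (?B z \<union> (\<Union>z\<in>A. ?B z)) = infsum ?G (?B z) + infsum ?G (\<Union>z\<in>A. ?B z)"
        by (rule infsum_Un_disjoint[OF smG smG]) (use insert in auto)
      then show ?case using insert by simp
    qed simp
    then show ?thesis by simp
  qed
  also have "(\<Union>z\<in>torus L. ?B z) = UNIV" using L by auto
  finally show ?thesis .
qed

text \<open>Since \<open>min 1 (t\<^sup>2) \<le> t powr \<beta>\<close> for
  \<open>0 < \<beta> \<le> 2\<close>, the truncated moment is dominated by a moment of order
  \<open>\<beta> < \<alpha>\<close> on the lattice, which is finite.\<close>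

lemma moment_bound:
  assumes \<beta>: "0 < \<beta>" "\<beta> < \<alpha>" "\<beta> \<le> 2"
  obtains C where "C \<ge> 1" "\<And>L R. L > 0 \<Longrightarrow> R > 0 \<Longrightarrow> (\<Sum>z\<in>torus L. qL L z * Phi L R z) \<le> C * real R powr - \<beta>"
proof -
  let ?D = "real CARD('d)"
  let ?h = "\<lambda>x::int ^ 'd. Q 0 x * (?D * real_of_int (linf x) powr \<beta>)"
  have sm: "?h summable_on UNIV"
  proof (rule summable_on_comparison_test)
    show "(\<lambda>x::int ^ 'd. (K * ?D) * real_of_int (linf x) powr - (?D + (\<alpha> - \<beta>))) summable_on UNIV"
      by (intro summable_on_cmult_right summable_linf_powr) (use \<beta> in simp)
    fix x :: "int ^ 'd"
    show "?h x \<le> (K * ?D) * real_of_int (linf x) powr - (?D + (\<alpha> - \<beta>))"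
    proof (cases "x = 0")
      case False
      have "?h x \<le> (K * real_of_int (linf x) powr - (?D + \<alpha>)) * (?D * real_of_int (linf x) powr \<beta>)"
        using heavy[of 0 x] False by (intro mult_right_mono) (auto simp: linf_uminus)
      also have "\<dots> = (K * ?D) * (real_of_int (linf x) powr - (?D + \<alpha>) * real_of_int (linf x) powr \<beta>)" by simp
      also have "real_of_int (linf x) powr - (?D + \<alpha>) * real_of_int (linf x) powr \<beta> =
          real_of_int (linf x) powr - (?D + (\<alpha> - \<beta>))"
        by (simp add: powr_add[symmetric] algebra_simps)
      finally show ?thesis .
    qed (use linf_eq_0_iff[of x] K in simp)
    show "0 \<le> ?h x" by (simp add: Q_nonneg)
  qed
  define C where "C = max 1 (infsum ?h UNIV)"
  have "(\<Sum>z\<in>torus L. qL L z * Phi L R z) \<le> C * real R powr - \<beta>" if L: "L > 0" and R: "R > 0" for L R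
  proof -
    have "(\<Sum>z\<in>torus L. qL L z * Phi L R z) \<le>
        infsum (\<lambda>x. Q 0 x * (?D * real_of_int (linf x) powr \<beta> * real R powr - \<beta>)) UNIV"
    proof (rule sum_qL_le[OF L Phi_periodic Phi_nonneg])
      fix x :: "int ^ 'd"
      have "Phi L R x \<le> (\<Sum>i\<in>(UNIV::'d set). real_of_int (linf x) powr \<beta> * real R powr - \<beta>)"
        unfolding Phi_def
      proof (rule sum_mono)
        fix i
        define t where "t = real_of_int (linf x) / real R"
        have t: "t \<ge> 0" using linf_nonneg[of x] by (simp add: t_def)
        have "dl L (x $ i) \<le> linf x" using dl_le_abs[OF L, of "x $ i"] abs_nth_le_linf[of x i] by linarith
        then have "(real_of_int (dl L (x $ i)) / real R)\<^sup>2 \<le> t\<^sup>2"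
          unfolding t_def using dl_nonneg[OF L] by (intro power_mono divide_right_mono) auto
        then have "psi L R (x $ i) \<le> min 1 (t\<^sup>2)" by (auto simp: psi_def)
        also have "\<dots> \<le> t powr \<beta>"
        proof (cases "t = 0 \<or> t \<ge> 1")
          case True
          then show ?thesis using \<beta> by (auto simp: min_def ge_one_powr_ge_zero)
        next
          case False
          then have "t\<^sup>2 = t powr 2" using t by simp
          also have "\<dots> \<le> t powr \<beta>" using False t \<beta> by (intro powr_mono') auto
          finally show ?thesis by simp
        qed
        also have "\<dots> = real_of_int (linf x) powr \<beta> * real R powr - \<beta>"
          using R linf_nonneg[of x] by (simp add: t_def powr_divide powr_minus field_simps)
        finally show "psi L R (x $ i) \<le> real_of_int (linf x) powr \<beta> * real R powr - \<beta>" .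
      qed
      then show "Phi L R x \<le> ?D * real_of_int (linf x) powr \<beta> * real R powr - \<beta>" by simp
    next
      show "(\<lambda>x. Q 0 x * (?D * real_of_int (linf x) powr \<beta> * real R powr - \<beta>)) summable_on UNIV"
        using summable_on_cmult_left[OF sm, of "real R powr - \<beta>"] by (simp add: mult.assoc)
    qed
    also have "\<dots> = infsum ?h UNIV * real R powr - \<beta>"
      using infsum_cmult_left[OF sm, of "real R powr - \<beta>"] by (simp add: mult.assoc)
    also have "\<dots> \<le> C * real R powr - \<beta>" by (intro mult_right_mono) (auto simp: C_def)
    finally show ?thesis .
  qed
  then show ?thesis using that[of C] by (simp add: C_def)
qed

end

section \<open>Exponents, and the hitting estimate for blocks\<close>

lemma nat_ceiling_bounds:
  fixes x :: real
  assumes "x \<ge> 1"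
  shows "x \<le> real (nat \<lceil>x\<rceil>)" "real (nat \<lceil>x\<rceil>) \<le> 2 * x" "nat \<lceil>x\<rceil> \<ge> 1"
proof -
  have c: "1 \<le> \<lceil>x\<rceil>" using assms le_of_int_ceiling[of x] by linarith
  then have e: "real (nat \<lceil>x\<rceil>) = real_of_int \<lceil>x\<rceil>" by simp
  show "x \<le> real (nat \<lceil>x\<rceil>)" unfolding e by (rule le_of_int_ceiling)
  show "real (nat \<lceil>x\<rceil>) \<le> 2 * x" unfolding e using of_int_ceiling_le_add_one[of x] assms by linarith
  show "nat \<lceil>x\<rceil> \<ge> 1" using c by linarith
qed

context torus_walk
begin

text \<open>The radius \<open>R\<close> of order \<open>(2 * C * k) powr (1 / \<beta>)\<close> is
  the one at which the bound for the mean of \<open>Phi\<close> after \<open>k\<close> steps falls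
  to 1/2.\<close>

lemma u_poly:
  assumes \<beta>: "\<beta> > 0" and C: "C \<ge> 1" and mb: "\<And>R. R > 0 \<Longrightarrow> (\<Sum>z\<in>V. q z * Phi L R z) \<le> C * real R powr - \<beta>"
    and k: "k \<ge> 1"
  shows "1 / (4 * (4 * (2 * C) powr (1 / \<beta>)) ^ CARD('d)) * real k powr - (real CARD('d) / \<beta>) \<le> u k"
proof -
  define x where "x = (2 * C * real k) powr (1 / \<beta>)"
  have "1 * 1 \<le> 2 * C * real k" using C k by (intro mult_mono) auto
  then have x1: "x \<ge> 1" unfolding x_def using \<beta> by (intro ge_one_powr_ge_zero) auto
  define R where "R = nat \<lceil>x\<rceil>"
  have R: "x \<le> real R" "real R \<le> 2 * x" "R > 0"
    unfolding R_def using nat_ceiling_bounds[OF x1] by auto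
  have "real k * (\<Sum>z\<in>V. q z * Phi L R z) \<le> real k * (C * real R powr - \<beta>)"
    by (intro mult_left_mono mb R) auto
  also have "\<dots> \<le> real k * (C * x powr - \<beta>)"
    using R x1 \<beta> C by (intro mult_left_mono powr_mono2') auto
  also have "x powr - \<beta> = 1 / (2 * C * real k)"
    using \<beta> C k by (simp add: x_def powr_powr powr_minus field_simps)
  also have "real k * (C * (1 / (2 * C * real k))) = 1 / 2" using C k by simp
  finally have "u k \<ge> 1 / (4 * (2 * real R) ^ CARD('d))" by (rule u_lower[OF R(3)])
  moreover have "1 / (4 * (4 * x) ^ CARD('d)) \<le> 1 / (4 * (2 * real R) ^ CARD('d))"
    using R x1 by (intro divide_left_mono mult_left_mono power_mono mult_pos_pos zero_less_power) auto
  moreover have "(4 * x) ^ CARD('d) = (4 * (2 * C) powr (1 / \<beta>)) ^ CARD('d) * real k powr (real CARD('d) / \<beta>)"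
  proof -
    have "x = (2 * C) powr (1 / \<beta>) * real k powr (1 / \<beta>)"
      unfolding x_def using C by (subst powr_mult) auto
    moreover have "(real k powr (1 / \<beta>)) ^ CARD('d) = real k powr (real CARD('d) / \<beta>)"
      using k by (simp add: powr_realpow[symmetric] powr_powr)
    ultimately show ?thesis by (simp add: power_mult_distrib mult.assoc)
  qed
  ultimately show ?thesis by (simp add: powr_minus field_simps)
qed

text \<open>The logarithm in \<open>s_le\<close> is traded for a small power
  \<open>\<kappa>\<close>, so that later estimates involve powers of \<open>k\<close> only.\<close>

lemma s_poly:
  assumes c: "0 < c" "c \<le> 1" "\<delta> \<ge> 0" and \<kappa>: "\<kappa> > 0" and k: "k \<ge> 1" and u: "c * real k powr - \<delta> \<le> u k"
  shows "s k \<le> (ln (1 / c) + \<delta> / \<kappa>) * real k powr (\<kappa> - 1)"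
proof -
  have k1: "1 \<le> real k powr \<kappa>" using k \<kappa> by (intro ge_one_powr_ge_zero) auto
  have "ln (c * real k powr - \<delta>) \<le> ln (u k)" using u c k u_pos[of k] by (subst ln_le_cancel_iff) auto
  then have "- ln (u k) \<le> ln (1 / c) + \<delta> * ln (real k)" using c k by (simp add: ln_mult ln_div ln_powr)
  also have "\<dots> \<le> ln (1 / c) * real k powr \<kappa> + \<delta> * (real k powr \<kappa> / \<kappa>)"
  proof (rule add_mono)
    show "ln (1 / c) \<le> ln (1 / c) * real k powr \<kappa>"
      using mult_left_mono[OF k1, of "ln (1 / c)"] c by simp
    show "\<delta> * ln (real k) \<le> \<delta> * (real k powr \<kappa> / \<kappa>)"
      using ln_powr_bound[of "real k" \<kappa>] k \<kappa> c by (intro mult_left_mono) auto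
  qed
  finally have "real k * s k \<le> (ln (1 / c) + \<delta> / \<kappa>) * real k powr \<kappa>"
    using s_le[of k] by (simp add: algebra_simps)
  then have "s k \<le> (ln (1 / c) + \<delta> / \<kappa>) * real k powr \<kappa> / real k" using k by (simp add: field_simps)
  also have "\<dots> = (ln (1 / c) + \<delta> / \<kappa>) * real k powr (\<kappa> - 1)"
    using k by (simp add: powr_diff)
  finally show ?thesis .
qed

end

text \<open>With radius \<open>k powr ((1 - \<kappa>) / a)\<close> and \<open>u k\<close> at least
  of order \<open>k powr - (D / (a * (1 - \<kappa>)))\<close>, the last expression is the exponent
  of the summed hitting probabilities; \<open>(1 + \<kappa>) / 2\<close> comes from the Green
  function at the origin. The choice of \<open>\<kappa>\<close> keeps the mismatch of the two powers
  of \<open>k\<close> above \<open>- 1 / 8\<close>.\<close>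

lemma hitting_exponent:
  fixes a D :: real
  assumes a: "0 < a" "a \<le> 2" and D: "D \<ge> 2" and \<kappa>: "\<kappa> = a / (24 * D)"
  shows "0 < \<kappa>" "\<kappa> \<le> 1 / 24" "1 - \<kappa> \<le> (1 - \<kappa>) / a * D"
    "1 / 4 \<le> 1 + (1 - \<kappa>) / a * D - D / (a * (1 - \<kappa>)) - (1 + \<kappa>) / 2"
proof -
  show k0: "0 < \<kappa>" using a D by (simp add: \<kappa>)
  have "a \<le> D" using a D by linarith
  then show k1: "\<kappa> \<le> 1 / 24" using a D by (simp add: \<kappa> divide_simps)
  have "1 * (1 - \<kappa>) \<le> D / a * (1 - \<kappa>)"
    using \<open>a \<le> D\<close> a k1 by (intro mult_right_mono) (auto simp: divide_simps)
  then show "1 - \<kappa> \<le> (1 - \<kappa>) / a * D" by (simp add: mult.commute)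
  have Da: "D / a = 1 / (24 * \<kappa>)" using a D by (simp add: \<kappa>)
  have "(1 - \<kappa>) / a * D - D / (a * (1 - \<kappa>)) = D / a * ((1 - \<kappa>) - 1 / (1 - \<kappa>))"
    by (simp add: right_diff_distrib mult.commute)
  also have "\<dots> = - ((2 - \<kappa>) / (24 * (1 - \<kappa>)))"
    unfolding Da using k0 k1 by (simp add: divide_simps) (simp add: algebra_simps power2_eq_square)
  finally have e: "(1 - \<kappa>) / a * D - D / (a * (1 - \<kappa>)) = - ((2 - \<kappa>) / (24 * (1 - \<kappa>)))" .
  have "(2 - \<kappa>) / (24 * (1 - \<kappa>)) \<le> 1 / 8" using k0 k1 by (simp add: divide_simps)
  then show "1 / 4 \<le> 1 + (1 - \<kappa>) / a * D - D / (a * (1 - \<kappa>)) - (1 + \<kappa>) / 2"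
  proof -
    have h: "(1 + \<kappa>) / 2 = 1 / 2 + \<kappa> / 2" by simp
    show ?thesis if "(2 - \<kappa>) / (24 * (1 - \<kappa>)) \<le> 1 / 8" unfolding h using e k1 that by linarith
  qed
qed

context heavy_kernel
begin

text \<open>The times are chosen such that a cube of radius about \<open>4 * r k\<close> is flat
  from time \<open>k\<close> on. The expected number of hits grows like a power of \<open>k\<close>,
  and the side \<open>r k\<close> is at most a power of \<open>k\<close>, so that exponential bounds
  will beat a union over the block.\<close>

lemma block_hitting:
  obtains c b \<theta> :: real and r n :: "nat \<Rightarrow> nat" where
    "c > 0" "b > 0" "\<theta> > 0" "filterlim r at_top at_top" "\<And>k. real (r k) \<le> b * real k powr \<theta>"
    "\<forall>\<^sub>F k in at_top. \<forall>\<^sub>F L in at_top. \<forall>W \<subseteq> torus_walk.cube (4 * r k). card W = r k ^ CARD('d) \<longrightarrow>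
       c * real k powr (1 / 4) \<le> (\<Sum>z\<in>W. torus_walk.hit L (qL L) (n k) z)"
proof -
  define D a where "D = real CARD('d)" and "a = min \<alpha> 2"
  have D: "D \<ge> 2" using dim by (simp add: D_def)
  have a: "0 < a" "a \<le> 2" "a \<le> \<alpha>" using \<alpha> by (auto simp: a_def)
  define \<kappa> where "\<kappa> = a / (24 * D)"
  note ex = hitting_exponent[OF a(1,2) D \<kappa>_def]
  define \<theta> \<beta> where "\<theta> = (1 - \<kappa>) / a" and "\<beta> = a * (1 - \<kappa>)"
  have \<theta>: "\<theta> > 0" using a ex by (simp add: \<theta>_def)
  have \<theta>a: "\<theta> * a = 1 - \<kappa>" using a by (simp add: \<theta>_def)
  have "\<beta> < a * 1" unfolding \<beta>_def using a(1) ex(1) by (intro mult_strict_left_mono) auto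
  moreover have "0 < \<beta>" unfolding \<beta>_def using a(1) ex(2) by (intro mult_pos_pos) auto
  ultimately have \<beta>: "0 < \<beta>" "\<beta> < \<alpha>" "\<beta> \<le> 2" using a by linarith+
  obtain C where C: "C \<ge> 1" "\<And>L R. L > 0 \<Longrightarrow> R > 0 \<Longrightarrow> (\<Sum>z\<in>torus L. qL L z * Phi L R z) \<le> C * real R powr - \<beta>"
    using moment_bound[OF \<beta>] by blast
  define c5 where "c5 = 1 / (4 * (4 * (2 * C) powr (1 / \<beta>)) ^ CARD('d))"
  have "1 * 1 \<le> 4 * (4 * (2 * C) powr (1 / \<beta>)) ^ CARD('d)"
  proof -
    have "1 \<le> (2 * C) powr (1 / \<beta>)" using C(1) \<beta> by (intro ge_one_powr_ge_zero) auto
    then show ?thesis by (intro mult_mono one_le_power) auto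
  qed
  then have c5: "0 < c5" "c5 \<le> 1" using C(1) by (auto simp: c5_def)
  define A where "A = ln (1 / c5) + D / \<beta> / \<kappa>"
  have A: "A > 0" unfolding A_def using c5 D \<beta> ex by (intro add_nonneg_pos) auto
  define cp where "cp = (inverse K)\<^sup>2 * 6 powr - (real CARD('d) + \<alpha>)"
  define c3 where "c3 = min (cp / (4 * 4 ^ CARD('d))) (cp / (4 * (real CARD('d))\<^sup>2))"
  have c3: "c3 > 0" using K by (auto simp: c3_def cp_def)
  \<comment> \<open>With this \<open>b\<close> the bound \<open>A * k powr (\<kappa> - 1)\<close> on
    \<open>s k\<close> equals \<open>c3 * (b * k powr \<theta>) powr - a\<close>, the smallness that
    \<open>card_bad\<close> requires at radius \<open>b * k powr \<theta>\<close>.\<close>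
  define b where "b = (c3 / A) powr (1 / a)"
  have b: "b > 0" using c3 A by (simp add: b_def)
  have bA: "c3 * (b * real k powr \<theta>) powr - a = A * real k powr (\<kappa> - 1)" if "k \<ge> 1" for k
  proof -
    have "(b * real k powr \<theta>) powr - a = b powr - a * real k powr (- (\<theta> * a))"
      using b by (simp add: powr_mult powr_powr)
    also have "b powr - a = A / c3" using c3 A a by (simp add: b_def powr_powr powr_minus)
    finally show ?thesis using c3 by (simp add: \<theta>a)
  qed
  define N where "N k = nat \<lfloor>b * real k powr \<theta>\<rfloor>" for k
  define r where "r k = N k div 4" for k
  define n where "n k = Suc (4 * k)" for k
  have Nle: "real (N k) \<le> b * real k powr \<theta>" for k using b by (simp add: N_def)
  have Nge: "b * real k powr \<theta> - 1 \<le> real (N k)" for k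
    unfolding N_def using b by (simp add: of_nat_nat)
  have rN: "4 * r k \<le> N k" for k by (simp add: r_def)
  have rle: "real (r k) \<le> b * real k powr \<theta>" for k using rN[of k] Nle[of k] by linarith
  have rge: "(b * real k powr \<theta> - 1) / 4 - 1 \<le> real (r k)" for k
  proof -
    have "N k \<le> 4 * r k + 3" by (simp add: r_def)
    then have "real (N k) \<le> 4 * real (r k) + 3" by linarith
    then show ?thesis using Nge[of k] by (simp add: field_simps)
  qed
  have lim: "filterlim (\<lambda>k. b * real k powr \<theta>) at_top at_top" using b \<theta> by real_asymp
  have lim2: "filterlim (\<lambda>k. b * sqrt (real k) powr \<theta>) at_top at_top" using b \<theta> by real_asymp
  have rlim: "filterlim r at_top at_top"
  proof -
    have "filterlim (\<lambda>k. (b * real k powr \<theta> - 1) / 4 - 1) at_top at_top" using b \<theta> by real_asymp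
    then have "filterlim (\<lambda>k. real (r k)) at_top at_top"
      by (rule filterlim_at_top_mono) (use rge in auto)
    then show ?thesis by (simp add: filterlim_sequentially_iff_filterlim_real)
  qed
  define B8 where "B8 = 4 + 24 * (2 / b) ^ CARD('d)"
  have B8: "B8 > 0" unfolding B8_def using b by (intro add_pos_nonneg) auto
  define c9 where "c9 = (b / 8) ^ CARD('d) * (c5 * 2 powr - (D / \<beta>)) / (4 * B8)"
  have c9: "c9 > 0" using b c5 B8 by (simp add: c9_def)
  have main: "c9 * real k powr (1 / 4) \<le> (\<Sum>z\<in>W. torus_walk.hit L (qL L) (n k) z)"
    if k: "k \<ge> 1" "10 \<le> b * real k powr \<theta>" "2 \<le> b * sqrt (real k) powr \<theta>"
      and Lb: "2 * N k + 2 * N (nat \<lceil>sqrt (real k)\<rceil>) + 1 \<le> L"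
      and W: "W \<subseteq> torus_walk.cube (4 * r k)" "card W = r k ^ CARD('d)" for k L W
  proof -
    have L0: "L > 0" using Lb by simp
    interpret torus_walk L "qL L" by (rule torus_walk[OF L0])
    have p2: "p2_lower (real CARD('d) + \<alpha>) cp" unfolding cp_def by (rule p2_lower[OF L0])
    have ul: "c5 * real j powr - (D / \<beta>) \<le> u j" if "j \<ge> 1" for j
      unfolding c5_def D_def by (rule u_poly[OF \<beta>(1) C(1) C(2)[OF L0] that])
    have sl: "s j \<le> A * real j powr (\<kappa> - 1)" if "j \<ge> 1" for j
      unfolding A_def by (rule s_poly[OF c5 _ ex(1) that ul[OF that]]) (use D \<beta> in auto)
    have sb: "s j \<le> c3 * real M powr - a" if j: "j \<ge> j'" "j' \<ge> 1" and M: "1 \<le> M" "M \<le> N j'" for j j' M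
    proof -
      have "s j \<le> A * real j powr (\<kappa> - 1)" using j by (intro sl) auto
      also have "\<dots> \<le> A * real j' powr (\<kappa> - 1)"
        using j A ex by (intro mult_left_mono powr_mono2') auto
      also have "\<dots> = c3 * (b * real j' powr \<theta>) powr - a" using bA[OF j(2)] by simp
      also have "\<dots> \<le> c3 * real M powr - a"
        using M Nle[of j'] a c3 by (intro mult_left_mono powr_mono2') auto
      finally show ?thesis .
    qed
    have bd: "real (card (bad M j)) \<le> real M ^ CARD('d) / (2 * 4 ^ CARD('d))"
      if "j \<ge> j'" "j' \<ge> 1" "1 \<le> M" "M \<le> N j'" "2 * M < L" for j j' M
      by (rule card_bad[OF p2 a_def that(3) that(5)]) (use sb[OF that(1-4)] in \<open>simp add: c3_def\<close>)
    \<comment> \<open>Cutting the Green function at a time \<open>m\<close> of order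
      \<open>sqrt k\<close> costs \<open>sqrt k\<close>, and the remaining terms are of order
      \<open>k * u m\<close>; both are at most of order
      \<open>k powr ((1 + \<kappa>) / 2)\<close>.\<close>
    define m where "m = nat \<lceil>sqrt (real k)\<rceil>"
    have sk: "1 \<le> sqrt (real k)" using k by simp
    have m: "sqrt (real k) \<le> real m" "real m \<le> 2 * sqrt (real k)" "m \<ge> 1"
      unfolding m_def using nat_ceiling_bounds[OF sk] by auto
    have bm: "2 \<le> b * real m powr \<theta>"
      by (rule order_trans[OF k(3)]) (use b \<theta> m sk in \<open>intro mult_left_mono powr_mono2, auto\<close>)
    have Nm: "b * real m powr \<theta> / 2 \<le> real (N m)" using Nge[of m] bm by (simp add: field_simps)
    have Nm1: "1 \<le> N m" using Nm bm by linarith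
    have um: "u m \<le> 4 * (2 / b) ^ CARD('d) * real k powr - ((1 - \<kappa>) / 2)"
    proof -
      have "u m \<le> 4 / real (N m) ^ CARD('d)"
        by (rule u_upper[OF Nm1 _ bd[OF order_refl m(3) Nm1 order_refl]]) (use Lb m_def in auto)
      also have "\<dots> \<le> 4 / (b * real m powr \<theta> / 2) ^ CARD('d)"
        using Nm b m Nm1 by (intro divide_left_mono power_mono mult_pos_pos zero_less_power) auto
      also have "\<dots> = 4 * (2 / b) ^ CARD('d) * real m powr - (\<theta> * D)"
        using b m by (simp add: power_mult_distrib power_divide powr_minus D_def powr_powr flip: powr_realpow) (simp add: field_simps)
      also have "\<dots> \<le> 4 * (2 / b) ^ CARD('d) * real k powr - ((1 - \<kappa>) / 2)"
      proof (rule mult_left_mono)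
        have "real m powr - (\<theta> * D) \<le> real m powr - (1 - \<kappa>)"
          using m ex(3) by (intro powr_mono) (auto simp: \<theta>_def)
        also have "\<dots> \<le> sqrt (real k) powr - (1 - \<kappa>)" using m sk ex by (intro powr_mono2') auto
        also have "\<dots> = real k powr - ((1 - \<kappa>) / 2)"
        proof -
          have "1 / 2 * - y = - (y / 2)" for y :: real by simp
          then show ?thesis by (simp only: powr_half_sqrt[symmetric] powr_powr of_nat_0_le_iff)
        qed
        finally show "real m powr - (\<theta> * D) \<le> real k powr - ((1 - \<kappa>) / 2)" .
      qed (use b in auto)
      finally show ?thesis .
    qed
    have rk: "b * real k powr \<theta> / 8 \<le> real (r k)" "1 \<le> r k"
    proof -
      show *: "b * real k powr \<theta> / 8 \<le> real (r k)" using rge[of k] k(2) by (simp add: field_simps)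
      show "1 \<le> r k" using order_trans[OF _ *, of "10 / 8"] k(2) by simp
    qed
    let ?S = "\<Sum>z\<in>W. hit (n k) z"
    have S0: "?S \<ge> 0" by (intro sum_nonneg hit_nonneg)
    have h: "real k * real (r k) ^ CARD('d) * u (2 * k) / 4 \<le> 2 * (real m + 3 * real k * u m) * ?S"
      unfolding n_def
    proof (rule hit_sum_lower[OF rk(2) W k(1)])
      fix j assume "k \<le> j"
      then show "real (card (bad (4 * r k) j)) \<le> real (4 * r k) ^ CARD('d) / (2 * 4 ^ CARD('d))"
        using rN[of k] rk(2) Lb k(1) by (intro bd[of k]) auto
    qed
    have k1: "real k powr (1 / 2) \<le> real k powr ((1 + \<kappa>) / 2)" using k ex by (intro powr_mono) auto
    have "2 * (real m + 3 * real k * u m) \<le> B8 * real k powr ((1 + \<kappa>) / 2)"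
    proof -
      have "3 * real k * u m \<le> 3 * real k * (4 * (2 / b) ^ CARD('d) * real k powr - ((1 - \<kappa>) / 2))"
        by (intro mult_left_mono um) auto
      also have "\<dots> = 12 * (2 / b) ^ CARD('d) * (real k powr 1 * real k powr - ((1 - \<kappa>) / 2))" by simp
      also have "real k powr 1 * real k powr - ((1 - \<kappa>) / 2) = real k powr ((1 + \<kappa>) / 2)"
        unfolding powr_add[symmetric] by (rule arg_cong[of _ _ "\<lambda>x. real k powr x"]) (simp add: field_simps)
      finally have "3 * real k * u m \<le> 12 * (2 / b) ^ CARD('d) * real k powr ((1 + \<kappa>) / 2)" .
      moreover have "real m \<le> 2 * real k powr ((1 + \<kappa>) / 2)"
        using m(2) k1 by (simp add: powr_half_sqrt)
      moreover have "x \<le> 12 * y * z \<Longrightarrow> w \<le> 2 * z \<Longrightarrow> 2 * (w + x) \<le> (4 + 24 * y) * z" for x y z w :: real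
        by (simp add: algebra_simps)
      ultimately show ?thesis unfolding B8_def by blast
    qed
    then have h2: "2 * (real m + 3 * real k * u m) * ?S \<le> B8 * real k powr ((1 + \<kappa>) / 2) * ?S"
      by (rule mult_right_mono[OF _ S0])
    have "(b / 8) ^ CARD('d) * (c5 * 2 powr - (D / \<beta>)) / 4 * real k powr (1 + \<theta> * D - D / \<beta>)
      = real k * (b * real k powr \<theta> / 8) ^ CARD('d) * (c5 * real (2 * k) powr - (D / \<beta>)) / 4"
    proof -
      have "(b * real k powr \<theta> / 8) ^ CARD('d) = (b / 8) ^ CARD('d) * real k powr (\<theta> * D)"
        using k by (simp add: power_mult_distrib power_divide D_def powr_powr flip: powr_realpow)
      moreover have "real (2 * k) powr - (D / \<beta>) = 2 powr - (D / \<beta>) * real k powr - (D / \<beta>)"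
        by (simp add: powr_mult)
      moreover have "real k powr (1 + \<theta> * D - D / \<beta>) = real k * real k powr (\<theta> * D) * real k powr - (D / \<beta>)"
        using k by (simp add: powr_add powr_diff powr_minus field_simps)
      ultimately show ?thesis by simp
    qed
    also have "\<dots> \<le> real k * real (r k) ^ CARD('d) * u (2 * k) / 4"
      using rk b k c5 ul[of "2 * k"] u_pos[of "2 * k"]
      by (intro divide_right_mono mult_mono power_mono) (auto intro!: mult_nonneg_nonneg)
    also have "\<dots> \<le> B8 * real k powr ((1 + \<kappa>) / 2) * ?S" using h h2 by linarith
    finally have "(b / 8) ^ CARD('d) * (c5 * 2 powr - (D / \<beta>)) / 4 * real k powr (1 + \<theta> * D - D / \<beta>)
       \<le> B8 * real k powr ((1 + \<kappa>) / 2) * ?S" .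
    then have "(b / 8) ^ CARD('d) * (c5 * 2 powr - (D / \<beta>)) / 4 * real k powr (1 + \<theta> * D - D / \<beta>) / (B8 * real k powr ((1 + \<kappa>) / 2)) \<le> ?S"
      using B8 k by (subst pos_divide_le_eq) (auto simp: mult_ac)
    moreover have "(b / 8) ^ CARD('d) * (c5 * 2 powr - (D / \<beta>)) / 4 * real k powr (1 + \<theta> * D - D / \<beta>) / (B8 * real k powr ((1 + \<kappa>) / 2))
      = c9 * real k powr (1 + \<theta> * D - D / \<beta> - (1 + \<kappa>) / 2)"
      unfolding c9_def powr_diff[of "real k" "1 + \<theta> * D - D / \<beta>"] by simp
    moreover have "c9 * real k powr (1 / 4) \<le> c9 * real k powr (1 + \<theta> * D - D / \<beta> - (1 + \<kappa>) / 2)"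
      using c9 k ex(4) by (intro mult_left_mono powr_mono) (auto simp: \<theta>_def \<beta>_def)
    ultimately show ?thesis by simp
  qed
  have "\<forall>\<^sub>F k in at_top. k \<ge> 1 \<and> 10 \<le> b * real k powr \<theta> \<and> 2 \<le> b * sqrt (real k) powr \<theta>"
    using lim lim2 by (intro eventually_conj eventually_ge_at_top) (auto simp: filterlim_at_top)
  then have "\<forall>\<^sub>F k in at_top. \<forall>\<^sub>F L in at_top. \<forall>W \<subseteq> torus_walk.cube (4 * r k). card W = r k ^ CARD('d) \<longrightarrow>
       c9 * real k powr (1 / 4) \<le> (\<Sum>z\<in>W. torus_walk.hit L (qL L) (n k) z)"
  proof (rule eventually_mono)
    fix k assume k: "k \<ge> 1 \<and> 10 \<le> b * real k powr \<theta> \<and> 2 \<le> b * sqrt (real k) powr \<theta>"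
    show "\<forall>\<^sub>F L in at_top. \<forall>W \<subseteq> torus_walk.cube (4 * r k). card W = r k ^ CARD('d) \<longrightarrow>
       c9 * real k powr (1 / 4) \<le> (\<Sum>z\<in>W. torus_walk.hit L (qL L) (n k) z)"
      using eventually_ge_at_top[of "2 * N k + 2 * N (nat \<lceil>sqrt (real k)\<rceil>) + 1"]
      by (rule eventually_mono) (use main k in blast)
  qed
  with that[OF c9 b \<theta> rlim rle] show ?thesis by blast
qed

end

section \<open>Boxes on the torus\<close>

definition Box :: "nat \<Rightarrow> int ^ 'd::finite \<Rightarrow> nat \<Rightarrow> (int ^ 'd) set" where
  "Box L x n = (\<lambda>z. proj L (x + z)) ` torus n"

lemma proj_eq_iff_dvd: "proj L x = proj L y \<longleftrightarrow> (\<forall>i. int L dvd x $ i - y $ i)"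
  by (simp add: proj_def vec_eq_iff mod_eq_dvd_iff)

lemma proj_inj_small:
  assumes "proj L (x + z) = proj L (x + z')" "z \<in> torus L" "z' \<in> torus L"
  shows "z = z'"
proof -
  have "z $ i = z' $ i" for i
  proof -
    have "int L dvd z $ i - z' $ i" using assms(1) by (simp add: proj_eq_iff_dvd)
    moreover have "\<bar>z $ i - z' $ i\<bar> < int L"
      using assms(2,3) unfolding torus_def by (simp add: abs_less_iff) (smt (verit))
    ultimately show ?thesis using dvd_imp_le_int[of "z $ i - z' $ i" "int L"] by linarith
  qed
  then show ?thesis by (simp add: vec_eq_iff)
qed

lemma torus_mono: "n \<le> m \<Longrightarrow> torus n \<subseteq> torus m"
  unfolding torus_def by (auto intro: less_le_trans)

lemma inj_on_Box: "n \<le> L \<Longrightarrow> inj_on (\<lambda>z. proj L (x + z)) (torus n)"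
  by (rule inj_onI) (use proj_inj_small torus_mono in blast)

lemma card_Box: "n \<le> L \<Longrightarrow> card (Box L (x :: int ^ 'd::finite) n) = n ^ CARD('d)"
  unfolding Box_def by (subst card_image[OF inj_on_Box]) (auto simp: card_torus)

lemma finite_Box [simp]: "finite (Box L x n)"
  by (simp add: Box_def)

lemma Box_subset_torus: "L > 0 \<Longrightarrow> Box L x n \<subseteq> torus L"
  by (auto simp: Box_def)

lemma Box_full: "L > 0 \<Longrightarrow> Box L x L = torus L"
proof
  assume L: "L > 0"
  show "torus L \<subseteq> Box L x L"
  proof
    fix v :: "int ^ 'a" assume v: "v \<in> torus L"
    show "v \<in> Box L x L"
      unfolding Box_def by (rule image_eqI[of _ _ "proj L (v - x)"]) (use v L in \<open>auto simp: proj_id\<close>)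
  qed
qed (rule Box_subset_torus)

lemma torus_combine:
  assumes "w \<in> torus q" "z \<in> torus m"
  shows "int m *s w + z \<in> torus (m * q)"
proof -
  have "0 \<le> int m * w $ i + z $ i \<and> int m * w $ i + z $ i < int (m * q)" for i
  proof -
    have w: "0 \<le> w $ i" "w $ i \<le> int q - 1" and z: "0 \<le> z $ i" "z $ i < int m"
      using assms by (auto simp: torus_def)
    have "int m * w $ i \<le> int m * (int q - 1)" by (rule mult_left_mono) (use w in auto)
    then show ?thesis using w z by (auto simp: algebra_simps)
  qed
  then show ?thesis by (simp add: torus_def)
qed

lemma torus_combine_inj:
  assumes "z \<in> torus m" "z' \<in> torus m" "int m *s w + z = int m *s w' + z'"
  shows "w = w'" "z = z'"
proof -
  have e: "w $ i = w' $ i \<and> z $ i = z' $ i" for i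
  proof -
    have z: "0 \<le> z $ i" "z $ i < int m" "0 \<le> z' $ i" "z' $ i < int m"
      using assms by (auto simp: torus_def)
    have eq: "int m * w $ i + z $ i = int m * w' $ i + z' $ i"
      using assms(3) by (metis vector_add_component vector_smult_component)
    have "(int m * w $ i + z $ i) div int m = w $ i" "(int m * w' $ i + z' $ i) div int m = w' $ i"
      using z by auto
    then show ?thesis using eq by auto
  qed
  then show "w = w'" "z = z'" by (auto simp: vec_eq_iff)
qed

lemma Box_sub:
  assumes "w \<in> torus q" "m * q \<le> n"
  shows "Box L (x + int m *s w) m \<subseteq> Box L x n"
proof
  fix v assume "v \<in> Box L (x + int m *s w) m"
  then obtain z where z: "z \<in> torus m" "v = proj L (x + (int m *s w + z))"
    by (auto simp: Box_def add.assoc)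
  then show "v \<in> Box L x n"
    unfolding Box_def using torus_combine[OF assms(1) z(1)] torus_mono[OF assms(2)] by blast
qed

lemma Box_disjoint:
  assumes "w \<in> torus q" "w' \<in> torus q" "m * q \<le> L" "w \<noteq> w'"
  shows "Box L (x + int m *s w) m \<inter> Box L (x + int m *s w') m = {}"
proof (rule ccontr)
  assume "Box L (x + int m *s w) m \<inter> Box L (x + int m *s w') m \<noteq> {}"
  then obtain z z' where z: "z \<in> torus m" "z' \<in> torus m"
      "proj L (x + (int m *s w + z)) = proj L (x + (int m *s w' + z'))"
    by (auto simp: Box_def add.assoc)
  have "int m *s w + z = int m *s w' + z'"
    using torus_combine assms z torus_mono[OF assms(3)] by (intro proj_inj_small[OF z(3)]) blast+
  from torus_combine_inj(1)[OF z(1,2) this] assms(4) show False by simp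
qed

section \<open>Paths of particles\<close>

type_synonym 'd path = "(int ^ 'd) list"

fun wt :: "(int ^ 'd::finite \<Rightarrow> int ^ 'd \<Rightarrow> real) \<Rightarrow> 'd path \<Rightarrow> real" where
  "wt k (x # y # ys) = k x y * wt k (y # ys)"
| "wt k xs = 1"

lemma wt_prod: "wt k (x # ys) = (\<Prod>i<length ys. k ((x # ys) ! i) ((x # ys) ! Suc i))"
proof (induction ys arbitrary: x)
  case (Cons y ys)
  then show ?case by (simp add: prod.lessThan_Suc_shift del: prod.lessThan_Suc)
qed simp

definition lists_of :: "nat \<Rightarrow> nat \<Rightarrow> (int ^ 'd::finite) list set" where
  "lists_of L n = {ys. length ys = n \<and> set ys \<subseteq> torus L}"

lemma finite_lists_of [simp]: "finite (lists_of L n)"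
proof -
  have "lists_of L n = {ys. set ys \<subseteq> torus L \<and> length ys = n}" by (auto simp: lists_of_def)
  then show ?thesis using finite_lists_length_eq[OF finite_torus] by metis
qed

lemma lists_of_0: "lists_of L 0 = {[]}"
  by (auto simp: lists_of_def)

lemma lists_of_Suc: "lists_of L (Suc n) = (\<lambda>(y, ys). y # ys) ` (torus L \<times> lists_of L n)"
  by (force simp: lists_of_def length_Suc_conv)

lemma sum_lists_of_Suc:
  "(\<Sum>ys\<in>lists_of L (Suc n). F ys) = (\<Sum>y\<in>torus L. \<Sum>ys\<in>lists_of L n. F (y # ys))"
  unfolding lists_of_Suc by (subst sum.reindex) (auto simp: inj_on_def sum.cartesian_product case_prod_unfold)

text \<open>\<open>l\<close> counts steps, so the lists have \<open>Suc l\<close> vertices.\<close>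

definition paths :: "nat \<Rightarrow> nat \<Rightarrow> 'd::finite path set" where
  "paths L l = lists_of L (Suc l)"

lemma finite_paths [simp]: "finite (paths L l)" by (simp add: paths_def)

text \<open>The parameter \<open>1 - exp (- lam * w x)\<close> is the probability that a Poisson
  variable of mean \<open>lam * w x\<close> is positive, so void probabilities multiply to an
  exponential of the total weight.\<close>

lemma prob_void:
  assumes U: "U \<subseteq> I" and I: "finite I" and w: "\<And>x. x \<in> I \<Longrightarrow> 0 \<le> w x" and lam: "lam > 0"
  shows "measure_pmf.prob (Pi_pmf I False (\<lambda>x. bernoulli_pmf (1 - exp (- lam * w x)))) {f. \<forall>x\<in>U. \<not> f x} =
    exp (- lam * (\<Sum>x\<in>U. w x))"
proof -
  let ?B = "\<lambda>x. if x \<in> U then {False} else UNIV"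
  have b: "pmf (bernoulli_pmf (1 - exp (- lam * w x))) False = exp (- lam * w x)" if "x \<in> I" for x
    using w[OF that] lam by (subst pmf_bernoulli_False) auto
  have "{f. \<forall>x\<in>U. \<not> f x} = Pi I ?B" using U by (auto simp: Pi_def)
  then have "measure_pmf.prob (Pi_pmf I False (\<lambda>x. bernoulli_pmf (1 - exp (- lam * w x)))) {f. \<forall>x\<in>U. \<not> f x} =
      (\<Prod>x\<in>I. measure_pmf.prob (bernoulli_pmf (1 - exp (- lam * w x))) (?B x))"
    by (simp only: measure_Pi_pmf_Pi[OF I])
  also have "\<dots> = (\<Prod>x\<in>I. if x \<in> U then exp (- lam * w x) else 1)"
  proof (rule prod.cong[OF refl])
    fix x assume "x \<in> I"
    from b[OF this] show "measure_pmf.prob (bernoulli_pmf (1 - exp (- lam * w x))) (?B x) =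
        (if x \<in> U then exp (- lam * w x) else 1)"
      by (cases "x \<in> U") (simp_all add: measure_pmf_single)
  qed
  also have "\<dots> = (\<Prod>x\<in>U. exp (- lam * w x))"
    using prod.inter_restrict[OF I, of "\<lambda>x. exp (- lam * w x)" U] U by (simp add: Int_absorb1)
  also have "\<dots> = exp (- lam * (\<Sum>x\<in>U. w x))"
    using finite_subset[OF U I] by (simp add: exp_sum sum_distrib_left)
  finally show ?thesis .
qed

context heavy_kernel
begin

abbreviation "kq L \<equiv> torus_kernel L Q"

lemma wt_nonneg: "wt (kq L) xs \<ge> 0"
  by (induction "kq L" xs rule: wt.induct) (auto simp: torus_kernel_nonneg[OF kernel])

lemma sum_kq:
  assumes L: "L > 0" and F: "periodic L F"
  shows "(\<Sum>y\<in>torus L. kq L x y * F y) = (\<Sum>z\<in>torus L. qL L z * F (x + z))"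
proof -
  interpret torus_walk L "qL L" by (rule torus_walk[OF L])
  have per: "periodic L (\<lambda>z. qL L z * F (x + z))"
    using periodic_mult[OF q_periodic periodic_shift[OF F, of x]] by (simp add: add.commute)
  have "(\<Sum>y\<in>torus L. kq L x y * F y) = (\<Sum>y\<in>torus L. qL L (y + - x) * F (x + (y + - x)))"
    by (simp add: torus_kernel_diff[of L x])
  also have "\<dots> = (\<Sum>z\<in>torus L. qL L z * F (x + z))" by (rule sum_torus_shift[OF L per])
  finally show ?thesis .
qed

lemma sum_wt: "L > 0 \<Longrightarrow> (\<Sum>ys\<in>lists_of L n. wt (kq L) (x # ys)) = 1"
proof (induction n arbitrary: x)
  case (Suc n)
  have "(\<Sum>ys\<in>lists_of L (Suc n). wt (kq L) (x # ys)) =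
      (\<Sum>y\<in>torus L. kq L x y * (\<Sum>ys\<in>lists_of L n. wt (kq L) (y # ys)))"
    by (simp add: sum_lists_of_Suc sum_distrib_left)
  also have "\<dots> = (\<Sum>y\<in>torus L. kq L x y * 1)" using Suc by simp
  also have "\<dots> = 1"
    using sum_kq[OF Suc.prems, of "\<lambda>_. 1" x] sum_torus_kernel[OF kernel Suc.prems] by (simp add: periodic_def)
  finally show ?case .
qed (simp add: lists_of_0)

lemma sum_wt_hit:
  assumes L: "L > 0" and u: "u \<in> torus L" and x: "x \<in> torus L"
  shows "(\<Sum>ys\<in>lists_of L n. if u \<in> set (x # ys) then wt (kq L) (x # ys) else 0) =
    torus_walk.hit L (qL L) n (x - u)"
proof -
  interpret torus_walk L "qL L" by (rule torus_walk[OF L])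
  have pz: "proj L (y - u) = 0 \<longleftrightarrow> y = u" if "y \<in> torus L" for y
  proof
    assume *: "proj L (y - u) = 0"
    have "y = proj L (proj L (y - u) + u)" using that by (simp add: proj_id)
    then show "y = u" unfolding * using u by (simp add: proj_id)
  qed simp
  show ?thesis using x
  proof (induction n arbitrary: x)
    case 0
    then show ?case using pz[of x] by (auto simp: lists_of_0)
  next
    case (Suc n)
    show ?case
    proof (cases "x = u")
      case True
      then show ?thesis using pz[OF Suc.prems] sum_wt[OF L, where n = "Suc n"] by simp
    next
      case False
      have "(\<Sum>ys\<in>lists_of L (Suc n). if u \<in> set (x # ys) then wt (kq L) (x # ys) else 0) =
          (\<Sum>y\<in>torus L. kq L x y * (\<Sum>ys\<in>lists_of L n. if u \<in> set (y # ys) then wt (kq L) (y # ys) else 0))"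
        using False by (simp add: sum_lists_of_Suc sum_distrib_left) (intro sum.cong refl, auto)
      also have "\<dots> = (\<Sum>y\<in>torus L. kq L x y * hit n (y - u))"
        by (intro sum.cong refl arg_cong2[of _ _ _ _ "(*)"] Suc.IH)
      also have "\<dots> = (\<Sum>z\<in>torus L. qL L z * hit n (x + z - u))"
        using sum_kq[OF L periodic_shift[OF hit_periodic[of n], of "- u"], of x] by simp
      also have "\<dots> = hit (Suc n) (x - u)"
        using False pz[OF Suc.prems] by (simp add: algebra_simps)
      finally show ?thesis .
    qed
  qed
qed

text \<open>A fixed nonzero displacement; \<open>undefined\<close> merely names some coordinate
  direction. Reserving this first step for open blocks separates them from all constructions that
  use other first steps.\<close>

definition step0 :: "int ^ 'd" where "step0 = axis undefined 1"

lemma step0_neq_0: "step0 \<noteq> 0" by (auto simp: step0_def axis_def vec_eq_iff)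

definition base_class :: "nat \<Rightarrow> nat \<Rightarrow> (int ^ 'd) set \<Rightarrow> 'd path set" where
  "base_class L l B = {xs \<in> paths L l. hd xs \<in> B \<and> xs ! 1 = proj L (hd xs + step0)}"

definition path_law :: "nat \<Rightarrow> nat \<Rightarrow> real \<Rightarrow> ('d path \<Rightarrow> bool) pmf" where
  "path_law L l lam = Pi_pmf (paths L l) False (\<lambda>xs. bernoulli_pmf (1 - exp (- lam * wt (kq L) xs)))"

text \<open>The exponent is, up to sign, the mean number of particles that start in
  \<open>B\<close>, make the prescribed first step and then visit \<open>u\<close>; the class
  \<open>?U\<close> lists the corresponding paths.\<close>

lemma prob_not_hit:
  assumes L: "L > 0" and lam: "lam > 0" and B: "B \<subseteq> torus L" and u: "u \<in> torus L"
  shows "measure_pmf.prob (path_law L (Suc n) lam) {f. \<forall>xs\<in>base_class L (Suc n) B. u \<in> set xs \<longrightarrow> \<not> f xs} \<le>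
    exp (- lam * (qL L step0 * (\<Sum>v\<in>B. torus_walk.hit L (qL L) n (v + step0 - u))))"
proof -
  interpret torus_walk L "qL L" by (rule torus_walk[OF L])
  let ?w = "\<lambda>v. proj L (v + step0)"
  let ?U = "(\<lambda>(v, ys). v # ?w v # ys) ` (SIGMA v:B. {ys\<in>lists_of L n. u \<in> set (?w v # ys)})"
  have U: "?U \<subseteq> base_class L (Suc n) B"
    using B L by (auto simp: base_class_def paths_def lists_of_def)
  have "measure_pmf.prob (path_law L (Suc n) lam) {f. \<forall>xs\<in>base_class L (Suc n) B. u \<in> set xs \<longrightarrow> \<not> f xs} \<le>
      measure_pmf.prob (path_law L (Suc n) lam) {f. \<forall>xs\<in>?U. \<not> f xs}"
    by (rule prob_mono_pmf) (use U in fastforce)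
  also have "\<dots> = exp (- lam * (\<Sum>xs\<in>?U. wt (kq L) xs))"
    unfolding path_law_def
    by (rule prob_void) (use U lam in \<open>auto simp: base_class_def wt_nonneg\<close>)
  also have "(\<Sum>xs\<in>?U. wt (kq L) xs) = (\<Sum>v\<in>B. \<Sum>ys\<in>{ys\<in>lists_of L n. u \<in> set (?w v # ys)}. wt (kq L) (v # ?w v # ys))"
    using finite_subset[OF B] by (subst sum.reindex) (auto simp: inj_on_def sum.Sigma case_prod_unfold)
  also have "\<dots> = (\<Sum>v\<in>B. qL L step0 * hit n (v + step0 - u))"
  proof (rule sum.cong[OF refl])
    fix v assume "v \<in> B"
    have "(\<Sum>ys\<in>{ys\<in>lists_of L n. u \<in> set (?w v # ys)}. wt (kq L) (v # ?w v # ys)) =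
        kq L v (?w v) * (\<Sum>ys\<in>{ys\<in>lists_of L n. u \<in> set (?w v # ys)}. wt (kq L) (?w v # ys))"
      by (simp add: sum_distrib_left)
    also have "kq L v (?w v) = qL L step0"
      unfolding torus_kernel_diff[of L v] by (rule periodic_cong[OF q_periodic]) simp
    also have "(\<Sum>ys\<in>{ys\<in>lists_of L n. u \<in> set (?w v # ys)}. wt (kq L) (?w v # ys)) =
        (\<Sum>ys\<in>lists_of L n. if u \<in> set (?w v # ys) then wt (kq L) (?w v # ys) else 0)"
      by (rule sum.inter_filter) simp
    also have "\<dots> = hit n (?w v - u)" by (rule sum_wt_hit[OF L u]) (use L in simp)
    also have "\<dots> = hit n (v + step0 - u)" by (rule periodic_cong[OF hit_periodic]) simp
    finally show "(\<Sum>ys\<in>{ys\<in>lists_of L n. u \<in> set (?w v # ys)}. wt (kq L) (v # ?w v # ys)) =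
        qL L step0 * hit n (v + step0 - u)" .
  qed
  finally show ?thesis by (simp only: sum_distrib_left)
qed

text \<open>Relative to its lower corner a block occupies \<open>[0, r)\<close> in each coordinate,
  so this range covers it together with all neighbouring blocks.\<close>

definition window :: "nat \<Rightarrow> (int ^ 'd) set" where
  "window r = {t. \<forall>i. t $ i \<in> {- int r..<2 * int r}}"

lemma finite_window [simp]: "finite (window r)"
  unfolding window_def by (rule finite_vec_box) simp

lemma card_window: "card (window r) = (3 * r) ^ CARD('d)"
proof -
  have "card {- int r..<2 * int r} = 3 * r" by simp
  then show ?thesis unfolding window_def by (subst card_vec_box) simp
qed

definition open_block :: "nat \<Rightarrow> nat \<Rightarrow> nat \<Rightarrow> int ^ 'd \<Rightarrow> ('d path \<Rightarrow> bool) \<Rightarrow> bool" where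
  "open_block L l r x f \<longleftrightarrow>
     (\<forall>t\<in>window r. \<exists>xs\<in>base_class L l (Box L x r). proj L (x + t) \<in> set xs \<and> f xs)"

text \<open>The displacements from the block, after the first step, to a fixed vertex of the window
  form a set of \<open>r ^ d\<close> points in the cube of radius \<open>4 * r\<close>, so one
  hypothesis on sets \<open>W\<close> covers every vertex of the window.\<close>

lemma prob_not_open_block:
  assumes L: "L > 0" and lam: "lam > 0" and r: "r \<ge> 1" "r \<le> L" and e: "e \<ge> 0"
    and hit: "\<And>W. W \<subseteq> torus_walk.cube (4 * r) \<Longrightarrow> card W = r ^ CARD('d) \<Longrightarrow> e \<le> (\<Sum>z\<in>W. torus_walk.hit L (qL L) n z)"
  shows "measure_pmf.prob (path_law L (Suc n) lam) {f. \<not> open_block L (Suc n) r x f} \<le>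
    real ((3 * r) ^ CARD('d)) * exp (- lam * (Q 0 step0 * e))"
proof -
  interpret torus_walk L "qL L" by (rule torus_walk[OF L])
  have "measure_pmf.prob (path_law L (Suc n) lam) {f. \<not> open_block L (Suc n) r x f} \<le>
      measure_pmf.prob (path_law L (Suc n) lam)
        {f. \<exists>t\<in>window r. \<forall>xs\<in>base_class L (Suc n) (Box L x r). proj L (x + t) \<in> set xs \<longrightarrow> \<not> f xs}"
    by (rule prob_mono_pmf) (auto simp: open_block_def)
  also have "\<dots> \<le> (\<Sum>t\<in>window r. exp (- lam * (Q 0 step0 * e)))"
  proof (rule prob_union_le)
    fix t assume t: "t \<in> window r"
    let ?g = "\<lambda>z. z + step0 - t"
    have inj: "inj_on ?g (torus r)" by (simp add: inj_on_def)
    have W: "?g ` torus r \<subseteq> cube (4 * r)"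
    proof
      fix y assume "y \<in> ?g ` torus r"
      then obtain z where z: "z \<in> torus r" "y = ?g z" by blast
      have "\<bar>y $ i\<bar> \<le> int (4 * r)" for i
      proof -
        have "0 \<le> z $ i" "z $ i < int r" "- int r \<le> t $ i" "t $ i < 2 * int r" "0 \<le> step0 $ i" "step0 $ i \<le> 1"
          using z t by (auto simp: torus_def window_def step0_def axis_def)
        then show ?thesis using r(1) unfolding z(2) by simp
      qed
      then show "y \<in> cube (4 * r)" by (simp add: cube_def)
    qed
    have "(\<Sum>v\<in>Box L x r. hit n (v + step0 - proj L (x + t))) =
        (\<Sum>z\<in>torus r. hit n (proj L (x + z) + step0 - proj L (x + t)))"
      unfolding Box_def by (simp add: sum.reindex[OF inj_on_Box[OF r(2)]])
    also have "\<dots> = (\<Sum>z\<in>torus r. hit n (?g z))"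
    proof (intro sum.cong refl periodic_cong[OF hit_periodic])
      fix z
      have "proj L (proj L (x + z) + step0 - proj L (x + t)) = proj L (proj L (x + z) + (step0 - (x + t)))"
        by (simp add: add_diff_eq)
      also have "\<dots> = proj L ((x + z) + (step0 - (x + t)))" by (simp only: proj_simps)
      also have "(x + z) + (step0 - (x + t)) = ?g z" by simp
      finally show "proj L (proj L (x + z) + step0 - proj L (x + t)) = proj L (?g z)" .
    qed
    also have "\<dots> = (\<Sum>y\<in>?g ` torus r. hit n y)" by (simp add: sum.reindex[OF inj])
    finally have e_le: "e \<le> (\<Sum>v\<in>Box L x r. hit n (v + step0 - proj L (x + t)))"
      using hit[OF W] by (simp add: card_image[OF inj] card_torus)
    have "measure_pmf.prob (path_law L (Suc n) lam)
        {f. \<forall>xs\<in>base_class L (Suc n) (Box L x r). proj L (x + t) \<in> set xs \<longrightarrow> \<not> f xs} \<le>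
      exp (- lam * (qL L step0 * (\<Sum>v\<in>Box L x r. hit n (v + step0 - proj L (x + t)))))"
      by (rule prob_not_hit[OF L lam Box_subset_torus[OF L]]) (use L in simp)
    also have "\<dots> \<le> exp (- lam * (Q 0 step0 * e))"
      unfolding exp_le_cancel_iff mult_minus_left neg_le_iff_le
      using lam e by (intro mult_left_mono mult_mono qL_ge e_le) (auto simp: q_nonneg)
    finally show "measure_pmf.prob (path_law L (Suc n) lam)
        {f. \<forall>xs\<in>base_class L (Suc n) (Box L x r). proj L (x + t) \<in> set xs \<longrightarrow> \<not> f xs} \<le>
      exp (- lam * (Q 0 step0 * e))" .
  qed simp
  also have "\<dots> = real ((3 * r) ^ CARD('d)) * exp (- lam * (Q 0 step0 * e))"
    by (simp only: sum_constant card_window)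
  finally show ?thesis .
qed

text \<open>The union over the window costs a power of \<open>k\<close>, while the failure at one
  vertex is exponentially small in \<open>k powr (1 / 4)\<close>; a single large \<open>k\<close>
  thus fixes the side of the blocks and the length of the paths.\<close>

lemma open_block_likely:
  assumes lam: "lam > 0" and \<epsilon>: "\<epsilon> > 0"
  obtains r n where "r \<ge> R"
    "\<forall>\<^sub>F L in at_top. \<forall>x. measure_pmf.prob (path_law L (Suc n) lam) {f. \<not> open_block L (Suc n) r x f} \<le> \<epsilon>"
proof -
  obtain c b \<theta> r n where bh: "c > 0" "b > 0" "\<theta> > 0" "filterlim r at_top at_top" "\<And>k. real (r k) \<le> b * real k powr \<theta>"
    "\<forall>\<^sub>F k in at_top. \<forall>\<^sub>F L in at_top. \<forall>W \<subseteq> torus_walk.cube (4 * r k). card W = r k ^ CARD('d) \<longrightarrow>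
       c * real k powr (1 / 4) \<le> (\<Sum>z\<in>W. torus_walk.hit L (qL L) (n k) z)"
    using block_hitting by blast
  define g where "g = lam * Q 0 step0 * c"
  have g: "g > 0" using lam bh(1) Q0_pos[OF step0_neq_0] by (simp add: g_def)
  have "((\<lambda>k::nat. (3 * b * real k powr \<theta>) ^ CARD('d) * exp (- g * real k powr (1 / 4))) \<longlongrightarrow> 0) at_top"
    using bh(2,3) g by real_asymp
  then have "\<forall>\<^sub>F k in at_top. (3 * b * real k powr \<theta>) ^ CARD('d) * exp (- g * real k powr (1 / 4)) < \<epsilon>"
    using \<epsilon> by (rule order_tendstoD)
  moreover have "\<forall>\<^sub>F k in at_top. r k \<ge> max 1 R" using bh(4) unfolding filterlim_at_top by blast
  ultimately have "\<forall>\<^sub>F k in at_top. (3 * b * real k powr \<theta>) ^ CARD('d) * exp (- g * real k powr (1 / 4)) < \<epsilon> \<and>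
     r k \<ge> max 1 R \<and> (\<forall>\<^sub>F L in at_top. \<forall>W \<subseteq> torus_walk.cube (4 * r k). card W = r k ^ CARD('d) \<longrightarrow>
       c * real k powr (1 / 4) \<le> (\<Sum>z\<in>W. torus_walk.hit L (qL L) (n k) z))"
    using bh(6) by eventually_elim auto
  then obtain k where k: "(3 * b * real k powr \<theta>) ^ CARD('d) * exp (- g * real k powr (1 / 4)) < \<epsilon>"
     "r k \<ge> max 1 R" "\<forall>\<^sub>F L in at_top. \<forall>W \<subseteq> torus_walk.cube (4 * r k). card W = r k ^ CARD('d) \<longrightarrow>
       c * real k powr (1 / 4) \<le> (\<Sum>z\<in>W. torus_walk.hit L (qL L) (n k) z)"
    using eventually_happens by (metis (no_types, lifting) trivial_limit_at_top_linorder)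
  have "\<forall>\<^sub>F L in at_top. \<forall>x. measure_pmf.prob (path_law L (Suc (n k)) lam) {f. \<not> open_block L (Suc (n k)) (r k) x f} \<le> \<epsilon>"
    using k(3) eventually_ge_at_top[of "r k"]
  proof eventually_elim
    case (elim L)
    have L: "L > 0" using elim(2) k(2) by simp
    have "real ((3 * r k) ^ CARD('d)) * exp (- lam * (Q 0 step0 * (c * real k powr (1 / 4)))) \<le>
        (3 * b * real k powr \<theta>) ^ CARD('d) * exp (- g * real k powr (1 / 4))"
    proof (rule mult_mono)
      show "real ((3 * r k) ^ CARD('d)) \<le> (3 * b * real k powr \<theta>) ^ CARD('d)"
        unfolding of_nat_power using bh(5)[of k] by (intro power_mono) auto
    qed (use bh(2) in \<open>auto simp: g_def mult.assoc intro!: mult_nonneg_nonneg zero_le_power\<close>)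
    then have le: "real ((3 * r k) ^ CARD('d)) * exp (- lam * (Q 0 step0 * (c * real k powr (1 / 4)))) \<le> \<epsilon>"
      using k(1) by linarith
    show ?case
    proof
      fix x
      show "measure_pmf.prob (path_law L (Suc (n k)) lam) {f. \<not> open_block L (Suc (n k)) (r k) x f} \<le> \<epsilon>"
        by (rule order_trans[OF prob_not_open_block[OF L lam _ elim(2)] le])
           (use k(2) bh(1) elim(1) in auto)
    qed
  qed
  with that[of "r k" "n k"] k(2) show ?thesis by simp
qed

end

section \<open>Poisson thinning\<close>

text \<open>Multiplicities are forgotten: whether some particle follows the path is a Bernoulli
  variable, whereas the number of such particles would be a Poisson variable.\<close>

definition present :: "nat \<Rightarrow> nat \<Rightarrow> ('d::finite) frog_sample \<Rightarrow> 'd path \<Rightarrow> bool" where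
  "present L l \<omega> xs \<longleftrightarrow> xs \<in> paths L l \<and>
     (\<exists>j<fst \<omega> (hd xs). \<forall>k\<le>l. fst (snd \<omega>) (hd xs, j) k = xs ! k)"

lemma poisson_generating_function:
  assumes "lam > 0" "0 \<le> a" "a \<le> 1"
  shows "(\<integral>\<^sup>+n. ennreal ((1 - a) ^ n) \<partial>measure_pmf (poisson_pmf lam)) = ennreal (exp (- lam * a))"
proof -
  have "(\<integral>\<^sup>+n. ennreal ((1 - a) ^ n) \<partial>measure_pmf (poisson_pmf lam)) =
      (\<Sum>n. ennreal (pmf (poisson_pmf lam) n * (1 - a) ^ n))"
    using assms by (simp add: nn_integral_measure_pmf nn_integral_count_space_nat del: pmf_poisson flip: ennreal_mult)
  also have "\<dots> = ennreal (exp (- lam * a))"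
  proof (rule suminf_ennreal_eq)
    show "0 \<le> pmf (poisson_pmf lam) n * (1 - a) ^ n" for n using assms by simp
    have "(\<lambda>n. exp (- lam) * ((lam * (1 - a)) ^ n /\<^sub>R fact n)) sums (exp (- lam) * exp (lam * (1 - a)))"
      by (intro sums_mult exp_converges)
    moreover have "exp (- lam) * exp (lam * (1 - a)) = exp (- lam * a)"
      by (simp add: exp_add[symmetric] algebra_simps)
    moreover have "exp (- lam) * ((lam * (1 - a)) ^ n /\<^sub>R fact n) = pmf (poisson_pmf lam) n * (1 - a) ^ n" for n
      using assms by (simp add: power_mult_distrib divide_inverse)
    ultimately show "(\<lambda>n. pmf (poisson_pmf lam) n * (1 - a) ^ n) sums exp (- lam * a)" by simp
  qed
  finally show ?thesis .
qed

context heavy_kernel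
begin

definition follows :: "nat \<Rightarrow> (nat \<Rightarrow> int ^ 'd) \<Rightarrow> 'd path \<Rightarrow> bool" where
  "follows l S xs \<longleftrightarrow> (\<forall>k\<le>l. S k = xs ! k)"

lemma paths_nth_in: "xs \<in> paths L l \<Longrightarrow> k \<le> l \<Longrightarrow> xs ! k \<in> torus L"
proof -
  assume "xs \<in> paths L l" "k \<le> l"
  then have "k < length xs" "set xs \<subseteq> torus L" by (simp_all add: paths_def lists_of_def)
  then show "xs ! k \<in> torus L" using nth_mem by blast
qed

lemma sets_follows:
  assumes "xs \<in> paths L l"
  shows "{S \<in> space (walk_law L Q v). follows l S xs} \<in> sets (walk_law L Q v)"
  unfolding follows_def by measurable (auto simp: paths_nth_in[OF assms])

lemma measure_follows:
  assumes L: "L > 0" and v: "v \<in> torus L" and xs: "xs \<in> paths L l"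
  shows "measure (walk_law L Q v) {S \<in> space (walk_law L Q v). follows l S xs} =
    (if hd xs = v then wt (kq L) xs else 0)"
proof -
  obtain y ys where y: "xs = y # ys" "length ys = l"
    using xs by (auto simp: paths_def lists_of_def length_Suc_conv)
  show ?thesis
    using walk_law_cylinder[OF kernel L v, of l "\<lambda>k. xs ! k"] paths_nth_in[OF xs] wt_prod[of "kq L" y ys] y
    by (cases "y = v") (auto simp: follows_def)
qed

text \<open>A trajectory follows at most one path of a given length, so the probabilities of
  following the paths in \<open>U\<close> add up.\<close>

lemma measure_avoids:
  assumes L: "L > 0" and v: "v \<in> torus L" and U: "U \<subseteq> paths L l" "\<And>xs. xs \<in> U \<Longrightarrow> hd xs = v"
  shows "{S \<in> space (walk_law L Q v). \<forall>xs\<in>U. \<not> follows l S xs} \<in> sets (walk_law L Q v)"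
    and "measure (walk_law L Q v) {S \<in> space (walk_law L Q v). \<forall>xs\<in>U. \<not> follows l S xs} =
      1 - (\<Sum>xs\<in>U. wt (kq L) xs)"
proof -
  let ?M = "walk_law L Q v"
  let ?E = "\<lambda>xs. {S \<in> space ?M. follows l S xs}"
  interpret prob_space ?M by (rule prob_space_walk_law[OF kernel L])
  have fU: "finite U" by (rule finite_subset[OF U(1)]) simp
  have E: "?E xs \<in> sets ?M" if "xs \<in> U" for xs using sets_follows U(1) that by blast
  have eq: "{S \<in> space ?M. \<forall>xs\<in>U. \<not> follows l S xs} = space ?M - (\<Union>xs\<in>U. ?E xs)" by auto
  have UE: "(\<Union>xs\<in>U. ?E xs) \<in> sets ?M" using E fU by (intro sets.finite_UN) auto
  show "{S \<in> space ?M. \<forall>xs\<in>U. \<not> follows l S xs} \<in> sets ?M" unfolding eq using UE by auto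
  have disj: "disjoint_family_on ?E U"
    unfolding disjoint_family_on_def
  proof (intro ballI impI)
    fix xs ys assume xy: "xs \<in> U" "ys \<in> U" "xs \<noteq> ys"
    show "?E xs \<inter> ?E ys = {}"
    proof (rule ccontr)
      assume "?E xs \<inter> ?E ys \<noteq> {}"
      then have "xs ! k = ys ! k" if "k \<le> l" for k using that unfolding follows_def by auto
      moreover have "length xs = Suc l" "length ys = Suc l" using xy U(1) by (auto simp: paths_def lists_of_def)
      ultimately have "xs = ys" by (intro nth_equalityI) (auto simp: less_Suc_eq_le)
      with xy show False by simp
    qed
  qed
  have "measure ?M (\<Union>xs\<in>U. ?E xs) = (\<Sum>xs\<in>U. measure ?M (?E xs))"
    by (rule finite_measure_finite_Union[OF fU _ disj]) (use E in auto)
  also have "\<dots> = (\<Sum>xs\<in>U. wt (kq L) xs)"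
    using U measure_follows[OF L v] by (intro sum.cong) auto
  finally show "measure ?M {S \<in> space ?M. \<forall>xs\<in>U. \<not> follows l S xs} = 1 - (\<Sum>xs\<in>U. wt (kq L) xs)"
    unfolding eq using prob_compl[OF UE] by simp
qed

lemma sum_wt_le_1:
  assumes L: "L > 0" and v: "v \<in> torus L" and U: "U \<subseteq> paths L l"
  shows "(\<Sum>xs\<in>{xs\<in>U. hd xs = v}. wt (kq L) xs) \<le> 1"
proof -
  have "{xs\<in>U. hd xs = v} \<subseteq> paths L l" using U by auto
  from measure_avoids(2)[OF L v this]
  have "1 - (\<Sum>xs\<in>{xs\<in>U. hd xs = v}. wt (kq L) xs) =
      measure (walk_law L Q v) {S \<in> space (walk_law L Q v). \<forall>xs\<in>{xs\<in>U. hd xs = v}. \<not> follows l S xs}"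
    by simp
  also have "\<dots> \<ge> 0" by (rule measure_nonneg)
  finally show ?thesis by simp
qed

abbreviation "numbers_law L lam \<equiv> \<Pi>\<^sub>M v\<in>(torus L :: (int ^ 'd) set). measure_pmf (poisson_pmf lam)"
abbreviation "walks_law L \<equiv> \<Pi>\<^sub>M p\<in>torus L \<times> (UNIV :: nat set). walk_law L Q (fst p)"

lemma emeasure_walks_avoid:
  assumes L: "L > 0" and U: "U \<subseteq> paths L l"
  shows "{S \<in> space (walks_law L). \<forall>xs\<in>U. \<forall>j<\<eta> (hd xs). \<not> follows l (S (hd xs, j)) xs} \<in> sets (walks_law L)"
    and "emeasure (walks_law L) {S \<in> space (walks_law L). \<forall>xs\<in>U. \<forall>j<\<eta> (hd xs). \<not> follows l (S (hd xs, j)) xs} =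
     (\<Prod>v\<in>torus L. ennreal ((1 - (\<Sum>xs\<in>{xs\<in>U. hd xs = v}. wt (kq L) xs)) ^ \<eta> v))"
proof -
  interpret product_prob_space "\<lambda>p. walk_law L Q (fst p)" "torus L \<times> (UNIV :: nat set)"
    using prob_space_walk_law[OF kernel L]
    by (simp add: product_prob_space_def product_sigma_finite_def product_prob_space_axioms_def
        prob_space_imp_sigma_finite)
  let ?J = "SIGMA v:torus L. {..<\<eta> v}"
  let ?U = "\<lambda>v. {xs\<in>U. hd xs = v}"
  let ?A = "\<lambda>p. {S \<in> space (walk_law L Q (fst p)). \<forall>xs\<in>?U (fst p). \<not> follows l S xs}"
  have J: "?J \<subseteq> torus L \<times> UNIV" "finite ?J" by auto
  have A: "?A p \<in> sets (walk_law L Q (fst p))" if "p \<in> ?J" for p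
    using that U by (intro measure_avoids(1)[OF L]) auto
  have hd: "hd xs \<in> torus L" if "xs \<in> U" for xs
    using U that by (auto simp: paths_def lists_of_def length_Suc_conv)
  have spc: "S p \<in> space (walk_law L Q (fst p))" if "S \<in> space (walks_law L)" "p \<in> ?J" for S p
    using that J(1) by (auto simp: space_PiM)
  have eq: "{S \<in> space (walks_law L). \<forall>xs\<in>U. \<forall>j<\<eta> (hd xs). \<not> follows l (S (hd xs, j)) xs} =
      {S \<in> space (walks_law L). \<forall>p\<in>?J. S p \<in> ?A p}"
    using spc hd by (intro Collect_cong conj_cong refl) fastforce
  show "{S \<in> space (walks_law L). \<forall>xs\<in>U. \<forall>j<\<eta> (hd xs). \<not> follows l (S (hd xs, j)) xs} \<in> sets (walks_law L)"
    unfolding eq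
  proof (intro sets.sets_Collect_finite_All J(2))
    fix p assume p: "p \<in> ?J"
    have "{S \<in> space (walks_law L). S p \<in> ?A p} = (\<lambda>S. S p) -` ?A p \<inter> space (walks_law L)" by auto
    also have "\<dots> \<in> sets (walks_law L)"
    proof (rule measurable_sets[OF _ A[OF p]])
      show "(\<lambda>S. S p) \<in> walks_law L \<rightarrow>\<^sub>M walk_law L Q (fst p)"
        by (rule measurable_component_singleton) (use p J(1) in auto)
    qed
    finally show "{S \<in> space (walks_law L). S p \<in> ?A p} \<in> sets (walks_law L)" .
  qed
  have "emeasure (walks_law L) {S \<in> space (walks_law L). \<forall>p\<in>?J. S p \<in> ?A p} =
      (\<Prod>p\<in>?J. emeasure (walk_law L Q (fst p)) (?A p))"
    by (rule emeasure_PiM_Collect[OF J A])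
  also have "\<dots> = (\<Prod>p\<in>?J. ennreal (1 - (\<Sum>xs\<in>?U (fst p). wt (kq L) xs)))"
  proof (rule prod.cong[OF refl])
    fix p assume p: "p \<in> ?J"
    have "measure (walk_law L Q (fst p)) (?A p) = 1 - (\<Sum>xs\<in>?U (fst p). wt (kq L) xs)"
      by (rule measure_avoids(2)[OF L]) (use p U in auto)
    then show "emeasure (walk_law L Q (fst p)) (?A p) = ennreal (1 - (\<Sum>xs\<in>?U (fst p). wt (kq L) xs))"
      by (simp add: M.emeasure_eq_measure)
  qed
  also have "\<dots> = (\<Prod>v\<in>torus L. \<Prod>j<\<eta> v. ennreal (1 - (\<Sum>xs\<in>?U v. wt (kq L) xs)))"
    by (subst prod.Sigma) (auto simp: case_prod_unfold)
  also have "\<dots> = (\<Prod>v\<in>torus L. ennreal ((1 - (\<Sum>xs\<in>?U v. wt (kq L) xs)) ^ \<eta> v))"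
  proof (rule prod.cong[OF refl])
    fix v :: "int ^ 'd" assume v: "v \<in> torus L"
    have "0 \<le> 1 - (\<Sum>xs\<in>?U v. wt (kq L) xs)" using sum_wt_le_1[OF L v U] by simp
    then show "(\<Prod>j<\<eta> v. ennreal (1 - (\<Sum>xs\<in>?U v. wt (kq L) xs))) =
        ennreal ((1 - (\<Sum>xs\<in>?U v. wt (kq L) xs)) ^ \<eta> v)" by (simp add: ennreal_power)
  qed
  finally show "emeasure (walks_law L) {S \<in> space (walks_law L). \<forall>xs\<in>U. \<forall>j<\<eta> (hd xs). \<not> follows l (S (hd xs, j)) xs} =
     (\<Prod>v\<in>torus L. ennreal ((1 - (\<Sum>xs\<in>?U v. wt (kq L) xs)) ^ \<eta> v))"
    unfolding eq .
qed

lemma sets_present: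
  assumes L: "L > 0"
  shows "{\<omega> \<in> space (frog_law L Q lam). present L l \<omega> xs} \<in> sets (frog_law L Q lam)"
proof (cases "xs \<in> paths L l")
  case False
  then show ?thesis by (simp add: present_def)
next
  case True
  then have hd: "hd xs \<in> torus L" by (auto simp: paths_def lists_of_def length_Suc_conv)
  let ?F = "frog_law L Q lam"
  have "(\<lambda>\<omega>. fst \<omega> (hd xs)) \<in> ?F \<rightarrow>\<^sub>M measure_pmf (poisson_pmf lam)"
    unfolding frog_law_def using hd by measurable
  then have [measurable]: "(\<lambda>\<omega>. fst \<omega> (hd xs)) \<in> ?F \<rightarrow>\<^sub>M count_space UNIV" by simp
  have walk: "(\<lambda>\<omega>. fst (snd \<omega>) (hd xs, j)) \<in> ?F \<rightarrow>\<^sub>M walk_law L Q (fst (hd xs, j))" for j :: nat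
    unfolding frog_law_def
    by (rule measurable_compose[where g = "\<lambda>S. S (hd xs, j)",
          OF measurable_compose[OF measurable_snd measurable_fst]
            measurable_component_singleton]) (use hd in auto)
  have [measurable]: "Measurable.pred ?F (\<lambda>\<omega>. follows l (fst (snd \<omega>) (hd xs, j)) xs)" for j
  proof -
    have "{\<omega> \<in> space ?F. follows l (fst (snd \<omega>) (hd xs, j)) xs} =
      (\<lambda>\<omega>. fst (snd \<omega>) (hd xs, j)) -` {S \<in> space (walk_law L Q (fst (hd xs, j))). follows l S xs} \<inter> space ?F"
      using measurable_space[OF walk[of j]] by auto
    also have "\<dots> \<in> sets ?F" by (rule measurable_sets[OF walk sets_follows[OF True]])
    finally show ?thesis by (simp add: pred_def)
  qed
  have "Measurable.pred ?F (\<lambda>\<omega>. \<exists>j<fst \<omega> (hd xs). follows l (fst (snd \<omega>) (hd xs, j)) xs)"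
    by measurable
  then have "{\<omega> \<in> space ?F. \<exists>j<fst \<omega> (hd xs). follows l (fst (snd \<omega>) (hd xs, j)) xs} \<in> sets ?F"
    unfolding pred_def .
  moreover have "present L l \<omega> xs \<longleftrightarrow> (\<exists>j<fst \<omega> (hd xs). follows l (fst (snd \<omega>) (hd xs, j)) xs)" for \<omega>
    using True by (simp only: present_def follows_def simp_thms)
  ultimately show ?thesis by (simp only:)
qed

lemma sets_planted:
  assumes "{S \<in> space (walk_law L Q 0). \<psi> S} \<in> sets (walk_law L Q 0)"
  shows "{\<omega> \<in> space (frog_law L Q lam). \<psi> (snd (snd \<omega>))} \<in> sets (frog_law L Q lam)"
proof -
  have m: "(\<lambda>\<omega>. snd (snd \<omega>)) \<in> frog_law L Q lam \<rightarrow>\<^sub>M walk_law L Q 0"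
    unfolding frog_law_def by measurable
  have "{\<omega> \<in> space (frog_law L Q lam). \<psi> (snd (snd \<omega>))} =
      (\<lambda>\<omega>. snd (snd \<omega>)) -` {S \<in> space (walk_law L Q 0). \<psi> S} \<inter> space (frog_law L Q lam)"
    using measurable_space[OF m] by auto
  also have "\<dots> \<in> sets (frog_law L Q lam)" by (rule measurable_sets[OF m assms])
  finally show ?thesis .
qed

text \<open>Given the particle numbers, every particle avoids \<open>U\<close> independently;
  averaging over Poisson numbers turns the factor of each vertex into an exponential. The event
  \<open>\<psi>\<close> of the planted trajectory is carried along as an independent factor.\<close>

lemma emeasure_void:
  assumes L: "L > 0" and lam: "lam > 0" and U: "U \<subseteq> paths L l"
    and \<psi>: "{S \<in> space (walk_law L Q 0). \<psi> S} \<in> sets (walk_law L Q 0)"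
  shows "emeasure (frog_law L Q lam)
      {\<omega> \<in> space (frog_law L Q lam). (\<forall>xs\<in>U. \<not> present L l \<omega> xs) \<and> \<psi> (snd (snd \<omega>))} =
    ennreal (exp (- lam * (\<Sum>xs\<in>U. wt (kq L) xs))) *
    emeasure (walk_law L Q 0) {S \<in> space (walk_law L Q 0). \<psi> S}"
proof -
  let ?N = "numbers_law L lam" and ?W = "walks_law L" and ?M = "walk_law L Q 0" and ?F = "frog_law L Q lam"
  interpret M: prob_space ?M by (rule prob_space_walk_law[OF kernel L])
  interpret W: prob_space ?W by (intro prob_space_PiM prob_space_walk_law kernel L)
  interpret WM: pair_prob_space ?W ?M ..
  let ?E = "{\<omega> \<in> space ?F. (\<forall>xs\<in>U. \<not> present L l \<omega> xs) \<and> \<psi> (snd (snd \<omega>))}"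
  let ?B = "{S \<in> space ?M. \<psi> S}"
  let ?A = "\<lambda>\<eta>. {S \<in> space ?W. \<forall>xs\<in>U. \<forall>j<\<eta> (hd xs). \<not> follows l (S (hd xs, j)) xs}"
  let ?a = "\<lambda>v. \<Sum>xs\<in>{xs\<in>U. hd xs = v}. wt (kq L) xs"
  have fU: "finite U" by (rule finite_subset[OF U]) simp
  have E: "?E \<in> sets ?F"
  proof -
    have "{\<omega> \<in> space ?F. \<forall>xs\<in>U. \<not> present L l \<omega> xs} \<in> sets ?F"
      by (intro sets.sets_Collect_finite_All sets.sets_Collect_neg sets_present L fU)
    then have "{\<omega> \<in> space ?F. \<forall>xs\<in>U. \<not> present L l \<omega> xs} \<inter> {\<omega> \<in> space ?F. \<psi> (snd (snd \<omega>))} \<in> sets ?F"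
      using sets_planted[OF \<psi>, of lam] by (rule sets.Int)
    moreover have "{\<omega> \<in> space ?F. \<forall>xs\<in>U. \<not> present L l \<omega> xs} \<inter> {\<omega> \<in> space ?F. \<psi> (snd (snd \<omega>))} = ?E"
      by auto
    ultimately show ?thesis by (simp only:)
  qed
  have "emeasure ?F ?E = (\<integral>\<^sup>+\<eta>. emeasure (?W \<Otimes>\<^sub>M ?M) (Pair \<eta> -` ?E) \<partial>?N)"
    using E unfolding frog_law_def by (intro WM.emeasure_pair_measure_alt) auto
  also have "\<dots> = (\<integral>\<^sup>+\<eta>. (\<Prod>v\<in>torus L. ennreal ((1 - ?a v) ^ \<eta> v)) * emeasure ?M ?B \<partial>?N)"
  proof (rule nn_integral_cong)
    fix \<eta> assume \<eta>: "\<eta> \<in> space ?N"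
    have "Pair \<eta> -` ?E = ?A \<eta> \<times> ?B"
      using U \<eta> by (auto simp: frog_law_def space_pair_measure present_def follows_def)
    then show "emeasure (?W \<Otimes>\<^sub>M ?M) (Pair \<eta> -` ?E) = (\<Prod>v\<in>torus L. ennreal ((1 - ?a v) ^ \<eta> v)) * emeasure ?M ?B"
      by (simp only: M.emeasure_pair_measure_Times[OF emeasure_walks_avoid(1)[OF L U] \<psi>] emeasure_walks_avoid(2)[OF L U])
  qed
  also have "\<dots> = (\<integral>\<^sup>+\<eta>. (\<Prod>v\<in>torus L. ennreal ((1 - ?a v) ^ \<eta> v)) \<partial>?N) * emeasure ?M ?B"
    by (rule nn_integral_multc) measurable
  also have "(\<integral>\<^sup>+\<eta>. (\<Prod>v\<in>torus L. ennreal ((1 - ?a v) ^ \<eta> v)) \<partial>?N) =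
      (\<Prod>v\<in>torus L. \<integral>\<^sup>+n. ennreal ((1 - ?a v) ^ n) \<partial>measure_pmf (poisson_pmf lam))"
  proof -
    interpret product_sigma_finite "\<lambda>v::int ^ 'd. measure_pmf (poisson_pmf lam)"
      by (simp add: product_sigma_finite_def prob_space_imp_sigma_finite prob_space_measure_pmf)
    show ?thesis by (rule product_nn_integral_prod) auto
  qed
  also have "\<dots> = (\<Prod>v\<in>torus L. ennreal (exp (- lam * ?a v)))"
  proof (rule prod.cong[OF refl], rule poisson_generating_function[OF lam])
    fix v :: "int ^ 'd" assume v: "v \<in> torus L"
    show "0 \<le> ?a v" by (intro sum_nonneg wt_nonneg)
    show "?a v \<le> 1" by (rule sum_wt_le_1[OF L v U])
  qed
  also have "\<dots> = ennreal (exp (- lam * (\<Sum>xs\<in>U. wt (kq L) xs)))"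
  proof -
    have "(\<Sum>v\<in>torus L. ?a v) = (\<Sum>xs\<in>U. wt (kq L) xs)"
      by (rule sum.group[OF fU]) (use U in \<open>auto simp: paths_def lists_of_def length_Suc_conv\<close>)
    then show ?thesis by (simp add: prod_ennreal exp_sum[symmetric] sum_distrib_left[symmetric] sum_negf)
  qed
  finally show ?thesis .
qed

end

text \<open>Inclusion-exclusion, one index at a time: requiring \<open>p\<close> to be present is
  the difference between no requirement and requiring \<open>p\<close> to be absent. Hence
  probabilities of absence determine all joint probabilities.\<close>

lemma moebius:
  fixes M :: "'w measure" and X :: "'w \<Rightarrow> 'p \<Rightarrow> bool"
  assumes "finite_measure M" and I: "finite I"
    and sX: "\<And>p. {\<omega> \<in> space M. X \<omega> p} \<in> sets M" and s\<psi>: "{\<omega> \<in> space M. \<psi> \<omega>} \<in> sets M"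
    and void: "\<And>U. U \<subseteq> I \<Longrightarrow> measure M {\<omega> \<in> space M. (\<forall>p\<in>U. \<not> X \<omega> p) \<and> \<psi> \<omega>} =
      measure_pmf.prob N {f. \<forall>p\<in>U. \<not> f p} * c"
    and U: "U \<subseteq> I" and W: "W \<subseteq> I"
  shows "measure M {\<omega> \<in> space M. (\<forall>p\<in>U. \<not> X \<omega> p) \<and> (\<forall>p\<in>W. X \<omega> p) \<and> \<psi> \<omega>} =
    measure_pmf.prob N {f. (\<forall>p\<in>U. \<not> f p) \<and> (\<forall>p\<in>W. f p)} * c"
proof -
  interpret finite_measure M by fact
  have "finite W" using W I by (rule finite_subset)
  then show ?thesis using W U
  proof (induction W arbitrary: U rule: finite_induct)
    case empty
    then show ?case using void[of U] by simp
  next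
    case (insert p W)
    have fU: "finite U" "finite W" using insert.prems I insert.hyps by (auto intro: finite_subset)
    let ?A = "\<lambda>U W. {\<omega> \<in> space M. (\<forall>p\<in>U. \<not> X \<omega> p) \<and> (\<forall>p\<in>W. X \<omega> p) \<and> \<psi> \<omega>}"
    let ?B = "\<lambda>U W. {f. (\<forall>p\<in>U. \<not> f p) \<and> (\<forall>p\<in>W. f p)}"
    have s: "?A U' W \<in> sets M" if "finite U'" for U'
      using that fU
      by (intro sets.sets_Collect_conj sets.sets_Collect_finite_All sets.sets_Collect_neg sX s\<psi>)
    have "measure M (?A U (insert p W)) = measure M (?A U W - ?A (insert p U) W)"
      by (rule arg_cong[of _ _ "measure M"]) auto
    also have "\<dots> = measure M (?A U W) - measure M (?A (insert p U) W)"
    proof (rule finite_measure_Diff)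
      show "?A U W \<in> sets M" by (rule s[OF fU(1)])
      show "?A (insert p U) W \<in> sets M" by (rule s) (use fU in simp)
    qed auto
    also have "\<dots> = (measure_pmf.prob N (?B U W) - measure_pmf.prob N (?B (insert p U) W)) * c"
      using insert.IH[of U] insert.IH[of "insert p U"] insert.prems by (simp add: left_diff_distrib)
    also have "measure_pmf.prob N (?B U W) - measure_pmf.prob N (?B (insert p U) W) =
        measure_pmf.prob N (?B U W - ?B (insert p U) W)"
      by (rule measure_pmf.finite_measure_Diff[symmetric]) auto
    also have "?B U W - ?B (insert p U) W = ?B U (insert p W)" by auto
    finally show ?case .
  qed
qed

text \<open>Only finitely many configurations are possible, so an arbitrary event splits into atoms
  to which \<open>moebius\<close> applies; \<open>XI\<close> and \<open>NI\<close> exclude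
  configurations that are not determined on \<open>I\<close>.\<close>

lemma moebius_transfer:
  fixes M :: "'w measure" and X :: "'w \<Rightarrow> 'p \<Rightarrow> bool"
  assumes fm: "finite_measure M" and I: "finite I"
    and sX: "\<And>p. {\<omega> \<in> space M. X \<omega> p} \<in> sets M" and s\<psi>: "{\<omega> \<in> space M. \<psi> \<omega>} \<in> sets M"
    and void: "\<And>U. U \<subseteq> I \<Longrightarrow> measure M {\<omega> \<in> space M. (\<forall>p\<in>U. \<not> X \<omega> p) \<and> \<psi> \<omega>} =
      measure_pmf.prob N {f. \<forall>p\<in>U. \<not> f p} * c"
    and XI: "\<And>\<omega> p. X \<omega> p \<Longrightarrow> p \<in> I" and NI: "set_pmf N \<subseteq> {f. \<forall>p. p \<notin> I \<longrightarrow> f p = False}"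
  shows "{\<omega> \<in> space M. \<phi> (X \<omega>) \<and> \<psi> \<omega>} \<in> sets M"
    and "measure M {\<omega> \<in> space M. \<phi> (X \<omega>) \<and> \<psi> \<omega>} = measure_pmf.prob N {f. \<phi> f} * c"
proof -
  interpret finite_measure M by (rule fm)
  let ?Fs = "{f. \<phi> f \<and> (\<forall>p. f p \<longrightarrow> p \<in> I)}"
  have "finite {f. \<forall>p. f p \<longrightarrow> p \<in> I}"
  proof (rule finite_surj[of "Pow I"])
    show "{f. \<forall>p. f p \<longrightarrow> p \<in> I} \<subseteq> (\<lambda>A p. p \<in> A) ` Pow I"
    proof
      fix f assume "f \<in> {f. \<forall>p. f p \<longrightarrow> p \<in> I}"
      then show "f \<in> (\<lambda>A p. p \<in> A) ` Pow I" by (intro image_eqI[of _ _ "Collect f"]) auto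
    qed
  qed (use I in simp)
  then have fFs: "finite ?Fs" by (rule finite_subset[rotated]) auto
  let ?A = "\<lambda>f. {\<omega> \<in> space M. X \<omega> = f \<and> \<psi> \<omega>}"
  have Aeq: "?A f = {\<omega> \<in> space M. (\<forall>p\<in>I - Collect f. \<not> X \<omega> p) \<and> (\<forall>p\<in>Collect f. X \<omega> p) \<and> \<psi> \<omega>}" if "f \<in> ?Fs" for f
  proof -
    have "X \<omega> = f \<longleftrightarrow> (\<forall>p\<in>I - Collect f. \<not> X \<omega> p) \<and> (\<forall>p\<in>Collect f. X \<omega> p)" for \<omega>
      unfolding fun_eq_iff using XI[of \<omega>] by blast
    then show ?thesis by auto
  qed
  have fin: "finite (Collect f)" "finite (I - Collect f)" if "f \<in> ?Fs" for f
    using that I by (auto intro: finite_subset[OF _ I])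
  have sA: "?A f \<in> sets M" if "f \<in> ?Fs" for f
    unfolding Aeq[OF that] using fin[OF that]
    by (intro sets.sets_Collect_conj sets.sets_Collect_finite_All sets.sets_Collect_neg sX s\<psi>)
  have un: "{\<omega> \<in> space M. \<phi> (X \<omega>) \<and> \<psi> \<omega>} = (\<Union>f\<in>?Fs. ?A f)" using XI by auto
  show "{\<omega> \<in> space M. \<phi> (X \<omega>) \<and> \<psi> \<omega>} \<in> sets M"
    unfolding un using sA fFs by (intro sets.finite_UN) auto
  have "measure M (\<Union>f\<in>?Fs. ?A f) = (\<Sum>f\<in>?Fs. measure M (?A f))"
    by (rule finite_measure_finite_Union[OF fFs]) (use sA in \<open>auto simp: disjoint_family_on_def\<close>)
  also have "\<dots> = (\<Sum>f\<in>?Fs. measure_pmf.prob N {f} * c)"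
  proof (rule sum.cong[OF refl])
    fix f assume f: "f \<in> ?Fs"
    have "measure M (?A f) = measure_pmf.prob N {g. (\<forall>p\<in>I - Collect f. \<not> g p) \<and> (\<forall>p\<in>Collect f. g p)} * c"
      unfolding Aeq[OF f] by (rule moebius[OF fm I sX s\<psi> void]) (use f in auto)
    also have "measure_pmf.prob N {g. (\<forall>p\<in>I - Collect f. \<not> g p) \<and> (\<forall>p\<in>Collect f. g p)} =
        measure_pmf.prob N ({g. (\<forall>p\<in>I - Collect f. \<not> g p) \<and> (\<forall>p\<in>Collect f. g p)} \<inter> set_pmf N)"
      by (rule measure_Int_set_pmf[symmetric])
    also have "{g. (\<forall>p\<in>I - Collect f. \<not> g p) \<and> (\<forall>p\<in>Collect f. g p)} \<inter> set_pmf N = {f} \<inter> set_pmf N"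
    proof -
      have "(\<forall>p\<in>I - Collect f. \<not> g p) \<and> (\<forall>p\<in>Collect f. g p) \<longleftrightarrow> g = f" if "g \<in> set_pmf N" for g
        unfolding fun_eq_iff using subsetD[OF NI that] f by blast
      then show ?thesis by auto
    qed
    finally show "measure M (?A f) = measure_pmf.prob N {f} * c" by (simp add: measure_Int_set_pmf)
  qed
  also have "\<dots> = measure_pmf.prob N ?Fs * c"
    using measure_measure_pmf_finite[OF fFs, of N] by (simp add: measure_pmf_single sum_distrib_right)
  also have "measure_pmf.prob N ?Fs = measure_pmf.prob N ({f. \<phi> f} \<inter> set_pmf N)"
  proof (subst measure_Int_set_pmf[symmetric], rule arg_cong[of _ _ "measure_pmf.prob N"])
    show "?Fs \<inter> set_pmf N = {f. \<phi> f} \<inter> set_pmf N" using NI by auto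
  qed
  finally show "measure M {\<omega> \<in> space M. \<phi> (X \<omega>) \<and> \<psi> \<omega>} = measure_pmf.prob N {f. \<phi> f} * c"
    unfolding un by (simp add: measure_Int_set_pmf)
qed

context heavy_kernel
begin

text \<open>Both laws have the same void probabilities, and this suffices. From here on ordinary
  particles enter only through \<open>path_law\<close>, independently of the planted
  trajectory.\<close>

lemma frog_transfer:
  assumes L: "L > 0" and lam: "lam > 0"
    and \<psi>: "{S \<in> space (walk_law L Q 0). \<psi> S} \<in> sets (walk_law L Q 0)"
  shows "{\<omega> \<in> space (frog_law L Q lam). \<phi> (present L l \<omega>) \<and> \<psi> (snd (snd \<omega>))} \<in> sets (frog_law L Q lam)"
    and "measure (frog_law L Q lam) {\<omega> \<in> space (frog_law L Q lam). \<phi> (present L l \<omega>) \<and> \<psi> (snd (snd \<omega>))} =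
      measure_pmf.prob (path_law L l lam) {f. \<phi> f} *
      measure (walk_law L Q 0) {S \<in> space (walk_law L Q 0). \<psi> S}"
proof -
  let ?F = "frog_law L Q lam"
  interpret F: prob_space ?F by (rule prob_space_frog_law[OF kernel L])
  interpret M: prob_space "walk_law L Q 0" by (rule prob_space_walk_law[OF kernel L])
  have fm: "finite_measure ?F" by unfold_locales
  have void: "measure ?F {\<omega> \<in> space ?F. (\<forall>p\<in>U. \<not> present L l \<omega> p) \<and> \<psi> (snd (snd \<omega>))} =
      measure_pmf.prob (path_law L l lam) {f. \<forall>p\<in>U. \<not> f p} *
      measure (walk_law L Q 0) {S \<in> space (walk_law L Q 0). \<psi> S}" if U: "U \<subseteq> paths L l" for U
  proof -
    have "measure_pmf.prob (path_law L l lam) {f. \<forall>p\<in>U. \<not> f p} = exp (- lam * (\<Sum>xs\<in>U. wt (kq L) xs))"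
      unfolding path_law_def by (rule prob_void[OF U]) (auto simp: wt_nonneg lam)
    then show ?thesis using emeasure_void[OF L lam U \<psi>]
      by (simp add: F.emeasure_eq_measure M.emeasure_eq_measure flip: ennreal_mult)
  qed
  have NI: "set_pmf (path_law L l lam) \<subseteq> {f. \<forall>p. p \<notin> paths L l \<longrightarrow> f p = False}"
    unfolding path_law_def by (rule set_Pi_pmf_subset) simp
  show "{\<omega> \<in> space ?F. \<phi> (present L l \<omega>) \<and> \<psi> (snd (snd \<omega>))} \<in> sets ?F"
    by (rule moebius_transfer(1)[OF fm finite_paths sets_present[OF L] sets_planted[OF \<psi>] void _ NI])
       (auto simp: present_def)
  show "measure ?F {\<omega> \<in> space ?F. \<phi> (present L l \<omega>) \<and> \<psi> (snd (snd \<omega>))} =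
      measure_pmf.prob (path_law L l lam) {f. \<phi> f} *
      measure (walk_law L Q 0) {S \<in> space (walk_law L Q 0). \<psi> S}"
    by (rule moebius_transfer(2)[OF fm finite_paths sets_present[OF L] sets_planted[OF \<psi>] void _ NI])
       (auto simp: present_def)
qed

end

section \<open>Activation times\<close>

definition hop :: "'d::finite path set \<Rightarrow> ('d path \<Rightarrow> bool) \<Rightarrow> int ^ 'd \<Rightarrow> int ^ 'd \<Rightarrow> bool" where
  "hop J f v u \<longleftrightarrow> (\<exists>xs\<in>J. f xs \<and> hd xs = v \<and> u \<in> set xs)"

lemma Inf_enat_mem: "A \<noteq> {} \<Longrightarrow> Inf A \<in> A" for A :: "enat set"
  unfolding Inf_enat_def by (metis LeastI ex_in_conv)

text \<open>A nonempty infimum in \<open>enat\<close> is attained, and a finite total bounds each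
  summand, so the finiteness condition of the definition becomes automatic.\<close>

lemma activation_time_le_iff:
  "activation_time L l lo \<omega> u \<le> enat t \<longleftrightarrow>
    (\<exists>m v. (\<Sum>i<m. travel_time l lo \<omega> (v i) (v (Suc i))) \<le> enat t \<and> v 0 = 0 \<and> v m = u \<and> (\<forall>i\<le>m. v i \<in> torus L))"
  (is "?A \<longleftrightarrow> ?B")
proof
  let ?S = "{\<Sum>i<m. travel_time l lo \<omega> (v i) (v (Suc i)) | m v.
            v 0 = 0 \<and> v m = u \<and> (\<forall>i\<le>m. v i \<in> torus L) \<and>
            (\<forall>i<m. travel_time l lo \<omega> (v i) (v (Suc i)) < \<infinity>)}"
  assume a: ?A
  then have "Inf ?S \<le> enat t" by (simp only: activation_time_def)
  then have "?S \<noteq> {}"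
  proof (intro notI)
    assume "Inf ?S \<le> enat t" and e: "?S = {}"
    then show False unfolding e by (simp add: top_enat_def)
  qed
  then have "Inf ?S \<in> ?S" by (rule Inf_enat_mem)
  then obtain m v where mv: "Inf ?S = (\<Sum>i<m. travel_time l lo \<omega> (v i) (v (Suc i)))"
      "v 0 = 0" "v m = u" "\<forall>i\<le>m. v i \<in> torus L" by blast
  from a mv(1) have "(\<Sum>i<m. travel_time l lo \<omega> (v i) (v (Suc i))) \<le> enat t"
    by (simp only: activation_time_def)
  with mv show ?B by blast
next
  assume ?B
  then obtain m v where mv: "(\<Sum>i<m. travel_time l lo \<omega> (v i) (v (Suc i))) \<le> enat t"
    "v 0 = 0" "v m = u" "\<forall>i\<le>m. v i \<in> torus L" by blast
  have "travel_time l lo \<omega> (v i) (v (Suc i)) < \<infinity>" if "i < m" for i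
  proof -
    have "travel_time l lo \<omega> (v i) (v (Suc i)) \<le> (\<Sum>i<m. travel_time l lo \<omega> (v i) (v (Suc i)))"
      by (rule member_le_sum) (use that in auto)
    also have "\<dots> \<le> enat t" by (rule mv(1))
    also have "enat t < \<infinity>" by simp
    finally show ?thesis .
  qed
  then have "activation_time L l lo \<omega> u \<le> (\<Sum>i<m. travel_time l lo \<omega> (v i) (v (Suc i)))"
    unfolding activation_time_def using mv(2-4) by (intro Inf_lower) blast
  with mv(1) show ?A by (rule order_trans[rotated])
qed

lemma activation_step:
  assumes "activation_time L l lo \<omega> v \<le> enat t" "u \<in> torus L" "travel_time l lo \<omega> v u \<le> enat s"
  shows "activation_time L l lo \<omega> u \<le> enat (t + s)"
proof -
  obtain m w where mw: "(\<Sum>i<m. travel_time l lo \<omega> (w i) (w (Suc i))) \<le> enat t"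
    "w 0 = 0" "w m = v" "\<forall>i\<le>m. w i \<in> torus L"
    using assms(1) unfolding activation_time_le_iff by blast
  define w' where "w' = w(Suc m := u)"
  have "(\<Sum>i<Suc m. travel_time l lo \<omega> (w' i) (w' (Suc i))) =
      (\<Sum>i<m. travel_time l lo \<omega> (w i) (w (Suc i))) + travel_time l lo \<omega> v u"
    using mw(3) by (simp add: w'_def del: travel_time.simps)
  also have "\<dots> \<le> enat t + enat s" by (rule add_mono[OF mw(1) assms(3)])
  finally have "(\<Sum>i<Suc m. travel_time l lo \<omega> (w' i) (w' (Suc i))) \<le> enat (t + s)" by simp
  moreover have "w' 0 = 0" "w' (Suc m) = u" "\<forall>i\<le>Suc m. w' i \<in> torus L"
    using mw assms(2) by (auto simp: w'_def le_Suc_eq)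
  ultimately show ?thesis unfolding activation_time_le_iff by blast
qed

lemma activation_origin: "L > 0 \<Longrightarrow> activation_time L l lo \<omega> 0 \<le> enat 0"
  unfolding activation_time_le_iff by (rule exI[of _ 0], rule exI[of _ "\<lambda>_. 0"]) (simp add: torus_def)

lemma activation_planted:
  assumes "L > 0" "snd (snd \<omega>) k = z" "k \<le> lo" "z \<in> torus L"
  shows "activation_time L l lo \<omega> z \<le> enat k"
proof -
  obtain \<eta> S S' where \<omega>: "\<omega> = (\<eta>, S, S')" by (cases \<omega>)
  have "travel_time l lo \<omega> 0 z \<le> enat k"
    unfolding \<omega> travel_time.simps by (rule INF_lower) (use assms in \<open>simp add: \<omega>\<close>)
  from activation_step[OF activation_origin[OF assms(1)] assms(4) this] show ?thesis by simp
qed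

text \<open>A path records the first \<open>l0\<close> steps of a particle, and a particle of
  lifespan \<open>l \<ge> l0\<close> makes all of them; this is how the result extends to all long
  lifespans.\<close>

lemma activation_hop:
  assumes "activation_time L l lo \<omega> v \<le> enat t" "hop (paths L l0) (present L l0 \<omega>) v u" "l0 \<le> l"
  shows "activation_time L l lo \<omega> u \<le> enat (t + l0)"
proof -
  obtain \<eta> S S' where \<omega>: "\<omega> = (\<eta>, S, S')" by (cases \<omega>)
  obtain xs where xs: "xs \<in> paths L l0" "present L l0 \<omega> xs" "hd xs = v" "u \<in> set xs"
    using assms(2) unfolding hop_def by blast
  then obtain k where k: "k < length xs" "u = xs ! k" by (metis in_set_conv_nth)
  have kl: "k \<le> l0" using k xs(1) by (simp add: paths_def lists_of_def)
  obtain j where "j < \<eta> v" "\<forall>k\<le>l0. S (v, j) k = xs ! k"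
    using xs(2,3) by (auto simp: present_def \<omega>)
  then have "\<exists>j<\<eta> v. S (v, j) k = u" using kl k by blast
  then have "travel_time l lo \<omega> v u \<le> enat k"
    unfolding \<omega> travel_time.simps using kl assms(3) by (intro INF_lower) auto
  also have "\<dots> \<le> enat l0" using kl by simp
  finally have "travel_time l lo \<omega> v u \<le> enat l0" .
  moreover have "u \<in> torus L" using xs(1,4) by (auto simp: paths_def lists_of_def)
  ultimately show ?thesis by (rule activation_step[OF assms(1), rotated])
qed

lemma activation_rch:
  assumes a: "activation_time L l lo \<omega> v \<le> enat t" and "rch (hop (paths L l0) (present L l0 \<omega>)) n v u" and l: "l0 \<le> l"
  shows "activation_time L l lo \<omega> u \<le> enat (t + n * l0)"
proof -
  obtain m where m: "m \<le> n" "(hop (paths L l0) (present L l0 \<omega>) ^^ m) v u" using assms(2) unfolding rch_def by blast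
  have "activation_time L l lo \<omega> u \<le> enat (t + m * l0)" using m(2)
  proof (induction m arbitrary: u)
    case 0
    then show ?case using a by simp
  next
    case (Suc m)
    then obtain w where w: "(hop (paths L l0) (present L l0 \<omega>) ^^ m) v w" "hop (paths L l0) (present L l0 \<omega>) w u" by auto
    show ?case using activation_hop[OF Suc.IH[OF w(1)] w(2) l] by (simp add: add_ac)
  qed
  also have "\<dots> \<le> enat (t + n * l0)" using m(1) by simp
  finally show ?thesis .
qed

section \<open>The planted particle sweeps a box\<close>

lemma wt_append: "wt k (x # ys @ zs) = wt k (x # ys) * wt k (last (x # ys) # zs)"
proof (induction ys arbitrary: x)
  case Nil
  then show ?case by simp
next
  case (Cons y ys)
  then show ?case by simp
qed

lemma sum_lists_of_append:
  "(\<Sum>ys\<in>lists_of L (m + n). F ys) = (\<Sum>y1\<in>lists_of L m. \<Sum>y2\<in>lists_of L n. F (y1 @ y2))"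
proof (induction m arbitrary: F)
  case (Suc m)
  then show ?case by (simp add: sum_lists_of_Suc)
qed (simp add: lists_of_0)

text \<open>The entries of \<open>zs\<close> are offsets from the position at time \<open>b\<close>,
  not increments, so a list of the vertices of a box describes a sweep of its translate.\<close>

definition win :: "nat \<Rightarrow> (int ^ 'd::finite) list \<Rightarrow> (nat \<Rightarrow> int ^ 'd) \<Rightarrow> nat \<Rightarrow> bool" where
  "win L zs S b \<longleftrightarrow> (\<forall>j<length zs. S (b + Suc j) = proj L (S b + zs ! j))"

context heavy_kernel
begin

text \<open>The lower heavy-tail bound makes every jump between different sites possible, so any
  enumeration without repetition has positive weight.\<close>

lemma wt_Q_pos: "distinct zs \<Longrightarrow> wt Q zs > 0"
proof (induction zs rule: induct_list012)
  case (3 x y zs)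
  have "Q x y > 0" using Q_shift[of x y] Q0_pos[of "y - x"] 3(3) by auto
  then show ?case using 3 by simp
qed auto

lemma wt_Q_nonneg: "wt Q zs \<ge> 0"
  by (induction zs rule: induct_list012) (auto simp: Q_nonneg)

lemma wt_Q_le: "wt Q zs \<le> wt (kq L) (map (\<lambda>z. proj L (x + z)) zs)"
proof (induction "kq L" zs rule: wt.induct)
  case (1 y z ys)
  have "Q y z \<le> kq L (proj L (x + y)) (proj L (x + z))"
  proof -
    have "Q y z \<le> qL L (z - y)" using Q_shift[of y z] qL_ge by simp
    also have "\<dots> = kq L (proj L (x + y)) (proj L (x + z))"
      by (simp add: torus_kernel_def)
    finally show ?thesis .
  qed
  then show ?case using 1 by (auto intro!: mult_mono simp: torus_kernel_nonneg[OF kernel] wt_Q_nonneg)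
qed auto

lemma if_and_mult: "(if \<not> P \<and> R then a * b else 0) = (if P then 0 else a * (if R then b else (0::real)))"
  by auto

text \<open>Time is cut into attempts of \<open>length zs\<close> steps. By the Markov property, in
  the form of \<open>wt_append\<close>, each succeeds with probability at least \<open>c\<close>,
  whatever the current position; and \<open>c\<close> does not depend on \<open>L\<close>.\<close>

lemma sum_no_win_le:
  assumes L: "L > 0" and c: "c = wt Q (0 # zs)" and x: "x \<in> torus L"
  shows "(\<Sum>ys\<in>lists_of L (A * length zs).
    if \<forall>a<A. \<not> win L zs (\<lambda>k. (x # ys) ! k) (a * length zs) then wt (kq L) (x # ys) else 0) \<le> (1 - c) ^ A"
  using x
proof (induction A arbitrary: x)
  case 0
  then show ?case by (simp add: lists_of_0)
next
  case (Suc A)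
  let ?W = "length zs"
  define ts where "ts = map (\<lambda>z. proj L (x + z)) zs"
  have ts: "ts \<in> lists_of L ?W" using L by (auto simp: ts_def lists_of_def)
  let ?nw = "\<lambda>A x ys. \<forall>a<A. \<not> win L zs (\<lambda>k. (x # ys) ! k) (a * ?W)"
  have c_le: "c \<le> wt (kq L) (x # ts)"
    using wt_Q_le[of "0 # zs" L x] Suc.prems by (simp add: c ts_def proj_id)
  also have "\<dots> \<le> (\<Sum>ys\<in>lists_of L ?W. wt (kq L) (x # ys))"
    by (rule member_le_sum[OF ts]) (auto simp: wt_nonneg)
  finally have c1: "c \<le> 1" by (simp add: sum_wt[OF L])
  have split: "?nw (Suc A) x (y1 @ y2) \<longleftrightarrow> y1 \<noteq> ts \<and> ?nw A (last (x # y1)) y2"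
    if y1: "y1 \<in> lists_of L ?W" for y1 y2 :: "'d path"
  proof -
    have len: "length y1 = ?W" using y1 by (simp add: lists_of_def)
    \<comment> \<open>The last vertex of the first attempt is the initial vertex of the remaining
      path.\<close>
    have shift: "(x # y1 @ y2) ! (?W + k) = (last (x # y1) # y2) ! k" for k
    proof (cases k)
      case 0
      then show ?thesis using len by (cases y1 rule: rev_cases) (auto simp: nth_Cons' nth_append)
    next
      case (Suc k')
      then show ?thesis using len by (simp add: nth_append)
    qed
    have w0: "win L zs (\<lambda>k. (x # y1 @ y2) ! k) 0 \<longleftrightarrow> y1 = ts"
    proof -
      have "win L zs (\<lambda>k. (x # y1 @ y2) ! k) 0 \<longleftrightarrow> (\<forall>j<?W. y1 ! j = ts ! j)"
        using len by (simp add: win_def nth_append ts_def)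
      also have "\<dots> \<longleftrightarrow> y1 = ts" using len by (auto simp: list_eq_iff_nth_eq ts_def)
      finally show ?thesis .
    qed
    have wS: "win L zs (\<lambda>k. (x # y1 @ y2) ! k) (Suc a * ?W) \<longleftrightarrow> win L zs (\<lambda>k. (last (x # y1) # y2) ! k) (a * ?W)" for a
      unfolding win_def by (simp only: mult_Suc add.assoc shift)
    show ?thesis unfolding All_less_Suc2 using w0 wS by (simp del: mult_Suc last.simps)
  qed
  have "(\<Sum>ys\<in>lists_of L (Suc A * ?W). if ?nw (Suc A) x ys then wt (kq L) (x # ys) else 0) =
      (\<Sum>y1\<in>lists_of L ?W. \<Sum>y2\<in>lists_of L (A * ?W). if ?nw (Suc A) x (y1 @ y2) then wt (kq L) (x # y1 @ y2) else 0)"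
    unfolding mult_Suc by (rule sum_lists_of_append)
  also have "\<dots> = (\<Sum>y1\<in>lists_of L ?W. if y1 = ts then 0 else wt (kq L) (x # y1) *
      (\<Sum>y2\<in>lists_of L (A * ?W). if ?nw A (last (x # y1)) y2 then wt (kq L) (last (x # y1) # y2) else 0))"
  proof (rule sum.cong[OF refl])
    fix y1 :: "'d path" assume y1: "y1 \<in> lists_of L ?W"
    have "(\<Sum>y2\<in>lists_of L (A * ?W). if ?nw (Suc A) x (y1 @ y2) then wt (kq L) (x # y1 @ y2) else 0) =
       (\<Sum>y2\<in>lists_of L (A * ?W). if y1 = ts then 0 else wt (kq L) (x # y1) *
          (if ?nw A (last (x # y1)) y2 then wt (kq L) (last (x # y1) # y2) else 0))"
    proof (rule sum.cong[OF refl])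
      fix y2 :: "'d path"
      show "(if ?nw (Suc A) x (y1 @ y2) then wt (kq L) (x # y1 @ y2) else 0) =
        (if y1 = ts then 0 else wt (kq L) (x # y1) * (if ?nw A (last (x # y1)) y2 then wt (kq L) (last (x # y1) # y2) else 0))"
        unfolding split[OF y1] wt_append[of "kq L" x y1]
        by (rule if_and_mult)
    qed
    then show "(\<Sum>y2\<in>lists_of L (A * ?W). if ?nw (Suc A) x (y1 @ y2) then wt (kq L) (x # y1 @ y2) else 0) =
       (if y1 = ts then 0 else wt (kq L) (x # y1) *
      (\<Sum>y2\<in>lists_of L (A * ?W). if ?nw A (last (x # y1)) y2 then wt (kq L) (last (x # y1) # y2) else 0))"
      by (simp add: sum_distrib_left del: last.simps)
  qed
  also have "\<dots> \<le> (\<Sum>y1\<in>lists_of L ?W. if y1 = ts then 0 else wt (kq L) (x # y1) * (1 - c) ^ A)"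
  proof (rule sum_mono)
    fix y1 :: "'d path" assume y1: "y1 \<in> lists_of L ?W"
    have "last (x # y1) \<in> set (x # y1)" by (rule last_in_set) simp
    then have "last (x # y1) \<in> torus L" using y1 Suc.prems by (auto simp: lists_of_def simp del: last.simps)
    from mult_left_mono[OF Suc.IH[OF this] wt_nonneg]
    show "(if y1 = ts then 0 else wt (kq L) (x # y1) *
      (\<Sum>y2\<in>lists_of L (A * ?W). if ?nw A (last (x # y1)) y2 then wt (kq L) (last (x # y1) # y2) else 0)) \<le>
      (if y1 = ts then 0 else wt (kq L) (x # y1) * (1 - c) ^ A)" by (simp del: last.simps)
  qed
  also have "\<dots> = (\<Sum>y1\<in>lists_of L ?W - {ts}. wt (kq L) (x # y1)) * (1 - c) ^ A"
    unfolding sum_distrib_right by (rule sum.mono_neutral_cong_right) auto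
  also have "(\<Sum>y1\<in>lists_of L ?W - {ts}. wt (kq L) (x # y1)) = 1 - wt (kq L) (x # ts)"
    using sum.remove[OF finite_lists_of ts, of "\<lambda>y. wt (kq L) (x # y)"] sum_wt[OF L, where n = ?W and x = x] by simp
  also have "(1 - wt (kq L) (x # ts)) * (1 - c) ^ A \<le> (1 - c) * (1 - c) ^ A"
    using c_le c1 by (intro mult_right_mono) auto
  finally show ?case by simp
qed

lemma walk_cylinder_event:
  assumes L: "L > 0" and R: "\<And>S S'. (\<And>k. k \<le> N \<Longrightarrow> S k = S' k) \<Longrightarrow> R S = R S'"
  shows "{S \<in> space (walk_law L Q 0). R S} \<in> sets (walk_law L Q 0)"
    and "measure (walk_law L Q 0) {S \<in> space (walk_law L Q 0). R S} =
      (\<Sum>ys\<in>lists_of L N. if R (\<lambda>k. (0 # ys) ! k) then wt (kq L) (0 # ys) else 0)"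
proof -
  let ?M = "walk_law L Q 0"
  interpret prob_space ?M by (rule prob_space_walk_law[OF kernel L])
  let ?P = "{xs\<in>paths L N. R (\<lambda>k. xs ! k)}"
  let ?E = "\<lambda>xs. {S \<in> space ?M. follows N S xs}"
  have sp: "S k \<in> torus L" if "S \<in> space ?M" for S k
    using that by (auto simp: walk_law_def space_PiM)
  have eq: "{S \<in> space ?M. R S} = (\<Union>xs\<in>?P. ?E xs)"
  proof (intro equalityI subsetI)
    fix S assume S: "S \<in> {S \<in> space ?M. R S}"
    define xs where "xs = map S [0..<Suc N]"
    have xs: "xs ! k = S k" if "k \<le> N" for k using that by (simp add: xs_def nth_map_upt del: upt_Suc)
    have "R (\<lambda>k. xs ! k) = R S" by (rule R) (rule xs)
    moreover have "xs \<in> paths L N" using sp S by (auto simp: xs_def paths_def lists_of_def)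
    ultimately show "S \<in> (\<Union>xs\<in>?P. ?E xs)" using S xs by (auto simp: follows_def)
  next
    fix S assume "S \<in> (\<Union>xs\<in>?P. ?E xs)"
    then obtain xs where xs: "xs \<in> ?P" "S \<in> space ?M" "follows N S xs" by blast
    have "R S = R (\<lambda>k. xs ! k)" by (rule R) (use xs in \<open>auto simp: follows_def\<close>)
    with xs show "S \<in> {S \<in> space ?M. R S}" by simp
  qed
  have fP: "finite ?P" by simp
  have E: "?E xs \<in> sets ?M" if "xs \<in> ?P" for xs using sets_follows that by blast
  show "{S \<in> space ?M. R S} \<in> sets ?M" unfolding eq by (rule sets.finite_UN[OF fP E])
  have disj: "disjoint_family_on ?E ?P"
    unfolding disjoint_family_on_def
  proof (intro ballI impI)
    fix xs ys assume xy: "xs \<in> ?P" "ys \<in> ?P" "xs \<noteq> ys"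
    show "?E xs \<inter> ?E ys = {}"
    proof (rule ccontr)
      assume "?E xs \<inter> ?E ys \<noteq> {}"
      then have "xs ! k = ys ! k" if "k \<le> N" for k using that unfolding follows_def by auto
      moreover have "length xs = Suc N" "length ys = Suc N" using xy by (auto simp: paths_def lists_of_def)
      ultimately have "xs = ys" by (intro nth_equalityI) (auto simp: less_Suc_eq_le)
      with xy show False by simp
    qed
  qed
  have z: "(0 :: int ^ 'd) \<in> torus L" using L by (simp add: torus_def)
  have "measure ?M {S \<in> space ?M. R S} = (\<Sum>xs\<in>?P. measure ?M (?E xs))"
    unfolding eq by (rule finite_measure_finite_Union[OF fP _ disj]) (use E in auto)
  also have "\<dots> = (\<Sum>xs\<in>?P. if hd xs = 0 then wt (kq L) xs else 0)"
    by (intro sum.cong refl measure_follows[OF L z]) simp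
  also have "\<dots> = (\<Sum>xs\<in>paths L N. if R (\<lambda>k. xs ! k) \<and> hd xs = 0 then wt (kq L) xs else 0)"
    unfolding sum.inter_filter[OF finite_paths] by (intro sum.cong refl) auto
  also have "\<dots> = (\<Sum>y\<in>torus L. \<Sum>ys\<in>lists_of L N. if R (\<lambda>k. (y # ys) ! k) \<and> y = 0 then wt (kq L) (y # ys) else 0)"
    unfolding paths_def sum_lists_of_Suc by simp
  also have "\<dots> = (\<Sum>y\<in>(torus L :: (int ^ 'd) set). if y = 0 then \<Sum>ys\<in>lists_of L N. if R (\<lambda>k. (0 # ys) ! k) then wt (kq L) (0 # ys) else 0 else 0)"
    by (rule sum.cong[OF refl]) auto
  also have "\<dots> = (\<Sum>ys\<in>lists_of L N. if R (\<lambda>k. (0 # ys) ! k) then wt (kq L) (0 # ys) else 0)"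
    using z by simp
  finally show "measure ?M {S \<in> space ?M. R S} =
      (\<Sum>ys\<in>lists_of L N. if R (\<lambda>k. (0 # ys) ! k) then wt (kq L) (0 # ys) else 0)" .
qed

text \<open>The swept box is the one at the start of the first successful attempt. This makes the
  events \<open>\<psi> x\<close> disjoint in \<open>x\<close>, so that their probabilities can be
  added; \<open>T\<close> is uniform in \<open>L\<close>.\<close>

lemma planted_sweep:
  assumes n: "n \<ge> 1" and e: "e > 0"
  shows "\<exists>T. \<forall>L>0. \<exists>\<psi>. (\<forall>x. {S \<in> space (walk_law L Q 0). \<psi> x S} \<in> sets (walk_law L Q 0)) \<and>
    (\<forall>x S. \<psi> x S \<longrightarrow> (\<forall>z\<in>Box L x n. \<exists>k\<le>T. S k = z) \<or> S \<notin> space (walk_law L Q 0)) \<and>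
    (\<forall>x x' S. \<psi> x S \<longrightarrow> \<psi> x' S \<longrightarrow> x = x') \<and>
    1 - e \<le> (\<Sum>x\<in>torus L. measure (walk_law L Q 0) {S \<in> space (walk_law L Q 0). \<psi> x S})"
proof -
  obtain zs where zs: "distinct zs" "set zs = torus n - {0::int ^ 'd}"
    using finite_distinct_list[of "torus n - {0::int ^ 'd}"] by auto
  define c where "c = wt Q (0 # zs)"
  have c: "c > 0" unfolding c_def by (rule wt_Q_pos) (use zs in simp)
  \<comment> \<open>One attempt on the torus with a single vertex: a nonnegative sum is at most
    \<open>1 - c\<close>.\<close>
  have c1: "c \<le> 1"
  proof -
    have "(\<Sum>ys\<in>lists_of 1 (1 * length zs).
      if \<forall>a<1. \<not> win 1 zs (\<lambda>k. (0 # ys) ! k) (a * length zs) then wt (kq 1) (0 # ys) else 0) \<le> (1 - c) ^ 1"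
      by (rule sum_no_win_le) (auto simp: c_def torus_def)
    moreover have "0 \<le> (\<Sum>ys\<in>lists_of 1 (1 * length zs).
      if \<forall>a<1. \<not> win 1 zs (\<lambda>k. (0 # ys) ! k) (a * length zs) then wt (kq 1) (0 # ys) else 0)"
      by (intro sum_nonneg) (simp add: wt_nonneg)
    ultimately show ?thesis by simp
  qed
  have "(\<lambda>A. (1 - c) ^ A) \<longlonglongrightarrow> 0" using c c1 by (intro LIMSEQ_power_zero) auto
  then have "\<forall>\<^sub>F A in at_top. (1 - c) ^ A < e" using e by (rule order_tendstoD)
  then obtain A where A: "(1 - c) ^ A < e" using eventually_happens'[OF sequentially_bot] by blast
  let ?W = "length zs"
  define T where "T = A * ?W"
  have "\<exists>\<psi>. (\<forall>x. {S \<in> space (walk_law L Q 0). \<psi> x S} \<in> sets (walk_law L Q 0)) \<and>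
    (\<forall>x S. \<psi> x S \<longrightarrow> (\<forall>z\<in>Box L x n. \<exists>k\<le>T. S k = z) \<or> S \<notin> space (walk_law L Q 0)) \<and>
    (\<forall>x x' S. \<psi> x S \<longrightarrow> \<psi> x' S \<longrightarrow> x = x') \<and>
    1 - e \<le> (\<Sum>x\<in>torus L. measure (walk_law L Q 0) {S \<in> space (walk_law L Q 0). \<psi> x S})" if L: "L > 0" for L
  proof -
    let ?M = "walk_law L Q 0"
    interpret prob_space ?M by (rule prob_space_walk_law[OF kernel L])
    define a where "a S = (LEAST a. a < A \<and> win L zs S (a * ?W))" for S
    define R where "R S \<longleftrightarrow> (\<exists>a<A. win L zs S (a * ?W))" for S
    define \<psi> where "\<psi> x S \<longleftrightarrow> R S \<and> S (a S * ?W) = x" for x S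
    have aA: "a S < A \<and> win L zs S (a S * ?W)" if "R S" for S
      using that unfolding R_def a_def by (rule LeastI_ex[of "\<lambda>a. a < A \<and> win L zs S (a * ?W)"])
    have wcong: "win L zs S (a * ?W) = win L zs S' (a * ?W)"
      if "a < A" "\<And>k. k \<le> T \<Longrightarrow> S k = S' k" for a S S'
    proof -
      have "Suc a * ?W \<le> A * ?W" by (rule mult_le_mono1) (use that(1) in simp)
      then have le: "a * ?W + ?W \<le> T" by (simp add: T_def)
      have 1: "S (a * ?W + Suc j) = S' (a * ?W + Suc j)" if "j < ?W" for j
        by (rule \<open>\<And>k. k \<le> T \<Longrightarrow> S k = S' k\<close>) (use le that in simp)
      have 2: "S (a * ?W) = S' (a * ?W)"
        by (rule \<open>\<And>k. k \<le> T \<Longrightarrow> S k = S' k\<close>) (use le in simp)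
      show ?thesis unfolding win_def using 1 2 by simp
    qed
    have Rcong: "R S = R S'" and acong: "a S = a S'" if eq: "\<And>k. k \<le> T \<Longrightarrow> S k = S' k" for S S'
    proof -
      have w: "a < A \<and> win L zs S (a * ?W) \<longleftrightarrow> a < A \<and> win L zs S' (a * ?W)" for a
      proof (cases "a < A")
        case True
        have "win L zs S (a * ?W) = win L zs S' (a * ?W)" by (rule wcong[OF True]) (rule eq)
        then show ?thesis by (rule arg_cong)
      qed simp
      show "R S = R S'" unfolding R_def w ..
      show "a S = a S'" unfolding a_def w ..
    qed
    have \<psi>cong: "\<psi> x S = \<psi> x S'" if eq: "\<And>k. k \<le> T \<Longrightarrow> S k = S' k" for x S S'
    proof (cases "R S")
      case True
      have "a S * ?W \<le> T" using aA[OF True] unfolding T_def by (intro mult_le_mono1) simp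
      then have 1: "S (a S * ?W) = S' (a S * ?W)" by (rule eq)
      have 2: "R S = R S'" by (rule Rcong) (rule eq)
      have 3: "a S = a S'" by (rule acong) (rule eq)
      show ?thesis unfolding \<psi>_def 1 2 unfolding 3 ..
    next
      case False
      moreover have "R S = R S'" by (rule Rcong) (rule eq)
      ultimately show ?thesis by (simp add: \<psi>_def)
    qed
    have sets\<psi>: "{S \<in> space ?M. \<psi> x S} \<in> sets ?M" for x
      by (rule walk_cylinder_event(1)[OF L]) (rule \<psi>cong)
    have setsR: "{S \<in> space ?M. R S} \<in> sets ?M"
      by (rule walk_cylinder_event(1)[OF L]) (rule Rcong)
    have sp: "S k \<in> torus L" if "S \<in> space ?M" for S k
      using that by (auto simp: walk_law_def space_PiM)
    have sweep: "\<exists>k\<le>T. S k = z" if S: "S \<in> space ?M" "\<psi> x S" and z: "z \<in> Box L x n" for x S z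
    proof -
      have RS: "R S" and x: "S (a S * ?W) = x" using S by (auto simp: \<psi>_def)
      have "Suc (a S) * ?W \<le> A * ?W" by (rule mult_le_mono1) (use aA[OF RS] in simp)
      then have bT: "a S * ?W + ?W \<le> T" by (simp add: T_def)
      obtain y where y: "y \<in> torus n" "z = proj L (x + y)" using z by (auto simp: Box_def)
      show ?thesis
      proof (cases "y = 0")
        case True
        then have "z = S (a S * ?W)" using y x sp[OF S(1)] by (metis add.right_neutral proj_id)
        then show ?thesis using bT by (intro exI[of _ "a S * ?W"]) auto
      next
        case False
        then have "y \<in> set zs" using y zs by simp
        then obtain j where j: "j < ?W" "zs ! j = y" by (auto simp: in_set_conv_nth)
        have "S (a S * ?W + Suc j) = z" using aA[OF RS] j y x by (simp add: win_def)
        then show ?thesis using bT j by (intro exI[of _ "a S * ?W + Suc j"]) auto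
      qed
    qed
    have "1 - e \<le> 1 - (1 - c) ^ A" using A by simp
    also have "\<dots> \<le> 1 - measure ?M {S \<in> space ?M. \<not> R S}"
    proof -
      have "measure ?M {S \<in> space ?M. \<not> R S} =
        (\<Sum>ys\<in>lists_of L T. if \<not> R (\<lambda>k. (0 # ys) ! k) then wt (kq L) (0 # ys) else 0)"
        by (rule walk_cylinder_event(2)[OF L]) (intro arg_cong[of _ _ Not], rule Rcong)
      also have "\<dots> \<le> (1 - c) ^ A"
        using sum_no_win_le[OF L c_def, of 0 A] L unfolding R_def T_def by (simp add: torus_def)
      finally show ?thesis by simp
    qed
    also have "\<dots> = measure ?M {S \<in> space ?M. R S}"
      using prob_neg[of R] setsR by simp
    also have "{S \<in> space ?M. R S} = (\<Union>x\<in>torus L. {S \<in> space ?M. \<psi> x S})"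
      using sp by (auto simp: \<psi>_def)
    also have "measure ?M \<dots> = (\<Sum>x\<in>torus L. measure ?M {S \<in> space ?M. \<psi> x S})"
    proof (rule finite_measure_finite_Union)
      show "(\<lambda>x. {S \<in> space ?M. \<psi> x S}) ` torus L \<subseteq> sets ?M" using sets\<psi> by blast
    qed (auto simp: disjoint_family_on_def \<psi>_def)
    finally have "1 - e \<le> (\<Sum>x\<in>torus L. measure ?M {S \<in> space ?M. \<psi> x S})" .
    moreover have "\<forall>x x' S. \<psi> x S \<longrightarrow> \<psi> x' S \<longrightarrow> x = x'" by (auto simp: \<psi>_def)
    ultimately show ?thesis using sets\<psi> sweep by (intro exI[of _ \<psi>]) blast
  qed
  then show ?thesis by (intro exI[of _ T] allI impI)
qed

text \<open>For each \<open>x\<close> the spread from the box at \<open>x\<close> is independent of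
  the event that this box is swept. Summing the products over the disjoint events gives
  \<open>(1 - e)\<^sup>2 \<ge> 1 - 2 * e\<close>; the sweep adds only the bounded time
  \<open>T\<close>, which \<open>lo\<close> eventually exceeds.\<close>

lemma spread_from_swept_box:
  assumes lam: "lam > 0" and n: "n \<ge> 1" and l: "l0 \<le> l" and e: "e > 0" and lo: "filterlim lo at_top at_top"
    and spread: "\<forall>\<^sub>F L in at_top. \<forall>x. measure_pmf.prob (path_law L l0 lam)
      {f. \<not> \<rho> * real L ^ CARD('d) \<le> real (card {u\<in>torus L. \<exists>z\<in>Box L x n. rch (hop (paths L l0) f) (H L) z u})} \<le> e"
    and t: "\<And>T. \<forall>\<^sub>F L in at_top. real T + real (H L) * real l0 \<le> t L"
  shows "\<forall>\<^sub>F L in at_top. measure (frog_law L Q lam) {\<omega> \<in> space (frog_law L Q lam).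
      real (card (activated L l (lo L) \<omega> (t L))) / real L ^ CARD('d) \<ge> \<rho>} \<ge> 1 - 2 * e"
proof -
  from planted_sweep[OF n e] obtain T where T: "\<forall>L>0. \<exists>\<psi>. (\<forall>x. {S \<in> space (walk_law L Q 0). \<psi> x S} \<in> sets (walk_law L Q 0)) \<and>
    (\<forall>x S. \<psi> x S \<longrightarrow> (\<forall>z\<in>Box L x n. \<exists>k\<le>T. S k = z) \<or> S \<notin> space (walk_law L Q 0)) \<and>
    (\<forall>x x' S. \<psi> x S \<longrightarrow> \<psi> x' S \<longrightarrow> x = x') \<and>
    1 - e \<le> (\<Sum>x\<in>torus L. measure (walk_law L Q 0) {S \<in> space (walk_law L Q 0). \<psi> x S})"
    by (rule exE)
  have "\<forall>\<^sub>F L in at_top. T \<le> lo L" using lo unfolding filterlim_at_top by blast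
  then show ?thesis using spread t[of T] eventually_gt_at_top[of 0]
  proof eventually_elim
    case (elim L)
    note loT = elim(1) and sp = elim(2) and tL = elim(3) and L = elim(4)
    let ?F = "frog_law L Q lam" and ?M = "walk_law L Q 0"
    interpret F: prob_space ?F by (rule prob_space_frog_law[OF kernel L])
    interpret M: prob_space ?M by (rule prob_space_walk_law[OF kernel L])
    from T[rule_format, OF L] obtain \<psi> where conj: "(\<forall>x. {S \<in> space ?M. \<psi> x S} \<in> sets ?M) \<and>
      (\<forall>x S. \<psi> x S \<longrightarrow> (\<forall>z\<in>Box L x n. \<exists>k\<le>T. S k = z) \<or> S \<notin> space ?M) \<and>
      (\<forall>x x' S. \<psi> x S \<longrightarrow> \<psi> x' S \<longrightarrow> x = x') \<and>
      1 - e \<le> (\<Sum>x\<in>torus L. measure ?M {S \<in> space ?M. \<psi> x S})" by (rule exE)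
    have \<psi>: "{S \<in> space ?M. \<psi> x S} \<in> sets ?M"
      "\<psi> x S \<Longrightarrow> (\<forall>z\<in>Box L x n. \<exists>k\<le>T. S k = z) \<or> S \<notin> space ?M"
      "\<psi> x S \<Longrightarrow> \<psi> x' S \<Longrightarrow> x = x'"
      "1 - e \<le> (\<Sum>x\<in>torus L. measure ?M {S \<in> space ?M. \<psi> x S})" for x x' S
      using conj by blast+
    let ?R = "\<lambda>f x. {u\<in>torus L. \<exists>z\<in>Box L x n. rch (hop (paths L l0) f) (H L) z u}"
    let ?N = "\<lambda>x f. \<rho> * real L ^ CARD('d) \<le> real (card (?R f x))"
    let ?E = "\<lambda>x. {\<omega> \<in> space ?F. ?N x (present L l0 \<omega>) \<and> \<psi> x (snd (snd \<omega>))}"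
    let ?A = "{\<omega> \<in> space ?F. real (card (activated L l (lo L) \<omega> (t L))) / real L ^ CARD('d) \<ge> \<rho>}"
    have e1: "1 - e \<le> measure_pmf.prob (path_law L l0 lam) {f. ?N x f}" for x
    proof -
      have "{f. ?N x f} = UNIV - {f. \<not> ?N x f}" by auto
      then have "measure_pmf.prob (path_law L l0 lam) {f. ?N x f} = 1 - measure_pmf.prob (path_law L l0 lam) {f. \<not> ?N x f}"
        using measure_pmf.prob_compl[of "{f. \<not> ?N x f}" "path_law L l0 lam"] by simp
      with spec[OF sp, of x] show ?thesis by linarith
    qed
    have Esets: "?E x \<in> sets ?F" for x by (rule frog_transfer(1)[OF L lam \<psi>(1)])
    have sub: "(\<Union>x\<in>torus L. ?E x) \<subseteq> ?A"
    proof
      fix \<omega> assume "\<omega> \<in> (\<Union>x\<in>torus L. ?E x)"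
      then obtain x where w: "\<omega> \<in> space ?F" "?N x (present L l0 \<omega>)" "\<psi> x (snd (snd \<omega>))" by blast
      have "snd (snd \<omega>) \<in> space ?M" using w(1) by (auto simp: frog_law_def space_pair_measure)
      with \<psi>(2)[OF w(3)] have sw: "\<forall>z\<in>Box L x n. \<exists>k\<le>T. snd (snd \<omega>) k = z" by blast
      have "?R (present L l0 \<omega>) x \<subseteq> activated L l (lo L) \<omega> (t L)"
      proof
        fix u assume u: "u \<in> ?R (present L l0 \<omega>) x"
        then obtain z where z: "z \<in> Box L x n" "rch (hop (paths L l0) (present L l0 \<omega>)) (H L) z u" by blast
        obtain k where k: "k \<le> T" "snd (snd \<omega>) k = z" using sw z(1) by blast
        have "activation_time L l (lo L) \<omega> z \<le> enat k"
          by (rule activation_planted[OF L k(2)]) (use k loT z Box_subset_torus[OF L] in auto)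
        from activation_rch[OF this z(2) l]
        have at: "activation_time L l (lo L) \<omega> u \<le> enat (k + H L * l0)" .
        have "ereal_of_enat (activation_time L l (lo L) \<omega> u) \<le> ereal_of_enat (enat (k + H L * l0))"
          using at by (simp only: ereal_of_enat_le_iff)
        also have "\<dots> = ereal (real (k + H L * l0))" by simp
        also have "\<dots> \<le> ereal (t L)" using tL k(1) by simp
        finally show "u \<in> activated L l (lo L) \<omega> (t L)" using u by (simp add: activated_def)
      qed
      then have "card (?R (present L l0 \<omega>) x) \<le> card (activated L l (lo L) \<omega> (t L))"
        by (rule card_mono[rotated]) (auto simp: activated_def)
      then have "\<rho> * real L ^ CARD('d) \<le> real (card (activated L l (lo L) \<omega> (t L)))" using w(2) by simp
      then show "\<omega> \<in> ?A" using w(1) L by (simp add: pos_le_divide_eq)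
    qed
    have "1 - 2 * e \<le> (1 - e) * (1 - e)" by (simp add: algebra_simps)
    also have "\<dots> \<le> (if 1 - e \<ge> 0 then (1 - e) * (\<Sum>x\<in>torus L. measure ?M {S \<in> space ?M. \<psi> x S}) else (1 - e) * (1 - e))"
      using \<psi>(4) by (auto intro: mult_left_mono)
    finally have *: "1 - 2 * e \<le> (1 - e) * (\<Sum>x\<in>torus L. measure ?M {S \<in> space ?M. \<psi> x S})" if "e \<le> 1"
      using that by simp
    show ?case
    proof (cases "e \<le> 1")
      case False
      then show ?thesis using measure_nonneg[of ?F ?A] by linarith
    next
      case True
      have "1 - 2 * e \<le> (\<Sum>x\<in>torus L. (1 - e) * measure ?M {S \<in> space ?M. \<psi> x S})"
        using *[OF True] by (simp add: sum_distrib_left)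
      also have "\<dots> \<le> (\<Sum>x\<in>torus L. measure ?F (?E x))"
      proof (rule sum_mono)
        fix x :: "int ^ 'd"
        have "measure ?F (?E x) = measure_pmf.prob (path_law L l0 lam) {f. ?N x f} * measure ?M {S \<in> space ?M. \<psi> x S}"
          by (rule frog_transfer(2)[OF L lam \<psi>(1)])
        moreover have "(1 - e) * measure ?M {S \<in> space ?M. \<psi> x S} \<le>
          measure_pmf.prob (path_law L l0 lam) {f. ?N x f} * measure ?M {S \<in> space ?M. \<psi> x S}"
          by (intro mult_right_mono e1) simp
        ultimately show "(1 - e) * measure ?M {S \<in> space ?M. \<psi> x S} \<le> measure ?F (?E x)" by simp
      qed
      also have "\<dots> = measure ?F (\<Union>x\<in>torus L. ?E x)"
        by (rule F.finite_measure_finite_Union[symmetric])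
           (use Esets \<psi>(3) in \<open>auto simp: disjoint_family_on_def\<close>)
      also have "\<dots> \<le> measure ?F ?A"
        by (rule F.finite_measure_mono[OF sub sets_activated_event[OF L]])
      finally show ?thesis .
    qed
  qed
qed

end

section \<open>Linear spread through open blocks\<close>

text \<open>With \<open>9 ^ k \<le> n < 9 ^ (k + 1)\<close> the top boxes have side
  \<open>3 ^ k \<le> sqrt n\<close>, so rounding \<open>n\<close> to a multiple of
  \<open>r * 3 ^ k\<close> is negligible. On the other hand
  \<open>2 ^ k \<ge> (n / 9) powr (1 / 4)\<close>, since \<open>9 \<le> 2 ^ 4\<close>, which makes
  the term with \<open>c ^ (4 * 2 ^ k)\<close> smaller than any power of \<open>n\<close>.\<close>

lemma percolation_scales:
  fixes c \<delta> D :: real and r d :: nat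
  assumes c: "0 < c" "c < 1" and r: "r \<ge> 1" and \<delta>: "\<delta> > 0" and D: "D \<ge> 0"
  shows "\<forall>\<^sub>F n in at_top. \<exists>k q. 3 ^ k dvd q \<and> q > 0 \<and> r * q \<le> n \<and> (1 - \<delta>) * real n \<le> real (r * q) \<and>
    real q ^ d * c ^ (4 * 2 ^ k) + D / real q \<le> real n powr (- 1 / 2)"
proof -
  define b where "b = - ln c"
  have b: "b > 0" using c by (simp add: b_def)
  define \<delta>' where "\<delta>' = min \<delta> (1 / 2)"
  have \<delta>': "0 < \<delta>'" "\<delta>' \<le> \<delta>" "\<delta>' \<le> 1 / 2" using \<delta> by (auto simp: \<delta>'_def)
  define R where "R = real r"
  have R: "R > 0" using r by (simp add: R_def)
  define d' where "d' = real d"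
  have "\<forall>\<^sub>F n::nat in at_top. R * sqrt (real n) \<le> \<delta>' * real n"
    using R \<delta>' by real_asymp
  moreover have "\<forall>\<^sub>F n::nat in at_top. real n powr d' * exp (- (4 * b) * (real n / 9) powr (1 / 4)) \<le> real n powr (- 1 / 2) / 2"
    using b by real_asymp
  moreover have "\<forall>\<^sub>F n::nat in at_top. (2 * D * R) / real n \<le> real n powr (- 1 / 2) / 2"
    by real_asymp
  ultimately show ?thesis using eventually_gt_at_top[of 0]
  proof eventually_elim
    case (elim n)
    obtain k where k: "9 ^ k \<le> n" "n < 9 ^ (k + 1)" using ex_power_ivl1[of 9 n] elim(4) by auto
    define q where "q = 3 ^ k * (n div (r * 3 ^ k))"
    have rq: "r * q + n mod (r * 3 ^ k) = n" by (simp add: q_def flip: mult.assoc)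
    then have rqn: "r * q \<le> n" by linarith
    have "n mod (r * 3 ^ k) < r * 3 ^ k" using r by simp
    with rq have "n \<le> r * q + r * 3 ^ k" by linarith
    then have "real n \<le> real (r * q + r * 3 ^ k)" by (rule of_nat_mono)
    then have "real n \<le> real (r * q) + R * 3 ^ k" by (simp add: R_def)
    moreover have "3 ^ k \<le> sqrt (real n)"
    proof (rule real_le_rsqrt)
      have "((3::real) ^ k)\<^sup>2 = 9 ^ k" by (simp add: power2_eq_square flip: power_mult_distrib)
      also have "\<dots> = real (9 ^ k)" by simp
      also have "\<dots> \<le> real n" using k(1) by (simp only: of_nat_le_iff)
      finally show "((3::real) ^ k)\<^sup>2 \<le> real n" .
    qed
    then have "R * 3 ^ k \<le> R * sqrt (real n)" using R by simp
    ultimately have low: "(1 - \<delta>') * real n \<le> real (r * q)" using elim(1) by (simp add: algebra_simps)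
    have "(1 - \<delta>) * real n \<le> (1 - \<delta>') * real n" using \<delta>' by (intro mult_right_mono) auto
    with low have low1: "(1 - \<delta>) * real n \<le> real (r * q)" by linarith
    have "1 / 2 * real n \<le> (1 - \<delta>') * real n" using \<delta>' by (intro mult_right_mono) auto
    with low have low2: "real n \<le> 2 * R * real q" by (simp add: R_def)
    with elim(4) have q0: "q > 0" using R by (cases "q = 0") auto
    have "q \<le> n" using rqn r by (metis le_trans mult.commute mult_le_mono2 nat_mult_1_right)
    have "c ^ (4 * 2 ^ k) = exp (- (4 * b) * 2 ^ k)"
    proof -
      have "c ^ (4 * 2 ^ k) = exp (ln c) ^ (4 * 2 ^ k)" using c by simp
      also have "\<dots> = exp (real (4 * 2 ^ k) * ln c)" by (rule exp_of_nat_mult[symmetric])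
      finally show ?thesis by (simp add: b_def algebra_simps)
    qed
    also have "\<dots> \<le> exp (- (4 * b) * (real n / 9) powr (1 / 4))"
    proof -
      have "real n < real (9 ^ (k + 1))" using k(2) by (simp only: of_nat_less_iff)
      then have "real n / 9 \<le> 9 ^ k" by simp
      also have "(9::real) ^ k \<le> 16 ^ k" by (rule power_mono) auto
      also have "(16::real) ^ k = (2 ^ 4) ^ k" by simp
      also have "\<dots> = (2 ^ k) ^ 4" unfolding power_mult[symmetric] by (simp only: mult.commute)
      also have "\<dots> = (2 ^ k) powr 4" by (simp add: powr_numeral)
      finally have "(real n / 9) powr (1 / 4) \<le> ((2 ^ k) powr 4) powr (1 / 4)" by (intro powr_mono2) auto
      then have "(real n / 9) powr (1 / 4) \<le> 2 ^ k" unfolding powr_powr by simp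
      then show ?thesis using b by simp
    qed
    finally have "real q ^ d * c ^ (4 * 2 ^ k) \<le> real n ^ d * exp (- (4 * b) * (real n / 9) powr (1 / 4))"
      using \<open>q \<le> n\<close> c by (intro mult_mono power_mono) auto
    also have "\<dots> \<le> real n powr (- 1 / 2) / 2" using elim(2,4) by (simp add: d'_def powr_realpow)
    finally have 1: "real q ^ d * c ^ (4 * 2 ^ k) \<le> real n powr (- 1 / 2) / 2" .
    have "D / real q \<le> (2 * D * R) / real n"
      using mult_left_mono[OF low2 D] q0 elim(4) by (simp add: field_simps)
    with elim(3) have "D / real q \<le> real n powr (- 1 / 2) / 2" by linarith
    with 1 have "real q ^ d * c ^ (4 * 2 ^ k) + D / real q \<le> real n powr (- 1 / 2)" by linarith
    then show ?case using q0 rqn low1 by (intro exI[of _ k] exI[of _ q]) (simp add: q_def)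
  qed
qed

definition block :: "nat \<Rightarrow> nat \<Rightarrow> int ^ 'd::finite \<Rightarrow> int ^ 'd \<Rightarrow> (int ^ 'd) set" where
  "block L r x y = Box L (x + int r *s y) r"

context heavy_kernel
begin

text \<open>Sites outside the cube count as closed, so open chains cannot leave it.\<close>

definition opn :: "nat \<Rightarrow> nat \<Rightarrow> nat \<Rightarrow> int ^ 'd \<Rightarrow> nat \<Rightarrow> ('d path \<Rightarrow> bool) \<Rightarrow> int ^ 'd \<Rightarrow> bool" where
  "opn L l r x q f y \<longleftrightarrow> y \<in> torus q \<and> open_block L l r (x + int r *s y) f"

lemma open_step:
  assumes r: "r \<ge> 1" and st: "stp (opn L l r x q f) y y'" and u: "u \<in> block L r x y'"
  obtains xs where "xs \<in> base_class L l (block L r x y)" "f xs" "u \<in> set xs"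
proof -
  obtain z where z: "z \<in> torus r" "u = proj L (x + int r *s y' + z)" using u by (auto simp: block_def Box_def)
  define t where "t = int r *s (y' - y) + z"
  have "t \<in> window r"
    unfolding window_def
  proof (intro CollectI allI)
    fix i
    have "\<bar>y $ i - y' $ i\<bar> \<le> 1" using st by (auto simp: stp_def adj_def) (metis abs_zero diff_self order.refl zero_le_one)
    then consider "y' $ i - y $ i = 0" | "y' $ i - y $ i = 1" | "y' $ i - y $ i = -1" by linarith
    moreover have "t $ i = int r * (y' $ i - y $ i) + z $ i" by (simp add: t_def algebra_simps)
    moreover have "0 \<le> z $ i" "z $ i < int r" using z(1) by (auto simp: torus_def)
    ultimately show "t $ i \<in> {- int r..<2 * int r}" by cases auto
  qed
  moreover have "proj L (x + int r *s y + t) = u" unfolding z(2) t_def by (simp add: vector_ssub_ldistrib algebra_simps)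
  ultimately show ?thesis using st that unfolding stp_def opn_def open_block_def block_def by metis
qed

text \<open>The chain is followed backwards from its end \<open>u\<close>: openness of a block
  provides, for each vertex of the next block, some vertex from which it is reached, but not a
  prescribed one.\<close>

lemma open_chain:
  assumes r: "r \<ge> 1" and J: "\<And>y. y \<in> torus q \<Longrightarrow> base_class L l (block L r x y) \<subseteq> J"
    and ch: "(stp (opn L l r x q f) ^^ k) y y'" and u: "u \<in> block L r x y'"
  shows "\<exists>v\<in>block L r x y. (hop J f ^^ k) v u"
  using ch
proof (induction k arbitrary: y)
  case 0
  then show ?case using u by auto
next
  case (Suc k)
  from Suc.prems obtain y1 where y1: "stp (opn L l r x q f) y y1" "(stp (opn L l r x q f) ^^ k) y1 y'"
    by (meson relpowp_Suc_D2)
  obtain v1 where v1: "v1 \<in> block L r x y1" "(hop J f ^^ k) v1 u" using Suc.IH[OF y1(2)] by blast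
  obtain xs where xs: "xs \<in> base_class L l (block L r x y)" "f xs" "v1 \<in> set xs"
    by (rule open_step[OF r y1(1) v1(1)])
  have "y \<in> torus q" using y1(1) by (simp add: stp_def opn_def)
  then have "hop J f (hd xs) v1" using J xs unfolding hop_def by blast
  then have "(hop J f ^^ Suc k) (hd xs) u" using v1(2) by (meson relpowp_Suc_I2)
  moreover have "hd xs \<in> block L r x y" using xs(1) by (simp add: base_class_def)
  ultimately show ?case by blast
qed

lemma open_chain_rch:
  assumes r: "r \<ge> 1" and J: "\<And>y. y \<in> torus q \<Longrightarrow> base_class L l (block L r x y) \<subseteq> J"
    and ch: "rch (stp (opn L l r x q f)) k y y'" and u: "u \<in> block L r x y'"
  obtains v where "v \<in> block L r x y" "rch (hop J f) k v u"
  using ch open_chain[OF r J _ u] unfolding rch_def by meson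

lemma block_subset: "y \<in> torus q \<Longrightarrow> r * q \<le> n \<Longrightarrow> block L r x y \<subseteq> Box L x n"
  unfolding block_def by (rule Box_sub)

lemma block_disjoint:
  "y \<in> torus q \<Longrightarrow> y' \<in> torus q \<Longrightarrow> r * q \<le> L \<Longrightarrow> y \<noteq> y' \<Longrightarrow> block L r x y \<inter> block L r x y' = {}"
  unfolding block_def by (rule Box_disjoint)

lemma card_blocks:
  fixes H :: "(int ^ 'd) set"
  assumes "H \<subseteq> torus q" "r * q \<le> L" "q > 0"
  shows "card (\<Union>y\<in>H. block L r x y) = card H * r ^ CARD('d)"
proof -
  have fH: "finite H" using assms(1) finite_torus by (rule finite_subset)
  have rL: "r \<le> L" using assms(2,3) by (metis le_trans mult.commute mult_le_mono1 nat_mult_1 Suc_leI One_nat_def)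
  have "card (\<Union>y\<in>H. block L r x y) = (\<Sum>y\<in>H. card (block L r x y))"
  proof (rule card_UN_disjoint[OF fH])
    show "\<forall>y\<in>H. \<forall>y'\<in>H. y \<noteq> y' \<longrightarrow> block L r x y \<inter> block L r x y' = {}"
      using block_disjoint[OF _ _ assms(2)] assms(1) by blast
  qed (simp add: block_def)
  also have "\<dots> = card H * r ^ CARD('d)" using card_Box[OF rL, where 'd = 'd] by (simp add: block_def)
  finally show ?thesis .
qed

lemma block_percolation:
  assumes q: "r * q \<le> L" and c: "0 < c" "4 * (8 * real CARD('d) + 3) * c \<le> 1"
    and pr: "\<And>x. measure_pmf.prob (path_law L l lam) {f. \<not> open_block L l r x f} \<le> c ^ 4 / 9 ^ CARD('d)"
  shows "percolation (paths L l) False (\<lambda>xs. bernoulli_pmf (1 - exp (- lam * wt (kq L) xs)))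
    (opn L l r x q) (\<lambda>y. base_class L l (block L r x y)) q c"
proof
  fix y :: "int ^ 'd" assume y: "y \<in> torus q"
  show "dep (\<lambda>f. opn L l r x q f y) (base_class L l (block L r x y))"
    unfolding dep_def opn_def open_block_def block_def by blast
  show "measure_pmf.prob (Pi_pmf (paths L l) False (\<lambda>xs. bernoulli_pmf (1 - exp (- lam * wt (kq L) xs))))
      {f. \<not> opn L l r x q f y} \<le> c ^ 4 / 9 ^ CARD('d)"
    using pr[of "x + int r *s y"] y unfolding path_law_def opn_def by simp
  fix y' :: "int ^ 'd" assume "y' \<in> torus q" "y \<noteq> y'"
  then have "block L r x y \<inter> block L r x y' = {}" using block_disjoint y q by blast
  then show "base_class L l (block L r x y) \<inter> base_class L l (block L r x y') = {}"
    unfolding base_class_def by blast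
qed (use c in auto)

end

text \<open>The block side \<open>r\<close> and path length \<open>l\<close> are fixed such that
  open blocks are likely for all large \<open>L\<close>; \<open>\<eta>\<close> measures the density
  that the percolation argument may lose.\<close>

locale block_model = heavy_kernel Q \<alpha> K for Q :: "int ^ 'd::finite \<Rightarrow> int ^ 'd \<Rightarrow> real" and \<alpha> K +
  fixes lam c \<eta> :: real and r l L0 :: nat
  assumes lam: "lam > 0" and c: "0 < c" "4 * (8 * real CARD('d) + 3) * c \<le> \<eta>" and \<eta>: "\<eta> \<le> 1"
    and r: "r \<ge> 2" and l: "l \<ge> 1" and L0: "L0 \<ge> 1"
    and open_prob: "\<And>L x. L \<ge> L0 \<Longrightarrow>
      measure_pmf.prob (path_law L l lam) {f. \<not> open_block L l r x f} \<le> c ^ 4 / 9 ^ CARD('d)"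
begin

lemma \<eta>_pos: "\<eta> > 0"
proof -
  have "0 < 4 * (8 * real CARD('d) + 3) * c" using c(1) by (intro mult_pos_pos) auto
  with c(2) show ?thesis by linarith
qed

lemma c1: "4 * (8 * real CARD('d) + 3) * c \<le> 1" using c \<eta> by linarith

lemma percolation: "L \<ge> L0 \<Longrightarrow> r * q \<le> L \<Longrightarrow>
  percolation (paths L l) False (\<lambda>xs. bernoulli_pmf (1 - exp (- lam * wt (kq L) xs)))
    (opn L l r x q) (\<lambda>y. base_class L l (block L r x y)) q c"
  using block_percolation[OF _ c(1) c1 open_prob] by blast

lemma c4: "c \<le> 1 / 4"
proof -
  have "4 * c \<le> 4 * (8 * real CARD('d) + 3) * c" by (rule mult_right_mono) (use c in auto)
  with c1 show ?thesis by linarith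
qed

definition core :: "nat \<Rightarrow> nat \<Rightarrow> (int ^ 'd \<Rightarrow> bool) \<Rightarrow> (int ^ 'd) set" where
  "core k q op = {y \<in> torus q. nice_site c k q op y \<and> hub_site k op y}"

lemma typical_core:
  assumes k: "3 ^ k dvd q" and q: "q > 0"
    and ty: "(\<forall>y\<in>torus q. good op k (lev k y)) \<and>
      real (card {x\<in>torus q. \<not> (nice_site c k q op x \<and> hub_site k op x)}) \<le> 2 * \<eta> * real q ^ CARD('d)"
  shows "(1 - 2 * \<eta>) * real q ^ CARD('d) \<le> real (card (core k q op))" and "anchor op k 0 \<noteq> {}"
    and "a \<in> anchor op k 0 \<Longrightarrow> y \<in> core k q op \<Longrightarrow> rch (stp op) (10 * CARD('d) * q) a y"
proof -
  have top: "\<And>y. y \<in> torus q \<Longrightarrow> good op k (lev k y)"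
    and few: "real (card {x\<in>torus q. \<not> (nice_site c k q op x \<and> hub_site k op x)}) \<le> 2 * \<eta> * real q ^ CARD('d)"
    using ty by blast+
  have "core k q op \<union> {x\<in>torus q. \<not> (nice_site c k q op x \<and> hub_site k op x)} = torus q"
    by (auto simp: core_def)
  then have "card (torus q :: (int ^ 'd) set) \<le> card (core k q op) + card {x\<in>torus q. \<not> (nice_site c k q op x \<and> hub_site k op x)}"
    by (metis card_Un_le)
  then have "real q ^ CARD('d) \<le> real (card (core k q op)) + real (card {x\<in>torus q. \<not> (nice_site c k q op x \<and> hub_site k op x)})"
    unfolding card_torus by (simp flip: of_nat_add of_nat_power)
  with few show "(1 - 2 * \<eta>) * real q ^ CARD('d) \<le> real (card (core k q op))" by (simp add: algebra_simps)
  have "0 \<in> (torus q :: (int ^ 'd) set)" using q by (simp add: torus_def)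
  from top[OF this] show "anchor op k 0 \<noteq> {}" by (intro anchor_nonempty detour_kap_le_cost(1))
  show "rch (stp op) (10 * CARD('d) * q) a y" if "a \<in> anchor op k 0" "y \<in> core k q op"
    using nice_site_reach[OF dim k _ c1 top _ _ that(1) hub_site_anchor] that(2) c(1) by (simp add: core_def)
qed

lemma core_density:
  fixes \<rho> \<delta> :: real
  assumes \<delta>: "0 < \<delta>" "\<delta> < 1" and \<rho>: "\<rho> \<le> (1 - \<delta>) ^ CARD('d) * (1 - 2 * \<eta>)" "\<eta> \<le> 1 / 2"
    and q: "(1 - \<delta>) * real n \<le> real (r * q)" and h: "(1 - 2 * \<eta>) * real q ^ CARD('d) \<le> real h"
  shows "\<rho> * real n ^ CARD('d) \<le> real (h * r ^ CARD('d))"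
proof -
  have "\<rho> * real n ^ CARD('d) \<le> ((1 - \<delta>) ^ CARD('d) * (1 - 2 * \<eta>)) * real n ^ CARD('d)"
    using \<rho> by (intro mult_right_mono) auto
  also have "\<dots> = (1 - 2 * \<eta>) * ((1 - \<delta>) * real n) ^ CARD('d)" by (simp add: power_mult_distrib)
  also have "\<dots> \<le> (1 - 2 * \<eta>) * real (r * q) ^ CARD('d)"
    using \<delta> \<rho> q by (intro mult_left_mono power_mono) auto
  also have "\<dots> = ((1 - 2 * \<eta>) * real q ^ CARD('d)) * real r ^ CARD('d)" by (simp add: power_mult_distrib)
  also have "\<dots> \<le> real h * real r ^ CARD('d)" using h by (intro mult_right_mono) auto
  finally show ?thesis by simp
qed

text \<open>All blocks of the core are reached from an anchor of the origin. With high probability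
  the boxes of level at least \<open>k0\<close> around the origin are good, so this anchor lies in a
  box of fixed side \<open>r * 3 ^ k0\<close>, which is the box to be swept.\<close>

lemma linear_spread:
  assumes \<delta>: "0 < \<delta>" "\<delta> < 1" and \<rho>: "\<rho> \<le> (1 - \<delta>) ^ CARD('d) * (1 - 2 * \<eta>)" "\<eta> \<le> 1 / 2" and e: "e > 0"
  shows "\<exists>n\<ge>1. \<forall>\<^sub>F L in at_top. \<forall>x. measure_pmf.prob (path_law L l lam)
    {f. \<not> \<rho> * real L ^ CARD('d) \<le> real (card {u\<in>torus L. \<exists>z\<in>Box L x n. rch (hop (paths L l) f) (10 * CARD('d) * L) z u})} \<le> e"
proof -
  have "(\<lambda>k. c ^ k) \<longlonglongrightarrow> 0" using c c4 by (intro LIMSEQ_power_zero) auto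
  then have "\<forall>\<^sub>F k in at_top. c ^ k < e / 2" using e by (intro order_tendstoD) auto
  then obtain k0 where k0: "c ^ k0 < e / 2" using eventually_happens'[OF sequentially_bot] by blast
  define D where "D = real CARD('d) * 2 ^ CARD('d) / \<eta>"
  have D: "D \<ge> 0" using \<eta>_pos by (simp add: D_def)
  define n where "n = r * 3 ^ k0"
  have n: "n \<ge> 1" using r by (simp add: n_def Suc_le_eq)
  have "\<forall>\<^sub>F L in at_top. \<exists>k q. 3 ^ k dvd q \<and> q > 0 \<and> r * q \<le> L \<and> (1 - \<delta>) * real L \<le> real (r * q) \<and>
    real q ^ CARD('d) * c ^ (4 * 2 ^ k) + D / real q \<le> real L powr (- 1 / 2)"
    by (rule percolation_scales) (use c c4 r \<delta> D in auto)
  moreover have "\<forall>\<^sub>F L::nat in at_top. real L powr (- 1 / 2) \<le> e / 2" using e by real_asymp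
  ultimately have "\<forall>\<^sub>F L in at_top. \<forall>x. measure_pmf.prob (path_law L l lam)
    {f. \<not> \<rho> * real L ^ CARD('d) \<le> real (card {u\<in>torus L. \<exists>z\<in>Box L x n. rch (hop (paths L l) f) (10 * CARD('d) * L) z u})} \<le> e"
    using eventually_ge_at_top[of L0]
  proof eventually_elim
    case (elim L)
    then obtain k q where kq: "3 ^ k dvd q" "q > 0" "r * q \<le> L" "(1 - \<delta>) * real L \<le> real (r * q)"
      "real q ^ CARD('d) * c ^ (4 * 2 ^ k) + D / real q \<le> real L powr (- 1 / 2)" by blast
    have L: "L > 0" using elim(3) L0 by simp
    show ?case
    proof
      fix x :: "int ^ 'd"
      interpret P: percolation "paths L l" False "\<lambda>xs. bernoulli_pmf (1 - exp (- lam * wt (kq L) xs))"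
        "opn L l r x q" "\<lambda>y. base_class L l (block L r x y)" q c
        by (rule percolation[OF elim(3) kq(3)])
      let ?pr = "\<lambda>A. measure_pmf.prob (path_law L l lam) {f. A f}"
      have 1: "?pr (\<lambda>f. \<not> P.typical \<eta> k (opn L l r x q f)) \<le> e / 2"
        using P.prob_not_typical[OF kq(1,2) c(2) \<eta>] kq(5) elim(2) unfolding path_law_def D_def by (simp add: mult.commute)
      \<comment> \<open>Indexing the levels from \<open>k0\<close> gives the union bound the factor
        \<open>c ^ k0\<close>, which is small however many levels there are.\<close>
      define I where "I = {i. k0 + i \<le> k}"
      have I: "finite I" "I \<subseteq> {..<Suc k}" unfolding I_def by (auto intro: finite_subset[of _ "{..k}"])
      have "?pr (\<lambda>f. \<exists>i\<in>I. \<not> good (opn L l r x q f) (k0 + i) 0) \<le> (\<Sum>i\<in>I. c ^ k0 * c ^ Suc i)"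
      proof (rule prob_union_le[OF I(1)])
        fix i assume "i \<in> I"
        then have "3 ^ (k0 + i) dvd q" using kq(1) unfolding I_def by (metis dvd_trans le_imp_power_dvd mem_Collect_eq)
        moreover have "0 \<in> (torus (q div 3 ^ (k0 + i)) :: (int ^ 'd) set)"
          using calculation kq(2) by (auto simp: torus_def dvd_def)
        ultimately have "P.inside (k0 + i) 0" by (rule P.inside_iff)
        from P.prob_good[OF this] have "?pr (\<lambda>f. \<not> good (opn L l r x q f) (k0 + i) 0) \<le> c ^ (4 * 2 ^ (k0 + i))"
          using P.bad_bound_le[of "k0 + i"] unfolding path_law_def by linarith
        also have "\<dots> \<le> c ^ 2 ^ (k0 + i)" using c c4 by (intro power_decreasing) auto
        also have "\<dots> \<le> c ^ Suc (k0 + i)" using c c4 by (intro power_two_power_le) auto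
        finally show "?pr (\<lambda>f. \<not> good (opn L l r x q f) (k0 + i) 0) \<le> c ^ k0 * c ^ Suc i" by (simp add: power_add mult_ac)
      qed
      also have "\<dots> \<le> (\<Sum>i<Suc k. c ^ k0 * c ^ Suc i)" using I c by (intro sum_mono2) auto
      also have "\<dots> \<le> c ^ k0 * (2 * c)" unfolding sum_distrib_left[symmetric]
        using c c4 by (intro mult_left_mono geometric_bound) auto
      also have "\<dots> \<le> c ^ k0 * 1" using c c4 by (intro mult_left_mono) auto
      finally have 2: "?pr (\<lambda>f. \<exists>i\<in>I. \<not> good (opn L l r x q f) (k0 + i) 0) \<le> e / 2" using k0 by linarith
      have "?pr (\<lambda>f. \<not> \<rho> * real L ^ CARD('d) \<le> real (card {u\<in>torus L. \<exists>z\<in>Box L x n. rch (hop (paths L l) f) (10 * CARD('d) * L) z u})) \<le>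
        ?pr (\<lambda>f. \<not> P.typical \<eta> k (opn L l r x q f) \<or> (\<exists>i\<in>I. \<not> good (opn L l r x q f) (k0 + i) 0))"
      proof (rule prob_mono_pmf, rule ccontr)
        fix f assume few: "\<not> \<rho> * real L ^ CARD('d) \<le> real (card {u\<in>torus L. \<exists>z\<in>Box L x n. rch (hop (paths L l) f) (10 * CARD('d) * L) z u})"
          and "\<not> (\<not> P.typical \<eta> k (opn L l r x q f) \<or> (\<exists>i\<in>I. \<not> good (opn L l r x q f) (k0 + i) 0))"
        then have ty: "P.typical \<eta> k (opn L l r x q f)" and gd: "\<And>i. i \<in> I \<Longrightarrow> good (opn L l r x q f) (k0 + i) 0" by blast+
        let ?op = "opn L l r x q f"
        note tc = typical_core[OF kq(1,2) ty[unfolded P.typical_def]]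
        obtain a where a: "a \<in> anchor ?op k 0" using tc(2) by blast
        have lev0: "lev j 0 = (0 :: int ^ 'd)" for j by (simp add: vec_eq_iff lev_nth)
        have "good ?op j (lev j 0)" if "k0 \<le> j" "j \<le> k" for j
          using gd[of "j - k0"] that by (simp add: I_def lev0)
        then have "kap ?op k 0 \<le> k0" by (rule kap_le)
        moreover have "lev (kap ?op k 0) a = 0" using a by (simp add: anchor_def hub_def lev0)
        ultimately have "lev k0 a = 0" using lev0 by (metis comp_apply funpow_add le_add_diff_inverse2)
        then have "lev k0 a \<in> torus (3 ^ k0 div 3 ^ k0)" by (simp add: torus_def)
        then have "a \<in> torus (3 ^ k0)" by (simp only: lev_torus dvd_refl)
        then have aB: "block L r x a \<subseteq> Box L x n" unfolding n_def by (rule block_subset) simp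
        let ?U = "\<Union>y\<in>core k q ?op. block L r x y"
        have "u \<in> {u\<in>torus L. \<exists>z\<in>Box L x n. rch (hop (paths L l) f) (10 * CARD('d) * L) z u}" if u: "u \<in> ?U" for u
        proof -
          obtain y where y: "y \<in> core k q ?op" "u \<in> block L r x y" using u by blast
          have J: "base_class L l (block L r x y) \<subseteq> paths L l" for y by (auto simp: base_class_def)
          obtain v where v: "v \<in> block L r x a" "rch (hop (paths L l) f) (10 * CARD('d) * q) v u"
            by (rule open_chain_rch[OF _ J tc(3)[OF a y(1)] y(2)]) (use r in auto)
          have "1 * q \<le> r * q" by (rule mult_le_mono1) (use r in simp)
          then have "10 * CARD('d) * q \<le> 10 * CARD('d) * L" using kq(3) by (intro mult_le_mono2) linarith
          from rch_mono[OF v(2) this] have "rch (hop (paths L l) f) (10 * CARD('d) * L) v u" .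
          moreover have "u \<in> torus L" using y(2) Box_subset_torus[OF L] unfolding block_def by (rule subsetD[rotated])
          moreover have "v \<in> Box L x n" using aB v(1) by (rule subsetD)
          ultimately show ?thesis by (intro CollectI conjI bexI)
        qed
        then have "card ?U \<le> card {u\<in>torus L. \<exists>z\<in>Box L x n. rch (hop (paths L l) f) (10 * CARD('d) * L) z u}"
          by (intro card_mono subsetI) auto
        moreover have "card ?U = card (core k q ?op) * r ^ CARD('d)"
          by (rule card_blocks[OF _ kq(3,2)]) (auto simp: core_def)
        moreover have "\<rho> * real L ^ CARD('d) \<le> real (card (core k q ?op) * r ^ CARD('d))"
          using core_density[OF \<delta> \<rho> kq(4) tc(1)] .
        ultimately show False using few by linarith
      qed
      also have "\<dots> \<le> e / 2 + e / 2" by (rule prob_disj_le[OF 1 2])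
      finally show "?pr (\<lambda>f. \<not> \<rho> * real L ^ CARD('d) \<le> real (card {u\<in>torus L. \<exists>z\<in>Box L x n. rch (hop (paths L l) f) (10 * CARD('d) * L) z u})) \<le> e"
        by simp
    qed
  qed
  with n show ?thesis by blast
qed

end

section \<open>Starting points of the recursion\<close>

lemma prob_all_indep:
  fixes A :: "'e \<Rightarrow> ('i \<Rightarrow> 'b) \<Rightarrow> bool"
  assumes I: "finite I" and E: "finite E" and dep: "\<And>e. e \<in> E \<Longrightarrow> dep (A e) (J e)"
    and disj: "\<And>e e'. e \<in> E \<Longrightarrow> e' \<in> E \<Longrightarrow> e \<noteq> e' \<Longrightarrow> J e \<inter> J e' = {}"
    and p: "p \<ge> 0" "\<And>e. e \<in> E \<Longrightarrow> p \<le> measure_pmf.prob (Pi_pmf I d b) {f. A e f}"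
  shows "p ^ card E \<le> measure_pmf.prob (Pi_pmf I d b) {f. \<forall>e\<in>E. A e f}"
  using E dep disj p(2)
proof (induction E rule: finite_induct)
  case (insert a E)
  have dE: "dep (\<lambda>f. \<forall>e\<in>E. A e f) (\<Union>e\<in>E. J e)"
    unfolding dep_def
  proof (intro allI impI ball_cong refl)
    fix f g :: "'i \<Rightarrow> 'b" and e assume fg: "\<forall>i\<in>\<Union> (J ` E). f i = g i" and e: "e \<in> E"
    show "A e f = A e g" by (rule depD[OF insert.prems(1)]) (use fg e in auto)
  qed
  have da: "dep (A a) (J a)" by (rule insert.prems(1)) simp
  have "J a \<inter> J e = {}" if "e \<in> E" for e by (rule insert.prems(2)) (use that insert.hyps in auto)
  then have dj: "J a \<inter> (\<Union>e\<in>E. J e) = {}" by blast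
  have "p ^ card E \<le> measure_pmf.prob (Pi_pmf I d b) {f. \<forall>e\<in>E. A e f}"
    by (rule insert.IH) (use insert.prems in auto)
  moreover have "p \<le> measure_pmf.prob (Pi_pmf I d b) {f. A a f}" by (rule insert.prems) simp
  ultimately have "p * p ^ card E \<le> measure_pmf.prob (Pi_pmf I d b) {f. A a f \<and> (\<forall>e\<in>E. A e f)}"
    unfolding Pi_pmf_indep[OF I da dE dj] using p(1) by (intro mult_mono) auto
  then show ?case using insert.hyps by simp
qed simp

section \<open>Direct jumps and seed blocks\<close>

definition edge_class :: "nat \<Rightarrow> nat \<Rightarrow> int ^ 'd::finite \<Rightarrow> int ^ 'd \<Rightarrow> 'd path set" where
  "edge_class L l v u = {xs \<in> paths L l. hd xs = v \<and> xs ! 1 = u}"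

lemma edge_class_hop:
  assumes l: "l \<ge> 1" and "xs \<in> edge_class L l v u" "xs \<in> J" "f xs"
  shows "hop J f v u"
proof -
  have "length xs > 1" using assms by (simp add: edge_class_def paths_def lists_of_def)
  then have "u \<in> set xs" using assms(2) by (auto simp: edge_class_def)
  then show ?thesis using assms unfolding hop_def edge_class_def by blast
qed

lemma edge_class_eq:
  assumes "v \<in> torus L" "u \<in> torus L"
  shows "edge_class L (Suc n) v u = (\<lambda>ys. v # u # ys) ` lists_of L n"
proof (intro equalityI subsetI)
  fix xs assume "xs \<in> edge_class L (Suc n) v u"
  then show "xs \<in> (\<lambda>ys. v # u # ys) ` lists_of L n"
    by (cases xs; cases "tl xs") (auto simp: edge_class_def paths_def lists_of_def)
qed (use assms in \<open>auto simp: edge_class_def paths_def lists_of_def\<close>)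

lemma edge_class_disjoint: "(v, u) \<noteq> (v', u') \<Longrightarrow> edge_class L l v u \<inter> edge_class L l v' u' = {}"
  by (auto simp: edge_class_def)

context heavy_kernel
begin

text \<open>The paths on which constructions inside \<open>B\<close> depend. The classes of disjoint
  sets are disjoint, and a jump from one such set into another belongs to none of them unless it is
  a \<open>step0\<close> step; links between boxes are therefore independent of what happens
  inside.\<close>

definition inner :: "nat \<Rightarrow> nat \<Rightarrow> (int ^ 'd) set \<Rightarrow> 'd path set" where
  "inner L l B = {xs \<in> paths L l. hd xs \<in> B \<and> (xs ! 1 = proj L (hd xs + step0) \<or> xs ! 1 \<in> B)}"

text \<open>A vertex of an open block need not carry a particle; from a vertex of a seed, all of its block is
  reached.  Paths with first step \<open>step0\<close> are excluded so that seeds are independent of open blocks.\<close>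

definition seed :: "nat \<Rightarrow> nat \<Rightarrow> (int ^ 'd) set \<Rightarrow> ('d path \<Rightarrow> bool) \<Rightarrow> bool" where
  "seed L l B f \<longleftrightarrow> (\<forall>v\<in>B. \<forall>u\<in>B. v \<noteq> u \<and> u \<noteq> proj L (v + step0) \<longrightarrow> (\<exists>xs\<in>edge_class L l v u. f xs))"

lemma base_class_inner: "B \<subseteq> B' \<Longrightarrow> base_class L l B \<subseteq> inner L l B'"
  by (auto simp: base_class_def inner_def)

lemma edge_class_inner: "v \<in> B \<Longrightarrow> u \<in> B \<Longrightarrow> edge_class L l v u \<subseteq> inner L l B"
  by (auto simp: edge_class_def inner_def)

lemma inner_mono: "B \<subseteq> B' \<Longrightarrow> inner L l B \<subseteq> inner L l B'"
  by (auto simp: inner_def)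

text \<open>The only excluded jump from \<open>v\<close> is the one along \<open>step0\<close>; a
  third vertex \<open>m\<close> of the block serves as intermediate stop, hence two hops.\<close>

lemma seed_rch:
  assumes l: "l \<ge> 1" and sd: "seed L l B f" and B: "B \<subseteq> B'" "B \<subseteq> torus L" "card B \<ge> 3" and vw: "v \<in> B" "w \<in> B"
  shows "rch (hop (inner L l B') f) 2 v w"
proof -
  let ?R = "hop (inner L l B') f"
  have direct: "?R v u" if "v \<in> B" "u \<in> B" "v \<noteq> u" "u \<noteq> proj L (v + step0)" for v u
  proof -
    have "\<exists>xs\<in>edge_class L l v u. f xs" using sd that unfolding seed_def by blast
    then obtain xs where xs: "xs \<in> edge_class L l v u" "f xs" by (rule bexE)
    have "xs \<in> inner L l B'" using edge_class_inner[OF that(1,2)] inner_mono[OF B(1)] xs(1) by blast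
    with xs l show ?thesis by (intro edge_class_hop)
  qed
  consider "v = w" | "v \<noteq> w" "w \<noteq> proj L (v + step0)" | "v \<noteq> w" "w = proj L (v + step0)" by blast
  then show ?thesis
  proof cases
    case 1
    then show ?thesis by simp
  next
    case 2
    then show ?thesis using direct[OF vw 2] by (intro rch_step) auto
  next
    case 3
    have "\<not> B \<subseteq> {v, w}"
    proof
      assume "B \<subseteq> {v, w}"
      then have "card B \<le> card {v, w}" by (intro card_mono) auto
      also have "\<dots> \<le> 2" by (simp add: card_insert_if)
      finally show False using B(3) by simp
    qed
    then obtain m where m: "m \<in> B" "m \<noteq> v" "m \<noteq> w" by blast
    have "w \<noteq> proj L (m + step0)"
    proof
      assume "w = proj L (m + step0)"
      then have "proj L (proj L (m + step0) - step0) = proj L (proj L (v + step0) - step0)" using 3 by simp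
      then have "proj L m = proj L v" by simp
      then show False using m vw B(2) by (auto simp: proj_id subset_iff)
    qed
    then have "?R m w" using m vw by (intro direct) auto
    moreover have "?R v m" using m vw 3 by (intro direct) auto
    ultimately have "rch ?R (1 + 1) v w" by (intro rch_trans[of ?R 1 v m]) (auto intro: rch_step)
    then show ?thesis by (simp add: numeral_2_eq_2)
  qed
qed

lemma sum_wt_edge_class:
  assumes L: "L > 0" and l: "l \<ge> 1" and v: "v \<in> torus L" "u \<in> torus L"
  shows "(\<Sum>xs\<in>edge_class L l v u. wt (kq L) xs) = kq L v u"
proof -
  obtain n where n: "l = Suc n" using l by (cases l) auto
  have "(\<Sum>xs\<in>edge_class L l v u. wt (kq L) xs) = (\<Sum>ys\<in>lists_of L n. wt (kq L) (v # u # ys))"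
    unfolding n edge_class_eq[OF v] by (subst sum.reindex) (auto simp: inj_on_def)
  also have "\<dots> = kq L v u" using sum_wt[OF L, of u n] by (simp flip: sum_distrib_left)
  finally show ?thesis .
qed

text \<open>Classes of different pairs are disjoint, and the paths in the class of a pair have total
  weight \<open>kq L v u\<close>; the exponents of the pairs therefore add up.\<close>

lemma prob_no_edge:
  assumes L: "L > 0" and l: "l \<ge> 1" and lam: "lam > 0" and P: "P \<subseteq> torus L \<times> torus L"
    and w: "\<And>v u. (v, u) \<in> P \<Longrightarrow> w \<le> kq L v u"
  shows "measure_pmf.prob (path_law L l lam) {f. \<forall>(v, u)\<in>P. \<forall>xs\<in>edge_class L l v u. \<not> f xs} \<le> exp (- lam * (real (card P) * w))"
proof -
  let ?U = "\<Union>(v, u)\<in>P. edge_class L l v u"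
  have fP: "finite P" using P by (rule finite_subset) simp
  have U: "?U \<subseteq> paths L l" by (auto simp: edge_class_def)
  have fe: "finite (edge_class L l v u)" for v u :: "int ^ 'd"
    by (rule finite_subset[of _ "paths L l"]) (auto simp: edge_class_def)
  have "real (card P) * w = (\<Sum>p\<in>P. w)" by simp
  also have "\<dots> \<le> (\<Sum>(v, u)\<in>P. kq L v u)" using w by (intro sum_mono) auto
  also have "\<dots> = (\<Sum>p\<in>P. \<Sum>xs\<in>edge_class L l (fst p) (snd p). wt (kq L) xs)"
    using sum_wt_edge_class[OF L l] P by (intro sum.cong refl) (auto simp: subset_iff)
  also have "\<dots> = (\<Sum>xs\<in>(\<Union>p\<in>P. edge_class L l (fst p) (snd p)). wt (kq L) xs)"
  proof (rule sum.UNION_disjoint[symmetric, OF fP])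
    show "\<forall>p\<in>P. \<forall>p'\<in>P. p \<noteq> p' \<longrightarrow> edge_class L l (fst p) (snd p) \<inter> edge_class L l (fst p') (snd p') = {}"
      by (intro ballI impI edge_class_disjoint) simp
  qed (simp add: fe)
  finally have le: "real (card P) * w \<le> (\<Sum>xs\<in>?U. wt (kq L) xs)" by (simp add: case_prod_unfold)
  have "{f. \<forall>(v, u)\<in>P. \<forall>xs\<in>edge_class L l v u. \<not> f xs} = {f. \<forall>xs\<in>?U. \<not> f xs}" by auto
  then have "measure_pmf.prob (path_law L l lam) {f. \<forall>(v, u)\<in>P. \<forall>xs\<in>edge_class L l v u. \<not> f xs} =
    exp (- lam * (\<Sum>xs\<in>?U. wt (kq L) xs))"
    unfolding path_law_def by (simp only:) (rule prob_void[OF U finite_paths wt_nonneg lam])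
  also have "\<dots> \<le> exp (- lam * (real (card P) * w))" using le lam by simp
  finally show ?thesis .
qed

lemma kq_Box_lower:
  assumes n: "n \<le> L" and v: "v \<in> Box L x n" "u \<in> Box L x n" "v \<noteq> u"
  shows "inverse K * real n powr - (real CARD('d) + \<alpha>) \<le> kq L v u"
proof -
  obtain a b where ab: "a \<in> torus n" "b \<in> torus n" "v = proj L (x + a)" "u = proj L (x + b)"
    using v by (auto simp: Box_def)
  have "linf (b - a) \<le> int n"
  proof -
    have "\<bar>(b - a) $ i\<bar> \<le> int n" for i
    proof -
      have "0 \<le> a $ i" "a $ i < int n" "0 \<le> b $ i" "b $ i < int n" using ab by (auto simp: torus_def)
      then show ?thesis by simp
    qed
    then show ?thesis unfolding linf_def by (subst Max_le_iff) auto
  qed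
  then have "inverse K * real n powr - (real CARD('d) + \<alpha>) \<le> Q 0 (b - a)"
    using Q0_lower[of "b - a" n] ab v(3) by auto
  also have "\<dots> \<le> qL L (b - a)" by (rule qL_ge)
  also have "\<dots> = kq L v u" by (simp add: ab torus_kernel_def)
  finally show ?thesis .
qed

definition seed_class :: "nat \<Rightarrow> nat \<Rightarrow> (int ^ 'd) set \<Rightarrow> 'd path set" where
  "seed_class L l B = {xs \<in> paths L l. hd xs \<in> B \<and> xs ! 1 \<noteq> proj L (hd xs + step0)}"

lemma dep_seed: "dep (seed L l B) (seed_class L l B)"
  unfolding dep_def
proof (intro allI impI)
  fix f g :: "'d path \<Rightarrow> bool" assume fg: "\<forall>xs\<in>seed_class L l B. f xs = g xs"
  have "(\<exists>xs\<in>edge_class L l v u. f xs) = (\<exists>xs\<in>edge_class L l v u. g xs)"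
    if "v \<in> B" "u \<noteq> proj L (v + step0)" for v u
    using fg that by (intro bex_cong refl) (auto simp: edge_class_def seed_class_def)
  then show "seed L l B f = seed L l B g" unfolding seed_def by (intro ball_cong refl) blast
qed

text \<open>At most \<open>r ^ d * r ^ d\<close> independent jumps are required, each with a
  probability bounded below in terms of \<open>r\<close>. The product may be tiny, but it is
  positive uniformly in \<open>L\<close> and \<open>x\<close>.\<close>

lemma prob_seed:
  assumes L: "r \<le> L" and r: "r \<ge> 1" and l: "l \<ge> 1" and lam: "lam > 0"
  shows "(1 - exp (- lam * (inverse K * real r powr - (real CARD('d) + \<alpha>)))) ^ (r ^ CARD('d) * r ^ CARD('d)) \<le>
    measure_pmf.prob (path_law L l lam) {f. seed L l (Box L x r) f}"
proof -
  let ?B = "Box L x r" and ?w = "inverse K * real r powr - (real CARD('d) + \<alpha>)"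
  define E where "E = {(v, u) \<in> ?B \<times> ?B. v \<noteq> u \<and> u \<noteq> proj L (v + step0)}"
  have E: "E \<subseteq> ?B \<times> ?B" by (auto simp: E_def)
  have fE: "finite E" using E by (rule finite_subset) simp
  have L0: "L > 0" using L r by simp
  have p0: "0 \<le> 1 - exp (- lam * ?w)" using lam K by simp
  have "(1 - exp (- lam * ?w)) ^ card E \<le>
    measure_pmf.prob (path_law L l lam) {f. \<forall>e\<in>E. \<exists>xs\<in>edge_class L l (fst e) (snd e). f xs}"
    unfolding path_law_def
  proof (rule prob_all_indep[OF finite_paths fE _ _ p0, where J = "\<lambda>e. edge_class L l (fst e) (snd e)"])
    fix e assume e: "e \<in> E"
    show "dep (\<lambda>f. \<exists>xs\<in>edge_class L l (fst e) (snd e). f xs) (edge_class L l (fst e) (snd e))"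
      unfolding dep_def by auto
    have "fst e \<in> ?B" "snd e \<in> ?B" using e by (auto simp: E_def)
    then have t: "fst e \<in> torus L" "snd e \<in> torus L" using Box_subset_torus[OF L0, of x r] by blast+
    have "measure_pmf.prob (path_law L l lam) {f. \<forall>(v, u)\<in>{e}. \<forall>xs\<in>edge_class L l v u. \<not> f xs} \<le> exp (- lam * (real (card {e}) * ?w))"
    proof (rule prob_no_edge[OF L0 l lam])
      show "{e} \<subseteq> torus L \<times> torus L" using t by (simp add: mem_Times_iff)
      fix v u assume "(v, u) \<in> {e}"
      then have "v \<in> ?B" "u \<in> ?B" "v \<noteq> u" using e by (auto simp: E_def)
      then show "?w \<le> kq L v u" by (rule kq_Box_lower[OF L])
    qed
    moreover have "measure_pmf.prob (path_law L l lam) {f. \<exists>xs\<in>edge_class L l (fst e) (snd e). f xs} =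
      1 - measure_pmf.prob (path_law L l lam) {f. \<forall>(v, u)\<in>{e}. \<forall>xs\<in>edge_class L l v u. \<not> f xs}"
    proof -
      have "{f. \<exists>xs\<in>edge_class L l (fst e) (snd e). f xs} = UNIV - {f. \<forall>(v, u)\<in>{e}. \<forall>xs\<in>edge_class L l v u. \<not> f xs}"
        by (auto simp: case_prod_unfold)
      then show ?thesis using measure_pmf.prob_compl[of "{f. \<forall>(v, u)\<in>{e}. \<forall>xs\<in>edge_class L l v u. \<not> f xs}" "path_law L l lam"] by simp
    qed
    ultimately show "1 - exp (- lam * ?w) \<le> measure_pmf.prob (Pi_pmf (paths L l) False (\<lambda>xs. bernoulli_pmf (1 - exp (- lam * wt (kq L) xs))))
      {f. \<exists>xs\<in>edge_class L l (fst e) (snd e). f xs}" unfolding path_law_def by simp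
  next
    fix e e' assume "e \<in> E" "e' \<in> E" "e \<noteq> e'"
    then show "edge_class L l (fst e) (snd e) \<inter> edge_class L l (fst e') (snd e') = {}"
      by (intro edge_class_disjoint) (auto simp: prod_eq_iff)
  qed
  also have "{f. \<forall>e\<in>E. \<exists>xs\<in>edge_class L l (fst e) (snd e). f xs} = {f. seed L l ?B f}"
    unfolding seed_def E_def by auto
  also have "(1 - exp (- lam * ?w)) ^ (r ^ CARD('d) * r ^ CARD('d)) \<le> (1 - exp (- lam * ?w)) ^ card E"
  proof (rule power_decreasing)
    have "card E \<le> card (?B \<times> ?B)" using E by (intro card_mono) auto
    then show "card E \<le> r ^ CARD('d) * r ^ CARD('d)" by (simp add: card_cartesian_product card_Box[OF L])
  qed (use p0 in auto)
  finally show ?thesis by simp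
qed

text \<open>\<open>G\<close> collects vertices at which the construction can be entered and
  \<open>A\<close> vertices that it then activates. Restricting hops to \<open>inner\<close> makes
  the property depend on the box alone.\<close>

definition spreads :: "nat \<Rightarrow> nat \<Rightarrow> int ^ 'd \<Rightarrow> nat \<Rightarrow> nat \<Rightarrow> ('d path \<Rightarrow> bool) \<Rightarrow> (int ^ 'd) set \<Rightarrow> (int ^ 'd) set \<Rightarrow> bool" where
  "spreads L l x n h f A G \<longleftrightarrow> A \<subseteq> Box L x n \<and> G \<subseteq> Box L x n \<and>
     (\<forall>v\<in>G. \<forall>u\<in>A. rch (hop (inner L l (Box L x n)) f) h v u)"

end

context block_model
begin

lemma core_subset: "core k q op \<subseteq> torus q"
  by (auto simp: core_def)

lemma stp_sym: "stp op y y' \<Longrightarrow> stp op y' y"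
  by (auto simp: stp_def adj_sym)

text \<open>Two hops inside the seed lead to the vertex at which the chain of open blocks begins, a
  vertex that cannot be prescribed. The chain runs through an anchor of the origin, which doubles
  \<open>10 * d * q\<close>.\<close>

lemma core_spreads:
  fixes f :: "'d path \<Rightarrow> bool"
  assumes k: "3 ^ k dvd q" "q > 0" and rq: "r * q \<le> n" and n: "n \<le> L" and L: "L \<ge> L0"
    and ty: "(\<forall>y\<in>torus q. good (opn L l r x q f) k (lev k y)) \<and>
      real (card {y\<in>torus q. \<not> (nice_site c k q (opn L l r x q f) y \<and> hub_site k (opn L l r x q f) y)}) \<le> 2 * \<eta> * real q ^ CARD('d)"
  shows "spreads L l x n (20 * CARD('d) * n + 2) f (\<Union>y\<in>core k q (opn L l r x q f). block L r x y)
    (\<Union>y\<in>{y\<in>core k q (opn L l r x q f). seed L l (block L r x y) f}. block L r x y)"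
proof -
  let ?op = "opn L l r x q f" and ?J = "inner L l (Box L x n)"
  have L1: "L > 0" using L L0 by simp
  note tc = typical_core[OF k ty]
  obtain a where a: "a \<in> anchor ?op k 0" using tc(2) by blast
  have sub: "block L r x y \<subseteq> Box L x n" if "y \<in> torus q" for y
    by (rule block_subset[OF that rq])
  have "r * 1 \<le> r * q" by (rule mult_le_mono2) (use k in simp)
  then have rL: "r \<le> L" using rq n by linarith
  have "2 ^ 2 \<le> r ^ 2" using r by (rule power_mono) simp
  also have "\<dots> \<le> r ^ CARD('d)" using r dim by (intro power_increasing) auto
  finally have r3: "3 \<le> r ^ CARD('d)" by simp
  have main: "rch (hop ?J f) (20 * CARD('d) * n + 2) v u"
    if y: "y \<in> core k q ?op" "seed L l (block L r x y) f" and v: "v \<in> block L r x y"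
      and y': "y' \<in> core k q ?op" and u: "u \<in> block L r x y'" for v u y y'
  proof -
    have "rch (stp ?op) (10 * CARD('d) * q + 10 * CARD('d) * q) y y'"
      by (rule rch_trans[OF rch_sym[OF stp_sym tc(3)[OF a y(1)]] tc(3)[OF a y']])
    then have st: "rch (stp ?op) (20 * CARD('d) * q) y y'" by (rule rch_mono) simp
    have J: "base_class L l (block L r x y) \<subseteq> ?J" if "y \<in> torus q" for y
      by (rule base_class_inner[OF sub[OF that]])
    obtain w where w: "w \<in> block L r x y" "rch (hop ?J f) (20 * CARD('d) * q) w u"
      by (rule open_chain_rch[OF _ J st u]) (use r in auto)
    have "rch (hop ?J f) 2 v w"
    proof (rule seed_rch[OF l y(2) _ _ _ v w(1)])
      show "block L r x y \<subseteq> Box L x n" using sub y(1) core_subset by blast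
      show "block L r x y \<subseteq> torus L" unfolding block_def by (rule Box_subset_torus[OF L1])
      show "card (block L r x y) \<ge> 3" unfolding block_def card_Box[OF rL] by (rule r3)
    qed
    from rch_trans[OF this w(2)] have "rch (hop ?J f) (2 + 20 * CARD('d) * q) v u" .
    then show ?thesis
    proof (rule rch_mono)
      have "1 * q \<le> r * q" by (rule mult_le_mono1) (use r in simp)
      then have "20 * CARD('d) * q \<le> 20 * CARD('d) * n" using rq by (intro mult_le_mono2) linarith
      then show "2 + 20 * CARD('d) * q \<le> 20 * CARD('d) * n + 2" by linarith
    qed
  qed
  show ?thesis unfolding spreads_def
  proof (intro conjI ballI)
    fix v u assume v: "v \<in> (\<Union>y\<in>{y\<in>core k q ?op. seed L l (block L r x y) f}. block L r x y)"
      and u: "u \<in> (\<Union>y\<in>core k q ?op. block L r x y)"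
    from v obtain y where "y \<in> core k q ?op" "seed L l (block L r x y) f" "v \<in> block L r x y" by blast
    moreover from u obtain y' where "y' \<in> core k q ?op" "u \<in> block L r x y'" by blast
    ultimately show "rch (hop ?J f) (20 * CARD('d) * n + 2) v u" by (rule main)
  qed (use sub core_subset in blast)+
qed

lemma seed_likely:
  obtains \<theta> :: real where "0 < \<theta>" "\<theta> \<le> 1"
    "\<And>L x. r \<le> L \<Longrightarrow> \<theta> \<le> measure_pmf.prob (path_law L l lam) {f. seed L l (Box L x r) f}"
proof
  let ?\<theta> = "(1 - exp (- lam * (inverse K * real r powr - (real CARD('d) + \<alpha>)))) ^ (r ^ CARD('d) * r ^ CARD('d))"
  have "0 < lam * (inverse K * real r powr - (real CARD('d) + \<alpha>))"
    using lam K r by (intro mult_pos_pos) auto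
  then show "0 < ?\<theta>" "?\<theta> \<le> 1" by (auto intro!: zero_less_power power_le_one)
  show "?\<theta> \<le> measure_pmf.prob (path_law L l lam) {f. seed L l (Box L x r) f}" if "r \<le> L" for L x
    by (rule prob_seed[OF that _ l lam]) (use r in simp)
qed

text \<open>Seeds of different blocks use disjoint path classes, so Chebyshev's inequality applies
  to a set \<open>C\<close> of blocks fixed beforehand; half of the expected number of seeds may be
  lost.\<close>

lemma few_seeds:
  assumes \<theta>: "0 < \<theta>" "\<theta> \<le> 1"
    and likely: "\<And>x. \<theta> \<le> measure_pmf.prob (path_law L l lam) {f. seed L l (Box L x r) f}"
    and q: "r * q \<le> L" and C: "C \<subseteq> torus q" "C \<noteq> {}"
  shows "measure_pmf.prob (path_law L l lam)
    {f. real (card C) * (1 - \<theta> / 2) \<le> real (card {y\<in>C. \<not> seed L l (block L r x y) f})} \<le> 4 / (real (card C) * \<theta>\<^sup>2)"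
proof -
  let ?M = "path_law L l lam"
  have fC: "finite C" using C(1) finite_torus by (rule finite_subset)
  have dp: "dep (\<lambda>f. \<not> seed L l (block L r x y) f) (seed_class L l (block L r x y))" for y
    using dep_seed unfolding dep_def by blast
  have dj: "seed_class L l (block L r x y) \<inter> seed_class L l (block L r x y') = {}"
    if "y \<in> C" "y' \<in> C" "y \<noteq> y'" for y y'
    using block_disjoint[of y q y' r L x] that C(1) q unfolding seed_class_def by blast
  have pr: "measure_pmf.prob ?M {f. \<not> seed L l (block L r x y) f} \<le> 1 - \<theta>" for y
  proof -
    have "measure_pmf.prob ?M (UNIV - {f. seed L l (block L r x y) f}) = 1 - measure_pmf.prob ?M {f. seed L l (block L r x y) f}"
      using measure_pmf.prob_compl[of "{f. seed L l (block L r x y) f}" ?M] by simp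
    moreover have "UNIV - {f. seed L l (block L r x y) f} = {f. \<not> seed L l (block L r x y) f}" by auto
    moreover have "\<theta> \<le> measure_pmf.prob ?M {f. seed L l (block L r x y) f}"
      unfolding block_def by (rule likely)
    ultimately show ?thesis by simp
  qed
  have "measure_pmf.prob ?M {f. real (card C) * ((1 - \<theta>) + \<theta> / 2) \<le>
      real (card {y\<in>C. f \<in> {f. \<not> seed L l (block L r x y) f}})} \<le> (1 - \<theta>) / (real (card C) * (\<theta> / 2)\<^sup>2)"
  proof (rule count_deviation[OF fC C(2)])
    fix y y' assume y: "y \<in> C" "y' \<in> C" "y \<noteq> y'"
    have "{f. \<not> seed L l (block L r x y) f} \<inter> {f. \<not> seed L l (block L r x y') f} =
      {f. \<not> seed L l (block L r x y) f \<and> \<not> seed L l (block L r x y') f}" by blast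
    then show "measure_pmf.prob ?M ({f. \<not> seed L l (block L r x y) f} \<inter> {f. \<not> seed L l (block L r x y') f}) =
      measure_pmf.prob ?M {f. \<not> seed L l (block L r x y) f} * measure_pmf.prob ?M {f. \<not> seed L l (block L r x y') f}"
      using Pi_pmf_indep[OF finite_paths dp dp dj[OF y]] unfolding path_law_def by simp
  qed (use \<theta> pr in auto)
  also have "\<dots> \<le> 1 / (real (card C) * (\<theta> / 2)\<^sup>2)" using \<theta> by (intro divide_right_mono) auto
  also have "\<dots> = 4 / (real (card C) * \<theta>\<^sup>2)" by (simp add: power_divide)
  finally show ?thesis by (simp add: algebra_simps)
qed

text \<open>The core is a function of paths with first step \<open>step0\<close>, and seeds are
  functions of paths with other first steps. Freezing the former makes the core a fixed set, to
  which \<open>few_seeds\<close> applies.\<close>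

lemma base_spreads:
  assumes \<delta>: "0 < \<delta>" "\<delta> < 1" and \<eta>': "\<eta> < 1 / 2" and \<rho>: "\<rho> > 0" "\<rho> \<le> (1 - \<delta>) ^ CARD('d) * (1 - 2 * \<eta>)"
  obtains \<theta> :: real where "0 < \<theta>" "\<forall>\<^sub>F n in at_top. \<forall>L x. n \<le> L \<longrightarrow> L0 \<le> L \<longrightarrow>
    measure_pmf.prob (path_law L l lam) {f. \<not> (\<exists>A G. spreads L l x n (20 * CARD('d) * n + 2) f A G \<and>
      \<rho> * real n ^ CARD('d) \<le> real (card A) \<and> \<theta> * real (card A) \<le> real (card G))} \<le> 2 * real n powr (- 1 / 2)"
proof -
  obtain \<theta> :: real where \<theta>: "0 < \<theta>" "\<theta> \<le> 1"
    "\<And>L x. r \<le> L \<Longrightarrow> \<theta> \<le> measure_pmf.prob (path_law L l lam) {f. seed L l (Box L x r) f}"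
    using seed_likely by blast
  define D where "D = real CARD('d) * 2 ^ CARD('d) / \<eta>"
  have D: "D \<ge> 0" using \<eta>_pos by (simp add: D_def)
  define E where "E = 4 * real r ^ CARD('d) / (\<rho> * \<theta>\<^sup>2)"
  have "\<forall>\<^sub>F n in at_top. \<exists>k q. 3 ^ k dvd q \<and> q > 0 \<and> r * q \<le> n \<and> (1 - \<delta>) * real n \<le> real (r * q) \<and>
    real q ^ CARD('d) * c ^ (4 * 2 ^ k) + D / real q \<le> real n powr (- 1 / 2)"
    by (rule percolation_scales) (use c c4 r \<delta> D in auto)
  moreover have "\<forall>\<^sub>F n::nat in at_top. E / real n \<le> real n powr (- 1 / 2)" by real_asymp
  ultimately have "\<forall>\<^sub>F n in at_top. \<forall>L x. n \<le> L \<longrightarrow> L0 \<le> L \<longrightarrow>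
    measure_pmf.prob (path_law L l lam) {f. \<not> (\<exists>A G. spreads L l x n (20 * CARD('d) * n + 2) f A G \<and>
      \<rho> * real n ^ CARD('d) \<le> real (card A) \<and> (\<theta> / 2) * real (card A) \<le> real (card G))} \<le> 2 * real n powr (- 1 / 2)"
    using eventually_gt_at_top[of 0]
  proof eventually_elim
    case (elim n)
    then obtain k q where kq: "3 ^ k dvd q" "q > 0" "r * q \<le> n" "(1 - \<delta>) * real n \<le> real (r * q)"
      "real q ^ CARD('d) * c ^ (4 * 2 ^ k) + D / real q \<le> real n powr (- 1 / 2)" by blast
    note n = elim(3)
    show ?case
    proof (intro allI impI)
      fix L and x :: "int ^ 'd" assume L: "n \<le> L" "L0 \<le> L"
      have rqL: "r * q \<le> L" using kq(3) L(1) by linarith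
      have "r * 1 \<le> r * q" by (rule mult_le_mono2) (use kq in simp)
      then have rL: "r \<le> L" using rqL by linarith
      interpret P: percolation "paths L l" False "\<lambda>xs. bernoulli_pmf (1 - exp (- lam * wt (kq L) xs))"
        "opn L l r x q" "\<lambda>y. base_class L l (block L r x y)" q c
        by (rule percolation[OF L(2) rqL])
      let ?pr = "\<lambda>A. measure_pmf.prob (path_law L l lam) {f. A f}"
      let ?op = "\<lambda>f. opn L l r x q f" and ?s = "\<lambda>f y. seed L l (block L r x y) f"
      have size: "\<rho> * real n ^ CARD('d) \<le> real (card (core k q (?op f)) * r ^ CARD('d))"
        if "P.typical \<eta> k (?op f)" for f
        using core_density[OF \<delta> \<rho>(2) _ kq(4) typical_core(1)[OF kq(1,2) that[unfolded P.typical_def]]] \<eta>' by simp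
      have ne: "core k q (?op f) \<noteq> {}" if "P.typical \<eta> k (?op f)" for f
      proof
        assume "core k q (?op f) = {}"
        then have "\<rho> * real n ^ CARD('d) \<le> 0" using size[OF that] by simp
        moreover have "\<rho> * real n ^ CARD('d) > 0" using \<rho>(1) n by simp
        ultimately show False by linarith
      qed
      have 1: "?pr (\<lambda>f. \<not> P.typical \<eta> k (?op f)) \<le> real n powr (- 1 / 2)"
        using P.prob_not_typical[OF kq(1,2) c(2) \<eta>] kq(5) unfolding path_law_def D_def by (simp add: mult.commute)
      define B where "B = (\<lambda>f. P.typical \<eta> k (?op f) \<and> real (card (core k q (?op f))) * (1 - \<theta> / 2) \<le>
        real (card {y\<in>core k q (?op f). \<not> ?s f y}))"
      define J where "J = (\<Union>y\<in>torus q. base_class L l (block L r x y))"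
      have 2: "?pr B \<le> E / real n"
        unfolding path_law_def
      proof (rule Pi_pmf_cond_le[OF finite_paths, where J = J])
        fix g :: "'d path \<Rightarrow> bool"
        let ?m = "\<lambda>f xs. if xs \<in> J then g xs else f xs"
        have op: "?op (?m f) = ?op g" for f
        proof
          fix y
          show "?op (?m f) y = ?op g y"
          proof (cases "y \<in> torus q")
            case True
            have "dep (\<lambda>f. ?op f y) J" by (rule dep_mono[OF P.dep_opn[OF True]]) (use True in \<open>auto simp: J_def\<close>)
            then show ?thesis by (rule dep_merge)
          qed (simp add: opn_def)
        qed
        have s: "?s (?m f) y = ?s f y" for f y
          by (rule dep_merge_disj[OF dep_seed]) (auto simp: J_def base_class_def seed_class_def)
        have "?pr (\<lambda>f. B (?m f)) \<le> E / real n"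
        proof (cases "P.typical \<eta> k (?op g)")
          case False
          then show ?thesis unfolding B_def op by (simp add: E_def less_imp_le[OF \<rho>(1)])
        next
          case True
          have "?pr (\<lambda>f. B (?m f)) \<le> 4 / (real (card (core k q (?op g))) * \<theta>\<^sup>2)"
            unfolding B_def op s using True by (simp only: simp_thms)
              (rule few_seeds[OF \<theta>(1,2) \<theta>(3)[OF rL] rqL core_subset ne[OF True]])
          also have "\<dots> \<le> E / real n"
          proof -
            have C0: "0 < real (card (core k q (?op g)))"
              using ne[OF True] core_subset finite_torus by (metis card_gt_0_iff finite_subset of_nat_0_less_iff)
            have "real n ^ 1 \<le> real n ^ CARD('d)" using n by (intro power_increasing) auto
            then have "\<rho> * real n \<le> \<rho> * real n ^ CARD('d)" using \<rho>(1) by simp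
            then have "\<rho> * real n \<le> real (card (core k q (?op g))) * real r ^ CARD('d)" using size[OF True] by simp
            then show ?thesis using C0 \<rho>(1) \<theta>(1) n by (simp add: E_def field_simps)
          qed
          finally show ?thesis .
        qed
        then show "measure_pmf.prob (Pi_pmf (paths L l) False (\<lambda>xs. bernoulli_pmf (1 - exp (- lam * wt (kq L) xs)))) {f. B (?m f)} \<le> E / real n"
          unfolding path_law_def .
      qed
      have "?pr (\<lambda>f. \<not> (\<exists>A G. spreads L l x n (20 * CARD('d) * n + 2) f A G \<and>
        \<rho> * real n ^ CARD('d) \<le> real (card A) \<and> (\<theta> / 2) * real (card A) \<le> real (card G))) \<le>
        ?pr (\<lambda>f. \<not> P.typical \<eta> k (?op f) \<or> B f)"
      proof (rule prob_mono_pmf, rule ccontr)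
        fix f assume no: "\<not> (\<exists>A G. spreads L l x n (20 * CARD('d) * n + 2) f A G \<and>
          \<rho> * real n ^ CARD('d) \<le> real (card A) \<and> (\<theta> / 2) * real (card A) \<le> real (card G))"
          and "\<not> (\<not> P.typical \<eta> k (?op f) \<or> B f)"
        then have ty: "P.typical \<eta> k (?op f)"
          and many: "real (card {y\<in>core k q (?op f). \<not> ?s f y}) < real (card (core k q (?op f))) * (1 - \<theta> / 2)"
          unfolding B_def by auto
        let ?C = "core k q (?op f)"
        let ?S = "{y\<in>?C. ?s f y}"
        have fC: "finite ?C" using core_subset finite_torus by (rule finite_subset)
        have "card ?C = card (?S \<union> {y\<in>?C. \<not> ?s f y})" by (rule arg_cong[of _ _ card]) blast
        also have "\<dots> = card ?S + card {y\<in>?C. \<not> ?s f y}" using fC by (intro card_Un_disjoint) auto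
        finally have "real (card ?C) = real (card ?S) + real (card {y\<in>?C. \<not> ?s f y})" by (simp only: of_nat_add)
        with many have "(\<theta> / 2) * real (card ?C) \<le> real (card ?S)" by (simp add: algebra_simps)
        then have "(\<theta> / 2) * real (card ?C) * real (r ^ CARD('d)) \<le> real (card ?S) * real (r ^ CARD('d))"
          by (rule mult_right_mono) simp
        moreover have "card (\<Union>y\<in>?C. block L r x y) = card ?C * r ^ CARD('d)"
          by (rule card_blocks[OF core_subset rqL kq(2)])
        moreover have "card (\<Union>y\<in>?S. block L r x y) = card ?S * r ^ CARD('d)"
          by (rule card_blocks[OF _ rqL kq(2)]) (use core_subset in blast)
        moreover note core_spreads[OF kq(1-3) L ty[unfolded P.typical_def]] size[OF ty]
        ultimately have "spreads L l x n (20 * CARD('d) * n + 2) f (\<Union>y\<in>?C. block L r x y) (\<Union>y\<in>?S. block L r x y) \<and>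
          \<rho> * real n ^ CARD('d) \<le> real (card (\<Union>y\<in>?C. block L r x y)) \<and>
          (\<theta> / 2) * real (card (\<Union>y\<in>?C. block L r x y)) \<le> real (card (\<Union>y\<in>?S. block L r x y))"
          by (simp add: mult.assoc)
        with no show False by blast
      qed
      also have "\<dots> \<le> real n powr (- 1 / 2) + E / real n" by (rule prob_disj_le[OF 1 2])
      finally show "?pr (\<lambda>f. \<not> (\<exists>A G. spreads L l x n (20 * CARD('d) * n + 2) f A G \<and>
        \<rho> * real n ^ CARD('d) \<le> real (card A) \<and> (\<theta> / 2) * real (card A) \<le> real (card G))) \<le> 2 * real n powr (- 1 / 2)"
        using elim(2) by linarith
    qed
  qed
  with that[of "\<theta> / 2"] \<theta>(1) show ?thesis by simp
qed

end

section \<open>Linking boxes by single jumps\<close>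

context heavy_kernel
begin

text \<open>Of the sets \<open>A\<close> and \<open>G\<close>, jumps leave from \<open>A\<close> and land in \<open>G\<close>.\<close>

definition witness :: "(nat \<Rightarrow> nat) \<Rightarrow> (nat \<Rightarrow> real) \<Rightarrow> real \<Rightarrow> nat \<Rightarrow> (int ^ 'd) set \<Rightarrow> nat \<Rightarrow> int ^ 'd \<Rightarrow> nat \<Rightarrow>
    ('d path \<Rightarrow> bool) \<Rightarrow> (int ^ 'd) set \<times> (int ^ 'd) set \<Rightarrow> bool" where
  "witness \<tau> dens \<theta> l S L x n f = (\<lambda>(A, G). spreads L l x n (\<tau> n) f A G \<and> dens n \<le> real (card A) \<and>
     \<theta> * real (card A) \<le> real (card G) \<and> G \<inter> S \<noteq> {})"

definition lucky :: "(nat \<Rightarrow> nat) \<Rightarrow> (nat \<Rightarrow> real) \<Rightarrow> real \<Rightarrow> nat \<Rightarrow> (int ^ 'd) set \<Rightarrow> nat \<Rightarrow> int ^ 'd \<Rightarrow> nat \<Rightarrow>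
    ('d path \<Rightarrow> bool) \<Rightarrow> bool" where
  "lucky \<tau> dens \<theta> l S L x n f \<longleftrightarrow> (\<exists>p. witness \<tau> dens \<theta> l S L x n f p)"

definition pick :: "(nat \<Rightarrow> nat) \<Rightarrow> (nat \<Rightarrow> real) \<Rightarrow> real \<Rightarrow> nat \<Rightarrow> (int ^ 'd) set \<Rightarrow> nat \<Rightarrow> int ^ 'd \<Rightarrow> nat \<Rightarrow>
    ('d path \<Rightarrow> bool) \<Rightarrow> (int ^ 'd) set \<times> (int ^ 'd) set" where
  "pick \<tau> dens \<theta> l S L x n f = (SOME p. witness \<tau> dens \<theta> l S L x n f p)"

lemma dep_witness: "dep (witness \<tau> dens \<theta> l S L x n) (inner L l (Box L x n))"
  unfolding dep_def
proof (intro allI impI)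
  fix f g :: "'d path \<Rightarrow> bool" assume fg: "\<forall>xs\<in>inner L l (Box L x n). f xs = g xs"
  have "hop (inner L l (Box L x n)) f = hop (inner L l (Box L x n)) g"
    using fg by (intro ext) (auto simp: hop_def)
  then show "witness \<tau> dens \<theta> l S L x n f = witness \<tau> dens \<theta> l S L x n g"
    by (simp add: witness_def spreads_def)
qed

lemma dep_lucky: "dep (lucky \<tau> dens \<theta> l S L x n) (inner L l (Box L x n))"
  using dep_witness unfolding dep_def lucky_def by metis

text \<open>Equal sets of witnesses yield the same choice, so freezing the paths inside a box
  determines the chosen sets \<open>A\<close> and \<open>G\<close>.\<close>

lemma dep_pick: "dep (pick \<tau> dens \<theta> l S L x n) (inner L l (Box L x n))"
  using dep_witness unfolding dep_def pick_def by metis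

lemma pick_witness: "lucky \<tau> dens \<theta> l S L x n f \<Longrightarrow> witness \<tau> dens \<theta> l S L x n f (pick \<tau> dens \<theta> l S L x n f)"
  unfolding lucky_def pick_def by (rule someI_ex)

lemma lucky_UNIV: "lucky \<tau> dens \<theta> l S L x n f \<Longrightarrow> lucky \<tau> dens \<theta> l UNIV L x n f"
  unfolding lucky_def witness_def by (auto simp: case_prod_unfold)

lemma inner_disjoint: "B \<inter> B' = {} \<Longrightarrow> inner L l B \<inter> inner L l B' = {}"
  by (auto simp: inner_def)

definition linked :: "nat \<Rightarrow> nat \<Rightarrow> ('d path \<Rightarrow> bool) \<Rightarrow> (int ^ 'd) set \<Rightarrow> (int ^ 'd) set \<Rightarrow> bool" where
  "linked L l f A G \<longleftrightarrow> (\<exists>v\<in>A. \<exists>u\<in>G. u \<noteq> proj L (v + step0) \<and> (\<exists>xs\<in>edge_class L l v u. f xs))"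

text \<open>For each \<open>v\<close> only the target reserved for \<open>step0\<close> is lost,
  which leaves at least \<open>a * (\<theta> * a - 1)\<close> pairs; by
  \<open>2 \<le> \<theta> * a\<close> this is at least
  \<open>\<theta> * a\<^sup>2 / 2\<close>.\<close>

lemma prob_not_linked:
  assumes n: "n \<le> L" "L > 0" and l: "l \<ge> 1" and lam: "lam > 0"
    and A: "A \<subseteq> Box L x n" and G: "G \<subseteq> Box L x n" "A \<inter> G = {}"
    and a: "0 < a" "a \<le> real (card A)" "\<theta> * a \<le> real (card G)" "2 \<le> \<theta> * a"
  shows "measure_pmf.prob (path_law L l lam) {f. \<not> linked L l f A G} \<le>
    exp (- lam * (\<theta> * a\<^sup>2 / 2 * (inverse K * real n powr - (real CARD('d) + \<alpha>))))"
proof -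
  let ?w = "inverse K * real n powr - (real CARD('d) + \<alpha>)"
  define P where "P = Sigma A (\<lambda>v. G - {proj L (v + step0)})"
  have fin: "finite A" "finite G" using A G finite_Box finite_subset by blast+
  have P: "P \<subseteq> torus L \<times> torus L" using A G Box_subset_torus[OF n(2), of x n] unfolding P_def by blast
  have G2: "real (card G) \<ge> 2" using a by linarith
  have "real (card A) * (real (card G) - 1) \<le> (\<Sum>v\<in>A. real (card (G - {proj L (v + step0)})))"
  proof -
    have "real (card G) - 1 \<le> real (card (G - {z}))" for z
      using fin(2) by (cases "z \<in> G") (auto simp: card_Diff_singleton of_nat_diff)
    then have "(\<Sum>v\<in>A. real (card G) - 1) \<le> (\<Sum>v\<in>A. real (card (G - {proj L (v + step0)})))" by (intro sum_mono)
    then show ?thesis by simp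
  qed
  also have "\<dots> = real (card P)" unfolding P_def by (subst card_SigmaI) (use fin in auto)
  finally have cP: "real (card A) * (real (card G) - 1) \<le> real (card P)" .
  have "\<theta> * a\<^sup>2 / 2 = a * (\<theta> * a / 2)" by (simp add: power2_eq_square)
  also have "\<dots> \<le> a * (real (card G) / 2)" using a G2 by (intro mult_left_mono) auto
  also have "\<dots> \<le> real (card A) * (real (card G) - 1)" using a G2 by (intro mult_mono) auto
  also note cP
  finally have "\<theta> * a\<^sup>2 / 2 \<le> real (card P)" .
  then have le: "\<theta> * a\<^sup>2 / 2 * ?w \<le> real (card P) * ?w" using K by (intro mult_right_mono) auto
  have "measure_pmf.prob (path_law L l lam) {f. \<not> linked L l f A G} =
    measure_pmf.prob (path_law L l lam) {f. \<forall>(v, u)\<in>P. \<forall>xs\<in>edge_class L l v u. \<not> f xs}"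
    by (rule arg_cong[of _ _ "measure_pmf.prob (path_law L l lam)"]) (auto simp: linked_def P_def)
  also have "\<dots> \<le> exp (- lam * (real (card P) * ?w))"
  proof (rule prob_no_edge[OF n(2) l lam P])
    fix v u assume "(v, u) \<in> P"
    then have "v \<in> Box L x n" "u \<in> Box L x n" "v \<noteq> u" using A G unfolding P_def by blast+
    then show "?w \<le> kq L v u" by (rule kq_Box_lower[OF n(1)])
  qed
  also have "\<dots> \<le> exp (- lam * (\<theta> * a\<^sup>2 / 2 * ?w))" using le lam by simp
  finally show ?thesis .
qed

text \<open>The box swept by the planted particle sits at the lower corner on all scales, so only
  the sub-box with index \<open>0\<close> has to keep an entry in \<open>S\<close>.\<close>

definition target :: "(int ^ 'd) set \<Rightarrow> int ^ 'd \<Rightarrow> (int ^ 'd) set" where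
  "target S w = (if w = 0 then S else UNIV)"

text \<open>Inside the starting sub-box one moves to the departure point of a jump, which lands in
  the set \<open>G\<close> of the other sub-box and so allows spreading there. Taking unions of both
  kinds of sets preserves the ratio \<open>\<theta>\<close>.\<close>

lemma lucky_combine:
  fixes f :: "'d path \<Rightarrow> bool" and S :: "(int ^ 'd) set" and x :: "int ^ 'd"
    and \<tau> :: "nat \<Rightarrow> nat" and dens :: "nat \<Rightarrow> real" and \<theta> :: real and l L n m q :: nat
  defines "lk \<equiv> \<lambda>m w. lucky \<tau> dens \<theta> l (target S w) L (x + int m *s w) m f"
  defines "pk \<equiv> \<lambda>m w. pick \<tau> dens \<theta> l (target S w) L (x + int m *s w) m f"
  assumes l: "l \<ge> 1" and mq: "m * q \<le> n" "n \<le> L"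
    and W: "W = {w \<in> torus q. lk m w}"
    and links: "\<And>w w'. w \<in> W \<Longrightarrow> w' \<in> W \<Longrightarrow> w \<noteq> w' \<Longrightarrow> linked L l f (fst (pk m w)) (snd (pk m w'))"
    and dens: "dens n \<le> real (card W) * dens m" and \<tau>: "2 * \<tau> m + 1 \<le> \<tau> n"
    and w0: "w0 \<in> W" "target S w0 = S"
  shows "lucky \<tau> dens \<theta> l S L x n f"
proof -
  let ?B = "\<lambda>w. Box L (x + int m *s w) m" and ?J = "inner L l (Box L x n)"
  let ?A = "\<lambda>w. fst (pk m w)" and ?G = "\<lambda>w. snd (pk m w)"
  have sub: "?B w \<subseteq> Box L x n" if "w \<in> W" for w using that W mq(1) by (intro Box_sub) auto
  have wit: "witness \<tau> dens \<theta> l (target S w) L (x + int m *s w) m f (pk m w)" if "w \<in> W" for w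
    using that unfolding W lk_def pk_def by (intro pick_witness) simp
  have AB: "?A w \<subseteq> ?B w" and GB: "?G w \<subseteq> ?B w" and dA: "dens m \<le> real (card (?A w))"
    and dG: "\<theta> * real (card (?A w)) \<le> real (card (?G w))" and GS: "?G w \<inter> target S w \<noteq> {}"
    and rc: "\<And>v u. v \<in> ?G w \<Longrightarrow> u \<in> ?A w \<Longrightarrow> rch (hop (inner L l (?B w)) f) (\<tau> m) v u" if "w \<in> W" for w
    using wit[OF that] unfolding witness_def spreads_def by (auto simp: case_prod_unfold)
  have rc': "rch (hop ?J f) (\<tau> m) v u" if "w \<in> W" "v \<in> ?G w" "u \<in> ?A w" for w v u
    using rc[OF that] by (rule rch_mono_rel) (use inner_mono[OF sub[OF that(1)], of L l] in \<open>auto simp: hop_def\<close>)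
  have fW: "finite W" using W finite_torus by (auto intro: finite_subset[of _ "torus q"])
  have dj: "?B w \<inter> ?B w' = {}" if "w \<in> W" "w' \<in> W" "w \<noteq> w'" for w w'
    using that W mq by (intro Box_disjoint) auto
  have finA: "finite (?A w)" "finite (?G w)" if "w \<in> W" for w
    using AB[OF that] GB[OF that] finite_Box finite_subset by blast+
  have cA: "card (\<Union>w\<in>W. ?A w) = (\<Sum>w\<in>W. card (?A w))" and cG: "card (\<Union>w\<in>W. ?G w) = (\<Sum>w\<in>W. card (?G w))"
    using dj AB GB finA by (intro card_UN_disjoint[OF fW]; blast)+
  have reach: "rch (hop ?J f) (\<tau> n) v u" if v: "v \<in> (\<Union>w\<in>W. ?G w)" and u: "u \<in> (\<Union>w\<in>W. ?A w)" for v u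
  proof -
    obtain w w' where w: "w \<in> W" "v \<in> ?G w" "w' \<in> W" "u \<in> ?A w'" using u v by blast
    show ?thesis
    proof (cases "w = w'")
      case True
      have "rch (hop ?J f) (\<tau> m) v u" by (rule rc'[OF w(1,2)]) (use w(4) True in simp)
      then show ?thesis by (rule rch_mono) (use \<tau> in linarith)
    next
      case False
      obtain a b xs where ab: "a \<in> ?A w" "b \<in> ?G w'" "xs \<in> edge_class L l a b" "f xs"
        using links[OF w(1,3) False] unfolding linked_def by blast
      have "a \<in> Box L x n" "b \<in> Box L x n" using ab AB GB sub w by blast+
      then have "xs \<in> ?J" using edge_class_inner ab(3) by blast
      then have "hop ?J f a b" by (rule edge_class_hop[where f = f, OF l ab(3) _ ab(4)])
      then have "rch (hop ?J f) (\<tau> m + 1 + \<tau> m) v u"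
        by (intro rch_trans[OF rch_trans[OF rc'[OF w(1,2) ab(1)] rch_step] rc'[OF w(3) ab(2) w(4)]]) auto
      then show ?thesis by (rule rch_mono) (use \<tau> in simp)
    qed
  qed
  have "witness \<tau> dens \<theta> l S L x n f (\<Union>w\<in>W. ?A w, \<Union>w\<in>W. ?G w)"
    unfolding witness_def spreads_def prod.case
  proof (intro conjI ballI)
    show "(\<Union>w\<in>W. ?A w) \<subseteq> Box L x n" "(\<Union>w\<in>W. ?G w) \<subseteq> Box L x n" using AB GB sub by blast+
    have "real (card W) * dens m = (\<Sum>w\<in>W. dens m)" by simp
    also have "\<dots> \<le> (\<Sum>w\<in>W. real (card (?A w)))" using dA by (rule sum_mono)
    finally show "dens n \<le> real (card (\<Union>w\<in>W. ?A w))" using dens unfolding cA by simp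
    have "\<theta> * (\<Sum>w\<in>W. real (card (?A w))) \<le> (\<Sum>w\<in>W. real (card (?G w)))"
      unfolding sum_distrib_left using dG by (rule sum_mono)
    then show "\<theta> * real (card (\<Union>w\<in>W. ?A w)) \<le> real (card (\<Union>w\<in>W. ?G w))" unfolding cA cG by simp
    show "(\<Union>w\<in>W. ?G w) \<inter> S \<noteq> {}" using GS[OF w0(1)] w0 by auto
  qed (rule reach)
  then show ?thesis unfolding lucky_def by blast
qed

text \<open>Two failures are counted: too many sub-boxes without a witness, by Chebyshev's
  inequality, and some pair of chosen sets without a link, by a union bound. The set
  \<open>S\<close> concerns the corner sub-box alone, whose failure probability is added
  once.\<close>

lemma lucky_step:
  fixes x :: "int ^ 'd"
  assumes l: "l \<ge> 1" and lam: "lam > 0" and mq: "m \<ge> 1" "q \<ge> 1" "m * q \<le> n" "n \<le> L"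
    and pm: "\<And>x. measure_pmf.prob (path_law L l lam) {f. \<not> lucky \<tau> dens \<theta> l UNIV L x m f} \<le> p" and t: "t > 0"
    and dens: "0 < dens m" "0 < dens n" "2 \<le> \<theta> * dens m" "dens n \<le> real q ^ CARD('d) * (1 - p - t) * dens m"
    and \<theta>: "\<theta> > 0" and \<tau>: "2 * \<tau> m + 1 \<le> \<tau> n"
  defines "\<delta> \<equiv> p / (real q ^ CARD('d) * t\<^sup>2) + (real q ^ CARD('d))\<^sup>2 *
    exp (- lam * (\<theta> * (dens m)\<^sup>2 / 2 * (inverse K * real n powr - (real CARD('d) + \<alpha>))))"
  shows "measure_pmf.prob (path_law L l lam) {f. \<not> lucky \<tau> dens \<theta> l UNIV L x n f} \<le> \<delta>"
    and "measure_pmf.prob (path_law L l lam) {f. \<not> lucky \<tau> dens \<theta> l S L x n f} \<le>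
      measure_pmf.prob (path_law L l lam) {f. \<not> lucky \<tau> dens \<theta> l S L x m f} + \<delta>"
proof -
  let ?pr = "\<lambda>A. measure_pmf.prob (path_law L l lam) {f. A f}"
  let ?B = "\<lambda>w. Box L (x + int m *s w) m"
  let ?V = "torus q :: (int ^ 'd) set"
  have L: "L > 0" using mq by (metis One_nat_def le_trans less_eq_Suc_le mult_le_mono nat_mult_1)
  have mqL: "m * q \<le> L" using mq by simp
  have cV: "card ?V = q ^ CARD('d)" by (rule card_torus)
  have V: "?V \<noteq> {}" using cV mq(2) by (metis card.empty power_eq_0_iff not_one_le_zero)
  define bad where "bad f = {w\<in>?V. \<not> lucky \<tau> dens \<theta> l UNIV L (x + int m *s w) m f}" for f
  have dj: "inner L l (?B w) \<inter> inner L l (?B w') = {}" if "w \<in> ?V" "w' \<in> ?V" "w \<noteq> w'" for w w'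
    by (rule inner_disjoint[OF Box_disjoint[OF that(1,2) mqL that(3)]])
  have few: "?pr (\<lambda>f. real q ^ CARD('d) * (p + t) \<le> real (card (bad f))) \<le> p / (real q ^ CARD('d) * t\<^sup>2)"
  proof -
    let ?E = "\<lambda>w. {f. \<not> lucky \<tau> dens \<theta> l UNIV L (x + int m *s w) m f}"
    have "measure_pmf.prob (path_law L l lam) {f. real (card ?V) * (p + t) \<le> real (card {w\<in>?V. f \<in> ?E w})} \<le> p / (real (card ?V) * t\<^sup>2)"
    proof (rule count_deviation[OF finite_torus V t _ pm])
      fix w w' assume w: "w \<in> ?V" "w' \<in> ?V" "w \<noteq> w'"
      have dp: "dep (\<lambda>f. \<not> lucky \<tau> dens \<theta> l UNIV L (x + int m *s w) m f) (inner L l (?B w))" for w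
        using dep_lucky unfolding dep_def by metis
      have "?E w \<inter> ?E w' = {f. \<not> lucky \<tau> dens \<theta> l UNIV L (x + int m *s w) m f \<and> \<not> lucky \<tau> dens \<theta> l UNIV L (x + int m *s w') m f}"
        by blast
      then show "measure_pmf.prob (path_law L l lam) (?E w \<inter> ?E w') =
          measure_pmf.prob (path_law L l lam) (?E w) * measure_pmf.prob (path_law L l lam) (?E w')"
        using Pi_pmf_indep[OF finite_paths dp dp dj[OF w]] unfolding path_law_def by simp
    qed
    then show ?thesis by (simp add: bad_def cV)
  qed
  \<comment> \<open>The alternative \<open>S = UNIV\<close> lets one argument prove both claims:
    without a restriction on entries the corner sub-box may fail, otherwise it is assumed
    lucky.\<close>
  have main: "?pr (\<lambda>f. \<not> lucky \<tau> dens \<theta> l S L x n f \<and> (lucky \<tau> dens \<theta> l S L x m f \<or> S = UNIV)) \<le> \<delta>" for S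
  proof -
    let ?lk = "\<lambda>f w. lucky \<tau> dens \<theta> l (target S w) L (x + int m *s w) m f"
    let ?pk = "\<lambda>f w. pick \<tau> dens \<theta> l (target S w) L (x + int m *s w) m f"
    let ?un = "\<lambda>f w w'. ?lk f w \<and> ?lk f w' \<and> \<not> linked L l f (fst (?pk f w)) (snd (?pk f w'))"
    define X where "X = {(w, w') \<in> ?V \<times> ?V. w \<noteq> w'}"
    have X: "X \<subseteq> ?V \<times> ?V" by (auto simp: X_def)
    have fX: "finite X" using X by (rule finite_subset) simp
    let ?e = "exp (- lam * (\<theta> * (dens m)\<^sup>2 / 2 * (inverse K * real n powr - (real CARD('d) + \<alpha>))))"
    have "?pr (\<lambda>f. \<exists>(w, w')\<in>X. ?un f w w') \<le> (\<Sum>(w, w')\<in>X. ?e)"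
      unfolding case_prod_unfold
    proof (rule prob_union_le[OF fX])
      fix z assume "z \<in> X"
      then obtain w w' where z: "z = (w, w')" and w: "w \<in> ?V" "w' \<in> ?V" "w \<noteq> w'" by (auto simp: X_def)
      \<comment> \<open>Freezing these paths fixes the sets chosen in both sub-boxes; an admissible
        link starts in one, ends in the other and avoids \<open>step0\<close>, so it remains
        random.\<close>
      let ?J = "inner L l (?B w) \<union> inner L l (?B w')"
      have "?pr (\<lambda>f. ?un f w w') \<le> ?e"
        unfolding path_law_def
      proof (rule Pi_pmf_cond_le[OF finite_paths, where J = ?J])
        fix g :: "'d path \<Rightarrow> bool"
        let ?m = "\<lambda>f xs. if xs \<in> ?J then g xs else f xs"
        have eq: "?lk (?m f) w = ?lk g w" "?lk (?m f) w' = ?lk g w'" "?pk (?m f) w = ?pk g w" "?pk (?m f) w' = ?pk g w'" for f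
          by (rule dep_merge[OF dep_mono[OF dep_lucky]] dep_merge[OF dep_mono[OF dep_pick]]; blast)+
        have "?pr (\<lambda>f. ?un (?m f) w w') \<le> ?e"
        proof (cases "?lk g w \<and> ?lk g w'")
          case False
          then have "{f. ?un (?m f) w w'} = {}" unfolding eq by blast
          then show ?thesis by (simp only: measure_empty exp_ge_zero)
        next
          case True
          let ?A = "fst (?pk g w)" and ?G = "snd (?pk g w')"
          from True have wA: "witness \<tau> dens \<theta> l (target S w) L (x + int m *s w) m g (?pk g w)"
            and wG: "witness \<tau> dens \<theta> l (target S w') L (x + int m *s w') m g (?pk g w')"
            by (auto intro: pick_witness)
          have A: "?A \<subseteq> ?B w" "dens m \<le> real (card ?A)" "\<theta> * real (card ?A) \<le> real (card (snd (?pk g w)))"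
            and G: "?G \<subseteq> ?B w'" "dens m \<le> real (card (fst (?pk g w')))" "\<theta> * real (card (fst (?pk g w'))) \<le> real (card ?G)"
            using wA wG unfolding witness_def spreads_def by (auto simp: case_prod_unfold)
          have BB: "?B w \<inter> ?B w' = {}" by (rule Box_disjoint[OF w(1,2) mqL w(3)])
          have mem: "xs \<notin> ?J" if "xs \<in> edge_class L l v u" "v \<in> ?A" "u \<in> ?G" "u \<noteq> proj L (v + step0)" for xs v u
          proof -
            have "v \<in> ?B w" "u \<in> ?B w'" using that A G by blast+
            then show ?thesis using that BB by (auto simp: edge_class_def inner_def)
          qed
          have lm: "linked L l (?m f) ?A ?G = linked L l f ?A ?G" for f
            unfolding linked_def by (intro bex_cong refl conj_cong) (use mem in auto)
          have "?pr (\<lambda>f. ?un (?m f) w w') = ?pr (\<lambda>f. \<not> linked L l f ?A ?G)"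
            unfolding eq lm using True by (simp only: simp_thms)
          also have "\<dots> \<le> exp (- lam * (\<theta> * (dens m)\<^sup>2 / 2 * (inverse K * real n powr - (real CARD('d) + \<alpha>))))"
          proof (rule prob_not_linked[OF mq(4) L l lam, of ?A x ?G])
            show "?A \<subseteq> Box L x n" "?G \<subseteq> Box L x n" using A(1) G(1) Box_sub[OF w(1) mq(3)] Box_sub[OF w(2) mq(3)] by blast+
            show "?A \<inter> ?G = {}" using A(1) G(1) BB by blast
            have "\<theta> * dens m \<le> \<theta> * real (card (fst (?pk g w')))" using G(2) \<theta> by (intro mult_left_mono) auto
            with G(3) show "\<theta> * dens m \<le> real (card ?G)" by linarith
          qed (use A(2) dens in auto)
          finally show ?thesis .
        qed
        then show "measure_pmf.prob (Pi_pmf (paths L l) False (\<lambda>xs. bernoulli_pmf (1 - exp (- lam * wt (kq L) xs)))) {f. ?un (?m f) w w'} \<le> ?e"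
          unfolding path_law_def .
      qed
      then show "?pr (\<lambda>f. ?un f (fst z) (snd z)) \<le> ?e" unfolding z by simp
    qed
    also have "\<dots> = real (card X) * ?e" by (simp add: case_prod_unfold)
    also have "\<dots> \<le> (real q ^ CARD('d))\<^sup>2 * ?e"
    proof (rule mult_right_mono)
      have "card X \<le> card (?V \<times> ?V)" using X by (intro card_mono) auto
      also have "\<dots> = (q ^ CARD('d)) ^ 2" by (simp add: card_cartesian_product cV power2_eq_square)
      finally have "real (card X) \<le> real ((q ^ CARD('d)) ^ 2)" by (rule of_nat_mono)
      then show "real (card X) \<le> (real q ^ CARD('d))\<^sup>2" by simp
    qed simp
    finally have un: "?pr (\<lambda>f. \<exists>(w, w')\<in>X. ?un f w w') \<le> (real q ^ CARD('d))\<^sup>2 * ?e" .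
    have "?pr (\<lambda>f. \<not> lucky \<tau> dens \<theta> l S L x n f \<and> (lucky \<tau> dens \<theta> l S L x m f \<or> S = UNIV)) \<le>
      ?pr (\<lambda>f. real q ^ CARD('d) * (p + t) \<le> real (card (bad f)) \<or> (\<exists>(w, w')\<in>X. ?un f w w'))"
    proof (rule prob_mono_pmf, rule ccontr)
      fix f assume a: "\<not> lucky \<tau> dens \<theta> l S L x n f \<and> (lucky \<tau> dens \<theta> l S L x m f \<or> S = UNIV)"
        and "\<not> (real q ^ CARD('d) * (p + t) \<le> real (card (bad f)) \<or> (\<exists>(w, w')\<in>X. ?un f w w'))"
      then have fb: "real (card (bad f)) < real q ^ CARD('d) * (p + t)" and nu: "\<And>w w'. (w, w') \<in> X \<Longrightarrow> \<not> ?un f w w'" by auto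
      define W where "W = {w \<in> ?V. ?lk f w}"
      have "w \<in> W \<longleftrightarrow> w \<in> ?V - bad f" for w
        using a lucky_UNIV[of \<tau> dens \<theta> l S L x m f] unfolding W_def bad_def target_def by (cases "w = 0") auto
      then have W: "W = ?V - bad f" by blast
      have "bad f \<subseteq> ?V" by (auto simp: bad_def)
      then have cW: "real (card W) = real q ^ CARD('d) - real (card (bad f))"
        unfolding W using card_mono[OF finite_torus, of "bad f" q] cV
        by (subst card_Diff_subset) (auto simp: of_nat_diff intro: finite_subset)
      then have big: "real q ^ CARD('d) * (1 - p - t) \<le> real (card W)" using fb by (simp add: algebra_simps)
      then have "real q ^ CARD('d) * (1 - p - t) * dens m \<le> real (card W) * dens m" using dens(1) by (intro mult_right_mono) auto
      with dens(4) have dn: "dens n \<le> real (card W) * dens m" by linarith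
      with dens(2) have "W \<noteq> {}" by (intro notI) simp
      moreover have "0 \<in> W" if "S \<noteq> UNIV" using a that mq(2) unfolding W_def by (auto simp: target_def torus_def)
      ultimately obtain w0 where w0: "w0 \<in> W" "target S w0 = S" unfolding target_def by (metis ex_in_conv)
      have "lucky \<tau> dens \<theta> l S L x n f"
      proof (rule lucky_combine[OF l mq(3,4) W_def _ dn \<tau> w0])
        fix w w' assume "w \<in> W" "w' \<in> W" "w \<noteq> w'"
        then show "linked L l f (fst (?pk f w)) (snd (?pk f w'))" using nu[of w w'] by (auto simp: W_def X_def)
      qed
      with a show False by blast
    qed
    also have "\<dots> \<le> \<delta>" unfolding \<delta>_def by (rule prob_disj_le[OF few un])
    finally show ?thesis .
  qed
  show "?pr (\<lambda>f. \<not> lucky \<tau> dens \<theta> l UNIV L x n f) \<le> \<delta>" using main[of UNIV] by simp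
  have "?pr (\<lambda>f. \<not> lucky \<tau> dens \<theta> l S L x n f) \<le>
    ?pr (\<lambda>f. \<not> lucky \<tau> dens \<theta> l S L x m f \<or> (\<not> lucky \<tau> dens \<theta> l S L x n f \<and> (lucky \<tau> dens \<theta> l S L x m f \<or> S = UNIV)))"
    by (rule prob_mono_pmf) blast
  also have "\<dots> \<le> ?pr (\<lambda>f. \<not> lucky \<tau> dens \<theta> l S L x m f) + \<delta>" by (rule prob_disj_le[OF order_refl main])
  finally show "?pr (\<lambda>f. \<not> lucky \<tau> dens \<theta> l S L x n f) \<le> ?pr (\<lambda>f. \<not> lucky \<tau> dens \<theta> l S L x m f) + \<delta>" .
qed

end

section \<open>Iteration over the scales\<close>

lemma powr_dominated:
  fixes C u v :: real
  assumes "v < u"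
  shows "\<forall>\<^sub>F n::nat in at_top. C * real n powr - u \<le> real n powr - v"
proof -
  define w where "w = u - v"
  have w: "w > 0" using assms by (simp add: w_def)
  have "\<forall>\<^sub>F n::nat in at_top. C * real n powr - w \<le> 1" using w by real_asymp
  then show ?thesis
  proof eventually_elim
    case (elim n)
    have "C * real n powr - w * real n powr - v \<le> 1 * real n powr - v" by (rule mult_right_mono[OF elim]) simp
    then show ?case by (simp add: w_def mult.assoc flip: powr_add)
  qed
qed

definition scale_down :: "real \<Rightarrow> nat \<Rightarrow> nat" where
  "scale_down \<gamma> n = nat \<lfloor>real n powr \<gamma>\<rfloor>"

text \<open>The factor \<open>1 + n powr - b\<close> decreases to 1 and absorbs the losses of all scales.\<close>

definition density :: "nat \<Rightarrow> real \<Rightarrow> real \<Rightarrow> nat \<Rightarrow> real" where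
  "density d \<rho> b n = \<rho> * (1 + real n powr - b) * real n ^ d"

lemma half_bound: "(2 * a) * b \<le> c \<Longrightarrow> a * b \<le> c / (2 :: real)"
  by simp

text \<open>The deviation is taken equal to \<open>p = m powr - \<kappa>\<close>. The Chebyshev term
  has order \<open>n powr (\<gamma> * \<kappa> - (1 - \<gamma>))\<close>, below
  \<open>n powr - \<kappa>\<close> because \<open>\<kappa> = (1 - \<gamma>) / 4\<close>; the link
  term is exponentially small since \<open>s < 2 * d * \<gamma>\<close>. As
  \<open>b < \<kappa>\<close>, the change of the density factor outweighs the losses from rounding
  and from bad sub-boxes. The last inequality makes failure probabilities telescope.\<close>

lemma scale_estimates:
  fixes \<gamma> s \<rho> \<theta> \<mu> :: real and d :: nat
  assumes \<gamma>: "0 < \<gamma>" "\<gamma> < 1" and s: "s < 2 * real d * \<gamma>" and pos: "\<rho> > 0" "\<theta> > 0" "\<mu> > 0" and d: "d \<ge> 1"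
  defines "b \<equiv> (1 - \<gamma>) / 8"
  defines "\<kappa> \<equiv> 2 * b"
  shows "\<forall>\<^sub>F n in at_top. let m = scale_down \<gamma> n; q = n div m; p = real m powr - \<kappa> in
    m \<ge> 1 \<and> q \<ge> 1 \<and> m < n \<and> real m \<le> real n powr \<gamma> \<and> 2 \<le> \<theta> * density d \<rho> b m \<and>
    density d \<rho> b n \<le> real q ^ d * (1 - p - p) * density d \<rho> b m \<and>
    p / (real q ^ d * p\<^sup>2) + (real q ^ d)\<^sup>2 * exp (- (\<mu> * (density d \<rho> b m)\<^sup>2 * real n powr - s)) \<le> real n powr - \<kappa> \<and>
    real n powr - b + real n powr - \<kappa> \<le> real m powr - b"
proof -
  have b: "b > 0" "b < 1" using \<gamma> by (auto simp: b_def)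
  have \<kappa>: "\<kappa> > 0" "\<kappa> < 1" "b < \<kappa>" using \<gamma> by (auto simp: \<kappa>_def b_def)
  define \<beta> where "\<beta> = 2 * real d * \<gamma> - s"
  have \<beta>: "\<beta> > 0" using s by (simp add: \<beta>_def)
  define \<nu> where "\<nu> = \<mu> * \<rho>\<^sup>2 / 4 ^ d"
  have \<nu>: "\<nu> > 0" using pos by (simp add: \<nu>_def)
  define D2 where "D2 = 2 * real d"
  define v where "v = \<gamma> * b"
  have g1: "1 - \<gamma> > 0" using \<gamma> by simp
  have "\<forall>\<^sub>F n::nat in at_top. 2 \<le> real n powr \<gamma>" using \<gamma>(1) by real_asymp
  moreover have "\<forall>\<^sub>F n::nat in at_top. 2 \<le> real n powr (1 - \<gamma>)" using g1 by real_asymp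
  moreover have "\<forall>\<^sub>F n::nat in at_top. 4 \<le> \<theta> * \<rho> * real n powr \<gamma>" using \<gamma>(1) pos by real_asymp
  moreover have "\<forall>\<^sub>F n::nat in at_top. (2 * 2 ^ d) * real n powr - ((1 - \<gamma>) - \<gamma> * \<kappa>) \<le> real n powr - \<kappa>"
  proof (rule powr_dominated)
    have "(1 + \<gamma>) * \<kappa> < 2 * \<kappa>" using \<gamma> \<kappa> by (intro mult_strict_right_mono) auto
    moreover have "(1 + \<gamma>) * \<kappa> = \<kappa> + \<gamma> * \<kappa>" by (simp add: algebra_simps)
    moreover have "4 * \<kappa> = 1 - \<gamma>" by (simp add: \<kappa>_def b_def)
    ultimately show "\<kappa> < 1 - \<gamma> - \<gamma> * \<kappa>" using g1 by linarith
  qed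
  moreover have "\<forall>\<^sub>F n::nat in at_top. real n powr D2 * exp (- \<nu> * real n powr \<beta>) \<le> real n powr - \<kappa> / 2"
    using \<nu> \<beta> by real_asymp
  moreover have "\<forall>\<^sub>F n::nat in at_top. (6 * real d) * real n powr - (1 - \<gamma>) \<le> real n powr - v"
  proof (rule powr_dominated)
    have "\<gamma> * b < 1 * b" using \<gamma> b by (intro mult_strict_right_mono) auto
    moreover have "8 * b = 1 - \<gamma>" by (simp add: b_def)
    ultimately show "v < 1 - \<gamma>" using b unfolding v_def by linarith
  qed
  moreover have "\<forall>\<^sub>F n::nat in at_top. 24 * real n powr - (\<gamma> * \<kappa>) \<le> real n powr - v"
    by (rule powr_dominated) (use \<gamma> \<kappa> in \<open>simp add: v_def\<close>)
  moreover have "\<forall>\<^sub>F n::nat in at_top. 3 * real n powr - b \<le> real n powr - v"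
    by (rule powr_dominated) (use \<gamma> b in \<open>simp add: v_def\<close>)
  ultimately show ?thesis using eventually_ge_at_top[of 1]
  proof eventually_elim
    case (elim n)
    define x where "x = real n"
    have x: "x \<ge> 1" using elim(9) by (simp add: x_def)
    define m where "m = scale_down \<gamma> n"
    define q where "q = n div m"
    define p where "p = real m powr - \<kappa>"
    define X where "X = x powr \<gamma>"
    define Y where "Y = x powr (1 - \<gamma>)"
    have X2: "X \<ge> 2" and Y2: "Y \<ge> 2" using elim(1,2) by (auto simp: X_def Y_def x_def)
    have XY: "X * Y = x" using x by (simp add: X_def Y_def flip: powr_add)
    have mX: "real m \<le> X" and Xm: "X < real m + 1"
      using X2 unfolding m_def scale_down_def X_def x_def by linarith+
    have m2: "X / 2 \<le> real m" using X2 Xm by linarith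
    have m1: "m \<ge> 1" using m2 X2 by (cases m) auto
    have "X * 2 \<le> X * Y" using X2 Y2 by (intro mult_left_mono) auto
    then have "2 * X \<le> x" using XY by simp
    then have mx: "2 * real m \<le> x" using mX by linarith
    then have mn: "m < n" using m1 by (simp add: x_def)
    have "m * q + n mod m = n" by (simp add: q_def)
    moreover have "n mod m < m" using m1 by simp
    ultimately have "n \<le> m * q + m" by linarith
    then have "real n \<le> real (m * q + m)" by (rule of_nat_mono)
    then have mq: "x - X \<le> real m * real q" using mX by (simp add: x_def)
    have "m * q \<le> n" by (simp add: q_def)
    then have "1 * q \<le> n" using m1 by (metis le_trans mult_le_mono1)
    then have qx: "real q \<le> x" by (simp add: x_def)
    have qY: "Y / 2 \<le> real q"
    proof -
      have "X * (Y - 1) \<le> X * real q" using mq mX XY mult_right_mono[OF mX, of "real q"] by (simp add: algebra_simps)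
      then have "Y - 1 \<le> real q" using X2 by simp
      then show ?thesis using Y2 by linarith
    qed
    have q1: "q \<ge> 1" using qY Y2 by (cases q) auto
    have lowb: "x powr - v \<le> real m powr - b"
    proof -
      have "x powr - v = X powr - b" by (simp add: X_def v_def powr_powr)
      also have "\<dots> \<le> real m powr - b" using mX m1 b by (intro powr_mono2') auto
      finally show ?thesis .
    qed
    have upk: "p \<le> 2 * x powr - (\<gamma> * \<kappa>)"
    proof -
      have "p \<le> (X / 2) powr - \<kappa>" unfolding p_def using m2 X2 \<kappa> by (intro powr_mono2') auto
      also have "\<dots> = 2 powr \<kappa> * X powr - \<kappa>" using X2 by (simp add: powr_divide powr_minus_divide)
      also have "\<dots> \<le> 2 powr 1 * X powr - \<kappa>" using \<kappa> by (intro mult_right_mono powr_mono) auto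
      also have "X powr - \<kappa> = x powr - (\<gamma> * \<kappa>)" by (simp add: X_def powr_powr)
      finally show ?thesis by simp
    qed
    have dm: "\<rho> * (X / 2) ^ d \<le> density d \<rho> b m"
    proof -
      have "\<rho> * (X / 2) ^ d \<le> \<rho> * real m ^ d" using m2 X2 pos by (intro mult_left_mono power_mono) auto
      also have "\<dots> \<le> \<rho> * (1 + real m powr - b) * real m ^ d"
        using pos by (intro mult_right_mono) (auto simp: algebra_simps)
      finally show ?thesis by (simp add: density_def)
    qed
    have c1: "2 \<le> \<theta> * density d \<rho> b m"
    proof -
      have "2 \<le> \<theta> * \<rho> * (X / 2) ^ 1" using elim(3) by (simp add: X_def x_def)
      also have "\<dots> \<le> \<theta> * \<rho> * (X / 2) ^ d" using X2 d pos by (intro mult_left_mono power_increasing) auto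
      also have "\<dots> \<le> \<theta> * density d \<rho> b m" using dm pos by (simp add: mult.assoc)
      finally show ?thesis .
    qed
    have c2: "density d \<rho> b n \<le> real q ^ d * (1 - p - p) * density d \<rho> b m"
    proof -
      define A where "A = real d * x powr - (1 - \<gamma>)"
      define B where "B = 2 * p"
      define E where "E = real m powr - b"
      have E0: "x powr - v \<le> E" using lowb by (simp add: E_def)
      have E1: "0 \<le> E" "E \<le> 1" using m1 b by (auto simp: E_def powr_le_one_le powr_minus_divide ge_one_powr_ge_zero)
      have A: "0 \<le> A" "6 * A \<le> E" using elim(6) E0 unfolding A_def x_def by auto
      have B: "0 \<le> B" "6 * B \<le> E" using elim(7) E0 upk unfolding B_def x_def p_def by auto
      have F: "3 * x powr - b \<le> E" using elim(8) E0 unfolding x_def by linarith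
      \<comment> \<open>\<open>A\<close> bounds the relative loss from rounding and \<open>B\<close>
        the loss from bad sub-boxes; each is at most \<open>E / 6\<close>, so
        \<open>1 + E - 2 * A - 2 * B\<close> is still at least \<open>1 + E / 3\<close>.\<close>
      have "(1 - A) * (1 - B) * (1 + E) - (1 + E - 2 * A - 2 * B) = (A + B) * (1 - E) + A * B * (1 + E)"
        by (simp add: algebra_simps)
      moreover have "\<dots> \<ge> 0" using A B E1 by (intro add_nonneg_nonneg mult_nonneg_nonneg) auto
      ultimately have key: "1 + x powr - b \<le> (1 - A) * (1 - B) * (1 + E)" using A B F E1 by linarith
      have "x * (1 - x powr - (1 - \<gamma>)) \<le> real m * real q"
      proof -
        have "x * x powr - (1 - \<gamma>) = X" using x by (simp add: X_def powr_mult_base)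
        then show ?thesis using mq by (simp add: algebra_simps)
      qed
      moreover have y1: "x powr - (1 - \<gamma>) \<le> 1" using powr_mono[of "- (1 - \<gamma>)" 0 x] x \<gamma> by simp
      ultimately have "(x * (1 - x powr - (1 - \<gamma>))) ^ d \<le> (real m * real q) ^ d" using x by (intro power_mono) auto
      moreover have "1 - A \<le> (1 - x powr - (1 - \<gamma>)) ^ d"
        using Bernoulli_inequality[of "- (x powr - (1 - \<gamma>))" d] y1 by (simp add: A_def)
      then have "x ^ d * (1 - A) \<le> (x * (1 - x powr - (1 - \<gamma>))) ^ d" using x by (simp add: power_mult_distrib)
      ultimately have size: "x ^ d * (1 - A) \<le> (real m * real q) ^ d" by linarith
      have "density d \<rho> b n = \<rho> * x ^ d * (1 + x powr - b)" by (simp add: density_def x_def)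
      also have "\<dots> \<le> \<rho> * x ^ d * ((1 - A) * (1 - B) * (1 + E))" using key pos x by (intro mult_left_mono) auto
      also have "\<dots> = \<rho> * ((1 - B) * (1 + E)) * (x ^ d * (1 - A))" by simp
      also have "\<dots> \<le> \<rho> * ((1 - B) * (1 + E)) * (real m * real q) ^ d"
        using size pos B E1 by (intro mult_left_mono) auto
      also have "\<dots> = real q ^ d * (1 - p - p) * density d \<rho> b m"
        by (simp add: density_def E_def B_def power_mult_distrib)
      finally show ?thesis .
    qed
    have c3: "p / (real q ^ d * p\<^sup>2) + (real q ^ d)\<^sup>2 * exp (- (\<mu> * (density d \<rho> b m)\<^sup>2 * real n powr - s)) \<le> real n powr - \<kappa>"
    proof -
      have p0: "p > 0" using m1 by (simp add: p_def)
      have "p / (real q ^ d * p\<^sup>2) = real m powr \<kappa> / real q ^ d"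
        using p0 m1 by (simp add: power2_eq_square p_def powr_minus field_simps)
      also have "\<dots> \<le> X powr \<kappa> / (Y / 2) ^ d"
        using mX qY Y2 \<kappa> m1 by (intro frac_le powr_mono2 power_mono) auto
      also have "\<dots> = 2 ^ d * (x powr (\<gamma> * \<kappa>) / Y ^ d)" by (simp add: X_def powr_powr power_divide)
      also have "\<dots> \<le> 2 ^ d * (x powr (\<gamma> * \<kappa>) / Y ^ 1)"
        using Y2 d by (intro mult_left_mono divide_left_mono power_increasing) auto
      also have "x powr (\<gamma> * \<kappa>) / Y ^ 1 = x powr - ((1 - \<gamma>) - \<gamma> * \<kappa>)" by (simp add: Y_def flip: powr_diff)
      also have "2 ^ d * x powr - ((1 - \<gamma>) - \<gamma> * \<kappa>) \<le> x powr - \<kappa> / 2" using elim(4) unfolding x_def by (rule half_bound)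
      finally have 1: "p / (real q ^ d * p\<^sup>2) \<le> x powr - \<kappa> / 2" .
      have "\<nu> * x powr \<beta> \<le> \<mu> * (density d \<rho> b m)\<^sup>2 * x powr - s"
      proof -
        have "(\<rho> * (X / 2) ^ d)\<^sup>2 \<le> (density d \<rho> b m)\<^sup>2" using dm X2 pos by (intro power_mono) auto
        then have "\<mu> * (\<rho> * (X / 2) ^ d)\<^sup>2 * x powr - s \<le> \<mu> * (density d \<rho> b m)\<^sup>2 * x powr - s"
          using pos by (intro mult_right_mono mult_left_mono) auto
        moreover have "\<nu> * x powr \<beta> = \<mu> * (\<rho> * (X / 2) ^ d)\<^sup>2 * x powr - s"
        proof -
          have "(X ^ d)\<^sup>2 = X ^ (2 * d)" by (simp add: mult.commute flip: power_mult)
          also have "\<dots> = X powr real (2 * d)" using X2 by (subst powr_realpow) auto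
          also have "\<dots> = x powr (2 * real d * \<gamma>)" by (simp add: X_def powr_powr mult_ac)
          finally have "(X ^ d)\<^sup>2 = x powr (2 * real d * \<gamma>)" .
          moreover have "((2::real) ^ d)\<^sup>2 = 4 ^ d" by (simp add: power2_eq_square flip: power_mult_distrib)
          ultimately show ?thesis
            by (simp add: \<nu>_def \<beta>_def power_mult_distrib power_divide powr_diff powr_minus_divide)
        qed
        ultimately show ?thesis by simp
      qed
      then have "exp (- (\<mu> * (density d \<rho> b m)\<^sup>2 * x powr - s)) \<le> exp (- \<nu> * x powr \<beta>)" by simp
      moreover have "(real q ^ d)\<^sup>2 \<le> x powr D2"
      proof -
        have "(real q ^ d)\<^sup>2 \<le> (x ^ d)\<^sup>2" using qx by (intro power_mono) auto
        also have "\<dots> = x ^ (2 * d)" by (simp add: mult.commute flip: power_mult)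
        also have "\<dots> = x powr D2" using x powr_realpow[of x "2 * d"] by (simp add: D2_def)
        finally show ?thesis .
      qed
      ultimately have "(real q ^ d)\<^sup>2 * exp (- (\<mu> * (density d \<rho> b m)\<^sup>2 * x powr - s)) \<le> x powr D2 * exp (- \<nu> * x powr \<beta>)"
        by (intro mult_mono) auto
      with 1 show ?thesis using elim(5) unfolding x_def by linarith
    qed
    have c4: "real n powr - b + real n powr - \<kappa> \<le> real m powr - b"
    proof -
      have "x powr - \<kappa> \<le> x powr - b" using x \<kappa> by (intro powr_mono) auto
      then show ?thesis using elim(8) lowb powr_ge_zero[of x "- b"] unfolding x_def by linarith
    qed
    show ?case using m1 q1 mn mX c1 c2 c3 c4 unfolding Let_def m_def q_def p_def X_def x_def by blast
  qed
qed

text \<open>The recursion \<open>2 * \<tau> + 1\<close> is plain doubling for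
  \<open>\<tau> + 1\<close>, which explains the subtraction of one; the lower bound 3 keeps the
  subtraction of naturals exact.\<close>

lemma nat_floor_double:
  fixes a b c :: real
  assumes "2 * a \<le> b" "c \<le> a" "3 \<le> c"
  shows "2 * (nat \<lfloor>a\<rfloor> - 1) + 1 \<le> nat \<lfloor>b\<rfloor> - 1"
  using assms by linarith

lemma (in heavy_kernel) spreads_mono:
  assumes "spreads L l x n h f A G" "h \<le> h'"
  shows "spreads L l x n h' f A G"
  unfolding spreads_def
proof (intro conjI ballI)
  fix v u assume "v \<in> G" "u \<in> A"
  then have "rch (hop (inner L l (Box L x n)) f) h v u" using assms(1) by (simp add: spreads_def)
  then show "rch (hop (inner L l (Box L x n)) f) h' v u" using assms(2) by (rule rch_mono)
qed (use assms(1) in \<open>simp_all add: spreads_def\<close>)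

context block_model
begin

text \<open>By \<open>\<gamma> powr \<Delta> = 1 / 2\<close> the quantity
  \<open>ln n powr \<Delta>\<close> is at least halved in passing to the smaller scale, in step with
  the doubling of hops. The recursion descends until it reaches scales at which
  \<open>base_spreads\<close> provides a linear bound.\<close>

lemma polylog_spread:
  assumes \<gamma>: "0 < \<gamma>" "\<gamma> < 1" "real CARD('d) + \<alpha> < 2 * real CARD('d) * \<gamma>" and \<Delta>: "\<gamma> powr \<Delta> = 1 / 2" "\<Delta> > 0"
    and \<delta>: "0 < \<delta>" "\<delta> < 1" and \<eta>': "\<eta> < 1 / 2"
    and \<rho>: "0 < \<rho>" "\<rho> < \<rho>0" "\<rho>0 \<le> (1 - \<delta>) ^ CARD('d) * (1 - 2 * \<eta>)" and e: "e > 0"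
  shows "\<exists>n\<ge>1. \<exists>T. \<forall>\<^sub>F L in at_top. \<forall>x. measure_pmf.prob (path_law L l lam)
    {f. \<not> \<rho> * real L ^ CARD('d) \<le>
      real (card {u\<in>torus L. \<exists>z\<in>Box L x n. rch (hop (paths L l) f) (nat \<lfloor>T * ln (real L) powr \<Delta>\<rfloor>) z u})} \<le> e"
proof -
  let ?d = "CARD('d)"
  let ?pr = "\<lambda>L A. measure_pmf.prob (path_law L l lam) {f. A f}"
  define b where "b = (1 - \<gamma>) / 8"
  define \<kappa> where "\<kappa> = 2 * b"
  have b: "0 < b" "b \<le> \<kappa>" "\<kappa> < 1 / 2" using \<gamma> by (auto simp: b_def \<kappa>_def)
  have \<rho>0: "\<rho>0 > 0" using \<rho> by linarith
  obtain \<theta> :: real where \<theta>: "0 < \<theta>" and base: "\<forall>\<^sub>F n in at_top. \<forall>L x. n \<le> L \<longrightarrow> L0 \<le> L \<longrightarrow>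
    ?pr L (\<lambda>f. \<not> (\<exists>A G. spreads L l x n (20 * ?d * n + 2) f A G \<and>
      \<rho>0 * real n ^ ?d \<le> real (card A) \<and> \<theta> * real (card A) \<le> real (card G))) \<le> 2 * real n powr (- 1 / 2)"
    using base_spreads[OF \<delta> \<eta>' \<rho>0 \<rho>(3)] by blast
  define \<mu> where "\<mu> = lam * \<theta> / 2 * inverse K"
  have \<mu>: "\<mu> > 0" using lam \<theta> K by (simp add: \<mu>_def)
  have d1: "1 \<le> ?d" using dim by linarith
  define m where "m = scale_down \<gamma>"
  define dens where "dens = density ?d \<rho> b"
  define good_scale where "good_scale n \<longleftrightarrow> (let q = n div m n; p = real (m n) powr - \<kappa> in
    m n \<ge> 1 \<and> q \<ge> 1 \<and> m n < n \<and> real (m n) \<le> real n powr \<gamma> \<and> 2 \<le> \<theta> * dens (m n) \<and>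
    dens n \<le> real q ^ ?d * (1 - p - p) * dens (m n) \<and>
    p / (real q ^ ?d * p\<^sup>2) + (real q ^ ?d)\<^sup>2 * exp (- (\<mu> * (dens (m n))\<^sup>2 * real n powr - (real ?d + \<alpha>))) \<le> real n powr - \<kappa> \<and>
    real n powr - b + real n powr - \<kappa> \<le> real (m n) powr - b)" for n
  have "\<forall>\<^sub>F n in at_top. good_scale n"
    using scale_estimates[OF \<gamma> \<rho>(1) \<theta> \<mu> d1] unfolding good_scale_def Let_def m_def dens_def b_def \<kappa>_def by blast
  moreover have "\<forall>\<^sub>F n::nat in at_top. \<rho> * (1 + real n powr - b) \<le> \<rho>0"
  proof -
    define \<rho>' where "\<rho>' = \<rho>0 / \<rho> - 1"
    have "\<rho>' > 0" using \<rho> by (simp add: \<rho>'_def field_simps)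
    then have "\<forall>\<^sub>F n::nat in at_top. real n powr - b \<le> \<rho>'" using b by real_asymp
    then show ?thesis by eventually_elim (use \<rho> in \<open>simp add: \<rho>'_def field_simps\<close>)
  qed
  moreover have "\<forall>\<^sub>F n::nat in at_top. 2 * real n powr (- 1 / 2) \<le> real n powr - \<kappa>"
    using powr_dominated[OF b(3), of 2] by simp
  moreover have "\<forall>\<^sub>F n::nat in at_top. 2 * real n powr - b \<le> e" using b e by real_asymp
  ultimately have "\<forall>\<^sub>F n in at_top. (\<forall>L x. n \<le> L \<longrightarrow> L0 \<le> L \<longrightarrow>
    ?pr L (\<lambda>f. \<not> (\<exists>A G. spreads L l x n (20 * ?d * n + 2) f A G \<and>
      \<rho>0 * real n ^ ?d \<le> real (card A) \<and> \<theta> * real (card A) \<le> real (card G))) \<le> real n powr - \<kappa>) \<and>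
    good_scale n \<and> \<rho> * (1 + real n powr - b) \<le> \<rho>0 \<and> 2 * real n powr - b \<le> e \<and> 3 \<le> n"
    using base eventually_ge_at_top[of 3]
  proof eventually_elim
    case (elim n)
    show ?case
    proof (intro conjI allI impI)
      fix L and x :: "int ^ 'd" assume L: "n \<le> L" "L0 \<le> L"
      show "?pr L (\<lambda>f. \<not> (\<exists>A G. spreads L l x n (20 * ?d * n + 2) f A G \<and>
        \<rho>0 * real n ^ ?d \<le> real (card A) \<and> \<theta> * real (card A) \<le> real (card G))) \<le> real n powr - \<kappa>"
        by (rule order_trans[OF elim(5)[rule_format, OF L] elim(3)])
    qed (use elim in blast)+
  qed
  then obtain N0 where N0: "\<And>n L x. N0 \<le> n \<Longrightarrow> n \<le> L \<Longrightarrow> L0 \<le> L \<Longrightarrow>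
    ?pr L (\<lambda>f. \<not> (\<exists>A G. spreads L l x n (20 * ?d * n + 2) f A G \<and>
      \<rho>0 * real n ^ ?d \<le> real (card A) \<and> \<theta> * real (card A) \<le> real (card G))) \<le> real n powr - \<kappa>"
    "\<And>n. N0 \<le> n \<Longrightarrow> good_scale n" "\<And>n. N0 \<le> n \<Longrightarrow> \<rho> * (1 + real n powr - b) \<le> \<rho>0"
    "2 * real N0 powr - b \<le> e" "3 \<le> N0"
    unfolding eventually_at_top_linorder by blast
  have "\<forall>\<^sub>F n::nat in at_top. real N0 + 1 \<le> real n powr \<gamma>" using \<gamma>(1) by real_asymp
  then have "\<forall>\<^sub>F n in at_top. N0 \<le> m n"
    by eventually_elim (unfold m_def scale_down_def, linarith)
  then obtain N2 where N2: "\<And>n. N2 \<le> n \<Longrightarrow> N0 \<le> m n" unfolding eventually_at_top_linorder by blast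
  \<comment> \<open>Scales from \<open>N0\<close> to \<open>N1\<close> are starting scales; beyond
    \<open>N1\<close> the next smaller scale is still at least \<open>N0\<close>.\<close>
  define N1 where "N1 = max N2 N0"
  have N1: "N0 \<le> N1" "\<And>n. N1 \<le> n \<Longrightarrow> N0 \<le> m n" using N2 by (auto simp: N1_def)
  \<comment> \<open>On the starting scales \<open>20 * d * N1 + 2\<close> hops suffice; one more
    compensates for the subtraction in \<open>\<tau>\<close>.\<close>
  define T where "T = real (20 * ?d * N1 + 3)"
  define \<tau> where "\<tau> n = nat \<lfloor>T * ln (real n) powr \<Delta>\<rfloor> - 1" for n
  have T: "T \<ge> 3" by (simp add: T_def)
  have ln1: "1 \<le> ln (real n)" if "3 \<le> n" for n
    using that exp_le by (subst ln_ge_iff) auto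
  have Tge: "T \<le> T * ln (real n) powr \<Delta>" if "3 \<le> n" for n
    using ln1[OF that] T \<Delta>(2) by (simp add: ge_one_powr_ge_zero)
  have \<tau>_base: "20 * ?d * N1 + 2 \<le> \<tau> n" if "3 \<le> n" for n
    using Tge[OF that] unfolding \<tau>_def T_def by linarith
  have \<tau>_step: "2 * \<tau> (m n) + 1 \<le> \<tau> n" if n: "N1 \<le> n" for n
  proof -
    have n0: "N0 \<le> n" and mn: "N0 \<le> m n" using n N1 by auto
    have m3: "3 \<le> m n" using mn N0(5) by linarith
    have "real (m n) \<le> real n powr \<gamma>" using N0(2)[OF n0] unfolding good_scale_def Let_def by blast
    then have "ln (real (m n)) \<le> ln (real n powr \<gamma>)" using m3 n0 N0(5) by (subst ln_le_cancel_iff) auto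
    also have "\<dots> = \<gamma> * ln (real n)" using n0 N0(5) by (simp add: ln_powr)
    finally have "ln (real (m n)) powr \<Delta> \<le> (\<gamma> * ln (real n)) powr \<Delta>"
      using ln1[OF m3] \<Delta>(2) by (intro powr_mono2) auto
    also have "\<dots> = 1 / 2 * ln (real n) powr \<Delta>" using \<gamma> \<Delta>(1) by (subst powr_mult) auto
    finally have "T * ln (real (m n)) powr \<Delta> \<le> T * (1 / 2 * ln (real n) powr \<Delta>)" using T by (intro mult_left_mono) auto
    then have le: "2 * (T * ln (real (m n)) powr \<Delta>) \<le> T * ln (real n) powr \<Delta>" by simp
    show ?thesis using le Tge[OF m3] T unfolding \<tau>_def
      by (rule nat_floor_double)
  qed
  have dens_pos: "0 < dens n" if "1 \<le> n" for n
    unfolding dens_def density_def using \<rho>(1) that by (intro mult_pos_pos add_pos_nonneg) auto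
  let ?lucky = "lucky \<tau> dens \<theta> l"
  have spreads_lucky: "\<exists>A G. witness \<tau> dens \<theta> l UNIV L x n f (A, G)"
    if n: "N0 \<le> n" "n \<le> N1" and sp: "\<exists>A G. spreads L l x n (20 * ?d * n + 2) f A G \<and>
      \<rho>0 * real n ^ ?d \<le> real (card A) \<and> \<theta> * real (card A) \<le> real (card G)" for L x n f
  proof -
    obtain A G where AG: "spreads L l x n (20 * ?d * n + 2) f A G"
      "\<rho>0 * real n ^ ?d \<le> real (card A)" "\<theta> * real (card A) \<le> real (card G)" using sp by blast
    have n3: "3 \<le> n" using n N0(5) by linarith
    have "20 * ?d * n + 2 \<le> 20 * ?d * N1 + 2" using n(2) by simp
    then have "20 * ?d * n + 2 \<le> \<tau> n" using \<tau>_base[OF n3] by linarith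
    then have "spreads L l x n (\<tau> n) f A G" by (rule spreads_mono[OF AG(1)])
    moreover have "dens n \<le> \<rho>0 * real n ^ ?d"
      unfolding dens_def density_def by (rule mult_right_mono[OF N0(3)[OF n(1)]]) simp
    then have dA: "dens n \<le> real (card A)" using AG(2) by linarith
    moreover have "G \<noteq> {}"
    proof
      assume "G = {}"
      moreover have "0 < \<theta> * real (card A)" using \<theta> dens_pos[of n] n3 dA by (intro mult_pos_pos) auto
      ultimately show False using AG(3) by simp
    qed
    ultimately show ?thesis using AG(3) unfolding witness_def by auto
  qed
  have base1: "?pr L (\<lambda>f. \<not> (\<exists>A G. witness \<tau> dens \<theta> l UNIV L x n f (A, G))) \<le> real n powr - \<kappa>"
    if n: "N0 \<le> n" "n \<le> N1" and L: "n \<le> L" "L0 \<le> L" for L x n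
    by (rule order_trans[OF prob_mono_pmf N0(1)[OF n(1) L]]) (use spreads_lucky[OF n] in blast)
  have step: "?pr L (\<lambda>f. \<not> ?lucky UNIV L x n f) \<le> real n powr - \<kappa>"
    "?pr L (\<lambda>f. \<not> ?lucky S L x n f) \<le> ?pr L (\<lambda>f. \<not> ?lucky S L x (m n) f) + real n powr - \<kappa>"
    if n: "N1 \<le> n" "n \<le> L" and pm: "\<And>x. ?pr L (\<lambda>f. \<not> ?lucky UNIV L x (m n) f) \<le> real (m n) powr - \<kappa>" for L n x S
  proof -
    have "good_scale n" using N0(2) N1(1) n(1) by (meson le_trans)
    then have g: "m n \<ge> 1" "n div m n \<ge> 1" "2 \<le> \<theta> * dens (m n)"
      "dens n \<le> real (n div m n) ^ ?d * (1 - real (m n) powr - \<kappa> - real (m n) powr - \<kappa>) * dens (m n)"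
      and le: "real (m n) powr - \<kappa> / (real (n div m n) ^ ?d * (real (m n) powr - \<kappa>)\<^sup>2) +
        (real (n div m n) ^ ?d)\<^sup>2 * exp (- (\<mu> * (dens (m n))\<^sup>2 * real n powr - (real ?d + \<alpha>))) \<le> real n powr - \<kappa>"
      unfolding good_scale_def Let_def by blast+
    have n1: "1 \<le> n" using n(1) N1(1) N0(5) by linarith
    have mq: "m n * (n div m n) \<le> n" by simp
    have t: "0 < real (m n) powr - \<kappa>" using g(1) by simp
    have ex: "- lam * (\<theta> * (dens (m n))\<^sup>2 / 2 * (inverse K * real n powr - (real ?d + \<alpha>))) =
      - (\<mu> * (dens (m n))\<^sup>2 * real n powr - (real ?d + \<alpha>))" by (simp add: \<mu>_def)
    note st = lucky_step[OF l lam g(1,2) mq n(2) pm t dens_pos[OF g(1)] dens_pos[OF n1] g(3,4) \<theta> \<tau>_step[OF n(1)], unfolded ex]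
    show "?pr L (\<lambda>f. \<not> ?lucky UNIV L x n f) \<le> real n powr - \<kappa>"
      by (rule order_trans[OF st(1) le])
    show "?pr L (\<lambda>f. \<not> ?lucky S L x n f) \<le> ?pr L (\<lambda>f. \<not> ?lucky S L x (m n) f) + real n powr - \<kappa>"
      by (rule order_trans[OF st(2) add_left_mono[OF le]])
  qed
  have m_less: "m n < n" if "N0 \<le> n" for n using N0(2)[OF that] unfolding good_scale_def Let_def by blast
  have all: "\<forall>x. ?pr L (\<lambda>f. \<not> ?lucky UNIV L x n f) \<le> real n powr - \<kappa>" if "N0 \<le> n" "n \<le> L" "L0 \<le> L" for n L
    using that
  proof (induction n rule: less_induct)
    case (less n)
    show ?case
    proof (cases "n \<le> N1")
      case True
      show ?thesis using base1[OF less.prems(1) True less.prems(2,3)] by (simp add: lucky_def)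
    next
      case False
      then have n: "N1 \<le> n" by simp
      have "\<forall>x. ?pr L (\<lambda>f. \<not> ?lucky UNIV L x (m n) f) \<le> real (m n) powr - \<kappa>"
        by (rule less.IH[OF m_less[OF less.prems(1)] N1(2)[OF n]]) (use m_less[OF less.prems(1)] less.prems in auto)
      then show ?thesis using step(1)[OF n less.prems(2)] by blast
    qed
  qed
  \<comment> \<open>The corner sub-box has to succeed on every scale, each of which adds
    \<open>n powr - \<kappa>\<close> to the failure probability; the subtracted term
    \<open>n powr - b\<close> makes these contributions telescope.\<close>
  have seeded: "?pr L (\<lambda>f. \<not> ?lucky (Box L x N1) L x n f) \<le> 2 * real N0 powr - b - real n powr - b"
    if "N0 \<le> n" "n \<le> L" "L0 \<le> L" for n L x
    using that
  proof (induction n rule: less_induct)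
    case (less n)
    show ?case
    proof (cases "n \<le> N1")
      case True
      have "?pr L (\<lambda>f. \<not> ?lucky (Box L x N1) L x n f) \<le> ?pr L (\<lambda>f. \<not> (\<exists>A G. witness \<tau> dens \<theta> l UNIV L x n f (A, G)))"
      proof (rule prob_mono_pmf, rule notI)
        fix f assume no: "\<not> ?lucky (Box L x N1) L x n f" and "\<exists>A G. witness \<tau> dens \<theta> l UNIV L x n f (A, G)"
        then obtain A G where w: "witness \<tau> dens \<theta> l UNIV L x n f (A, G)" by blast
        then have "G \<subseteq> Box L x n" "G \<noteq> {}" by (auto simp: witness_def spreads_def)
        \<comment> \<open>A starting scale lies entirely inside the swept box, so any entry vertex
          will do.\<close>
        moreover have "Box L x n \<subseteq> Box L x N1" unfolding Box_def by (rule image_mono[OF torus_mono[OF True]])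
        ultimately have "witness \<tau> dens \<theta> l (Box L x N1) L x n f (A, G)" using w by (auto simp: witness_def)
        with no show False unfolding lucky_def by blast
      qed
      also have "\<dots> \<le> real n powr - \<kappa>" by (rule base1[OF less.prems(1) True less.prems(2,3)])
      also have "\<dots> \<le> real n powr - b" using less.prems(1) N0(5) b by (intro powr_mono) auto
      also have "\<dots> \<le> 2 * real N0 powr - b - real n powr - b"
      proof -
        have "real n powr - b \<le> real N0 powr - b" using less.prems(1) N0(5) b by (intro powr_mono2') auto
        then show ?thesis by linarith
      qed
      finally show ?thesis .
    next
      case False
      then have n: "N1 \<le> n" by simp
      have mL: "m n \<le> L" using m_less[OF less.prems(1)] less.prems(2) by linarith
      have "?pr L (\<lambda>f. \<not> ?lucky (Box L x N1) L x n f) \<le> ?pr L (\<lambda>f. \<not> ?lucky (Box L x N1) L x (m n) f) + real n powr - \<kappa>"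
        by (rule step(2)[OF n less.prems(2)]) (use all[OF N1(2)[OF n] mL less.prems(3)] in blast)
      also have "\<dots> \<le> (2 * real N0 powr - b - real (m n) powr - b) + real n powr - \<kappa>"
        by (rule add_right_mono[OF less.IH[OF m_less[OF less.prems(1)] N1(2)[OF n] mL less.prems(3)]])
      also have "\<dots> \<le> 2 * real N0 powr - b - real n powr - b"
      proof -
        have "real n powr - b + real n powr - \<kappa> \<le> real (m n) powr - b"
          using N0(2)[OF less.prems(1)] unfolding good_scale_def Let_def by blast
        then show ?thesis by linarith
      qed
      finally show ?thesis .
    qed
  qed
  have "\<forall>\<^sub>F L in at_top. \<forall>x. ?pr L (\<lambda>f. \<not> \<rho> * real L ^ CARD('d) \<le>
      real (card {u\<in>torus L. \<exists>z\<in>Box L x N1. rch (hop (paths L l) f) (nat \<lfloor>T * ln (real L) powr \<Delta>\<rfloor>) z u})) \<le> e"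
    using eventually_ge_at_top[of "max N0 L0"]
  proof eventually_elim
    case (elim L)
    show ?case
    proof
      fix x :: "int ^ 'd"
      have L: "L > 0" using elim N0(5) by simp
      let ?R = "\<lambda>f. {u\<in>torus L. \<exists>z\<in>Box L x N1. rch (hop (paths L l) f) (nat \<lfloor>T * ln (real L) powr \<Delta>\<rfloor>) z u}"
      have "?pr L (\<lambda>f. \<not> \<rho> * real L ^ ?d \<le> real (card (?R f))) \<le> ?pr L (\<lambda>f. \<not> ?lucky (Box L x N1) L x L f)"
      proof (rule prob_mono_pmf, rule notI)
        fix f assume no: "\<not> \<rho> * real L ^ ?d \<le> real (card (?R f))" and lk: "?lucky (Box L x N1) L x L f"
        obtain A G where w: "witness \<tau> dens \<theta> l (Box L x N1) L x L f (A, G)"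
          using lk unfolding lucky_def by auto
        then obtain z where z: "z \<in> G" "z \<in> Box L x N1" by (auto simp: witness_def)
        have sp: "A \<subseteq> Box L x L" "\<And>u. u \<in> A \<Longrightarrow> rch (hop (inner L l (Box L x L)) f) (\<tau> L) z u"
          and dA: "dens L \<le> real (card A)" using w z(1) by (auto simp: witness_def spreads_def)
        have "u \<in> ?R f" if u: "u \<in> A" for u
        proof -
          have "rch (hop (paths L l) f) (\<tau> L) z u"
            using sp(2)[OF u] by (rule rch_mono_rel) (auto simp: hop_def inner_def)
          then have "rch (hop (paths L l) f) (nat \<lfloor>T * ln (real L) powr \<Delta>\<rfloor>) z u"
            by (rule rch_mono) (simp add: \<tau>_def)
          moreover have "u \<in> torus L" using sp(1) u Box_full[OF L] by blast
          ultimately show ?thesis using z(2) by blast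
        qed
        then have "card A \<le> card (?R f)" by (intro card_mono subsetI) auto
        moreover have "\<rho> * real L ^ ?d \<le> dens L"
          unfolding dens_def density_def using \<rho>(1) by (intro mult_right_mono) (auto simp: algebra_simps)
        ultimately show False using no dA by linarith
      qed
      also have "\<dots> \<le> 2 * real N0 powr - b - real L powr - b" by (rule seeded) (use elim in auto)
      also have "\<dots> \<le> e" using N0(4) powr_ge_zero[of "real L" "- b"] by linarith
      finally show "?pr L (\<lambda>f. \<not> \<rho> * real L ^ ?d \<le> real (card (?R f))) \<le> e" .
    qed
  qed
  moreover have "1 \<le> N1" using N1(1) N0(5) by linarith
  ultimately show ?thesis by blast
qed

end

text \<open>By Bernoulli's inequality both factors are at least \<open>1 - (1 - \<rho>) / 4\<close>,
  whose square exceeds \<open>(1 + \<rho>) / 2\<close>; this density between \<open>\<rho>\<close>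
  and 1 leaves room for the factor in \<open>density\<close>. Sides \<open>r \<ge> 2\<close> give
  the blocks the three vertices needed in \<open>seed_rch\<close>.\<close>

lemma (in heavy_kernel) block_model_exists:
  assumes lam: "lam > 0" and \<rho>: "0 < \<rho>" "\<rho> < 1"
  obtains \<delta> c \<eta> r l L0 where "block_model Q \<alpha> K lam c \<eta> r l L0" "0 < \<delta>" "\<delta> < 1" "\<eta> < 1 / 2"
    "(1 + \<rho>) / 2 \<le> (1 - \<delta>) ^ CARD('d) * (1 - 2 * \<eta>)"
proof -
  define \<eta> where "\<eta> = (1 - \<rho>) / 8"
  define \<delta> where "\<delta> = (1 - \<rho>) / (4 * real CARD('d))"
  define c where "c = \<eta> / (4 * (8 * real CARD('d) + 3))"
  have d1: "real CARD('d) \<ge> 1" using dim by linarith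
  have \<eta>: "0 < \<eta>" "\<eta> < 1 / 2" using \<rho> by (auto simp: \<eta>_def)
  have d0: "0 < 4 * (8 * real CARD('d) + 3)" by simp
  have c: "0 < c" "4 * (8 * real CARD('d) + 3) * c \<le> \<eta>" using \<eta> d0 by (auto simp: c_def)
  have dd: "real CARD('d) * \<delta> = (1 - \<rho>) / 4" using d1 by (simp add: \<delta>_def)
  have \<delta>0: "0 < \<delta>" using \<rho> d1 by (simp add: \<delta>_def)
  have "1 * \<delta> \<le> real CARD('d) * \<delta>" using d1 \<delta>0 by (intro mult_right_mono) auto
  moreover have "4 * (real CARD('d) * \<delta>) = 1 - \<rho>" using dd by simp
  ultimately have \<delta>1: "\<delta> < 1" using \<rho> by linarith
  have "1 - real CARD('d) * \<delta> \<le> (1 - \<delta>) ^ CARD('d)"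
    using Bernoulli_inequality[of "- \<delta>" "CARD('d)"] \<delta>1 by simp
  then have "(1 - (1 - \<rho>) / 4) * (1 - 2 * \<eta>) \<le> (1 - \<delta>) ^ CARD('d) * (1 - 2 * \<eta>)"
    using \<eta> dd by (intro mult_right_mono) auto
  moreover have "(1 + \<rho>) / 2 \<le> (1 - (1 - \<rho>) / 4) * (1 - 2 * \<eta>)"
  proof -
    have "(1 - (1 - \<rho>) / 4) * (1 - 2 * \<eta>) = (1 + \<rho>) / 2 + ((1 - \<rho>) / 4)\<^sup>2"
      by (simp add: \<eta>_def power2_eq_square field_simps)
    then show ?thesis by simp
  qed
  ultimately have size: "(1 + \<rho>) / 2 \<le> (1 - \<delta>) ^ CARD('d) * (1 - 2 * \<eta>)" by linarith
  have "0 < c ^ 4 / 9 ^ CARD('d)" using c by simp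
  from open_block_likely[OF lam this, of 2] obtain r n where rn: "r \<ge> 2"
    "\<forall>\<^sub>F L in at_top. \<forall>x. measure_pmf.prob (path_law L (Suc n) lam) {f. \<not> open_block L (Suc n) r x f} \<le> c ^ 4 / 9 ^ CARD('d)"
    by blast
  from rn(2) obtain L1 where L1: "\<And>L x. L1 \<le> L \<Longrightarrow>
    measure_pmf.prob (path_law L (Suc n) lam) {f. \<not> open_block L (Suc n) r x f} \<le> c ^ 4 / 9 ^ CARD('d)"
    unfolding eventually_at_top_linorder by blast
  have "block_model Q \<alpha> K lam c \<eta> r (Suc n) (max 1 L1)"
    by unfold_locales (use lam c \<eta> rn L1 in auto)
  then show ?thesis using \<delta>0 \<delta>1 \<eta>(2) size by (rule that)
qed

section \<open>Limits, time scales and the theorem\<close>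

lemma tendsto_one_prob:
  fixes P :: "nat \<Rightarrow> real"
  assumes "\<forall>\<^sub>F L in at_top. P L \<le> 1" and "\<And>e. e > 0 \<Longrightarrow> \<forall>\<^sub>F L in at_top. 1 - 2 * e \<le> P L"
  shows "P \<longlonglongrightarrow> 1"
proof (rule tendstoI)
  fix e :: real assume e: "e > 0"
  then have "\<forall>\<^sub>F L in at_top. 1 - 2 * (e / 4) \<le> P L" by (intro assms) auto
  with assms(1) show "\<forall>\<^sub>F L in at_top. dist (P L) 1 < e"
    by eventually_elim (use e in \<open>simp add: dist_real_def\<close>)
qed

lemma prob_tendsto_one:
  assumes "transition_kernel Q"
    and "\<And>e. e > 0 \<Longrightarrow> \<forall>\<^sub>F L in at_top. 1 - 2 * e \<le> measure (frog_law L Q lam) (E L)"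
  shows "(\<lambda>L. measure (frog_law L Q lam) (E L)) \<longlonglongrightarrow> 1"
proof (rule tendsto_one_prob[OF _ assms(2)])
  show "\<forall>\<^sub>F L in at_top. measure (frog_law L Q lam) (E L) \<le> 1"
    using eventually_gt_at_top[of 0]
    by eventually_elim (intro prob_space.prob_le_1 prob_space_frog_law assms(1))
qed

text \<open>The strictly larger exponent absorbs the sweep time \<open>a\<close>, the constant
  \<open>T\<close> and the number \<open>c\<close> of steps per hop.\<close>

lemma polylog_time:
  fixes D D' T c a :: real
  assumes "0 < D'" "D' < D" "0 \<le> c"
  shows "\<forall>\<^sub>F L::nat in at_top. a + real (nat \<lfloor>T * ln (real L) powr D'\<rfloor>) * c \<le> ln (real L) powr D"
proof -
  define w where "w = D - D'"
  have w: "w > 0" using assms by (simp add: w_def)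
  define C where "C = \<bar>T\<bar> * c"
  have "\<forall>\<^sub>F L::nat in at_top. a + C * ln (real L) powr D' \<le> ln (real L) powr (D' + w)"
    using assms(1) w by real_asymp
  then show ?thesis
  proof eventually_elim
    case (elim L)
    have "T * ln (real L) powr D' \<le> \<bar>T\<bar> * ln (real L) powr D'" "0 \<le> \<bar>T\<bar> * ln (real L) powr D'"
      by (auto intro: mult_right_mono)
    then have "real (nat \<lfloor>T * ln (real L) powr D'\<rfloor>) \<le> \<bar>T\<bar> * ln (real L) powr D'"
      by linarith
    then have "real (nat \<lfloor>T * ln (real L) powr D'\<rfloor>) * c \<le> (\<bar>T\<bar> * ln (real L) powr D') * c"
      by (rule mult_right_mono[OF _ assms(3)])
    also have "\<dots> = C * ln (real L) powr D'" by (simp add: C_def)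
    finally show ?case using elim by (simp add: w_def)
  qed
qed

theorem theorem2p1:
  fixes Q :: "int ^ 'd::finite \<Rightarrow> int ^ 'd \<Rightarrow> real"
    and \<alpha> :: real
    and lo :: "nat \<Rightarrow> nat"
  assumes "CARD('d) \<ge> 2"
    and "transition_kernel Q"
    and "symmetric_kernel Q"
    and "translation_invariant Q"
    and "\<alpha> > 0"
    and "heavy_tailed \<alpha> Q"
    and "filterlim lo at_top at_top"
  shows "(\<alpha> < real CARD('d) \<longrightarrow>
           (let \<Delta> = 1 / log 2 (2 * real CARD('d) / (real CARD('d) + \<alpha>)) in
             \<forall>lam > 0. \<forall>\<rho> \<in> {0<..<1}. \<forall>\<epsilon> > 0. \<exists>C0 > (0::real). \<forall>l::nat. real l > C0 \<longrightarrow>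
               (\<lambda>L. measure (frog_law L Q lam)
                      {\<omega> \<in> space (frog_law L Q lam).
                         real (card (activated L l (lo L) \<omega> (ln (real L) powr (\<Delta> + \<epsilon>))))
                           / real L ^ CARD('d) \<ge> \<rho>}) \<longlonglongrightarrow> 1))
       \<and> (\<alpha> \<ge> real CARD('d) \<longrightarrow>
             (\<forall>lam > 0. \<forall>\<rho> \<in> {0<..<1}. \<exists>C > (0::real). \<exists>C0 > (0::real). \<forall>l::nat. real l > C0 \<longrightarrow>
               (\<lambda>L. measure (frog_law L Q lam)
                      {\<omega> \<in> space (frog_law L Q lam).
                         real (card (activated L l (lo L) \<omega> (C * real L)))
                           / real L ^ CARD('d) \<ge> \<rho>}) \<longlonglongrightarrow> 1))"
proof -
  obtain K where K: "K > 0" "\<And>x y. x \<noteq> y \<Longrightarrow>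
        inverse K * real_of_int (linf (x - y)) powr - (real CARD('d) + \<alpha>) \<le> Q x y \<and>
        Q x y \<le> K * real_of_int (linf (x - y)) powr - (real CARD('d) + \<alpha>)"
    using assms(6) unfolding heavy_tailed_def by blast
  interpret heavy_kernel Q \<alpha> K by unfold_locales (use assms K in auto)
  let ?d = "real CARD('d)"
  show ?thesis unfolding Let_def
  proof (intro conjI impI allI ballI)
    fix lam \<rho> \<epsilon> :: real
    assume \<alpha>d: "\<alpha> < ?d" and lam: "lam > 0" and \<rho>: "\<rho> \<in> {0<..<1}" and \<epsilon>: "\<epsilon> > 0"
    define \<Delta> where "\<Delta> = 1 / log 2 (2 * ?d / (?d + \<alpha>))"
    have ratio: "1 < 2 * ?d / (?d + \<alpha>)" using \<alpha>d \<open>\<alpha> > 0\<close> by (simp add: field_simps)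
    then have \<Delta>: "\<Delta> > 0" by (simp add: \<Delta>_def)
    \<comment> \<open>The margin is split: one half of \<open>\<epsilon>\<close> moves
      \<open>\<gamma>\<close> strictly above \<open>(d + \<alpha>) / (2 * d)\<close>, the other half
      absorbs constants in the time bound.\<close>
    define \<Delta>' where "\<Delta>' = \<Delta> + \<epsilon> / 2"
    have \<Delta>': "\<Delta> < \<Delta>'" "\<Delta>' < \<Delta> + \<epsilon>" "0 < \<Delta>'" using \<epsilon> \<Delta> by (auto simp: \<Delta>'_def)
    define \<gamma> where "\<gamma> = 2 powr - (1 / \<Delta>')"
    have \<gamma>: "0 < \<gamma>" "\<gamma> < 1" using \<Delta>' by (auto simp: \<gamma>_def powr_less_one)
    have \<gamma>\<Delta>: "\<gamma> powr \<Delta>' = 1 / 2" using \<Delta>'(3) unfolding \<gamma>_def powr_powr by (simp add: powr_minus_divide)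
    have "(?d + \<alpha>) / (2 * ?d) < \<gamma>"
    proof -
      have "(?d + \<alpha>) / (2 * ?d) = inverse (2 * ?d / (?d + \<alpha>))" by simp
      also have "\<dots> = inverse (2 powr log 2 (2 * ?d / (?d + \<alpha>)))" using ratio by simp
      also have "\<dots> = 2 powr - (1 / \<Delta>)" by (simp add: \<Delta>_def powr_minus)
      also have "\<dots> < \<gamma>" unfolding \<gamma>_def using \<Delta> \<Delta>' by (intro powr_less_mono) (auto intro!: divide_strict_left_mono)
      finally show ?thesis .
    qed
    then have s: "?d + \<alpha> < 2 * ?d * \<gamma>" using dim by (simp add: field_simps)
    obtain \<delta> c \<eta> r l0 L0 where bm: "block_model Q \<alpha> K lam c \<eta> r l0 L0" and par: "0 < \<delta>" "\<delta> < 1" "\<eta> < 1 / 2"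
      "(1 + \<rho>) / 2 \<le> (1 - \<delta>) ^ CARD('d) * (1 - 2 * \<eta>)"
      by (rule block_model_exists[OF lam, of \<rho>]) (use \<rho> in auto)
    interpret block_model Q \<alpha> K lam c \<eta> r l0 L0 by (rule bm)
    have "(\<lambda>L. measure (frog_law L Q lam) {\<omega> \<in> space (frog_law L Q lam).
        real (card (activated L l (lo L) \<omega> (ln (real L) powr (\<Delta> + \<epsilon>)))) / real L ^ CARD('d) \<ge> \<rho>}) \<longlonglongrightarrow> 1"
      if ll: "real l > real l0" for l
    proof (rule prob_tendsto_one[OF kernel])
      fix e :: real assume e: "e > 0"
      have "0 < \<rho>" "\<rho> < (1 + \<rho>) / 2" using \<rho> by auto
      from polylog_spread[OF \<gamma> s \<gamma>\<Delta> \<Delta>'(3) par(1-3) this par(4) e]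
      obtain n T where n: "n \<ge> 1" and sp: "\<forall>\<^sub>F L in at_top. \<forall>x. measure_pmf.prob (path_law L l0 lam)
        {f. \<not> \<rho> * real L ^ CARD('d) \<le>
          real (card {u\<in>torus L. \<exists>z\<in>Box L x n. rch (hop (paths L l0) f) (nat \<lfloor>T * ln (real L) powr \<Delta>'\<rfloor>) z u})} \<le> e"
        by blast
      show "\<forall>\<^sub>F L in at_top. 1 - 2 * e \<le> measure (frog_law L Q lam) {\<omega> \<in> space (frog_law L Q lam).
        real (card (activated L l (lo L) \<omega> (ln (real L) powr (\<Delta> + \<epsilon>)))) / real L ^ CARD('d) \<ge> \<rho>}"
        by (rule spread_from_swept_box[OF lam n _ e assms(7) sp polylog_time[OF \<Delta>'(3,2) of_nat_0_le_iff]]) (use ll in simp)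
    qed
    moreover have "real l0 > 0" using l by simp
    ultimately show "\<exists>C0>0. \<forall>l::nat. C0 < real l \<longrightarrow> (\<lambda>L. measure (frog_law L Q lam) {\<omega> \<in> space (frog_law L Q lam).
        real (card (activated L l (lo L) \<omega> (ln (real L) powr (1 / log 2 (2 * ?d / (?d + \<alpha>)) + \<epsilon>)))) / real L ^ CARD('d) \<ge> \<rho>}) \<longlonglongrightarrow> 1"
      unfolding \<Delta>_def by blast
  next
    fix lam \<rho> :: real
    assume lam: "lam > 0" and \<rho>: "\<rho> \<in> {0<..<1}"
    obtain \<delta> c \<eta> r l0 L0 where bm: "block_model Q \<alpha> K lam c \<eta> r l0 L0" and par: "0 < \<delta>" "\<delta> < 1" "\<eta> < 1 / 2"
      "(1 + \<rho>) / 2 \<le> (1 - \<delta>) ^ CARD('d) * (1 - 2 * \<eta>)"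
      by (rule block_model_exists[OF lam, of \<rho>]) (use \<rho> in auto)
    interpret block_model Q \<alpha> K lam c \<eta> r l0 L0 by (rule bm)
    \<comment> \<open>Each of the \<open>10 * d * L\<close> hops takes at most \<open>l0\<close>
      steps; the summand 1 covers the sweep time \<open>T\<close> once
      \<open>L \<ge> T\<close>.\<close>
    define C where "C = 10 * ?d * real l0 + 1"
    have "(\<lambda>L. measure (frog_law L Q lam) {\<omega> \<in> space (frog_law L Q lam).
        real (card (activated L l (lo L) \<omega> (C * real L))) / real L ^ CARD('d) \<ge> \<rho>}) \<longlonglongrightarrow> 1"
      if ll: "real l > real l0" for l
    proof (rule prob_tendsto_one[OF kernel])
      fix e :: real assume e: "e > 0"
      have "\<rho> \<le> (1 - \<delta>) ^ CARD('d) * (1 - 2 * \<eta>)" "\<eta> \<le> 1 / 2" using par \<rho> by auto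
      from linear_spread[OF par(1,2) this e]
      obtain n where n: "n \<ge> 1" and sp: "\<forall>\<^sub>F L in at_top. \<forall>x. measure_pmf.prob (path_law L l0 lam)
        {f. \<not> \<rho> * real L ^ CARD('d) \<le> real (card {u\<in>torus L. \<exists>z\<in>Box L x n. rch (hop (paths L l0) f) (10 * CARD('d) * L) z u})} \<le> e"
        by blast
      have "\<forall>\<^sub>F L in at_top. real T + real (10 * CARD('d) * L) * real l0 \<le> C * real L" for T
        using eventually_ge_at_top[of T] by eventually_elim (simp add: C_def algebra_simps)
      from spread_from_swept_box[OF lam n _ e assms(7) sp this]
      show "\<forall>\<^sub>F L in at_top. 1 - 2 * e \<le> measure (frog_law L Q lam) {\<omega> \<in> space (frog_law L Q lam).
        real (card (activated L l (lo L) \<omega> (C * real L))) / real L ^ CARD('d) \<ge> \<rho>}" using ll by simp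
    qed
    moreover have "real l0 > 0" using l by simp
    moreover have "C > 0" unfolding C_def by (intro add_nonneg_pos) auto
    ultimately show "\<exists>C>0. \<exists>C0>0. \<forall>l::nat. C0 < real l \<longrightarrow> (\<lambda>L. measure (frog_law L Q lam) {\<omega> \<in> space (frog_law L Q lam).
        real (card (activated L l (lo L) \<omega> (C * real L))) / real L ^ CARD('d) \<ge> \<rho>}) \<longlonglongrightarrow> 1" by blast
  qed
qed

end
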